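(* Let $(R,\mathfrak m)$ be a commutative Artinian local ring with $\mathfrak m^3=0$ and let $M$ be a finitely generated $R$-module. (1) If $\operatorname{Ext}^i_R(M, M\oplus R)=0$ for four consecutive values of $i$ with $i\ge 2$, then $M$ is free. (2) If $R$ is Gorenstein and $\operatorname{Ext}^i_R(M,M)=0$ for some $i>0$, then $M$ is free. *)

theory Defs
  imports "HOL-Algebra.Module" "HOL-Algebra.Ideal_Product" "HOL-Algebra.Ring_Divisibility"
begin

section \<open>Artinian local rings\<close>

definition artinian_ring :: "('a, 'r) ring_scheme \<Rightarrow> bool" where
  "artinian_ring R \<longleftrightarrow> cring R \<and>
     (\<forall>I :: nat \<Rightarrow> 'a set. (\<forall>n. ideal (I n) R) \<and> (\<forall>n. I (Suc n) \<subseteq> I n)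
        \<longrightarrow> (\<exists>n. \<forall>k\<ge>n. I k = I n))"

definition local_ring :: "('a, 'r) ring_scheme \<Rightarrow> 'a set \<Rightarrow> bool" where
  "local_ring R \<mm> \<longleftrightarrow> cring R \<and> maximalideal \<mm> R \<and> (\<forall>I. maximalideal I R \<longrightarrow> I = \<mm>)"


section \<open>Modules\<close>

definition mod_hom ::
    "('a, 'r) ring_scheme \<Rightarrow> ('a, 'b, 'm) module_scheme \<Rightarrow> ('a, 'c, 'n) module_scheme \<Rightarrow> ('b \<Rightarrow> 'c) set"
  where "mod_hom R M N =
    {f \<in> carrier M \<rightarrow> carrier N.
       (\<forall>x\<in>carrier M. \<forall>y\<in>carrier M. f (x \<oplus>\<^bsub>M\<^esub> y) = f x \<oplus>\<^bsub>N\<^esub> f y) \<and>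
       (\<forall>r\<in>carrier R. \<forall>x\<in>carrier M. f (r \<odot>\<^bsub>M\<^esub> x) = r \<odot>\<^bsub>N\<^esub> f x)}"

definition lin_comb :: "('a, 'b, 'm) module_scheme \<Rightarrow> ('b \<Rightarrow> 'a) \<Rightarrow> 'b set \<Rightarrow> 'b" where
  "lin_comb M c A = (\<Oplus>\<^bsub>M\<^esub>x\<in>A. c x \<odot>\<^bsub>M\<^esub> x)"

definition generates :: "('a, 'r) ring_scheme \<Rightarrow> ('a, 'b, 'm) module_scheme \<Rightarrow> 'b set \<Rightarrow> bool" where
  "generates R M B \<longleftrightarrow> B \<subseteq> carrier M \<and>
     (\<forall>x\<in>carrier M. \<exists>A c. finite A \<and> A \<subseteq> B \<and> c \<in> A \<rightarrow> carrier R \<and> x = lin_comb M c A)"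

definition lin_independent :: "('a, 'r) ring_scheme \<Rightarrow> ('a, 'b, 'm) module_scheme \<Rightarrow> 'b set \<Rightarrow> bool" where
  "lin_independent R M B \<longleftrightarrow> B \<subseteq> carrier M \<and>
     (\<forall>A c. finite A \<and> A \<subseteq> B \<and> c \<in> A \<rightarrow> carrier R \<and> lin_comb M c A = \<zero>\<^bsub>M\<^esub>
        \<longrightarrow> (\<forall>x\<in>A. c x = \<zero>\<^bsub>R\<^esub>))"

definition fin_gen_module :: "('a, 'r) ring_scheme \<Rightarrow> ('a, 'b, 'm) module_scheme \<Rightarrow> bool" where
  "fin_gen_module R M \<longleftrightarrow> module R M \<and> (\<exists>B. finite B \<and> generates R M B)"

definition free_module :: "('a, 'r) ring_scheme \<Rightarrow> ('a, 'b, 'm) module_scheme \<Rightarrow> bool" where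
  "free_module R M \<longleftrightarrow> module R M \<and> (\<exists>B. generates R M B \<and> lin_independent R M B)"

definition zero_module :: "('a, 'b, 'm) module_scheme \<Rightarrow> bool" where
  "zero_module M \<longleftrightarrow> carrier M = {\<zero>\<^bsub>M\<^esub>}"

text \<open>
  The record \<open>module\<close> extends \<open>ring\<close>; its fields \<open>mult\<close> and \<open>one\<close> are not constrained
  by the locale \<open>module\<close> and play no role below.
\<close>

definition regular_module :: "('a, 'r) ring_scheme \<Rightarrow> ('a, 'a) module" where
  "regular_module R =
     \<lparr>carrier = carrier R, monoid.mult = monoid.mult R, monoid.one = \<one>\<^bsub>R\<^esub>,
      ring.zero = \<zero>\<^bsub>R\<^esub>, ring.add = ring.add R,
      smult = monoid.mult R\<rparr>"

definition direct_sum ::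
    "('a, 'b, 'm) module_scheme \<Rightarrow> ('a, 'c, 'n) module_scheme \<Rightarrow> ('a, 'b \<times> 'c) module"
  where "direct_sum M N =
     \<lparr>carrier = carrier M \<times> carrier N, monoid.mult = undefined, monoid.one = undefined,
      ring.zero = (\<zero>\<^bsub>M\<^esub>, \<zero>\<^bsub>N\<^esub>),
      ring.add = (\<lambda>(x, y) (x', y'). (x \<oplus>\<^bsub>M\<^esub> x', y \<oplus>\<^bsub>N\<^esub> y')),
      smult = (\<lambda>r (x, y). (r \<odot>\<^bsub>M\<^esub> x, r \<odot>\<^bsub>N\<^esub> y))\<rparr>"

definition Hom_module ::
    "('a, 'r) ring_scheme \<Rightarrow> ('a, 'b, 'm) module_scheme \<Rightarrow> ('a, 'c, 'n) module_scheme
       \<Rightarrow> ('a, 'b \<Rightarrow> 'c) module"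
  where "Hom_module R M N =
     \<lparr>carrier = mod_hom R M N \<inter> extensional (carrier M),
      monoid.mult = undefined, monoid.one = undefined,
      ring.zero = (\<lambda>x\<in>carrier M. \<zero>\<^bsub>N\<^esub>),
      ring.add = (\<lambda>f g. \<lambda>x\<in>carrier M. f x \<oplus>\<^bsub>N\<^esub> g x),
      smult = (\<lambda>r f. \<lambda>x\<in>carrier M. r \<odot>\<^bsub>N\<^esub> f x)\<rparr>"

definition quotient_module :: "('a, 'b, 'm) module_scheme \<Rightarrow> 'b set \<Rightarrow> ('a, 'b set) module" where
  "quotient_module M K =
     \<lparr>carrier = a_rcosets\<^bsub>M\<^esub> K, monoid.mult = undefined, monoid.one = undefined,
      ring.zero = K, ring.add = set_add M,
      smult = (\<lambda>r X. \<Union>x\<in>X. K +>\<^bsub>M\<^esub> (r \<odot>\<^bsub>M\<^esub> x))\<rparr>"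


section \<open>Free resolutions and Ext\<close>

text \<open>
  \<open>\<dots> \<rightarrow> F 2 \<rightarrow> F 1 \<rightarrow> F 0 \<rightarrow> M \<rightarrow> 0\<close> exact, with \<open>d n : F (n + 1) \<rightarrow> F n\<close> and
  augmentation \<open>\<epsilon> : F 0 \<rightarrow> M\<close>.
\<close>

definition free_resolution ::
    "('a, 'r) ring_scheme \<Rightarrow> ('a, 'b, 'm) module_scheme
       \<Rightarrow> (nat \<Rightarrow> ('a, 'f) module) \<Rightarrow> (nat \<Rightarrow> 'f \<Rightarrow> 'f) \<Rightarrow> ('f \<Rightarrow> 'b) \<Rightarrow> bool"
  where "free_resolution R M F d \<epsilon> \<longleftrightarrow>
     (\<forall>n. free_module R (F n)) \<and>
     \<epsilon> \<in> mod_hom R (F 0) M \<and> (\<forall>n. d n \<in> mod_hom R (F (Suc n)) (F n)) \<and>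
     \<epsilon> ` carrier (F 0) = carrier M \<and>
     d 0 ` carrier (F 1) = a_kernel (F 0) M \<epsilon> \<and>
     (\<forall>n. d (Suc n) ` carrier (F (Suc (Suc n))) = a_kernel (F (Suc n)) (F n) (d n))"

text \<open>
  Cohomology in degree \<open>i\<close> of the complex with terms \<open>Hom\<^sub>R(F i, N)\<close> and differentials
  \<open>f \<mapsto> f \<circ> d i\<close>.
\<close>

definition Hom_cocycles ::
    "('a, 'r) ring_scheme \<Rightarrow> (nat \<Rightarrow> ('a, 'f) module) \<Rightarrow> (nat \<Rightarrow> 'f \<Rightarrow> 'f)
       \<Rightarrow> ('a, 'c, 'n) module_scheme \<Rightarrow> nat \<Rightarrow> ('f \<Rightarrow> 'c) set"
  where "Hom_cocycles R F d N i =
     {f \<in> carrier (Hom_module R (F i) N).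
        compose (carrier (F (Suc i))) f (d i) = \<zero>\<^bsub>Hom_module R (F (Suc i)) N\<^esub>}"

definition Hom_coboundaries ::
    "('a, 'r) ring_scheme \<Rightarrow> (nat \<Rightarrow> ('a, 'f) module) \<Rightarrow> (nat \<Rightarrow> 'f \<Rightarrow> 'f)
       \<Rightarrow> ('a, 'c, 'n) module_scheme \<Rightarrow> nat \<Rightarrow> ('f \<Rightarrow> 'c) set"
  where "Hom_coboundaries R F d N i =
     (case i of
        0 \<Rightarrow> {\<zero>\<^bsub>Hom_module R (F 0) N\<^esub>}
      | Suc j \<Rightarrow> (\<lambda>g. compose (carrier (F (Suc j))) g (d j)) ` carrier (Hom_module R (F j) N))"

definition Hom_cohomology ::
    "('a, 'r) ring_scheme \<Rightarrow> (nat \<Rightarrow> ('a, 'f) module) \<Rightarrow> (nat \<Rightarrow> 'f \<Rightarrow> 'f)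
       \<Rightarrow> ('a, 'c, 'n) module_scheme \<Rightarrow> nat \<Rightarrow> ('a, ('f \<Rightarrow> 'c) set) module"
  where "Hom_cohomology R F d N i =
     quotient_module (Hom_module R (F i) N\<lparr>carrier := Hom_cocycles R F d N i\<rparr>)
       (Hom_coboundaries R F d N i)"

text \<open>
  \<open>Ext\<^sup>i\<^sub>R(M, N)\<close>, computed from a chosen free resolution of \<open>M\<close> (any two choices give
  isomorphic modules).  The type \<open>('a \<times> 'b) list\<close> is large enough to carry a free resolution of
  every \<open>R\<close>-module \<open>M\<close>: the successive free modules on (the sets of) all elements of \<open>M\<close> and of the
  syzygies have cardinality at most that of \<open>('a \<times> 'b) list\<close>, so they can be transported to it.
  If \<open>R\<close> is Noetherian and \<open>M\<close> finitely generated, one can take free modules \<open>R\<^sup>n\<close>, realised as the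
  lists of length \<open>n\<close> with first components in \<open>R\<close> and a constant second component.
\<close>

definition chosen_resolution ::
    "('a, 'r) ring_scheme \<Rightarrow> ('a, 'b, 'm) module_scheme
       \<Rightarrow> (nat \<Rightarrow> ('a, ('a \<times> 'b) list) module) \<times> (nat \<Rightarrow> ('a \<times> 'b) list \<Rightarrow> ('a \<times> 'b) list)"
  where "chosen_resolution R M = (SOME (F, d). \<exists>\<epsilon>. free_resolution R M F d \<epsilon>)"

definition Ext ::
    "('a, 'r) ring_scheme \<Rightarrow> nat \<Rightarrow> ('a, 'b, 'm) module_scheme \<Rightarrow> ('a, 'c, 'n) module_scheme
       \<Rightarrow> ('a, (('a \<times> 'b) list \<Rightarrow> 'c) set) module"
  where "Ext R i M N = (case chosen_resolution R M of (F, d) \<Rightarrow> Hom_cohomology R F d N i)"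


section \<open>Injective dimension and Gorenstein local rings\<close>

text \<open>
  The lifting property is required for modules \<open>A\<close>, \<open>B\<close> whose elements have the type of the ring
  elements.  By Baer's criterion (the case of an ideal \<open>A\<close> of \<open>B = R\<close>) this implies the lifting
  property for modules over arbitrary types.
\<close>

definition injective_module :: "('a, 'r) ring_scheme \<Rightarrow> ('a, 'b, 'm) module_scheme \<Rightarrow> bool" where
  "injective_module R E \<longleftrightarrow> module R E \<and>
     (\<forall>(A :: ('a, 'a) module) (B :: ('a, 'a) module) f g.
        module R A \<and> module R B \<and> f \<in> mod_hom R A B \<and> inj_on f (carrier A) \<and> g \<in> mod_hom R A E
        \<longrightarrow> (\<exists>h \<in> mod_hom R B E. \<forall>x\<in>carrier A. h (f x) = g x))"

text \<open>
  \<open>0 \<rightarrow> N \<rightarrow> I 0 \<rightarrow> I 1 \<rightarrow> \<dots>\<close> exact, with \<open>\<delta> n : I n \<rightarrow> I (n + 1)\<close> and coaugmentation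
  \<open>\<eta> : N \<rightarrow> I 0\<close>.
\<close>

definition injective_resolution ::
    "('a, 'r) ring_scheme \<Rightarrow> ('a, 'b, 'm) module_scheme
       \<Rightarrow> (nat \<Rightarrow> ('a, 'e) module) \<Rightarrow> (nat \<Rightarrow> 'e \<Rightarrow> 'e) \<Rightarrow> ('b \<Rightarrow> 'e) \<Rightarrow> bool"
  where "injective_resolution R N I \<delta> \<eta> \<longleftrightarrow>
     (\<forall>n. injective_module R (I n)) \<and>
     \<eta> \<in> mod_hom R N (I 0) \<and> (\<forall>n. \<delta> n \<in> mod_hom R (I n) (I (Suc n))) \<and>
     inj_on \<eta> (carrier N) \<and>
     \<eta> ` carrier N = a_kernel (I 0) (I 1) (\<delta> 0) \<and>
     (\<forall>n. \<delta> n ` carrier (I n) = a_kernel (I (Suc n)) (I (Suc (Suc n))) (\<delta> (Suc n)))"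

text \<open>
  A Noetherian local ring is Gorenstein if it has finite injective dimension as a module over itself.
  The type \<open>'a list\<close> loses no generality: over a Noetherian ring \<open>R\<close>, the terms of the minimal
  injective resolution of \<open>R\<close> have cardinality at most that of \<open>'a list\<close>.
\<close>

definition gorenstein_local_ring :: "('a, 'r) ring_scheme \<Rightarrow> bool" where
  "gorenstein_local_ring R \<longleftrightarrow> noetherian_ring R \<and> (\<exists>\<mm>. local_ring R \<mm>) \<and>
     (\<exists>n (I :: nat \<Rightarrow> ('a, 'a list) module) \<delta> \<eta>.
        injective_resolution R (regular_module R) I \<delta> \<eta> \<and> (\<forall>j>n. zero_module (I j)))"

end

theory Submission
  imports Defs "HOL-Library.Extended_Nat"
begin

text \<open>
  Write \<open>L 0\<close> for the first syzygy of \<open>M\<close> in a minimal resolution and \<open>L j\<close> for its \<open>j\<close>-th syzygy,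
  \<open>b j\<close> for the minimal number of generators of \<open>L j\<close>, \<open>a j\<close> for the length of \<open>\<mm> (L j)\<close>, and
  \<open>e\<close>, \<open>s\<close> for the lengths of \<open>\<mm>/\<mm>\<^sup>2\<close> and \<open>\<mm>\<^sup>2\<close>.  As \<open>L j\<close> lies in \<open>\<mm>\<close> times a free module,
  \<open>\<mm>\<^sup>2 (L j) = 0\<close>, and counting lengths gives \<open>e b\<^sub>j \<le> b\<^sub>j\<^sub>+\<^sub>1 + a\<^sub>j\<close> and \<open>a\<^sub>j\<^sub>+\<^sub>1 \<le> s b\<^sub>j\<close>, with equality
  as soon as the socle of \<open>L (j + 1)\<close> is \<open>\<mm> (L (j + 1))\<close>.  The latter holds if \<open>Ext\<^sup>i(L t, L (j + 1)) = 0\<close>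
  for some \<open>i > 0\<close>, because then every homomorphism from the \<open>i\<close>-th syzygy of \<open>L t\<close> to \<open>L (j + 1)\<close> has
  values in \<open>\<mm> (L (j + 1))\<close>, so the residue field is not a summand of \<open>L (j + 1)\<close>.  Vanishing of \<open>Ext\<^sup>i(L t, L j)\<close>
  moreover compares the ratios of consecutive Betti numbers with \<open>b\<^sub>j/a\<^sub>j\<close>.

  In part (1), vanishing of \<open>Ext\<close> into \<open>R\<close> transports the vanishing from \<open>M\<close> to \<open>L 0\<close> and \<open>L 1\<close>, and the
  resulting inequalities force \<open>s = 1\<close> with \<open>\<mm>\<^sup>2\<close> the socle of \<open>R\<close>, that is, \<open>R\<close> is self-injective, as it is
  in part (2).  Then a single vanishing \<open>Ext\<^sup>i(M, M) = 0\<close> gives \<open>Ext\<^sup>i(L j, L j) = 0\<close> for all \<open>j\<close>, the ratios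
  \<open>b\<^sub>j\<^sub>+\<^sub>1/b\<^sub>j\<close> turn out to be constant, hence equal to \<open>1\<close>, and \<open>e = 2\<close>.  In this last case a homomorphism
  \<open>L t \<rightarrow> L j\<close> with values outside \<open>\<mm> (L j)\<close> yields one from \<open>L (t + 2)\<close> (by an explicit form of the
  Eisenbud operators of the complete intersection \<open>R\<close>); since the homomorphisms from both \<open>L (j + i)\<close> and
  \<open>L (j + i - 1)\<close> have values in \<open>\<mm> (L j)\<close>, so does the identity of \<open>L j\<close>, and \<open>L j = 0\<close>.
\<close>

section \<open>Submodules and homomorphisms\<close>

text \<open>The Betti numbers are compared through one linear map. On homomorphisms into
  \<open>L j\<close>, the differential \<open>Fn (b (Suc t)) \<rightarrow> Fn (b t)\<close> induces
  a map from \<open>b t\<close> to \<open>b (Suc t)\<close> copies of \<open>L j\<close>. Its matrix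
  has entries in \<open>\<mm>\<close>, so it descends to a map from \<open>b t\<close> copies of
  \<open>L j / \<mm> (L j)\<close> to \<open>b (Suc t)\<close> copies of \<open>\<mm> (L j)\<close>,
  of lengths \<open>b t * b j\<close> and \<open>b (Suc t) * a j\<close>. Vanishing of Ext makes it
  onto; absence of homomorphisms with values outside \<open>\<mm> (L j)\<close> makes it injective.
  A constant ratio \<open>x\<close> satisfies \<open>x + 1/x = e\<close>; as \<open>x\<close> is
  rational and \<open>e\<close> an integer, \<open>x = 1\<close>. Counting yields nothing beyond
  this, since equal Betti numbers do occur for nonfree modules over such rings, and the
  differentials themselves have to be used. \<open>Ext\<close> is computed from a free resolution
  picked by choice, possibly of infinite rank, so its vanishing must be carried to the minimal
  resolution. All later reasoning concerns extending homomorphisms from a syzygy to the free module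
  around it; no Ext module is formed again.\<close>

abbreviation mod_hom_on ::
    "('a, 'r) ring_scheme \<Rightarrow> ('a, 'b, 'm) module_scheme \<Rightarrow> 'b set \<Rightarrow> ('a, 'c, 'n) module_scheme \<Rightarrow> ('b \<Rightarrow> 'c) set"
  where "mod_hom_on R X U Y \<equiv> mod_hom R (X\<lparr>carrier := U\<rparr>) Y"

lemma mod_homI:
  assumes "\<And>x. x \<in> carrier M \<Longrightarrow> f x \<in> carrier N"
    and "\<And>x y. x \<in> carrier M \<Longrightarrow> y \<in> carrier M \<Longrightarrow> f (x \<oplus>\<^bsub>M\<^esub> y) = f x \<oplus>\<^bsub>N\<^esub> f y"
    and "\<And>r x. r \<in> carrier R \<Longrightarrow> x \<in> carrier M \<Longrightarrow> f (r \<odot>\<^bsub>M\<^esub> x) = r \<odot>\<^bsub>N\<^esub> f x"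
  shows "f \<in> mod_hom R M N"
  using assms by (auto simp: mod_hom_def)

lemma mod_homD:
  assumes "f \<in> mod_hom R M N"
  shows "x \<in> carrier M \<Longrightarrow> f x \<in> carrier N"
    and "x \<in> carrier M \<Longrightarrow> y \<in> carrier M \<Longrightarrow> f (x \<oplus>\<^bsub>M\<^esub> y) = f x \<oplus>\<^bsub>N\<^esub> f y"
    and "r \<in> carrier R \<Longrightarrow> x \<in> carrier M \<Longrightarrow> f (r \<odot>\<^bsub>M\<^esub> x) = r \<odot>\<^bsub>N\<^esub> f x"
  using assms by (auto simp: mod_hom_def)

lemma mod_hom_onI:
  assumes "\<And>x. x \<in> U \<Longrightarrow> f x \<in> carrier Y"
    and "\<And>x y. x \<in> U \<Longrightarrow> y \<in> U \<Longrightarrow> f (x \<oplus>\<^bsub>X\<^esub> y) = f x \<oplus>\<^bsub>Y\<^esub> f y"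
    and "\<And>r x. r \<in> carrier R \<Longrightarrow> x \<in> U \<Longrightarrow> f (r \<odot>\<^bsub>X\<^esub> x) = r \<odot>\<^bsub>Y\<^esub> f x"
  shows "f \<in> mod_hom_on R X U Y"
  using assms by (auto simp: mod_hom_def)

lemma mod_hom_onD:
  assumes "f \<in> mod_hom_on R X U Y"
  shows "x \<in> U \<Longrightarrow> f x \<in> carrier Y"
    and "x \<in> U \<Longrightarrow> y \<in> U \<Longrightarrow> f (x \<oplus>\<^bsub>X\<^esub> y) = f x \<oplus>\<^bsub>Y\<^esub> f y"
    and "r \<in> carrier R \<Longrightarrow> x \<in> U \<Longrightarrow> f (r \<odot>\<^bsub>X\<^esub> x) = r \<odot>\<^bsub>Y\<^esub> f x"
  using assms by (auto simp: mod_hom_def)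

lemma mod_hom_on_subset:
  assumes "f \<in> mod_hom_on R X U Y" "V \<subseteq> U"
  shows "f \<in> mod_hom_on R X V Y"
  by (rule mod_hom_onI) (use mod_hom_onD[OF assms(1)] assms(2) in blast)+

lemma mod_hom_on_carrier: "mod_hom_on R X (carrier X) Y = mod_hom R X Y"
  by (simp add: mod_hom_def)

context module
begin

lemma submodule_iff:
  "submodule U R M \<longleftrightarrow> U \<subseteq> carrier M \<and> \<zero>\<^bsub>M\<^esub> \<in> U \<and> (\<forall>x\<in>U. \<forall>y\<in>U. x \<oplus>\<^bsub>M\<^esub> y \<in> U)
     \<and> (\<forall>r\<in>carrier R. \<forall>x\<in>U. r \<odot>\<^bsub>M\<^esub> x \<in> U)"
proof
  assume U: "submodule U R M"
  then interpret U: submodule U R M .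
  show "U \<subseteq> carrier M \<and> \<zero>\<^bsub>M\<^esub> \<in> U \<and> (\<forall>x\<in>U. \<forall>y\<in>U. x \<oplus>\<^bsub>M\<^esub> y \<in> U)
     \<and> (\<forall>r\<in>carrier R. \<forall>x\<in>U. r \<odot>\<^bsub>M\<^esub> x \<in> U)"
    using submoduleE[OF U] U.one_closed by auto
next
  assume *: "U \<subseteq> carrier M \<and> \<zero>\<^bsub>M\<^esub> \<in> U \<and> (\<forall>x\<in>U. \<forall>y\<in>U. x \<oplus>\<^bsub>M\<^esub> y \<in> U)
     \<and> (\<forall>r\<in>carrier R. \<forall>x\<in>U. r \<odot>\<^bsub>M\<^esub> x \<in> U)"
  have "\<ominus>\<^bsub>M\<^esub> a \<in> U" if "a \<in> U" for a
  proof -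
    have "\<ominus>\<^bsub>M\<^esub> a = (\<ominus> \<one>) \<odot>\<^bsub>M\<^esub> a"
      using * that smult_l_minus[of \<one> a] by auto
    then show ?thesis using * that by auto
  qed
  then show "submodule U R M"
    using * by (intro submoduleI) auto
qed

lemma submoduleD:
  assumes "submodule U R M"
  shows "x \<in> U \<Longrightarrow> x \<in> carrier M"
    and "\<zero>\<^bsub>M\<^esub> \<in> U"
    and "x \<in> U \<Longrightarrow> y \<in> U \<Longrightarrow> x \<oplus>\<^bsub>M\<^esub> y \<in> U"
    and "r \<in> carrier R \<Longrightarrow> x \<in> U \<Longrightarrow> r \<odot>\<^bsub>M\<^esub> x \<in> U"
    and "x \<in> U \<Longrightarrow> \<ominus>\<^bsub>M\<^esub> x \<in> U"
    and "x \<in> U \<Longrightarrow> y \<in> U \<Longrightarrow> x \<ominus>\<^bsub>M\<^esub> y \<in> U"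
  using assms submoduleE[OF assms] unfolding submodule_iff by (auto simp: a_minus_def)

lemma submodule_add_cancel:
  assumes "submodule U R M" "x \<in> U" "y \<in> carrier M" "x \<oplus>\<^bsub>M\<^esub> y \<in> U"
  shows "y \<in> U"
proof -
  have x: "x \<in> carrier M" using submoduleD[OF assms(1)] assms(2) by auto
  have "y = (x \<oplus>\<^bsub>M\<^esub> y) \<ominus>\<^bsub>M\<^esub> x" using x assms(3)
    by (simp add: M.minus_eq M.a_assoc M.a_comm[of x] M.r_neg)
  then show ?thesis using submoduleD(6)[OF assms(1,4,2)] by simp
qed

lemma submodule_add_cancel':
  assumes "submodule U R M" "y \<in> U" "x \<in> carrier M" "x \<oplus>\<^bsub>M\<^esub> y \<in> U"
  shows "x \<in> U"
  using submodule_add_cancel[OF assms(1,2,3)] assms submoduleD[OF assms(1)] M.a_comm by metis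

lemma minus_eq_zero:
  assumes "x \<in> carrier M" "y \<in> carrier M" "x \<ominus>\<^bsub>M\<^esub> y = \<zero>\<^bsub>M\<^esub>"
  shows "x = y"
  using assms by (metis M.add.inv_closed M.minus_minus M.minus_equality M.a_comm M.minus_eq)

lemma minus_add_self:
  assumes "x \<in> carrier M" "y \<in> carrier M"
  shows "y \<oplus>\<^bsub>M\<^esub> (x \<ominus>\<^bsub>M\<^esub> y) = x"
  using assms by (simp add: M.minus_eq M.a_lcomm[of y x] M.r_neg)

lemma submodule_zero: "submodule {\<zero>\<^bsub>M\<^esub>} R M"
  by (auto simp: submodule_iff)

lemma submodule_Int: "submodule U R M \<Longrightarrow> submodule V R M \<Longrightarrow> submodule (U \<inter> V) R M"
  by (auto simp: submodule_iff)

lemma submodule_Inter: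
  assumes "\<And>U. U \<in> S \<Longrightarrow> submodule U R M" "S \<noteq> {}"
  shows "submodule (\<Inter>S) R M"
proof -
  obtain U where "U \<in> S" using assms(2) by auto
  then show ?thesis
    unfolding submodule_iff using submoduleD[OF assms(1)] by (auto intro: submoduleD(1)[OF assms(1)])
qed

lemma mem_set_add: "x \<in> U <+>\<^bsub>M\<^esub> V \<longleftrightarrow> (\<exists>u\<in>U. \<exists>v\<in>V. x = u \<oplus>\<^bsub>M\<^esub> v)"
  by (auto simp: set_add_def')

lemma submodule_set_add:
  assumes "submodule U R M" "submodule V R M"
  shows "submodule (U <+>\<^bsub>M\<^esub> V) R M"
proof -
  note U = submoduleD[OF assms(1)] and V = submoduleD[OF assms(2)]
  show ?thesis
    unfolding submodule_iff
  proof (intro conjI ballI)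
    show "U <+>\<^bsub>M\<^esub> V \<subseteq> carrier M" using U V by (auto simp: mem_set_add)
    show "\<zero>\<^bsub>M\<^esub> \<in> U <+>\<^bsub>M\<^esub> V" unfolding mem_set_add
      using U(2) V(2) by (intro bexI[of _ "\<zero>\<^bsub>M\<^esub>"]) auto
  next
    fix x y assume "x \<in> U <+>\<^bsub>M\<^esub> V" "y \<in> U <+>\<^bsub>M\<^esub> V"
    then obtain u v u' v' where *: "u \<in> U" "v \<in> V" "u' \<in> U" "v' \<in> V" "x = u \<oplus>\<^bsub>M\<^esub> v" "y = u' \<oplus>\<^bsub>M\<^esub> v'"
      by (auto simp: mem_set_add)
    then have "x \<oplus>\<^bsub>M\<^esub> y = (u \<oplus>\<^bsub>M\<^esub> u') \<oplus>\<^bsub>M\<^esub> (v \<oplus>\<^bsub>M\<^esub> v')"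
      using U(1) V(1) by (simp add: M.a_ac)
    then show "x \<oplus>\<^bsub>M\<^esub> y \<in> U <+>\<^bsub>M\<^esub> V" using * U(3) V(3) unfolding mem_set_add by blast
  next
    fix r x assume r: "r \<in> carrier R" and "x \<in> U <+>\<^bsub>M\<^esub> V"
    then obtain u v where *: "u \<in> U" "v \<in> V" "x = u \<oplus>\<^bsub>M\<^esub> v"
      by (auto simp: mem_set_add)
    then have "r \<odot>\<^bsub>M\<^esub> x = r \<odot>\<^bsub>M\<^esub> u \<oplus>\<^bsub>M\<^esub> r \<odot>\<^bsub>M\<^esub> v"
      using U(1) V(1) r by (simp add: smult_r_distr)
    then show "r \<odot>\<^bsub>M\<^esub> x \<in> U <+>\<^bsub>M\<^esub> V" using * U(4) V(4) r unfolding mem_set_add by blast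
  qed
qed

lemma set_add_upper:
  assumes "submodule U R M" "submodule V R M"
  shows "U \<subseteq> U <+>\<^bsub>M\<^esub> V" "V \<subseteq> U <+>\<^bsub>M\<^esub> V"
proof -
  note U = submoduleD[OF assms(1)] and V = submoduleD[OF assms(2)]
  show "U \<subseteq> U <+>\<^bsub>M\<^esub> V"
  proof
    fix x assume "x \<in> U"
    then show "x \<in> U <+>\<^bsub>M\<^esub> V" unfolding mem_set_add using U(1) V(2)
      by (intro bexI[of _ x] bexI[of _ "\<zero>\<^bsub>M\<^esub>"]) auto
  qed
  show "V \<subseteq> U <+>\<^bsub>M\<^esub> V"
  proof
    fix x assume "x \<in> V"
    then show "x \<in> U <+>\<^bsub>M\<^esub> V" unfolding mem_set_add using V(1) U(2)
      by (intro bexI[of _ x] bexI[of _ "\<zero>\<^bsub>M\<^esub>"]) auto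
  qed
qed

lemma set_add_least:
  assumes "submodule W R M" "U \<subseteq> W" "V \<subseteq> W"
  shows "U <+>\<^bsub>M\<^esub> V \<subseteq> W"
  using submoduleD(3)[OF assms(1)] assms unfolding subset_iff mem_set_add by blast

definition cyclic :: "'c \<Rightarrow> 'c set" where
  "cyclic x = (\<lambda>r. r \<odot>\<^bsub>M\<^esub> x) ` carrier R"

lemma submodule_cyclic:
  assumes "x \<in> carrier M"
  shows "submodule (cyclic x) R M"
  unfolding submodule_iff cyclic_def
proof (intro conjI ballI)
  show "\<zero>\<^bsub>M\<^esub> \<in> (\<lambda>r. r \<odot>\<^bsub>M\<^esub> x) ` carrier R"
    using assms by (intro image_eqI[of _ _ \<zero>]) auto
qed (use assms in \<open>auto simp flip: smult_l_distr smult_assoc1\<close>)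

lemma cyclic_self: "x \<in> carrier M \<Longrightarrow> x \<in> cyclic x"
  unfolding cyclic_def by (intro image_eqI[of _ _ \<one>]) auto

lemma mod_hom_on_zero:
  assumes "f \<in> mod_hom_on R X U M" "module R X" "submodule U R X"
  shows "f \<zero>\<^bsub>X\<^esub> = \<zero>\<^bsub>M\<^esub>"
proof -
  interpret X: module R X by fact
  have z: "\<zero>\<^bsub>X\<^esub> \<in> U" using X.submoduleD[OF assms(3)] by auto
  then have "f \<zero>\<^bsub>X\<^esub> = f (\<zero> \<odot>\<^bsub>X\<^esub> \<zero>\<^bsub>X\<^esub>)" by simp
  also have "\<dots> = \<zero> \<odot>\<^bsub>M\<^esub> f \<zero>\<^bsub>X\<^esub>" using z mod_hom_onD[OF assms(1)] by blast
  also have "\<dots> = \<zero>\<^bsub>M\<^esub>" using z mod_hom_onD[OF assms(1)] by simp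
  finally show ?thesis .
qed

lemma mod_hom_on_uminus:
  assumes "f \<in> mod_hom_on R X U M" "module R X" "submodule U R X" "x \<in> U"
  shows "f (\<ominus>\<^bsub>X\<^esub> x) = \<ominus>\<^bsub>M\<^esub> f x"
proof -
  interpret X: module R X by fact
  note f = mod_hom_onD[OF assms(1)]
  have "f (\<ominus>\<^bsub>X\<^esub> x) = f ((\<ominus> \<one>) \<odot>\<^bsub>X\<^esub> x)"
    using X.submoduleD[OF assms(3)] assms(4) by (simp add: X.smult_l_minus)
  also have "\<dots> = (\<ominus> \<one>) \<odot>\<^bsub>M\<^esub> f x" using f(3) assms(4) by simp
  also have "\<dots> = \<ominus>\<^bsub>M\<^esub> f x" using f(1) assms(4) by (simp add: smult_l_minus)
  finally show ?thesis .
qed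

lemma mod_hom_on_minus:
  assumes "f \<in> mod_hom_on R X U M" "module R X" "submodule U R X" "x \<in> U" "y \<in> U"
  shows "f (x \<ominus>\<^bsub>X\<^esub> y) = f x \<ominus>\<^bsub>M\<^esub> f y"
proof -
  interpret X: module R X by fact
  note f = mod_hom_onD[OF assms(1)]
  show ?thesis
    using f(2)[OF assms(4) X.submoduleD(5)[OF assms(3,5)]] mod_hom_on_uminus[OF assms(1-3,5)]
    by (simp add: a_minus_def)
qed

lemma submodule_image:
  assumes "f \<in> mod_hom_on R X U M" "module R X" "submodule U R X" "submodule V R X" "V \<subseteq> U"
  shows "submodule (f ` V) R M"
proof -
  interpret X: module R X by fact
  note f = mod_hom_onD[OF assms(1)] and V = X.submoduleD[OF assms(4)]
  show ?thesis
    unfolding submodule_iff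
  proof (intro conjI ballI)
    show "f ` V \<subseteq> carrier M" using f(1) assms(5) by auto
    show "\<zero>\<^bsub>M\<^esub> \<in> f ` V" using mod_hom_on_zero[OF assms(1-3)] V(2) by (metis imageI)
  next
    fix x y assume "x \<in> f ` V" "y \<in> f ` V"
    then obtain a b where ab: "a \<in> V" "b \<in> V" "x = f a" "y = f b" by blast
    then have "x \<oplus>\<^bsub>M\<^esub> y = f (a \<oplus>\<^bsub>X\<^esub> b)" using f(2) subsetD[OF assms(5)] by simp
    then show "x \<oplus>\<^bsub>M\<^esub> y \<in> f ` V" using V(3) ab by auto
  next
    fix r x assume r: "r \<in> carrier R" and "x \<in> f ` V"
    then obtain a where a: "a \<in> V" "x = f a" by blast
    then have "r \<odot>\<^bsub>M\<^esub> x = f (r \<odot>\<^bsub>X\<^esub> a)" using r f(3) subsetD[OF assms(5)] by simp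
    then show "r \<odot>\<^bsub>M\<^esub> x \<in> f ` V" using V(4) a r by auto
  qed
qed

lemma submodule_vimage:
  assumes "f \<in> mod_hom_on R X U M" "module R X" "submodule U R X" "submodule V R M"
  shows "submodule {x \<in> U. f x \<in> V} R X"
proof -
  interpret X: module R X by fact
  note f = mod_hom_onD[OF assms(1)] and U = X.submoduleD[OF assms(3)] and V = submoduleD[OF assms(4)]
  show ?thesis
    unfolding X.submodule_iff
    using f U V mod_hom_on_zero[OF assms(1-3)] by auto
qed

end

section \<open>Length\<close>

definition submodule_chain ::
    "('a, 'r) ring_scheme \<Rightarrow> ('a, 'b, 'm) module_scheme \<Rightarrow> nat \<Rightarrow> 'b set \<Rightarrow> 'b set \<Rightarrow> bool"
  where "submodule_chain R X n W U \<longleftrightarrow>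
     (\<exists>C. (\<forall>i\<le>n. submodule (C i) R X \<and> W \<subseteq> C i \<and> C i \<subseteq> U) \<and> (\<forall>i<n. C i \<subset> C (Suc i)))"

text \<open>The length of \<open>U/W\<close>, taken from chains between \<open>W\<close> and
  \<open>U\<close> so that no quotient module is formed. Values in \<open>enat\<close> let
  additivity hold with no finiteness hypothesis; natural numbers are extracted only where the ring
  supplies finite length.\<close>

definition mlength ::
    "('a, 'r) ring_scheme \<Rightarrow> ('a, 'b, 'm) module_scheme \<Rightarrow> 'b set \<Rightarrow> 'b set \<Rightarrow> enat"
  where "mlength R X W U = Sup {enat n | n. submodule_chain R X n W U}"

lemma submodule_chain_mono:
  "submodule_chain R X n W U \<Longrightarrow> m \<le> n \<Longrightarrow> submodule_chain R X m W U"
  unfolding submodule_chain_def by (elim exE, rule_tac x = C in exI) auto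

lemma submodule_chain_widen:
  "submodule_chain R X n W U \<Longrightarrow> U \<subseteq> U' \<Longrightarrow> submodule_chain R X n W U'"
  unfolding submodule_chain_def by (elim exE, rule_tac x = C in exI) auto

lemma submodule_chain_trans:
  assumes "submodule_chain R X p W V" "submodule_chain R X q V U" "W \<subseteq> V" "V \<subseteq> U"
  shows "submodule_chain R X (p + q) W U"
proof -
  obtain C where C: "\<And>i. i \<le> p \<Longrightarrow> submodule (C i) R X \<and> W \<subseteq> C i \<and> C i \<subseteq> V" "\<And>i. i < p \<Longrightarrow> C i \<subset> C (Suc i)"
    using assms(1) unfolding submodule_chain_def by blast
  obtain D where D: "\<And>i. i \<le> q \<Longrightarrow> submodule (D i) R X \<and> V \<subseteq> D i \<and> D i \<subseteq> U" "\<And>i. i < q \<Longrightarrow> D i \<subset> D (Suc i)"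
    using assms(2) unfolding submodule_chain_def by blast
  define E where "E i = (if i \<le> p then C i else D (i - p))" for i
  have "submodule (E i) R X \<and> W \<subseteq> E i \<and> E i \<subseteq> U" if "i \<le> p + q" for i
  proof (cases "i \<le> p")
    case True then show ?thesis using C(1)[of i] assms(4) by (auto simp: E_def)
  next
    case False
    then have "i - p \<le> q" using that by auto
    then show ?thesis using D(1)[of "i - p"] assms(3) False by (auto simp: E_def)
  qed
  moreover have "E i \<subset> E (Suc i)" if "i < p + q" for i
  proof (cases "i < p")
    case True then show ?thesis using C(2)[of i] by (simp add: E_def)
  next
    case False
    then have *: "E (Suc i) = D (Suc (i - p))" by (auto simp: E_def Suc_diff_le)
    have "D (i - p) \<subset> D (Suc (i - p))" using D(2)[of "i - p"] that False by auto
    moreover have "E i \<subseteq> D (i - p)"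
      using C(1)[of p] D(1)[of 0] False by (cases "i = p") (auto simp: E_def)
    ultimately show ?thesis using * by auto
  qed
  ultimately show ?thesis unfolding submodule_chain_def by blast
qed

lemma submodule_chain_snoc:
  assumes "submodule_chain R X p W A" "A \<subset> B" "submodule B R X" "W \<subseteq> B"
  shows "submodule_chain R X (Suc p) W B"
proof -
  obtain C where C: "\<And>i. i \<le> p \<Longrightarrow> submodule (C i) R X \<and> W \<subseteq> C i \<and> C i \<subseteq> A" "\<And>i. i < p \<Longrightarrow> C i \<subset> C (Suc i)"
    using assms(1) unfolding submodule_chain_def by blast
  have 1: "\<forall>i\<le>Suc p. submodule ((C(Suc p := B)) i) R X \<and> W \<subseteq> (C(Suc p := B)) i \<and> (C(Suc p := B)) i \<subseteq> B"
  proof (intro allI impI)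
    fix i assume "i \<le> Suc p"
    then consider "i = Suc p" | "i \<le> p" by linarith
    then show "submodule ((C(Suc p := B)) i) R X \<and> W \<subseteq> (C(Suc p := B)) i \<and> (C(Suc p := B)) i \<subseteq> B"
      by cases (use C(1)[of i] assms in auto)
  qed
  have 2: "\<forall>i<Suc p. (C(Suc p := B)) i \<subset> (C(Suc p := B)) (Suc i)"
  proof (intro allI impI)
    fix i assume "i < Suc p"
    then consider "i = p" | "i < p" by linarith
    then show "(C(Suc p := B)) i \<subset> (C(Suc p := B)) (Suc i)"
      by cases (use C(1)[of p] C(2)[of i] assms in auto)
  qed
  show ?thesis unfolding submodule_chain_def
    by (rule exI[of _ "C(Suc p := B)"]) (use 1 2 in blast)
qed

lemma submodule_chain_0:
  "submodule W R X \<Longrightarrow> W \<subseteq> U \<Longrightarrow> submodule_chain R X 0 W U"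
  unfolding submodule_chain_def by auto

lemma submodule_chain_le: "submodule_chain R X n W U \<Longrightarrow> enat n \<le> mlength R X W U"
  unfolding mlength_def by (auto intro: Sup_upper)

text \<open>Chains can be truncated: if none has length \<open>n\<close>, all are shorter, and the
  supremum is at most \<open>n - 1\<close>. This turns statements about a possibly infinite length
  into statements about single chains.\<close>

lemma le_mlength_iff:
  assumes "submodule W R X" "W \<subseteq> U"
  shows "enat n \<le> mlength R X W U \<longleftrightarrow> submodule_chain R X n W U"
proof
  assume le: "enat n \<le> mlength R X W U"
  show "submodule_chain R X n W U"
  proof (rule ccontr)
    assume not: "\<not> submodule_chain R X n W U"
    then obtain k where k: "n = Suc k"
      using submodule_chain_0[OF assms] by (cases n) auto
    have "mlength R X W U \<le> enat k"
      unfolding mlength_def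
    proof (rule Sup_least)
      fix x assume "x \<in> {enat n |n. submodule_chain R X n W U}"
      then obtain l where l: "x = enat l" "submodule_chain R X l W U" by auto
      then have "\<not> n \<le> l" using not submodule_chain_mono by blast
      then show "x \<le> enat k" using l k by auto
    qed
    then have "enat n \<le> enat k" using le by (rule order_trans[rotated])
    then show False using k by simp
  qed
qed (rule submodule_chain_le)

lemma enat_add_leI:
  fixes a b c :: enat
  assumes "\<And>p q. enat p \<le> a \<Longrightarrow> enat q \<le> b \<Longrightarrow> enat (p + q) \<le> c"
  shows "a + b \<le> c"
proof (cases "a = \<infinity> \<or> b = \<infinity>")
  case True
  have "enat n \<le> c" for n
    using assms[of n 0] assms[of 0 n] True by (auto simp: zero_enat_def[symmetric])
  then have "c = \<infinity>" by (cases c) (auto, metis Suc_n_not_le_n)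
  then show ?thesis by simp
next
  case False
  then show ?thesis using assms by auto
qed

context module
begin

text \<open>Intersecting a chain with \<open>V\<close> and adding \<open>V\<close> to it gives
  chains below and above \<open>V\<close>. By the modular law a strict step cannot become an
  equality in both, so the two strict chains together have at least as many steps.\<close>

lemma submodule_chain_split:
  assumes "submodule W R M" "submodule V R M" "W \<subseteq> V" "V \<subseteq> U" "submodule_chain R M n W U" "submodule U R M"
  shows "\<exists>p q. n \<le> p + q \<and> submodule_chain R M p W V \<and> submodule_chain R M q V U"
proof -
  obtain C where C: "\<And>i. i \<le> n \<Longrightarrow> submodule (C i) R M \<and> W \<subseteq> C i \<and> C i \<subseteq> U" "\<And>i. i < n \<Longrightarrow> C i \<subset> C (Suc i)"
    using assms(5) unfolding submodule_chain_def by blast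
  have "\<exists>p q. k \<le> p + q \<and> submodule_chain R M p W (V \<inter> C k) \<and> submodule_chain R M q V (V <+>\<^bsub>M\<^esub> C k)"
    if "k \<le> n" for k
    using that
  proof (induction k)
    case 0
    have "submodule_chain R M 0 W (V \<inter> C 0)" using C(1)[of 0] assms by (intro submodule_chain_0) auto
    moreover have "submodule_chain R M 0 V (V <+>\<^bsub>M\<^esub> C 0)"
      using C(1)[of 0] assms set_add_upper by (intro submodule_chain_0) auto
    ultimately show ?case by fastforce
  next
    case (Suc k)
    then obtain p q where pq: "k \<le> p + q" "submodule_chain R M p W (V \<inter> C k)"
      "submodule_chain R M q V (V <+>\<^bsub>M\<^esub> C k)" by auto
    have Ck: "submodule (C k) R M" and Ck': "submodule (C (Suc k)) R M" "W \<subseteq> C (Suc k)"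
      and strict: "C k \<subset> C (Suc k)"
      using C(1)[of k] C(1)[of "Suc k"] C(2)[of k] Suc.prems by auto
    have 1: "V \<inter> C k \<subseteq> V \<inter> C (Suc k)" using strict by auto
    have 2: "V <+>\<^bsub>M\<^esub> C k \<subseteq> V <+>\<^bsub>M\<^esub> C (Suc k)" using strict unfolding subset_iff mem_set_add by blast
    have "V \<inter> C k \<noteq> V \<inter> C (Suc k) \<or> V <+>\<^bsub>M\<^esub> C k \<noteq> V <+>\<^bsub>M\<^esub> C (Suc k)"
    proof (rule ccontr)
      assume "\<not> ?thesis"
      then have e: "V \<inter> C k = V \<inter> C (Suc k)" "V <+>\<^bsub>M\<^esub> C k = V <+>\<^bsub>M\<^esub> C (Suc k)" by auto
      have "x \<in> C k" if x: "x \<in> C (Suc k)" for x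
      proof -
        have "x \<in> V <+>\<^bsub>M\<^esub> C k" using e(2) set_add_upper[OF assms(2) Ck'(1)] x by auto
        then obtain v c where vc: "v \<in> V" "c \<in> C k" "x = v \<oplus>\<^bsub>M\<^esub> c" by (auto simp: mem_set_add)
        have "v \<in> C (Suc k)"
          using vc x submodule_add_cancel'[OF Ck'(1), of c v] submoduleD(1)[OF assms(2)] strict by auto
        then have "v \<in> C k" using e(1) vc by auto
        then show ?thesis using vc submoduleD(3)[OF Ck] by auto
      qed
      then show False using strict by auto
    qed
    then consider "V \<inter> C k \<subset> V \<inter> C (Suc k)" | "V <+>\<^bsub>M\<^esub> C k \<subset> V <+>\<^bsub>M\<^esub> C (Suc k)"
      using 1 2 by auto
    then show ?case
    proof cases
      case 1
      have a: "submodule_chain R M (Suc p) W (V \<inter> C (Suc k))"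
        using submodule_chain_snoc[OF pq(2) 1] submodule_Int[OF assms(2) Ck'(1)] assms Ck' by auto
      have b: "submodule_chain R M q V (V <+>\<^bsub>M\<^esub> C (Suc k))"
        using pq(3) 2 submodule_chain_widen by blast
      show ?thesis by (rule exI[of _ "Suc p"], rule exI[of _ q]) (use a b pq(1) in auto)
    next
      case 2
      have a: "submodule_chain R M p W (V \<inter> C (Suc k))"
        using pq(2) 1 submodule_chain_widen by blast
      have b: "submodule_chain R M (Suc q) V (V <+>\<^bsub>M\<^esub> C (Suc k))"
        using submodule_chain_snoc[OF pq(3) 2] submodule_set_add[OF assms(2) Ck'(1)]
          set_add_upper[OF assms(2) Ck'(1)] by auto
      show ?thesis by (rule exI[of _ p], rule exI[of _ "Suc q"]) (use a b pq(1) in auto)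
    qed
  qed
  from this[of n] obtain p q where pq: "n \<le> p + q" "submodule_chain R M p W (V \<inter> C n)"
      "submodule_chain R M q V (V <+>\<^bsub>M\<^esub> C n)" by auto
  have a: "submodule_chain R M p W V" using pq(2) by (rule submodule_chain_widen) auto
  have "V <+>\<^bsub>M\<^esub> C n \<subseteq> U"
    using set_add_least[OF assms(6,4)] C(1)[of n] by auto
  then have b: "submodule_chain R M q V U"
    using pq(3) submodule_chain_widen by blast
  show ?thesis using a b pq(1) by blast
qed

lemma mlength_additive:
  assumes "submodule W R M" "submodule V R M" "submodule U R M" "W \<subseteq> V" "V \<subseteq> U"
  shows "mlength R M W U = mlength R M W V + mlength R M V U"
proof (rule antisym)
  show "mlength R M W U \<le> mlength R M W V + mlength R M V U"
    unfolding mlength_def[of R M W U]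
  proof (rule Sup_least)
    fix x assume "x \<in> {enat n |n. submodule_chain R M n W U}"
    then obtain n where n: "x = enat n" "submodule_chain R M n W U" by auto
    obtain p q where pq: "n \<le> p + q" "submodule_chain R M p W V" "submodule_chain R M q V U"
      using submodule_chain_split[OF assms(1,2,4,5) n(2) assms(3)] by blast
    have "enat n \<le> enat p + enat q" using pq(1) by simp
    also have "\<dots> \<le> mlength R M W V + mlength R M V U"
      using pq by (intro add_mono submodule_chain_le)
    finally show "x \<le> mlength R M W V + mlength R M V U" using n by simp
  qed
  show "mlength R M W V + mlength R M V U \<le> mlength R M W U"
  proof (rule enat_add_leI)
    fix p q assume "enat p \<le> mlength R M W V" "enat q \<le> mlength R M V U"
    then have "submodule_chain R M p W V" "submodule_chain R M q V U"
      using le_mlength_iff assms by blast+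
    then have "submodule_chain R M (p + q) W U"
      using submodule_chain_trans assms by blast
    then show "enat (p + q) \<le> mlength R M W U" by (rule submodule_chain_le)
  qed
qed

lemma mlength_mono:
  assumes "submodule W R M" "submodule W' R M" "submodule U R M" "submodule U' R M"
    and "W \<subseteq> W'" "W' \<subseteq> U'" "U' \<subseteq> U"
  shows "mlength R M W' U' \<le> mlength R M W U"
proof -
  have "mlength R M W U = mlength R M W W' + (mlength R M W' U' + mlength R M U' U)"
    using mlength_additive[of W W' U] mlength_additive[of W' U' U] assms by auto
  then show ?thesis by (simp add: add.commute add.left_commute add_increasing2)
qed

lemma mlength_eq_0:
  assumes "submodule W R M" "submodule U R M" "W \<subseteq> U"
  shows "mlength R M W U = 0 \<longleftrightarrow> W = U"
proof
  assume 0: "mlength R M W U = 0"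
  show "W = U"
  proof (rule ccontr)
    assume "W \<noteq> U"
    then have "submodule_chain R M (Suc 0) W U"
      using assms by (intro submodule_chain_snoc[of R M 0 W W U] submodule_chain_0) auto
    then have "enat (Suc 0) \<le> mlength R M W U" by (rule submodule_chain_le)
    then show False using 0 by (simp add: zero_enat_def)
  qed
next
  assume "W = U"
  have "mlength R M W U \<le> 0"
    unfolding mlength_def
  proof (rule Sup_least)
    fix x assume "x \<in> {enat n |n. submodule_chain R M n W U}"
    then obtain n where n: "x = enat n" and "submodule_chain R M n W U" by blast
    then obtain C where C: "\<forall>i\<le>n. submodule (C i) R M \<and> W \<subseteq> C i \<and> C i \<subseteq> U" "\<forall>i<n. C i \<subset> C (Suc i)"
      unfolding submodule_chain_def by (elim exE conjE)
    have "n = 0"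
    proof (rule ccontr)
      assume "n \<noteq> 0"
      then have "C 0 \<subset> C (Suc 0)" "W \<subseteq> C 0" "C (Suc 0) \<subseteq> U" using C by auto
      then show False using \<open>W = U\<close> by auto
    qed
    then show "x \<le> 0" using n by (simp add: zero_enat_def)
  qed
  then show "mlength R M W U = 0" by simp
qed

lemma mlength_eq_1:
  assumes "submodule W R M" "submodule U R M" "W \<subset> U"
    and simple: "\<And>V. submodule V R M \<Longrightarrow> W \<subseteq> V \<Longrightarrow> V \<subseteq> U \<Longrightarrow> V = W \<or> V = U"
  shows "mlength R M W U = 1"
proof (rule antisym)
  show "mlength R M W U \<le> 1"
    unfolding mlength_def
  proof (rule Sup_least)
    fix x assume "x \<in> {enat n |n. submodule_chain R M n W U}"
    then obtain n where n: "x = enat n" and "submodule_chain R M n W U" by blast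
    then obtain C where C: "\<forall>i\<le>n. submodule (C i) R M \<and> W \<subseteq> C i \<and> C i \<subseteq> U" "\<forall>i<n. C i \<subset> C (Suc i)"
      unfolding submodule_chain_def by (elim exE conjE)
    have "n \<le> 1"
    proof (rule ccontr)
      assume "\<not> n \<le> 1"
      then have "C 0 \<subset> C 1" "C 1 \<subset> C 2" "0 \<le> n" "1 \<le> n" "2 \<le> n"
        using C(2)[rule_format, of 0] C(2)[rule_format, of 1] by (auto simp: numeral_2_eq_2)
      then show False using simple[of "C 1"] C(1)[rule_format, of 0] C(1)[rule_format, of 1]
          C(1)[rule_format, of 2] by auto
    qed
    then show "x \<le> 1" using n by (simp add: one_enat_def)
  qed
  have "submodule_chain R M (Suc 0) W U"
    using assms by (intro submodule_chain_snoc[of R M 0 W W U] submodule_chain_0) auto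
  then show "1 \<le> mlength R M W U" using submodule_chain_le by (fastforce simp: one_enat_def)
qed

end

text \<open>A strictly increasing map between two intervals of submodules takes chains to chains,
  which is enough to compare lengths. For an injection the map will be
  \<open>V \<mapsto> f V + W'\<close>, for a surjection the preimage.\<close>

lemma mlength_embedding:
  assumes "\<And>V. submodule V R X \<Longrightarrow> W \<subseteq> V \<Longrightarrow> V \<subseteq> U \<Longrightarrow> submodule (\<Phi> V) R Y \<and> W' \<subseteq> \<Phi> V \<and> \<Phi> V \<subseteq> U'"
    and "\<And>V1 V2. submodule V1 R X \<Longrightarrow> submodule V2 R X \<Longrightarrow> W \<subseteq> V1 \<Longrightarrow> V1 \<subset> V2 \<Longrightarrow> V2 \<subseteq> U \<Longrightarrow> \<Phi> V1 \<subset> \<Phi> V2"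
  shows "mlength R X W U \<le> mlength R Y W' U'"
  unfolding mlength_def[of R X W U]
proof (rule Sup_least)
  fix x assume "x \<in> {enat n |n. submodule_chain R X n W U}"
  then obtain n where n: "x = enat n" and "submodule_chain R X n W U" by blast
  then obtain C where C: "\<forall>i\<le>n. submodule (C i) R X \<and> W \<subseteq> C i \<and> C i \<subseteq> U" "\<forall>i<n. C i \<subset> C (Suc i)"
    unfolding submodule_chain_def by (elim exE conjE)
  have "\<forall>i\<le>n. submodule (\<Phi> (C i)) R Y \<and> W' \<subseteq> \<Phi> (C i) \<and> \<Phi> (C i) \<subseteq> U'"
    using C(1) assms(1) by blast
  moreover have "\<forall>i<n. \<Phi> (C i) \<subset> \<Phi> (C (Suc i))"
    using C assms(2) by (simp add: less_imp_le_nat Suc_le_eq)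
  ultimately have "submodule_chain R Y n W' U'"
    unfolding submodule_chain_def by (intro exI[of _ "\<lambda>i. \<Phi> (C i)"]) blast
  then show "x \<le> mlength R Y W' U'" using n submodule_chain_le by blast
qed

text \<open>Strictness is the point: an equation \<open>f x = f v + w\<close> with
  \<open>w \<in> W'\<close> puts \<open>x - v\<close> into \<open>W\<close>, so \<open>x\<close>
  already belongs to the smaller submodule.\<close>

lemma mlength_inj:
  assumes "module R X" "module R Y" "submodule U R X" "submodule W R X" "W \<subseteq> U"
    and "submodule U' R Y" "submodule W' R Y" "W' \<subseteq> U'"
    and f: "f \<in> mod_hom_on R X U Y" "f ` U \<subseteq> U'" "\<And>x. x \<in> U \<Longrightarrow> f x \<in> W' \<Longrightarrow> x \<in> W"
  shows "mlength R X W U \<le> mlength R Y W' U'"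
proof -
  interpret X: module R X by fact
  interpret Y: module R Y by fact
  note fD = mod_hom_onD[OF f(1)]
  show ?thesis
  proof (rule mlength_embedding[where \<Phi> = "\<lambda>V. f ` V <+>\<^bsub>Y\<^esub> W'"])
    fix V assume V: "submodule V R X" "W \<subseteq> V" "V \<subseteq> U"
    have s: "submodule (f ` V) R Y" using Y.submodule_image[OF f(1) assms(1,3) V(1,3)] .
    have "f ` V <+>\<^bsub>Y\<^esub> W' \<subseteq> U'"
      using Y.set_add_least[OF assms(6) _ assms(8), of "f ` V"] V f(2) by blast
    then show "submodule (f ` V <+>\<^bsub>Y\<^esub> W') R Y \<and> W' \<subseteq> f ` V <+>\<^bsub>Y\<^esub> W' \<and> f ` V <+>\<^bsub>Y\<^esub> W' \<subseteq> U'"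
      using Y.submodule_set_add[OF s assms(7)] Y.set_add_upper[OF s assms(7)] by blast
  next
    fix V1 V2 assume V: "submodule V1 R X" "submodule V2 R X" "W \<subseteq> V1" "V1 \<subset> V2" "V2 \<subseteq> U"
    then obtain x where x: "x \<in> V2" "x \<notin> V1" by blast
    have s: "submodule (f ` V2) R Y" using Y.submodule_image[OF f(1) assms(1,3) V(2,5)] .
    have "f x \<in> f ` V2 <+>\<^bsub>Y\<^esub> W'" using Y.set_add_upper[OF s assms(7)] x by blast
    moreover have "f x \<notin> f ` V1 <+>\<^bsub>Y\<^esub> W'"
    proof
      assume "f x \<in> f ` V1 <+>\<^bsub>Y\<^esub> W'"
      then obtain v w where vw: "v \<in> V1" "w \<in> W'" "f x = f v \<oplus>\<^bsub>Y\<^esub> w" unfolding Y.mem_set_add by blast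
      have xv: "x \<in> U" "v \<in> U" using V x vw by auto
      have w: "w \<in> carrier Y" using Y.submoduleD(1)[OF assms(7)] vw by auto
      have "f (x \<ominus>\<^bsub>X\<^esub> v) = f x \<ominus>\<^bsub>Y\<^esub> f v" using Y.mod_hom_on_minus[OF f(1) assms(1,3) xv] .
      also have "\<dots> = w" using vw(3) w fD(1)[OF xv(2)]
        by (simp add: Y.M.minus_eq Y.M.a_comm[of "f v"] Y.M.a_assoc Y.M.r_neg)
      finally have "x \<ominus>\<^bsub>X\<^esub> v \<in> W" using f(3) X.submoduleD(6)[OF assms(3) xv] vw(2) by auto
      then have "v \<oplus>\<^bsub>X\<^esub> (x \<ominus>\<^bsub>X\<^esub> v) \<in> V1" using X.submoduleD(3)[OF V(1)] vw(1) V(3) by blast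
      then show False using x(2) X.minus_add_self X.submoduleD(1)[OF assms(3)] xv by auto
    qed
    moreover have "f ` V1 <+>\<^bsub>Y\<^esub> W' \<subseteq> f ` V2 <+>\<^bsub>Y\<^esub> W'"
      using V(4) unfolding subset_iff Y.mem_set_add by blast
    ultimately show "f ` V1 <+>\<^bsub>Y\<^esub> W' \<subset> f ` V2 <+>\<^bsub>Y\<^esub> W'" by blast
  qed
qed

lemma mlength_surj:
  assumes "module R X" "module R Y" "submodule U R X" "submodule W R X" "W \<subseteq> U"
    and "submodule U' R Y" "submodule W' R Y" "W' \<subseteq> U'"
    and f: "f \<in> mod_hom_on R X U Y" "\<And>y. y \<in> U' \<Longrightarrow> \<exists>x\<in>U. \<exists>w\<in>W'. y = f x \<oplus>\<^bsub>Y\<^esub> w" "f ` W \<subseteq> W'"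
  shows "mlength R Y W' U' \<le> mlength R X W U"
proof -
  interpret X: module R X by fact
  interpret Y: module R Y by fact
  note fD = mod_hom_onD[OF f(1)]
  show ?thesis
  proof (rule mlength_embedding[where \<Phi> = "\<lambda>V. {x \<in> U. f x \<in> V}"])
    fix V assume V: "submodule V R Y" "W' \<subseteq> V" "V \<subseteq> U'"
    show "submodule {x \<in> U. f x \<in> V} R X \<and> W \<subseteq> {x \<in> U. f x \<in> V} \<and> {x \<in> U. f x \<in> V} \<subseteq> U"
      using Y.submodule_vimage[OF f(1) assms(1,3) V(1)] f(3) assms(5) V(2) by blast
  next
    fix V1 V2 assume V: "submodule V1 R Y" "submodule V2 R Y" "W' \<subseteq> V1" "V1 \<subset> V2" "V2 \<subseteq> U'"
    then obtain y where y: "y \<in> V2" "y \<notin> V1" by blast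
    then obtain x w where xw: "x \<in> U" "w \<in> W'" "y = f x \<oplus>\<^bsub>Y\<^esub> w" using f(2) V(5) by blast
    have "f x \<in> V2"
      using Y.submodule_add_cancel'[OF V(2), of w "f x"] xw y V fD(1)[OF xw(1)] by blast
    moreover have "f x \<notin> V1"
      using Y.submoduleD(3)[OF V(1), of "f x" w] xw y V by blast
    ultimately show "{x \<in> U. f x \<in> V1} \<subset> {x \<in> U. f x \<in> V2}" using V(4) xw(1) by blast
  qed
qed

section \<open>Tuples and finite free modules\<close>

text \<open>All sequences form one ambient module, with \<open>R^n\<close> and its submodules inside
  it as sequences that vanish from \<open>n\<close> on. Free modules of every rank thus share a
  type, as a family of syzygies indexed by natural numbers requires, and equality of tuples is
  equality of functions.\<close>

definition seq_module :: "('a, 'b, 'm) module_scheme \<Rightarrow> ('a, nat \<Rightarrow> 'b) module" where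
  "seq_module X =
     \<lparr>carrier = {f. \<forall>l. f l \<in> carrier X}, monoid.mult = undefined, monoid.one = undefined,
      ring.zero = (\<lambda>_. \<zero>\<^bsub>X\<^esub>), ring.add = (\<lambda>f g l. f l \<oplus>\<^bsub>X\<^esub> g l),
      smult = (\<lambda>r f l. r \<odot>\<^bsub>X\<^esub> f l)\<rparr>"

lemma seq_module_simps [simp]:
  "f \<in> carrier (seq_module X) \<longleftrightarrow> (\<forall>l. f l \<in> carrier X)"
  "\<zero>\<^bsub>seq_module X\<^esub> = (\<lambda>_. \<zero>\<^bsub>X\<^esub>)"
  "f \<oplus>\<^bsub>seq_module X\<^esub> g = (\<lambda>l. f l \<oplus>\<^bsub>X\<^esub> g l)"
  "r \<odot>\<^bsub>seq_module X\<^esub> f = (\<lambda>l. r \<odot>\<^bsub>X\<^esub> f l)"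
  by (simp_all add: seq_module_def)

definition tuples :: "('a, 'b, 'm) module_scheme \<Rightarrow> nat \<Rightarrow> 'b set \<Rightarrow> (nat \<Rightarrow> 'b) set" where
  "tuples X n U = {f. (\<forall>l<n. f l \<in> U) \<and> (\<forall>l\<ge>n. f l = \<zero>\<^bsub>X\<^esub>)}"

lemma regular_module_simps [simp]:
  "carrier (regular_module R) = carrier R"
  "\<zero>\<^bsub>regular_module R\<^esub> = \<zero>\<^bsub>R\<^esub>"
  "x \<oplus>\<^bsub>regular_module R\<^esub> y = x \<oplus>\<^bsub>R\<^esub> y"
  "r \<odot>\<^bsub>regular_module R\<^esub> x = r \<otimes>\<^bsub>R\<^esub> x"
  by (simp_all add: regular_module_def)

primrec lincomb :: "('a, 'b, 'm) module_scheme \<Rightarrow> (nat \<Rightarrow> 'a) \<Rightarrow> (nat \<Rightarrow> 'b) \<Rightarrow> nat \<Rightarrow> 'b" where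
  "lincomb X v c 0 = \<zero>\<^bsub>X\<^esub>"
| "lincomb X v c (Suc n) = lincomb X v c n \<oplus>\<^bsub>X\<^esub> v n \<odot>\<^bsub>X\<^esub> c n"

definition lspan :: "('a, 'r) ring_scheme \<Rightarrow> ('a, 'b, 'm) module_scheme \<Rightarrow> (nat \<Rightarrow> 'b) \<Rightarrow> nat \<Rightarrow> 'b set" where
  "lspan R X c n = (\<lambda>v. lincomb X v c n) ` tuples (regular_module R) n (carrier R)"

definition unit_vec :: "('a, 'r) ring_scheme \<Rightarrow> nat \<Rightarrow> nat \<Rightarrow> 'a" where
  "unit_vec R l = (\<lambda>i. if i = l then \<one>\<^bsub>R\<^esub> else \<zero>\<^bsub>R\<^esub>)"

text \<open>The least submodule containing the products. An upper bound for \<open>I U\<close> is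
  then tested on single products \<open>r u\<close>, with no sums of products to handle.\<close>

definition mprod :: "('a, 'r) ring_scheme \<Rightarrow> ('a, 'b, 'm) module_scheme \<Rightarrow> 'a set \<Rightarrow> 'b set \<Rightarrow> 'b set" where
  "mprod R X I U = \<Inter>{W. submodule W R X \<and> (\<forall>r\<in>I. \<forall>u\<in>U. r \<odot>\<^bsub>X\<^esub> u \<in> W)}"

abbreviation (in cring) Reg :: "('a, 'a) module" where "Reg \<equiv> regular_module R"
abbreviation (in cring) Vec :: "('a, nat \<Rightarrow> 'a) module" where "Vec \<equiv> seq_module (regular_module R)"
abbreviation (in cring) Fn :: "nat \<Rightarrow> (nat \<Rightarrow> 'a) set" where "Fn n \<equiv> tuples Reg n (carrier R)"

lemma (in cring) module_regular: "module R Reg"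
proof (rule moduleI)
  show "cring R" by (rule is_cring)
  show "abelian_group Reg"
  proof (rule abelian_groupI)
    fix x assume "x \<in> carrier Reg"
    then show "\<exists>y\<in>carrier Reg. y \<oplus>\<^bsub>Reg\<^esub> x = \<zero>\<^bsub>Reg\<^esub>"
      by (intro bexI[of _ "\<ominus> x"]) (auto simp: l_neg)
  qed (auto simp: a_ac)
qed (auto simp: m_ac l_distr r_distr)

lemma (in module) module_seq: "module R (seq_module M)"
proof (rule moduleI)
  show "cring R" by (rule R.is_cring)
  show "abelian_group (seq_module M)"
  proof (rule abelian_groupI)
    fix x assume "x \<in> carrier (seq_module M)"
    then show "\<exists>y\<in>carrier (seq_module M). y \<oplus>\<^bsub>seq_module M\<^esub> x = \<zero>\<^bsub>seq_module M\<^esub>"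
      by (intro bexI[of _ "\<lambda>l. \<ominus>\<^bsub>M\<^esub> x l"]) (auto simp: M.l_neg)
  qed (auto simp: M.a_ac)
qed (auto simp: smult_l_distr smult_r_distr smult_assoc1)

lemma (in cring) module_Vec: "module R Vec"
  using module.module_seq[OF module_regular] .

lemma (in module) seq_uminus:
  assumes "f \<in> carrier (seq_module M)"
  shows "\<ominus>\<^bsub>seq_module M\<^esub> f = (\<lambda>l. \<ominus>\<^bsub>M\<^esub> f l)"
proof -
  interpret S: module R "seq_module M" by (rule module_seq)
  show ?thesis
    by (rule S.M.minus_equality) (use assms in \<open>auto simp: M.l_neg\<close>)
qed

lemma (in module) seq_minus:
  assumes "f \<in> carrier (seq_module M)" "g \<in> carrier (seq_module M)"
  shows "f \<ominus>\<^bsub>seq_module M\<^esub> g = (\<lambda>l. f l \<ominus>\<^bsub>M\<^esub> g l)"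
  using assms seq_uminus[OF assms(2)] by (simp add: a_minus_def)

lemma (in cring) uminus_regular: "x \<in> carrier R \<Longrightarrow> \<ominus>\<^bsub>Reg\<^esub> x = \<ominus> x"
proof -
  assume x: "x \<in> carrier R"
  interpret S: module R Reg by (rule module_regular)
  show ?thesis
    by (rule S.M.minus_equality) (use x in \<open>auto simp: l_neg\<close>)
qed

lemma (in cring) minus_regular: "x \<in> carrier R \<Longrightarrow> y \<in> carrier R \<Longrightarrow> x \<ominus>\<^bsub>Reg\<^esub> y = x \<ominus> y"
  by (simp add: a_minus_def uminus_regular)

context module
begin

lemma submodule_tuples:
  assumes "submodule U R M"
  shows "submodule (tuples M n U) R (seq_module M)"
proof -
  interpret S: module R "seq_module M" by (rule module_seq)
  note U = submoduleD[OF assms]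
  have "f l \<in> carrier M" if "f \<in> tuples M n U" for f l
    using that U(1) by (cases "l < n") (auto simp: tuples_def)
  then show ?thesis
    unfolding S.submodule_iff
    using U by (auto simp: tuples_def)
qed

lemma tuples_mono: "W \<subseteq> U \<Longrightarrow> tuples M n W \<subseteq> tuples M n U"
  by (auto simp: tuples_def)

lemma tuples_0 [simp]: "tuples M 0 U = {\<lambda>_. \<zero>\<^bsub>M\<^esub>}"
  by (auto simp: tuples_def)

lemma mlength_eqI:
  assumes "module R X" "submodule U R X" "submodule W R X" "W \<subseteq> U"
    and "submodule U' R M" "submodule W' R M" "W' \<subseteq> U'"
    and f: "f \<in> mod_hom_on R X U M" "f ` U = U'" "\<And>x. x \<in> U \<Longrightarrow> f x \<in> W' \<longleftrightarrow> x \<in> W"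
  shows "mlength R X W U = mlength R M W' U'"
proof (rule antisym)
  have M: "module R M" by (rule module_axioms)
  show "mlength R X W U \<le> mlength R M W' U'"
    using f by (intro mlength_inj[OF assms(1) M assms(2-7)]) auto
  show "mlength R M W' U' \<le> mlength R X W U"
  proof (rule mlength_surj[OF assms(1) M assms(2-7) f(1)])
    fix y assume y: "y \<in> U'"
    then obtain x where x: "x \<in> U" "y = f x" using f(2) by blast
    have "f x = f x \<oplus>\<^bsub>M\<^esub> \<zero>\<^bsub>M\<^esub>" using y x submoduleD(1)[OF assms(5)] by simp
    then show "\<exists>x\<in>U. \<exists>w\<in>W'. y = f x \<oplus>\<^bsub>M\<^esub> w" using x submoduleD(2)[OF assms(6)] by blast
  next
    show "f ` W \<subseteq> W'" using f(3) assms(4) by blast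
  qed
qed

text \<open>Induction on \<open>n\<close> through the intermediate submodule of tuples whose last
  entry lies in \<open>W\<close>: above it, evaluation at the last index leaves \<open>U/W\<close>;
  below it, erasing that entry leaves the case of \<open>n\<close>.\<close>

lemma mlength_tuples:
  assumes "submodule W R M" "submodule U R M" "W \<subseteq> U"
  shows "mlength R (seq_module M) (tuples M n W) (tuples M n U) = enat n * mlength R M W U"
proof (induction n)
  case 0
  interpret S: module R "seq_module M" by (rule module_seq)
  show ?case
    using S.mlength_eq_0[OF submodule_tuples[OF assms(1), of 0] submodule_tuples[OF assms(2), of 0]]
    by (simp add: zero_enat_def[symmetric])
next
  case (Suc n)
  interpret S: module R "seq_module M" by (rule module_seq)
  note U = submoduleD[OF assms(2)] and W = submoduleD[OF assms(1)]
  note SW = submodule_tuples[OF assms(1)] and SU = submodule_tuples[OF assms(2)]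
  have hom: "(\<lambda>f. f n) \<in> mod_hom_on R (seq_module M) (tuples M (Suc n) U) M"
    using U(1) by (intro mod_hom_onI) (auto simp: tuples_def)
  define V where "V = {f \<in> tuples M (Suc n) U. f n \<in> W}"
  have V: "submodule V R (seq_module M)"
    unfolding V_def using submodule_vimage[OF hom S.module_axioms SU assms(1)] .
  have WV: "tuples M (Suc n) W \<subseteq> V" using assms(3) by (auto simp: V_def tuples_def)
  have VU: "V \<subseteq> tuples M (Suc n) U" by (auto simp: V_def)
  have img: "(\<lambda>f. f n) ` tuples M (Suc n) U = U"
  proof (intro equalityI subsetI)
    fix u assume "u \<in> U"
    then have "(\<lambda>l. if l = n then u else \<zero>\<^bsub>M\<^esub>) \<in> tuples M (Suc n) U" using U(2) by (auto simp: tuples_def)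
    then show "u \<in> (\<lambda>f. f n) ` tuples M (Suc n) U" by (rule rev_image_eqI) simp
  qed (auto simp: tuples_def)
  have 1: "mlength R (seq_module M) V (tuples M (Suc n) U) = mlength R M W U"
    by (rule mlength_eqI[OF S.module_axioms SU V VU assms(2,1,3) hom img]) (auto simp: V_def)
  define g where "g f = f(n := \<zero>\<^bsub>M\<^esub>)" for f :: "nat \<Rightarrow> 'c"
  have g: "g \<in> mod_hom_on R (seq_module M) V (seq_module M)"
  proof (rule mod_hom_onI)
    fix f assume "f \<in> V"
    then have "f l \<in> carrier M" for l
      using U(1) M.zero_closed by (cases "l < Suc n") (auto simp: V_def tuples_def)
    then show "g f \<in> carrier (seq_module M)" by (simp add: g_def)
  qed (auto simp: g_def fun_eq_iff)
  have gim: "g ` V = tuples M n U"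
  proof (intro equalityI subsetI)
    fix f assume "f \<in> tuples M n U"
    then have "f \<in> V" "g f = f" using U(2) W(2) by (auto simp: V_def g_def tuples_def less_Suc_eq)
    then show "f \<in> g ` V" by (metis imageI)
  qed (auto simp: g_def V_def tuples_def)
  have giff: "g f \<in> tuples M n W \<longleftrightarrow> f \<in> tuples M (Suc n) W" if "f \<in> V" for f
    using that by (auto simp: g_def V_def tuples_def less_Suc_eq)
  have 2: "mlength R (seq_module M) (tuples M (Suc n) W) V = enat n * mlength R M W U"
    unfolding Suc[symmetric]
    by (rule S.mlength_eqI[OF S.module_axioms V SW WV SU SW tuples_mono[OF assms(3)] g gim giff])
  have "mlength R (seq_module M) (tuples M (Suc n) W) (tuples M (Suc n) U) =
      enat n * mlength R M W U + mlength R M W U"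
    using S.mlength_additive[OF SW V SU WV VU] 1 2 by simp
  also have "\<dots> = enat (Suc n) * mlength R M W U"
    by (cases "mlength R M W U") (auto simp: zero_enat_def[symmetric] imult_infinity_right split: if_splits nat.splits)
  finally show ?case .
qed

lemma lincomb_closed:
  assumes "submodule U R M" "\<And>l. l < n \<Longrightarrow> v l \<in> carrier R" "\<And>l. l < n \<Longrightarrow> v l \<in> carrier R \<Longrightarrow> v l \<odot>\<^bsub>M\<^esub> c l \<in> U"
  shows "lincomb M v c n \<in> U"
  using assms(2,3) by (induction n) (use submoduleD[OF assms(1)] in auto)

lemma lincomb_carrier [simp]:
  assumes "\<And>l. l < n \<Longrightarrow> v l \<in> carrier R" "\<And>l. l < n \<Longrightarrow> c l \<in> carrier M"
  shows "lincomb M v c n \<in> carrier M"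
  using assms by (intro lincomb_closed[OF carrier_is_submodule]) auto

lemma lincomb_cong:
  assumes "\<And>l. l < n \<Longrightarrow> v l = v' l" "\<And>l. l < n \<Longrightarrow> c l = c' l"
  shows "lincomb M v c n = lincomb M v' c' n"
  using assms by (induction n) auto

lemma lincomb_add:
  assumes "\<And>l. l < n \<Longrightarrow> v l \<in> carrier R" "\<And>l. l < n \<Longrightarrow> w l \<in> carrier R" "\<And>l. l < n \<Longrightarrow> c l \<in> carrier M"
  shows "lincomb M (\<lambda>l. v l \<oplus> w l) c n = lincomb M v c n \<oplus>\<^bsub>M\<^esub> lincomb M w c n"
  using assms
proof (induction n)
  case (Suc n)
  have "lincomb M v c n \<in> carrier M" "lincomb M w c n \<in> carrier M" using Suc.prems by auto
  then show ?case using Suc by (simp add: smult_l_distr M.a_ac)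
qed simp

lemma lincomb_smult:
  assumes "\<And>l. l < n \<Longrightarrow> v l \<in> carrier R" "r \<in> carrier R" "\<And>l. l < n \<Longrightarrow> c l \<in> carrier M"
  shows "lincomb M (\<lambda>l. r \<otimes> v l) c n = r \<odot>\<^bsub>M\<^esub> lincomb M v c n"
  using assms
proof (induction n)
  case (Suc n)
  have "lincomb M v c n \<in> carrier M" using Suc.prems by auto
  then show ?case using Suc by (simp add: smult_r_distr smult_assoc1)
qed simp

lemma lincomb_add_right:
  assumes "\<And>l. l < n \<Longrightarrow> v l \<in> carrier R" "\<And>l. l < n \<Longrightarrow> c l \<in> carrier M" "\<And>l. l < n \<Longrightarrow> d l \<in> carrier M"
  shows "lincomb M v (\<lambda>l. c l \<oplus>\<^bsub>M\<^esub> d l) n = lincomb M v c n \<oplus>\<^bsub>M\<^esub> lincomb M v d n"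
  using assms
proof (induction n)
  case (Suc n)
  have "lincomb M v c n \<in> carrier M" "lincomb M v d n \<in> carrier M" using Suc.prems by auto
  then show ?case using Suc by (simp add: smult_r_distr M.a_ac)
qed simp

lemma lincomb_smult_right:
  assumes "\<And>l. l < n \<Longrightarrow> v l \<in> carrier R" "r \<in> carrier R" "\<And>l. l < n \<Longrightarrow> c l \<in> carrier M"
  shows "lincomb M v (\<lambda>l. r \<odot>\<^bsub>M\<^esub> c l) n = r \<odot>\<^bsub>M\<^esub> lincomb M v c n"
  using assms
proof (induction n)
  case (Suc n)
  have "lincomb M v c n \<in> carrier M" using Suc.prems by auto
  moreover have "v n \<odot>\<^bsub>M\<^esub> (r \<odot>\<^bsub>M\<^esub> c n) = r \<odot>\<^bsub>M\<^esub> (v n \<odot>\<^bsub>M\<^esub> c n)"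
    using Suc.prems by (simp flip: smult_assoc1 add: R.m_comm)
  ultimately show ?case using Suc by (simp add: smult_r_distr)
qed simp

lemma lincomb_zero:
  assumes "\<And>l. l < n \<Longrightarrow> v l \<odot>\<^bsub>M\<^esub> c l = \<zero>\<^bsub>M\<^esub>"
  shows "lincomb M v c n = \<zero>\<^bsub>M\<^esub>"
  using assms by (induction n) auto

lemma lincomb_unit_vec:
  assumes "l < n" "\<And>l. l < n \<Longrightarrow> c l \<in> carrier M"
  shows "lincomb M (unit_vec R l) c n = c l"
  using assms
proof (induction n)
  case (Suc n)
  show ?case
  proof (cases "l = n")
    case True
    then have "lincomb M (unit_vec R l) c n = \<zero>\<^bsub>M\<^esub>"
      using Suc.prems by (intro lincomb_zero) (auto simp: unit_vec_def)
    then show ?thesis using True Suc.prems by (simp add: unit_vec_def)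
  next
    case False
    then have "lincomb M (unit_vec R l) c n = c l" using Suc by auto
    then show ?thesis using False Suc.prems by (simp add: unit_vec_def)
  qed
qed simp

lemma lincomb_hom:
  assumes "f \<in> mod_hom_on R X U M" "module R X" "submodule U R X"
    and "\<And>l. l < n \<Longrightarrow> v l \<in> carrier R" "\<And>l. l < n \<Longrightarrow> c l \<in> U"
  shows "f (lincomb X v c n) = lincomb M v (\<lambda>l. f (c l)) n"
  using assms(4,5)
proof (induction n)
  case 0 then show ?case using mod_hom_on_zero[OF assms(1-3)] by simp
next
  case (Suc n)
  interpret X: module R X by fact
  note U = X.submoduleD[OF assms(3)]
  have "lincomb X v c n \<in> U" using Suc.prems U by (intro X.lincomb_closed[OF assms(3)]) auto
  then show ?case using mod_hom_onD[OF assms(1)] Suc U(4) by simp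
qed

lemma Fn_iff: "v \<in> R.Fn n \<longleftrightarrow> (\<forall>l. v l \<in> carrier R) \<and> (\<forall>l\<ge>n. v l = \<zero>)"
  by (auto simp: tuples_def) (metis R.zero_closed linorder_not_le)

lemma hom_lincomb:
  assumes "\<And>l. l < n \<Longrightarrow> c l \<in> carrier M"
  shows "(\<lambda>v. lincomb M v c n) \<in> mod_hom_on R R.Vec (R.Fn n) M"
  using assms by (intro mod_hom_onI) (auto simp: Fn_iff lincomb_add lincomb_smult)

end

context cring
begin

lemma submodule_Fn: "submodule (Fn n) R Vec"
proof -
  interpret G: module R Reg by (rule module_regular)
  show ?thesis using G.submodule_tuples[OF G.carrier_is_submodule] by simp
qed

lemma mem_Fn: "v \<in> Fn n \<longleftrightarrow> (\<forall>l. v l \<in> carrier R) \<and> (\<forall>l\<ge>n. v l = \<zero>)"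
  using module.Fn_iff[OF module_regular] .

lemma unit_vec_Fn: "l < n \<Longrightarrow> unit_vec R l \<in> Fn n"
  by (auto simp: mem_Fn unit_vec_def)

lemma lincomb_unit_vecs:
  assumes "v \<in> Fn n"
  shows "lincomb Vec v (unit_vec R) n = v"
proof
  fix i
  have *: "lincomb Vec v (unit_vec R) k i = (if i < k then v i else \<zero>)" for k
    using assms by (induction k) (auto simp: mem_Fn unit_vec_def less_Suc_eq)
  show "lincomb Vec v (unit_vec R) n i = v i"
    using assms unfolding * by (auto simp: mem_Fn)
qed

end

context module
begin

lemma submodule_span:
  assumes "\<And>l. l < n \<Longrightarrow> c l \<in> carrier M"
  shows "submodule (lspan R M c n) R M"
  unfolding lspan_def
  using submodule_image[OF hom_lincomb[OF assms] R.module_Vec R.submodule_Fn R.submodule_Fn] by auto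

lemma span_gen: "l < n \<Longrightarrow> (\<And>l. l < n \<Longrightarrow> c l \<in> carrier M) \<Longrightarrow> c l \<in> lspan R M c n"
  unfolding lspan_def by (rule image_eqI[of _ _ "unit_vec R l"]) (auto simp: lincomb_unit_vec R.unit_vec_Fn)

lemma span_least:
  assumes "submodule U R M" "\<And>l. l < n \<Longrightarrow> c l \<in> U"
  shows "lspan R M c n \<subseteq> U"
  unfolding lspan_def using submoduleD[OF assms(1)] assms(2)
  by (auto intro!: lincomb_closed[OF assms(1)] simp: Fn_iff)

lemma hom_Fn_eq_lincomb:
  assumes "f \<in> mod_hom_on R R.Vec (R.Fn n) M" "v \<in> R.Fn n"
  shows "f v = lincomb M v (\<lambda>l. f (unit_vec R l)) n"
proof -
  have "f v = f (lincomb R.Vec v (unit_vec R) n)" using R.lincomb_unit_vecs[OF assms(2)] by simp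
  also have "\<dots> = lincomb M v (\<lambda>l. f (unit_vec R l)) n"
    using assms(2) by (intro lincomb_hom[OF assms(1) R.module_Vec R.submodule_Fn]) (auto simp: Fn_iff intro: R.unit_vec_Fn[unfolded R.mem_Fn, THEN conjunct1, rule_format] R.unit_vec_Fn[unfolded R.mem_Fn, THEN conjunct2, rule_format])
  finally show ?thesis .
qed

lemma submodule_mprod:
  assumes "I \<subseteq> carrier R" "U \<subseteq> carrier M"
  shows "submodule (mprod R M I U) R M"
  unfolding mprod_def
  by (rule submodule_Inter) (use carrier_is_submodule assms in auto)

lemma mprod_mem: "r \<in> I \<Longrightarrow> u \<in> U \<Longrightarrow> r \<odot>\<^bsub>M\<^esub> u \<in> mprod R M I U"
  by (auto simp: mprod_def)

lemma mprod_least: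
  "submodule W R M \<Longrightarrow> (\<And>r u. r \<in> I \<Longrightarrow> u \<in> U \<Longrightarrow> r \<odot>\<^bsub>M\<^esub> u \<in> W) \<Longrightarrow> mprod R M I U \<subseteq> W"
  by (auto simp: mprod_def)

lemma mprod_subset: "I \<subseteq> carrier R \<Longrightarrow> submodule U R M \<Longrightarrow> mprod R M I U \<subseteq> U"
  using submoduleD(4) by (intro mprod_least) auto

lemma mprod_mono: "U \<subseteq> V \<Longrightarrow> mprod R M I U \<subseteq> mprod R M I V"
  unfolding mprod_def by (rule Inter_anti_mono) blast

lemma mprod_image:
  assumes "f \<in> mod_hom_on R X U M" "module R X" "submodule U R X" "I \<subseteq> carrier R" "V \<subseteq> carrier M"
    and "f ` U \<subseteq> V" "x \<in> mprod R X I U"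
  shows "f x \<in> mprod R M I V"
proof -
  interpret X: module R X by fact
  have "mprod R X I U \<subseteq> {x \<in> U. f x \<in> mprod R M I V}"
  proof (rule X.mprod_least)
    show "submodule {x \<in> U. f x \<in> mprod R M I V} R X"
      by (rule submodule_vimage[OF assms(1-3) submodule_mprod[OF assms(4,5)]])
  next
    fix r u assume ru: "r \<in> I" "u \<in> U"
    then have "f (r \<odot>\<^bsub>X\<^esub> u) = r \<odot>\<^bsub>M\<^esub> f u" using mod_hom_onD[OF assms(1)] assms(4) by blast
    moreover have "r \<odot>\<^bsub>M\<^esub> f u \<in> mprod R M I V" using ru assms(6) by (intro mprod_mem) auto
    ultimately show "r \<odot>\<^bsub>X\<^esub> u \<in> {x \<in> U. f x \<in> mprod R M I V}"
      using X.submoduleD(4)[OF assms(3)] assms(4) ru by auto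
  qed
  then show ?thesis using assms(7) by blast
qed

text \<open>Since \<open>I\<close> is an ideal, combinations of the generators with coefficients in
  \<open>I\<close> are already closed under addition and scalars, so one coefficient from
  \<open>I\<close> per generator is enough.\<close>

lemma mprod_span:
  assumes I: "submodule I R R.Reg" and c: "\<And>l. l < n \<Longrightarrow> c l \<in> carrier M"
  shows "mprod R M I (lspan R M c n) = (\<lambda>v. lincomb M v c n) ` tuples R.Reg n I"
proof
  interpret G: module R R.Reg by (rule R.module_regular)
  note ID = G.submoduleD[OF I]
  have sub: "tuples R.Reg n I \<subseteq> R.Fn n" using ID(1) by (auto simp: tuples_def)
  show "mprod R M I (lspan R M c n) \<subseteq> (\<lambda>v. lincomb M v c n) ` tuples R.Reg n I"
  proof (rule mprod_least)
    show "submodule ((\<lambda>v. lincomb M v c n) ` tuples R.Reg n I) R M"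
      by (rule submodule_image[OF hom_lincomb[OF c] R.module_Vec R.submodule_Fn G.submodule_tuples[OF I] sub])
  next
    fix r u assume ru: "r \<in> I" "u \<in> lspan R M c n"
    then obtain v where v: "v \<in> R.Fn n" "u = lincomb M v c n" by (auto simp: lspan_def)
    have "r \<odot>\<^bsub>M\<^esub> u = lincomb M (\<lambda>l. r \<otimes> v l) c n"
      using v c ru ID(1) by (subst lincomb_smult) (auto simp: Fn_iff)
    moreover have "(\<lambda>l. r \<otimes> v l) \<in> tuples R.Reg n I"
      using v ru ID(1,4) by (auto simp: Fn_iff tuples_def R.m_comm[of r])
    ultimately show "r \<odot>\<^bsub>M\<^esub> u \<in> (\<lambda>v. lincomb M v c n) ` tuples R.Reg n I" by blast
  qed
  show "(\<lambda>v. lincomb M v c n) ` tuples R.Reg n I \<subseteq> mprod R M I (lspan R M c n)"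
  proof (intro image_subsetI)
    fix v assume v: "v \<in> tuples R.Reg n I"
    have sp: "lspan R M c n \<subseteq> carrier M" using submoduleD(1)[OF submodule_span[OF c]] by auto
    show "lincomb M v c n \<in> mprod R M I (lspan R M c n)"
    proof (rule lincomb_closed[OF submodule_mprod])
      show "I \<subseteq> carrier R" using ID(1) by auto
      show "lspan R M c n \<subseteq> carrier M" by fact
    next
      fix l assume "l < n" then show "v l \<in> carrier R" using v ID(1) by (auto simp: tuples_def)
    next
      fix l assume "l < n" then show "v l \<odot>\<^bsub>M\<^esub> c l \<in> mprod R M I (lspan R M c n)"
        using v c span_gen by (intro mprod_mem) (auto simp: tuples_def)
    qed
  qed
qed

end

section \<open>Local rings of finite length with vanishing cube of the maximal ideal\<close>

text \<open>The hypotheses in the form used for computation: elements outside \<open>\<mm>\<close>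
  are units, threefold products vanish, and \<open>R\<close> has finite length in place of the
  descending chain condition, so that lengths can be added and cancelled.\<close>

locale local_cube_zero = cring R for R (structure) +
  fixes \<mm>
  assumes submodule_max: "submodule \<mm> R (regular_module R)"
    and one_notin_max: "\<one> \<notin> \<mm>"
    and UnitsI: "\<And>r. r \<in> carrier R \<Longrightarrow> r \<notin> \<mm> \<Longrightarrow> r \<in> Units R"
    and cube_zero: "\<And>r s t. r \<in> \<mm> \<Longrightarrow> s \<in> \<mm> \<Longrightarrow> t \<in> \<mm> \<Longrightarrow> r \<otimes> (s \<otimes> t) = \<zero>"
    and finite_length: "mlength R (regular_module R) {\<zero>} (carrier R) \<noteq> \<infinity>"
begin

sublocale Reg: module R "regular_module R" by (rule module_regular)
sublocale Vec: module R "seq_module (regular_module R)" by (rule module_Vec)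

abbreviation max2 where "max2 \<equiv> mprod R Reg \<mm> \<mm>"

lemmas maxD = Reg.submoduleD[OF submodule_max, simplified]

lemma max_carrier: "\<mm> \<subseteq> carrier R" using maxD(1) by auto

lemma submodule_carrier: "submodule (carrier R) R Reg"
  using Reg.carrier_is_submodule by simp

lemma submodule_max2: "submodule max2 R Reg"
  using max_carrier by (intro Reg.submodule_mprod) auto

lemma max2_subset: "max2 \<subseteq> \<mm>"
  using Reg.mprod_subset[OF max_carrier submodule_max] .

lemma mult_max2:
  assumes "r \<in> \<mm>" "s \<in> max2"
  shows "r \<otimes> s = \<zero>"
proof -
  have "max2 \<subseteq> {x \<in> carrier R. r \<otimes> x = \<zero>}"
  proof (rule Reg.mprod_least)
    have r: "r \<in> carrier R" using assms max_carrier by auto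
    show "submodule {x \<in> carrier R. r \<otimes> x = \<zero>} R Reg"
      unfolding Reg.submodule_iff using r by (auto simp: r_distr m_lcomm[of r])
  next
    fix s t assume "s \<in> \<mm>" "t \<in> \<mm>"
    then show "s \<odot>\<^bsub>Reg\<^esub> t \<in> {x \<in> carrier R. r \<otimes> x = \<zero>}"
      using cube_zero[OF assms(1)] max_carrier by auto
  qed
  then show ?thesis using assms(2) by auto
qed

lemma mult_Units_max:
  assumes "u \<in> Units R" "r \<in> carrier R" "u \<otimes> r \<in> \<mm>"
  shows "r \<in> \<mm>"
proof -
  have "inv u \<otimes> (u \<otimes> r) = r" using assms m_assoc[of "inv u" u r] by (simp add: Units_closed)
  then show ?thesis using maxD(4)[of "inv u" "u \<otimes> r"] assms by auto
qed

lemma max_prime: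
  assumes "r \<in> carrier R" "s \<in> carrier R" "r \<otimes> s \<in> \<mm>" "r \<notin> \<mm>"
  shows "s \<in> \<mm>"
  using mult_Units_max UnitsI assms by blast

lemma mlength_max: "mlength R Reg \<mm> (carrier R) = 1"
proof (rule Reg.mlength_eq_1[OF submodule_max submodule_carrier])
  show "\<mm> \<subset> carrier R" using max_carrier one_notin_max by auto
next
  fix V assume V: "submodule V R Reg" "\<mm> \<subseteq> V" "V \<subseteq> carrier R"
  show "V = \<mm> \<or> V = carrier R"
  proof (cases "V \<subseteq> \<mm>")
    case False
    then obtain u where u: "u \<in> V" "u \<notin> \<mm>" by blast
    then have U: "u \<in> Units R" using UnitsI V by blast
    have "r \<in> V" if "r \<in> carrier R" for r
    proof -
      have "(r \<otimes> inv u) \<otimes> u = r" using that U m_assoc[of r "inv u" u] by (simp add: Units_closed)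
      then show ?thesis using Reg.submoduleD(4)[OF V(1), of "r \<otimes> inv u" u] that U u by auto
    qed
    then show ?thesis using V by blast
  qed (use V in blast)
qed

lemma mlength_Fn_max: "mlength R Vec (tuples Reg n \<mm>) (Fn n) = enat n"
  using Reg.mlength_tuples[OF submodule_max submodule_carrier] max_carrier mlength_max by simp

lemma zero_Vec: "submodule {\<lambda>_. \<zero>} R Vec" using Vec.submodule_zero by simp

lemma tuples_zero: "tuples Reg n {\<zero>} = {\<lambda>_. \<zero>}"
  by (auto simp: tuples_def fun_eq_iff) (metis not_le)

lemma finite_length_sub:
  assumes "submodule U R Vec" "U \<subseteq> Fn n"
  shows "mlength R Vec {\<lambda>_. \<zero>} U \<noteq> \<infinity>"
proof -
  have "mlength R Vec (tuples Reg n {\<zero>}) (Fn n) = enat n * mlength R Reg {\<zero>} (carrier R)"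
    using Reg.mlength_tuples[OF Reg.submodule_zero submodule_carrier] by simp
  moreover have "mlength R Vec {\<lambda>_. \<zero>} U \<le> mlength R Vec {\<lambda>_. \<zero>} (Fn n)"
    using Vec.submoduleD(2)[OF assms(1)] by (intro Vec.mlength_mono zero_Vec submodule_Fn assms) auto
  ultimately show ?thesis using finite_length unfolding tuples_zero
    by (cases "mlength R Reg {\<zero>} (carrier R)"; cases "mlength R Vec {\<lambda>_. \<zero>} U") auto
qed

text \<open>As long as a finite family in \<open>U\<close> does not span, adjoining an element
  outside its span lengthens a chain; if this never stopped, chains of every length would
  exist.\<close>

lemma finite_length_imp_lspan:
  assumes X: "module R X" and U: "submodule U R X" "mlength R X {\<zero>\<^bsub>X\<^esub>} U \<noteq> \<infinity>"
  shows "\<exists>n c. (\<forall>l<n. c l \<in> U) \<and> U = lspan R X c n"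
proof (rule ccontr)
  assume not: "\<not> ?thesis"
  interpret X: module R X by fact
  note UD = X.submoduleD[OF U(1)]
  have "\<exists>c. (\<forall>l<n. c l \<in> U) \<and> submodule_chain R X n {\<zero>\<^bsub>X\<^esub>} (lspan R X c n)" for n
  proof (induction n)
    case 0
    have "submodule (lspan R X (\<lambda>_. \<zero>\<^bsub>X\<^esub>) 0) R X" by (rule X.submodule_span) auto
    then have "{\<zero>\<^bsub>X\<^esub>} \<subseteq> lspan R X (\<lambda>_. \<zero>\<^bsub>X\<^esub>) 0" using X.submoduleD(2) by blast
    then have "submodule_chain R X 0 {\<zero>\<^bsub>X\<^esub>} (lspan R X (\<lambda>_. \<zero>\<^bsub>X\<^esub>) 0)"
      by (rule submodule_chain_0[OF X.submodule_zero])
    then show ?case by auto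
  next
    case (Suc n)
    then obtain c where c: "\<forall>l<n. c l \<in> U" "submodule_chain R X n {\<zero>\<^bsub>X\<^esub>} (lspan R X c n)" by blast
    have "lspan R X c n \<subseteq> U" using X.span_least[OF U(1)] c by blast
    moreover have "lspan R X c n \<noteq> U" using not c(1) by blast
    ultimately obtain u where u: "u \<in> U" "u \<notin> lspan R X c n" by blast
    define d where "d = c(n := u)"
    have d: "\<forall>l<Suc n. d l \<in> U" using c u by (auto simp: d_def less_Suc_eq)
    then have dX: "\<And>l. l < Suc n \<Longrightarrow> d l \<in> carrier X" using UD(1) by auto
    have sub: "submodule (lspan R X d (Suc n)) R X" by (rule X.submodule_span) (use dX in auto)
    have "lspan R X c n \<subseteq> lspan R X d (Suc n)"
    proof (rule X.span_least[OF sub])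
      fix l assume "l < n"
      then have "d l = c l" "l < Suc n" by (auto simp: d_def)
      then show "c l \<in> lspan R X d (Suc n)" using X.span_gen[of l "Suc n" d] dX by auto
    qed
    moreover have "u \<in> lspan R X d (Suc n)"
      using X.span_gen[of n "Suc n" d] dX by (auto simp: d_def)
    ultimately have "lspan R X c n \<subset> lspan R X d (Suc n)" using u by blast
    moreover have "{\<zero>\<^bsub>X\<^esub>} \<subseteq> lspan R X d (Suc n)" using X.submoduleD(2)[OF sub] by blast
    ultimately have "submodule_chain R X (Suc n) {\<zero>\<^bsub>X\<^esub>} (lspan R X d (Suc n))"
      by (rule submodule_chain_snoc[OF c(2) _ sub])
    then show ?case using d by blast
  qed
  moreover have "lspan R X c n \<subseteq> U" if "\<forall>l<n. c l \<in> U" for n c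
    using X.span_least[OF U(1)] that by blast
  ultimately have "submodule_chain R X n {\<zero>\<^bsub>X\<^esub>} U" for n
    using submodule_chain_widen by metis
  then have le: "enat n \<le> mlength R X {\<zero>\<^bsub>X\<^esub>} U" for n by (rule submodule_chain_le)
  show False
  proof (cases "mlength R X {\<zero>\<^bsub>X\<^esub>} U")
    case (enat k) then show ?thesis using le[of "Suc k"] by simp
  qed (use U(2) in simp)
qed

text \<open>Minimality is imposed on relations: all their coefficients lie in \<open>\<mm>\<close>.
  In this form it says directly that the kernel of the cover lies in \<open>\<mm>\<close> times the
  free module, which is where every length count starts.\<close>

definition mincover :: "('a, 'c, 'n) module_scheme \<Rightarrow> 'c set \<Rightarrow> nat \<Rightarrow> (nat \<Rightarrow> 'c) \<Rightarrow> bool" where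
  "mincover X U n c \<longleftrightarrow> (\<forall>l<n. c l \<in> U) \<and> U = lspan R X c n \<and>
     (\<forall>v\<in>Fn n. lincomb X v c n = \<zero>\<^bsub>X\<^esub> \<longrightarrow> v \<in> tuples Reg n \<mm>)"

lemma lincomb_isolate:
  assumes "module R X" "submodule W R X" "l < n"
    and "\<And>i. i < n \<Longrightarrow> v i \<in> carrier R" "\<And>i. i < n \<Longrightarrow> c i \<in> carrier X"
    and "\<And>i. i < n \<Longrightarrow> i \<noteq> l \<Longrightarrow> c i \<in> W" "lincomb X v c n \<in> W"
  shows "v l \<odot>\<^bsub>X\<^esub> c l \<in> W"
  using assms(3-)
proof (induction n)
  case (Suc n)
  interpret X: module R X by fact
  note W = X.submoduleD[OF assms(2)]
  have 1: "lincomb X v c n \<in> carrier X" using Suc.prems by auto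
  have 2: "v n \<odot>\<^bsub>X\<^esub> c n \<in> carrier X" using Suc.prems by auto
  show ?case
  proof (cases "l = n")
    case True
    have "lincomb X v c n \<in> W" using Suc.prems True W(4) by (intro X.lincomb_closed[OF assms(2)]) auto
    then show ?thesis using X.submodule_add_cancel[OF assms(2) _ 2] Suc.prems(5) True by simp
  next
    case False
    then have "v n \<odot>\<^bsub>X\<^esub> c n \<in> W" using Suc.prems W(4) by auto
    then have "lincomb X v c n \<in> W" using X.submodule_add_cancel'[OF assms(2) _ 1] Suc.prems(5) by simp
    then show ?thesis using Suc.IH Suc.prems False by auto
  qed
qed simp

text \<open>A family of least cardinality works, for a relation with a coefficient outside
  \<open>\<mm>\<close>, a unit, would express one generator by the others.\<close>

lemma ex_mincover:
  assumes X: "module R X" and U: "submodule U R X" and c: "\<forall>l<n. c l \<in> U" "U = lspan R X c n"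
  shows "\<exists>n c. mincover X U n c"
proof -
  interpret X: module R X by fact
  note UD = X.submoduleD[OF U(1)]
  define P where "P n = (\<exists>c. (\<forall>l<n. c l \<in> U) \<and> U = lspan R X c n)" for n
  define k where "k = (LEAST n. P n)"
  have "P n" using c by (auto simp: P_def)
  then have "P k" unfolding k_def by (rule LeastI)
  then obtain d where d: "\<forall>l<k. d l \<in> U" "U = lspan R X d k" by (auto simp: P_def)
  have dX: "\<And>l. l < k \<Longrightarrow> d l \<in> carrier X" using UD d by auto
  have "v \<in> tuples Reg k \<mm>" if v: "v \<in> Fn k" "lincomb X v d k = \<zero>\<^bsub>X\<^esub>" for v
  proof (rule ccontr)
    assume "v \<notin> tuples Reg k \<mm>"
    then obtain l where l: "l < k" "v l \<notin> \<mm>" using v by (auto simp: tuples_def)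
    then have u: "v l \<in> Units R" using UnitsI v by (auto simp: mem_Fn)
    obtain k' where k': "k = Suc k'" using l by (cases k) auto
    define e where "e = d(l := d k')"
    have eU: "\<forall>i<k'. e i \<in> U" using d k' by (auto simp: e_def)
    then have eX: "\<And>i. i < k' \<Longrightarrow> e i \<in> carrier X" using UD by auto
    define W where "W = lspan R X e k'"
    have W: "submodule W R X" unfolding W_def by (rule X.submodule_span) (use eX in auto)
    have others: "d i \<in> W" if "i < k" "i \<noteq> l" for i
    proof (cases "i = k'")
      case True
      then have "l < k'" "e l = d i" using l k' that by (auto simp: e_def)
      then show ?thesis unfolding W_def using X.span_gen[of l k' e] eX by auto
    next
      case False
      then have "i < k'" "e i = d i" using k' that by (auto simp: e_def)
      then show ?thesis unfolding W_def using X.span_gen[of i k' e] eX by auto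
    qed
    have "v l \<odot>\<^bsub>X\<^esub> d l \<in> W"
      using v others X.submoduleD(2)[OF W]
      by (intro lincomb_isolate[OF X W l(1)]) (auto simp: mem_Fn dX)
    then have "inv (v l) \<odot>\<^bsub>X\<^esub> (v l \<odot>\<^bsub>X\<^esub> d l) \<in> W" using X.submoduleD(4)[OF W] u by auto
    then have "d l \<in> W" using u dX l(1) by (simp flip: X.smult_assoc1 add: Units_closed)
    then have "U \<subseteq> W" unfolding d(2) using others by (intro X.span_least[OF W]) metis
    moreover have "W \<subseteq> U" unfolding W_def by (rule X.span_least[OF U]) (use eU in auto)
    ultimately have "P k'" using eU by (auto simp: P_def W_def)
    then show False using Least_le[of P k'] k' by (simp add: k_def)
  qed
  then show ?thesis using d unfolding mincover_def by blast
qed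

lemma mincover_hom:
  assumes "module R X" "submodule U R X" "mincover X U n c"
  shows "(\<lambda>v. lincomb X v c n) \<in> mod_hom_on R Vec (Fn n) X" "(\<lambda>v. lincomb X v c n) ` Fn n = U"
    "l < n \<Longrightarrow> c l \<in> carrier X"
proof -
  interpret X: module R X by fact
  show c: "\<And>l. l < n \<Longrightarrow> c l \<in> carrier X"
    using assms(3) X.submoduleD(1)[OF assms(2)] by (auto simp: mincover_def)
  show "(\<lambda>v. lincomb X v c n) \<in> mod_hom_on R Vec (Fn n) X" by (rule X.hom_lincomb) (rule c)
  show "(\<lambda>v. lincomb X v c n) ` Fn n = U" using assms(3) by (auto simp: mincover_def lspan_def)
qed

lemma mincover_mprod:
  assumes "module R X" "submodule U R X" "mincover X U n c"
  shows "mprod R X \<mm> U = (\<lambda>v. lincomb X v c n) ` tuples Reg n \<mm>"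
proof -
  interpret X: module R X by fact
  show ?thesis
    using X.mprod_span[OF submodule_max mincover_hom(3)[OF assms]] assms(3) by (simp add: mincover_def)
qed

lemma submodule_tuples_max: "submodule (tuples Reg n \<mm>) R Vec"
  by (rule Reg.submodule_tuples[OF submodule_max])

lemma tuples_max_subset: "tuples Reg n \<mm> \<subseteq> Fn n"
  by (rule Reg.tuples_mono[OF max_carrier])

lemma mincover_mprod_iff:
  assumes "module R X" "submodule U R X" "mincover X U n c" "v \<in> Fn n"
  shows "lincomb X v c n \<in> mprod R X \<mm> U \<longleftrightarrow> v \<in> tuples Reg n \<mm>"
proof
  interpret X: module R X by fact
  assume "lincomb X v c n \<in> mprod R X \<mm> U"
  then obtain w where w: "w \<in> tuples Reg n \<mm>" "lincomb X v c n = lincomb X w c n"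
    unfolding mincover_mprod[OF assms(1-3)] by auto
  have wF: "w \<in> Fn n" using w tuples_max_subset by auto
  have "lincomb X (v \<ominus>\<^bsub>Vec\<^esub> w) c n = lincomb X v c n \<ominus>\<^bsub>X\<^esub> lincomb X w c n"
    using X.mod_hom_on_minus[OF mincover_hom(1)[OF assms(1-3)] module_Vec submodule_Fn assms(4) wF] .
  also have "\<dots> = \<zero>\<^bsub>X\<^esub>"
    using w(2) mod_hom_onD(1)[OF mincover_hom(1)[OF assms(1-3)] wF] by (simp add: X.M.r_neg X.M.minus_eq)
  finally have "v \<ominus>\<^bsub>Vec\<^esub> w \<in> tuples Reg n \<mm>"
    using assms(3) Vec.submoduleD(6)[OF submodule_Fn assms(4) wF] by (auto simp: mincover_def)
  then have "w \<oplus>\<^bsub>Vec\<^esub> (v \<ominus>\<^bsub>Vec\<^esub> w) \<in> tuples Reg n \<mm>"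
    using Vec.submoduleD(3)[OF submodule_tuples_max w(1)] by blast
  then show "v \<in> tuples Reg n \<mm>"
    using Vec.minus_add_self Vec.submoduleD(1)[OF submodule_Fn] assms(4) wF by metis
qed (use mincover_mprod[OF assms(1-3)] in blast)

text \<open>By minimality \<open>\<mm>\<close> times the free module is the full preimage of
  \<open>\<mm> U\<close>, so \<open>U / \<mm> U\<close> has the length of
  \<open>R^n / \<mm> R^n\<close>, which is \<open>n\<close>. The minimal number of generators
  thereby becomes a length.\<close>

lemma mincover_mlength:
  assumes "module R X" "submodule U R X" "mincover X U n c"
  shows "mlength R X (mprod R X \<mm> U) U = enat n"
proof -
  interpret X: module R X by fact
  have U: "U \<subseteq> carrier X" using X.submoduleD(1)[OF assms(2)] by auto
  have "mlength R Vec (tuples Reg n \<mm>) (Fn n) = mlength R X (mprod R X \<mm> U) U"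
    by (rule X.mlength_eqI[OF module_Vec submodule_Fn submodule_tuples_max tuples_max_subset assms(2)
          X.submodule_mprod[OF max_carrier U] X.mprod_subset[OF max_carrier assms(2)]
          mincover_hom(1,2)[OF assms] mincover_mprod_iff[OF assms]])
  then show ?thesis using mlength_Fn_max by simp
qed

lemma tuples_max_mprod: "tuples Reg n \<mm> \<subseteq> mprod R Vec \<mm> (Fn n)"
proof
  fix v assume v: "v \<in> tuples Reg n \<mm>"
  have F: "Fn n \<subseteq> carrier Vec" using Vec.submoduleD(1)[OF submodule_Fn] by blast
  have "lincomb Vec v (unit_vec R) n \<in> mprod R Vec \<mm> (Fn n)"
  proof (rule Vec.lincomb_closed[OF Vec.submodule_mprod[OF max_carrier F]])
    fix l assume "l < n"
    then show "v l \<in> carrier R" "v l \<odot>\<^bsub>Vec\<^esub> unit_vec R l \<in> mprod R Vec \<mm> (Fn n)"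
      using v max_carrier unit_vec_Fn by (auto simp: tuples_def intro!: Vec.mprod_mem simp del: seq_module_simps)
  qed
  then show "v \<in> mprod R Vec \<mm> (Fn n)" using lincomb_unit_vecs[OF subsetD[OF tuples_max_subset v]] by simp
qed

lemma mprod_tuples_max: "mprod R Vec \<mm> (tuples Reg n \<mm>) \<subseteq> tuples Reg n max2"
proof (rule Vec.mprod_least[OF Reg.submodule_tuples[OF submodule_max2]])
  fix r u assume "r \<in> \<mm>" "u \<in> tuples Reg n \<mm>"
  then show "r \<odot>\<^bsub>Vec\<^esub> u \<in> tuples Reg n max2"
    using Reg.mprod_mem[of r \<mm> _ \<mm>] max_carrier by (auto simp: tuples_def)
qed

lemma smult_tuples_max2:
  assumes "r \<in> \<mm>" "u \<in> tuples Reg n max2"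
  shows "r \<odot>\<^bsub>Vec\<^esub> u = (\<lambda>_. \<zero>)"
proof
  fix l show "(r \<odot>\<^bsub>Vec\<^esub> u) l = \<zero>"
    using assms mult_max2[OF assms(1)] max_carrier by (cases "l < n") (auto simp: tuples_def)
qed

lemma mprod_sub_max:
  assumes "U \<subseteq> tuples Reg n \<mm>"
  shows "mprod R Vec \<mm> U \<subseteq> tuples Reg n max2"
  using Vec.mprod_mono[OF assms] mprod_tuples_max by blast

end

text \<open>For a free module \<open>F\<close> this says that Ext in degree one from
  \<open>F/Z\<close> to \<open>N\<close> vanishes. All vanishing hypotheses are brought into this
  form.\<close>

definition extends ::
    "('a, 'r) ring_scheme \<Rightarrow> ('a, 'b, 'm) module_scheme \<Rightarrow> 'b set \<Rightarrow> 'b set \<Rightarrow> ('a, 'c, 'n) module_scheme \<Rightarrow> bool"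
  where "extends R X Z F N \<longleftrightarrow>
     (\<forall>f\<in>mod_hom_on R X Z N. \<exists>g\<in>mod_hom_on R X F N. \<forall>x\<in>Z. g x = f x)"

lemma extendsD:
  assumes "extends R X Z F N" "f \<in> mod_hom_on R X Z N"
  shows "\<exists>g\<in>mod_hom_on R X F N. \<forall>x\<in>Z. g x = f x"
  using assms(1) unfolding extends_def by (rule bspec[OF _ assms(2)])

lemma mod_hom_on_codomain_iff:
  "V \<subseteq> carrier Y \<Longrightarrow>
    f \<in> mod_hom_on R X U (Y\<lparr>carrier := V\<rparr>) \<longleftrightarrow> f \<in> mod_hom_on R X U Y \<and> f ` U \<subseteq> V"
  by (auto simp: mod_hom_def)

context module
begin

text \<open>The universal property of the quotient, with \<open>U\<close> itself in the role of
  \<open>F\<close> modulo the kernel of \<open>\<pi>\<close>: choice picks a preimage, and the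
  kernel condition makes the choice immaterial.\<close>

lemma mod_hom_factor:
  assumes X: "module R X" and Y: "module R Y" and F: "submodule F R X" "submodule U R Y"
    and \<pi>: "\<pi> \<in> mod_hom_on R X F Y" "\<pi> ` F = U"
    and f: "f \<in> mod_hom_on R X F M" "\<And>x. x \<in> F \<Longrightarrow> \<pi> x = \<zero>\<^bsub>Y\<^esub> \<Longrightarrow> f x = \<zero>\<^bsub>M\<^esub>"
  shows "\<exists>g\<in>mod_hom_on R Y U M. \<forall>x\<in>F. g (\<pi> x) = f x"
proof -
  interpret X: module R X by fact
  interpret Y: module R Y by fact
  note fD = mod_hom_onD[OF f(1)] and pD = mod_hom_onD[OF \<pi>(1)] and FD = X.submoduleD[OF F(1)]
  have eq: "f x = f y" if "x \<in> F" "y \<in> F" "\<pi> x = \<pi> y" for x y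
  proof -
    have "\<pi> (x \<ominus>\<^bsub>X\<^esub> y) = \<pi> x \<ominus>\<^bsub>Y\<^esub> \<pi> y" by (rule Y.mod_hom_on_minus[OF \<pi>(1) X F(1) that(1,2)])
    also have "\<dots> = \<zero>\<^bsub>Y\<^esub>" using that pD(1) by (simp add: Y.M.r_neg Y.M.minus_eq)
    finally have "f (x \<ominus>\<^bsub>X\<^esub> y) = \<zero>\<^bsub>M\<^esub>" using f(2) FD(6) that by blast
    then have "f x \<ominus>\<^bsub>M\<^esub> f y = \<zero>\<^bsub>M\<^esub>" using mod_hom_on_minus[OF f(1) X F(1) that(1,2)] by simp
    then show ?thesis using minus_eq_zero fD(1) that by blast
  qed
  define g where "g u = f (SOME x. x \<in> F \<and> \<pi> x = u)" for u
  have g: "g (\<pi> x) = f x" if "x \<in> F" for x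
  proof -
    have "(SOME y. y \<in> F \<and> \<pi> y = \<pi> x) \<in> F \<and> \<pi> (SOME y. y \<in> F \<and> \<pi> y = \<pi> x) = \<pi> x"
      by (rule someI[of "\<lambda>y. y \<in> F \<and> \<pi> y = \<pi> x" x]) (use that in auto)
    then show ?thesis unfolding g_def using eq that by blast
  qed
  have "g \<in> mod_hom_on R Y U M"
  proof (rule mod_hom_onI)
    fix u assume "u \<in> U"
    then obtain x where "x \<in> F" "u = \<pi> x" using \<pi>(2) by blast
    then show "g u \<in> carrier M" using g fD(1) by simp
  next
    fix u v assume "u \<in> U" "v \<in> U"
    then obtain x y where *: "x \<in> F" "u = \<pi> x" "y \<in> F" "v = \<pi> y" using \<pi>(2) by blast
    then have "u \<oplus>\<^bsub>Y\<^esub> v = \<pi> (x \<oplus>\<^bsub>X\<^esub> y)" "x \<oplus>\<^bsub>X\<^esub> y \<in> F" using pD(2) FD(3) by auto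
    then show "g (u \<oplus>\<^bsub>Y\<^esub> v) = g u \<oplus>\<^bsub>M\<^esub> g v" using g fD(2) * by simp
  next
    fix r u assume r: "r \<in> carrier R" and "u \<in> U"
    then obtain x where *: "x \<in> F" "u = \<pi> x" using \<pi>(2) by blast
    then have "r \<odot>\<^bsub>Y\<^esub> u = \<pi> (r \<odot>\<^bsub>X\<^esub> x)" "r \<odot>\<^bsub>X\<^esub> x \<in> F" using pD(3) FD(4) r by auto
    then show "g (r \<odot>\<^bsub>Y\<^esub> u) = r \<odot>\<^bsub>M\<^esub> g u" using g fD(3) * r by simp
  qed
  then show ?thesis using g by blast
qed

lemma mod_hom_on_compose:
  assumes "f \<in> mod_hom_on R X U Y" "f ` U \<subseteq> V" "g \<in> mod_hom_on R Y V M"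
  shows "(\<lambda>x. g (f x)) \<in> mod_hom_on R X U M"
proof (rule mod_hom_onI)
  note fD = mod_hom_onD[OF assms(1)] and gD = mod_hom_onD[OF assms(3)]
  have V: "f x \<in> V" if "x \<in> U" for x using assms(2) that by blast
  show "g (f x) \<in> carrier M" if "x \<in> U" for x using gD(1) V that by blast
  show "g (f (x \<oplus>\<^bsub>X\<^esub> y)) = g (f x) \<oplus>\<^bsub>M\<^esub> g (f y)" if "x \<in> U" "y \<in> U" for x y
    using fD(2) gD(2) V that by simp
  show "g (f (r \<odot>\<^bsub>X\<^esub> x)) = r \<odot>\<^bsub>M\<^esub> g (f x)" if "r \<in> carrier R" "x \<in> U" for r x
    using fD(3) gD(3) V that by simp
qed

lemma mod_hom_on_diff:
  assumes "f \<in> mod_hom_on R X U M" "g \<in> mod_hom_on R X U M"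
  shows "(\<lambda>x. f x \<ominus>\<^bsub>M\<^esub> g x) \<in> mod_hom_on R X U M"
proof (rule mod_hom_onI)
  note fD = mod_hom_onD[OF assms(1)] and gD = mod_hom_onD[OF assms(2)]
  show "f x \<ominus>\<^bsub>M\<^esub> g x \<in> carrier M" if "x \<in> U" for x using fD gD that by simp
  show "f (x \<oplus>\<^bsub>X\<^esub> y) \<ominus>\<^bsub>M\<^esub> g (x \<oplus>\<^bsub>X\<^esub> y) = f x \<ominus>\<^bsub>M\<^esub> g x \<oplus>\<^bsub>M\<^esub> (f y \<ominus>\<^bsub>M\<^esub> g y)" if "x \<in> U" "y \<in> U" for x y
  proof -
    have "f x \<in> carrier M" "f y \<in> carrier M" "g x \<in> carrier M" "g y \<in> carrier M"
      using fD gD that by auto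
    then show ?thesis using fD(2) gD(2) that by (simp add: M.minus_eq M.minus_add M.a_ac)
  qed
  show "f (r \<odot>\<^bsub>X\<^esub> x) \<ominus>\<^bsub>M\<^esub> g (r \<odot>\<^bsub>X\<^esub> x) = r \<odot>\<^bsub>M\<^esub> (f x \<ominus>\<^bsub>M\<^esub> g x)" if "r \<in> carrier R" "x \<in> U" for r x
  proof -
    have "f x \<in> carrier M" "g x \<in> carrier M" using fD gD that by auto
    then show ?thesis using fD(3) gD(3) that by (simp add: M.minus_eq smult_r_distr smult_r_minus)
  qed
qed

end

section \<open>Minimal syzygies\<close>

text \<open>No module \<open>M\<close> occurs: only a submodule \<open>L 0\<close> of
  \<open>\<mm> R^p\<close> is given, and everything after that takes place inside the one module of
  sequences. The data \<open>b\<close> and \<open>c\<close> fix a minimal cover of each syzygy, so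
  the differentials are explicit matrices with rows \<open>c (Suc t) i\<close>.\<close>

locale syzygies = local_cube_zero R \<mm> for R :: "('a, 'r) ring_scheme" (structure) and \<mm> +
  fixes L :: "nat \<Rightarrow> (nat \<Rightarrow> 'a) set" and b :: "nat \<Rightarrow> nat" and c :: "nat \<Rightarrow> nat \<Rightarrow> nat \<Rightarrow> 'a" and p :: nat
  assumes submodule_L0: "submodule (L 0) R (seq_module (regular_module R))"
    and L0_subset: "L 0 \<subseteq> tuples (regular_module R) p \<mm>"
    and mincover_L: "\<And>j. mincover (seq_module (regular_module R)) (L j) (b j) (c j)"
    and L_Suc: "\<And>j. L (Suc j) = {v \<in> Fn (b j). lincomb (seq_module (regular_module R)) v (c j) (b j) = (\<lambda>_. \<zero>)}"

lemma (in local_cube_zero) submodule_kernel: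
  assumes "module R X" "submodule U R X" "mincover X U n c"
  shows "submodule {v \<in> Fn n. lincomb X v c n = \<zero>\<^bsub>X\<^esub>} R Vec"
proof -
  interpret X: module R X by fact
  show ?thesis
    using X.submodule_vimage[OF mincover_hom(1)[OF assms] module_Vec submodule_Fn X.submodule_zero] by simp
qed

lemma (in local_cube_zero) ex_mincover_Vec:
  assumes "submodule U R Vec" "U \<subseteq> Fn q"
  shows "\<exists>n c. mincover Vec U n c"
  using finite_length_imp_lspan[OF module_Vec assms(1)] finite_length_sub[OF assms]
    ex_mincover[OF module_Vec assms(1)] by (auto simp del: seq_module_simps(1,3,4))

text \<open>Dependent choice on triples of a submodule, a rank and a minimal cover: the kernel of a
  cover lies in a free module of finite rank, so it has finite length and a minimal cover
  again.\<close>

lemma (in local_cube_zero) ex_syzygies: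
  assumes "submodule U R Vec" "U \<subseteq> tuples Reg p \<mm>"
  shows "\<exists>L b c. syzygies R \<mm> L b c p \<and> L 0 = U"
proof -
  let ?P = "\<lambda>(W, n, c). submodule W R Vec \<and> (\<exists>q. W \<subseteq> Fn q) \<and> mincover Vec W n c"
  let ?Q = "\<lambda>(W, n, c) (W', n', c'). W' = {v \<in> Fn n. lincomb Vec v c n = (\<lambda>_. \<zero>)}"
  have "\<exists>x. ?P x \<and> fst x = U"
    using ex_mincover_Vec[OF assms(1)] assms tuples_max_subset[of p] by fastforce
  then obtain x0 where x0: "?P x0" "fst x0 = U" by blast
  have ex: "\<exists>y. ?P y \<and> ?Q x y" if Px: "?P x" for x
  proof -
    obtain W k c where x: "x = (W, k, c)" by (cases x)
    let ?K = "{v \<in> Fn k. lincomb Vec v c k = (\<lambda>_. \<zero>)}"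
    have K: "submodule ?K R Vec" using submodule_kernel[OF module_Vec, of W k c] Px x by simp
    obtain n' c' where "mincover Vec ?K n' c'" using ex_mincover_Vec[OF K, of k] by blast
    then have "?P (?K, n', c') \<and> ?Q x (?K, n', c')" using K x by blast
    then show ?thesis by blast
  qed
  define f where "f = rec_nat x0 (\<lambda>_ x. SOME y. ?P y \<and> ?Q x y)"
  have f0: "f 0 = x0" and fS: "f (Suc n) = (SOME y. ?P y \<and> ?Q (f n) y)" for n
    by (simp_all add: f_def)
  have P: "?P (f n)" for n
  proof (induction n)
    case (Suc n)
    show ?case unfolding fS using someI_ex[OF ex[OF Suc]] by (rule conjunct1)
  qed (use x0(1) f0 in simp)
  have Q: "?Q (f n) (f (Suc n))" for n
    unfolding fS using someI_ex[OF ex[OF P]] by (rule conjunct2)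
  note f = f0 P Q
  define L where "L n = fst (f n)" for n
  define b where "b n = fst (snd (f n))" for n
  define c where "c n = snd (snd (f n))" for n
  have fn: "f n = (L n, b n, c n)" for n by (simp add: L_def b_def c_def)
  have "syzygies R \<mm> L b c p"
  proof (intro syzygies.intro syzygies_axioms.intro local_cube_zero_axioms)
    show "submodule (L 0) R Vec" using x0 f(1) assms by (simp add: L_def)
    show "L 0 \<subseteq> tuples Reg p \<mm>" using x0 f(1) assms by (simp add: L_def)
    show "mincover Vec (L j) (b j) (c j)" for j using f(2)[of j] unfolding fn by simp
    show "L (Suc j) = {v \<in> Fn (b j). lincomb Vec v (c j) (b j) = (\<lambda>_. \<zero>)}" for j
      using f(3)[of j] unfolding fn by simp
  qed
  moreover have "L 0 = U" using x0 f(1) by (simp add: L_def)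
  ultimately show ?thesis by blast
qed

context syzygies
begin

abbreviation \<pi> where "\<pi> j v \<equiv> lincomb Vec v (c j) (b j)"

abbreviation mL where "mL j \<equiv> mprod R Vec \<mm> (L j)"

lemma L_Suc_subset: "L (Suc j) \<subseteq> tuples Reg (b j) \<mm>"
  using mincover_L[of j] unfolding L_Suc mincover_def by auto

lemma L_subset: "\<exists>n. L j \<subseteq> tuples Reg n \<mm>"
  using L0_subset L_Suc_subset by (cases j) auto

lemma submodule_L: "submodule (L j) R Vec"
proof (induction j)
  case (Suc j)
  show ?case using submodule_kernel[OF module_Vec Suc mincover_L] unfolding L_Suc by simp
qed (rule submodule_L0)

lemma L_carrier: "L j \<subseteq> carrier Vec"
  using Vec.submoduleD(1)[OF submodule_L] by blast

lemma submodule_mL: "submodule (mL j) R Vec"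
  by (rule Vec.submodule_mprod[OF max_carrier L_carrier])

lemma mL_subset: "mL j \<subseteq> L j"
  by (rule Vec.mprod_subset[OF max_carrier submodule_L])

lemma \<pi>_hom: "\<pi> j \<in> mod_hom_on R Vec (Fn (b j)) Vec"
  by (rule mincover_hom(1)[OF module_Vec submodule_L mincover_L])

lemma \<pi>_image: "\<pi> j ` Fn (b j) = L j"
  by (rule mincover_hom(2)[OF module_Vec submodule_L mincover_L])

lemma \<pi>_mem: "v \<in> Fn (b j) \<Longrightarrow> \<pi> j v \<in> L j"
  using \<pi>_image by blast

lemma \<pi>_image_max: "\<pi> j ` tuples Reg (b j) \<mm> = mL j"
  using mincover_mprod[OF module_Vec submodule_L mincover_L] by simp

lemma c_mem: "l < b j \<Longrightarrow> c j l \<in> L j"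
  using mincover_L[of j] by (auto simp: mincover_def)

lemma \<pi>_unit_vec: "l < b j \<Longrightarrow> \<pi> j (unit_vec R l) = c j l"
  by (intro Vec.lincomb_unit_vec subsetD[OF L_carrier c_mem])

lemma smult_mL: "r \<in> \<mm> \<Longrightarrow> z \<in> mL j \<Longrightarrow> r \<odot>\<^bsub>Vec\<^esub> z = (\<lambda>_. \<zero>)"
proof -
  assume "r \<in> \<mm>" "z \<in> mL j"
  moreover obtain n where "L j \<subseteq> tuples Reg n \<mm>" using L_subset by blast
  ultimately show ?thesis using smult_tuples_max2 subsetD[OF mprod_sub_max] by blast
qed

definition a where "a j = the_enat (mlength R Vec {\<lambda>_. \<zero>} (mL j))"
definition e where "e = the_enat (mlength R Reg max2 \<mm>)"
definition s where "s = the_enat (mlength R Reg {\<zero>} max2)"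

lemma zero_subset: "submodule U R Vec \<Longrightarrow> {\<lambda>_. \<zero>} \<subseteq> U"
  using Vec.submoduleD(2) by auto

lemma mlength_L: "mlength R Vec (mL j) (L j) = enat (b j)"
  by (rule mincover_mlength[OF module_Vec submodule_L mincover_L])

lemma mlength_mL: "mlength R Vec {\<lambda>_. \<zero>} (mL j) = enat (a j)"
proof -
  obtain n where "L j \<subseteq> tuples Reg n \<mm>" using L_subset by blast
  then have "mL j \<subseteq> Fn n" using mL_subset tuples_max_subset by blast
  then show ?thesis using finite_length_sub[OF submodule_mL, of j n] unfolding a_def
    by (cases "mlength R Vec {\<lambda>_. \<zero>} (mL j)") auto
qed

lemma mlength_max2_max: "mlength R Reg max2 \<mm> = enat e"
  and mlength_max2: "mlength R Reg {\<zero>} max2 = enat s"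
proof -
  have z: "submodule {\<zero>} R Reg" "{\<zero>} \<subseteq> max2"
    using Reg.submodule_zero Reg.submoduleD(2)[OF submodule_max2] by auto
  have "mlength R Reg max2 \<mm> \<le> mlength R Reg {\<zero>} (carrier R)"
    "mlength R Reg {\<zero>} max2 \<le> mlength R Reg {\<zero>} (carrier R)"
    using z submodule_max submodule_max2 submodule_carrier max2_subset max_carrier
    by (intro Reg.mlength_mono; blast)+
  then show "mlength R Reg max2 \<mm> = enat e" "mlength R Reg {\<zero>} max2 = enat s"
    using finite_length unfolding e_def s_def
    by (cases "mlength R Reg max2 \<mm>"; cases "mlength R Reg {\<zero>} max2"; auto)+
qed

text \<open>The generators of \<open>L j\<close> have entries in \<open>\<mm>\<close>, and
  \<open>\<mm>\<^sup>3 = 0\<close>, so every tuple over \<open>\<mm>\<^sup>2\<close> is a relation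
  among them.\<close>

lemma max2_subset_L: "tuples Reg (b j) max2 \<subseteq> L (Suc j)"
proof
  fix v assume v: "v \<in> tuples Reg (b j) max2"
  have F: "v \<in> Fn (b j)"
    using v tuples_max_subset Reg.tuples_mono[OF max2_subset, of "b j"] by blast
  obtain n where n: "L j \<subseteq> tuples Reg n \<mm>" using L_subset by blast
  have "v l \<odot>\<^bsub>Vec\<^esub> c j l = \<zero>\<^bsub>Vec\<^esub>" if "l < b j" for l
  proof
    fix i
    have "v l \<in> max2" using v that by (auto simp: tuples_def)
    moreover have "c j l i \<in> \<mm>"
      using c_mem[OF that] n maxD(2) by (cases "i < n") (auto simp: tuples_def subset_iff)
    ultimately show "(v l \<odot>\<^bsub>Vec\<^esub> c j l) i = \<zero>\<^bsub>Vec\<^esub> i"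
      using mult_max2[of "c j l i" "v l"] maxD(1) subsetD[OF max2_subset] by (simp add: m_comm)
  qed
  then have "\<pi> j v = \<zero>\<^bsub>Vec\<^esub>" by (rule Vec.lincomb_zero)
  then show "v \<in> L (Suc j)" unfolding L_Suc using F by simp
qed

lemma mL_Suc_subset: "mL (Suc j) \<subseteq> tuples Reg (b j) max2"
  by (rule mprod_sub_max[OF L_Suc_subset])

lemma submodule_tuples_max2: "submodule (tuples Reg n max2) R Vec"
  by (rule Reg.submodule_tuples[OF submodule_max2])

lemma mlength_L_Suc_max: "mlength R Vec (L (Suc j)) (tuples Reg (b j) \<mm>) = enat (a j)"
proof -
  have "mlength R Vec (L (Suc j)) (tuples Reg (b j) \<mm>) = mlength R Vec {\<lambda>_. \<zero>} (mL j)"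
  proof (rule Vec.mlength_eqI[OF module_Vec submodule_tuples_max submodule_L L_Suc_subset submodule_mL zero_Vec
        zero_subset[OF submodule_mL] mod_hom_on_subset[OF \<pi>_hom tuples_max_subset] \<pi>_image_max])
    fix v assume "v \<in> tuples Reg (b j) \<mm>"
    then show "\<pi> j v \<in> {\<lambda>_. \<zero>} \<longleftrightarrow> v \<in> L (Suc j)" unfolding L_Suc using tuples_max_subset by auto
  qed
  then show ?thesis using mlength_mL by simp
qed

lemma mlength_tuples_max2_max: "mlength R Vec (tuples Reg n max2) (tuples Reg n \<mm>) = enat (n * e)"
  using Reg.mlength_tuples[OF submodule_max2 submodule_max max2_subset] mlength_max2_max by simp

lemma mlength_tuples_max2: "mlength R Vec {\<lambda>_. \<zero>} (tuples Reg n max2) = enat (n * s)"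
  using Reg.mlength_tuples[OF Reg.submodule_zero submodule_max2] mlength_max2
    Reg.submoduleD(2)[OF submodule_max2] by (simp add: tuples_zero)

text \<open>Put \<open>F = Fn (b j)\<close>. In the chain \<open>0 \<subseteq> mL (Suc j)
  \<subseteq> \<mm>\<^sup>2 F \<subseteq> L (Suc j) \<subseteq> \<mm> F\<close> the top factor has
  length \<open>a j\<close>, because the cover maps \<open>\<mm> F\<close> onto \<open>mL j\<close>
  with kernel \<open>L (Suc j)\<close>. Both inequalities lose exactly the length of
  \<open>\<mm>\<^sup>2 F / mL (Suc j)\<close>, which is zero in the last two claims.\<close>

lemma betti_step:
  shows "b j * e \<le> b (Suc j) + a j" "a (Suc j) \<le> b j * s"
    and "mL (Suc j) = tuples Reg (b j) max2 \<Longrightarrow> b j * e = b (Suc j) + a j"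
    and "mL (Suc j) = tuples Reg (b j) max2 \<Longrightarrow> a (Suc j) = b j * s"
proof -
  have 1: "enat (b j * e) = mlength R Vec (tuples Reg (b j) max2) (L (Suc j)) + enat (a j)"
    using Vec.mlength_additive[OF submodule_tuples_max2 submodule_L submodule_tuples_max max2_subset_L L_Suc_subset]
      mlength_tuples_max2_max mlength_L_Suc_max by simp
  have 2: "enat (b (Suc j)) = mlength R Vec (mL (Suc j)) (tuples Reg (b j) max2)
      + mlength R Vec (tuples Reg (b j) max2) (L (Suc j))"
    using Vec.mlength_additive[OF submodule_mL submodule_tuples_max2 submodule_L mL_Suc_subset max2_subset_L]
      mlength_L by simp
  have 3: "enat (b j * s) = enat (a (Suc j)) + mlength R Vec (mL (Suc j)) (tuples Reg (b j) max2)"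
    using Vec.mlength_additive[OF zero_Vec submodule_mL submodule_tuples_max2 zero_subset[OF submodule_mL] mL_Suc_subset]
      mlength_mL mlength_tuples_max2 by simp
  have 4: "mlength R Vec (mL (Suc j)) (tuples Reg (b j) max2) = 0"
    if "mL (Suc j) = tuples Reg (b j) max2"
    using Vec.mlength_eq_0[OF submodule_mL submodule_tuples_max2 mL_Suc_subset] that by blast
  obtain x y where xy: "mlength R Vec (tuples Reg (b j) max2) (L (Suc j)) = enat x"
      "mlength R Vec (mL (Suc j)) (tuples Reg (b j) max2) = enat y"
    using 1 3 by (metis enat.exhaust plus_enat_simps(2,3) enat.distinct(1))
  show "b j * e \<le> b (Suc j) + a j" "a (Suc j) \<le> b j * s"
    using 1 2 3 xy by auto
  show "mL (Suc j) = tuples Reg (b j) max2 \<Longrightarrow> b j * e = b (Suc j) + a j"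
    "mL (Suc j) = tuples Reg (b j) max2 \<Longrightarrow> a (Suc j) = b j * s"
    using 1 2 3 4 xy by (auto simp: zero_enat_def)
qed

section \<open>Homomorphisms between syzygies and vanishing of Ext\<close>

definition max_valued where
  "max_valued t j \<longleftrightarrow> (\<forall>f\<in>mod_hom_on R Vec (L t) Vec. f ` L t \<subseteq> L j \<longrightarrow> f ` L t \<subseteq> mL j)"

text \<open>Vanishing of Ext in degree one from \<open>L t\<close> to \<open>L j\<close>, as
  \<open>Fn (b t)\<close> covers \<open>L t\<close> with kernel \<open>L (Suc t)\<close>. When
  \<open>L 0\<close> is the first syzygy of a module \<open>M\<close>, this is degree
  \<open>t + 2\<close> of Ext from \<open>M\<close> to \<open>L j\<close>.\<close>

definition ext_zero where
  "ext_zero t j \<longleftrightarrow> extends R Vec (L (Suc t)) (Fn (b t)) (Vec\<lparr>carrier := L j\<rparr>)"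

lemma ext_zeroD:
  assumes "ext_zero t j" "f \<in> mod_hom_on R Vec (L (Suc t)) Vec" "f ` L (Suc t) \<subseteq> L j"
  shows "\<exists>g\<in>mod_hom_on R Vec (Fn (b t)) Vec. g ` Fn (b t) \<subseteq> L j \<and> (\<forall>x\<in>L (Suc t). g x = f x)"
proof -
  have "f \<in> mod_hom_on R Vec (L (Suc t)) (Vec\<lparr>carrier := L j\<rparr>)"
    by (rule mod_hom_on_codomain_iff[OF L_carrier, THEN iffD2]) (use assms(2,3) in simp)
  then have "\<exists>g\<in>mod_hom_on R Vec (Fn (b t)) (Vec\<lparr>carrier := L j\<rparr>). \<forall>x\<in>L (Suc t). g x = f x"
    by (rule extendsD[OF assms(1)[unfolded ext_zero_def]])
  then obtain g where g: "g \<in> mod_hom_on R Vec (Fn (b t)) (Vec\<lparr>carrier := L j\<rparr>)"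
    and eq: "\<forall>x\<in>L (Suc t). g x = f x" by (rule bexE)
  from g have "g \<in> mod_hom_on R Vec (Fn (b t)) Vec \<and> g ` Fn (b t) \<subseteq> L j"
    by (rule mod_hom_on_codomain_iff[OF L_carrier, THEN iffD1])
  then show ?thesis using eq by (intro bexI[of _ g]) simp_all
qed
text \<open>\<open>L (Suc t)\<close> lies in \<open>\<mm> Fn (b t)\<close>, and an extension to all
  of \<open>Fn (b t)\<close> takes this into \<open>\<mm> (L j)\<close>.\<close>

lemma ext_zero_max_valued:
  assumes "ext_zero t j"
  shows "max_valued (Suc t) j"
  unfolding max_valued_def
proof (intro ballI impI image_subsetI)
  fix f x assume f: "f \<in> mod_hom_on R Vec (L (Suc t)) Vec" "f ` L (Suc t) \<subseteq> L j" and x: "x \<in> L (Suc t)"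
  obtain g where g: "g \<in> mod_hom_on R Vec (Fn (b t)) Vec" "g ` Fn (b t) \<subseteq> L j" "\<forall>x\<in>L (Suc t). g x = f x"
    using ext_zeroD[OF assms f] by blast
  have "x \<in> mprod R Vec \<mm> (Fn (b t))" using x L_Suc_subset tuples_max_mprod by blast
  then have "g x \<in> mL j"
    by (rule Vec.mprod_image[OF g(1) module_Vec submodule_Fn max_carrier L_carrier g(2)])
  then show "f x \<in> mL j" using g(3) x by simp
qed

lemma hom_L:
  assumes "f \<in> mod_hom_on R Vec (Fn (b t)) Vec" "\<And>v. v \<in> L (Suc t) \<Longrightarrow> f v = (\<lambda>_. \<zero>)"
  shows "\<exists>g\<in>mod_hom_on R Vec (L t) Vec. \<forall>v\<in>Fn (b t). g (\<pi> t v) = f v"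
proof (rule Vec.mod_hom_factor[OF module_Vec module_Vec submodule_Fn submodule_L \<pi>_hom \<pi>_image assms(1)])
  fix v assume "v \<in> Fn (b t)" "\<pi> t v = \<zero>\<^bsub>Vec\<^esub>"
  then have "v \<in> L (Suc t)" by (simp add: L_Suc)
  then show "f v = \<zero>\<^bsub>Vec\<^esub>" using assms(2) by simp
qed

text \<open>A socle element outside \<open>mL j\<close> would receive a homomorphism from \<open>L t\<close> that is not
  \<open>mL j\<close>-valued.\<close>

lemma socle_L:
  assumes "max_valued t j" "b t > 0" "z \<in> L j" "\<And>r. r \<in> \<mm> \<Longrightarrow> r \<odot>\<^bsub>Vec\<^esub> z = (\<lambda>_. \<zero>)"
  shows "z \<in> mL j"
proof -
  have z: "\<And>i. z i \<in> carrier R" using subsetD[OF L_carrier assms(3)] by simp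
  have "(\<lambda>v. v 0 \<odot>\<^bsub>Vec\<^esub> z) \<in> mod_hom_on R Vec (Fn (b t)) Vec"
    by (rule mod_hom_onI) (use z in \<open>auto simp: mem_Fn l_distr m_assoc\<close>)
  moreover have "v 0 \<odot>\<^bsub>Vec\<^esub> z = (\<lambda>_. \<zero>)" if "v \<in> L (Suc t)" for v
  proof -
    have "v 0 \<in> \<mm>" using subsetD[OF L_Suc_subset that] assms(2) by (auto simp: tuples_def)
    then show ?thesis by (rule assms(4))
  qed
  ultimately obtain g where g: "g \<in> mod_hom_on R Vec (L t) Vec" "\<forall>v\<in>Fn (b t). g (\<pi> t v) = v 0 \<odot>\<^bsub>Vec\<^esub> z"
    using hom_L by blast
  have "g ` L t \<subseteq> L j"
  proof (intro image_subsetI)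
    fix x assume "x \<in> L t"
    then obtain v where v: "v \<in> Fn (b t)" "x = \<pi> t v" using \<pi>_image by blast
    then show "g x \<in> L j" using g(2) Vec.submoduleD(4)[OF submodule_L _ assms(3)] by (auto simp: mem_Fn)
  qed
  then have "g ` L t \<subseteq> mL j" using assms(1) g(1) by (auto simp: max_valued_def)
  moreover have "g (\<pi> t (unit_vec R 0)) = z"
    using g(2) unit_vec_Fn[OF assms(2)] z by (auto simp: unit_vec_def)
  ultimately show ?thesis using \<pi>_mem[OF unit_vec_Fn[OF assms(2)]] by blast
qed

text \<open>Tuples over \<open>\<mm>\<^sup>2\<close> lie in \<open>L (Suc j)\<close> and are
  annihilated by \<open>\<mm>\<close>, so \<open>socle_L\<close> puts them into
  \<open>mL (Suc j)\<close>. This is the case of equality in \<open>betti_step\<close>.\<close>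

lemma mL_Suc_eq:
  assumes "max_valued t (Suc j)" "b t > 0"
  shows "mL (Suc j) = tuples Reg (b j) max2"
proof
  show "tuples Reg (b j) max2 \<subseteq> mL (Suc j)"
  proof
    fix z assume z: "z \<in> tuples Reg (b j) max2"
    show "z \<in> mL (Suc j)"
      by (rule socle_L[OF assms]) (use z max2_subset_L smult_tuples_max2 in blast)+
  qed
qed (rule mL_Suc_subset)

lemma socle_mem_L_Suc:
  assumes "b j > 0" "r \<in> carrier R" "\<And>x. x \<in> \<mm> \<Longrightarrow> x \<otimes> r = \<zero>"
  shows "(\<lambda>i. r \<otimes> unit_vec R 0 i) \<in> L (Suc j)"
proof -
  define v where "v = (\<lambda>i. r \<otimes> unit_vec R 0 i)"
  have v: "v \<in> Fn (b j)" using assms(1,2) by (auto simp: v_def mem_Fn unit_vec_def)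
  obtain n where n: "L j \<subseteq> tuples Reg n \<mm>" using L_subset by blast
  have "\<pi> j v = \<zero>\<^bsub>Vec\<^esub>"
  proof (rule Vec.lincomb_zero)
    fix l assume l: "l < b j"
    show "v l \<odot>\<^bsub>Vec\<^esub> c j l = \<zero>\<^bsub>Vec\<^esub>"
    proof
      fix i
      have m: "c j l i \<in> \<mm>"
        using c_mem[OF l] n maxD(2) by (cases "i < n") (auto simp: tuples_def subset_iff)
      then have "r \<otimes> c j l i = \<zero>" using assms(2) assms(3)[OF m] maxD(1)[OF m] by (simp add: m_comm[of r])
      then show "(v l \<odot>\<^bsub>Vec\<^esub> c j l) i = \<zero>\<^bsub>Vec\<^esub> i"
        using assms(2) maxD(1)[OF m] by (auto simp: v_def unit_vec_def)
    qed
  qed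
  then show ?thesis using v by (simp add: L_Suc v_def)
qed

text \<open>A socle element \<open>r\<close> of the ring is tested on \<open>r\<close> times the
  first basis vector: this is a socle element of \<open>L (Suc j)\<close>, hence lies in
  \<open>mL (Suc j)\<close>, whose members have entries in \<open>\<mm>\<^sup>2\<close>.\<close>

lemma socle_eq_max2:
  assumes "max_valued t (Suc j)" "b t > 0" "b j > 0"
    and "r \<in> carrier R" "\<And>x. x \<in> \<mm> \<Longrightarrow> x \<otimes> r = \<zero>"
  shows "r \<in> max2"
proof -
  define v where "v = (\<lambda>i. r \<otimes> unit_vec R 0 i)"
  have "v \<in> L (Suc j)" unfolding v_def by (rule socle_mem_L_Suc[OF assms(3-5)])
  moreover have "x \<odot>\<^bsub>Vec\<^esub> v = (\<lambda>_. \<zero>)" if "x \<in> \<mm>" for x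
    using assms(4) assms(5)[OF that] maxD(1)[OF that] by (auto simp: v_def unit_vec_def)
  ultimately have "v \<in> mL (Suc j)" by (rule socle_L[OF assms(1,2)])
  then have "v 0 \<in> max2" using subsetD[OF mL_Suc_subset] assms(3) by (auto simp: tuples_def)
  then show ?thesis using assms(4) by (simp add: v_def unit_vec_def)
qed

end

lemma mod_hom_on_coord:
  assumes "f \<in> mod_hom_on R X U (seq_module Y)"
  shows "(\<lambda>x. f x i) \<in> mod_hom_on R X U Y"
  using mod_hom_onD[OF assms] by (intro mod_hom_onI) auto

context local_cube_zero
begin

text \<open>The induced map \<open>Ext\<^sup>i(M, Q) \<rightarrow> Ext\<^sup>i\<^sup>+\<^sup>1(M, Q\<^sub>1)\<close> is onto if \<open>Ext\<^sup>i\<^sup>+\<^sup>1(M, R) = 0\<close>, where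
  \<open>Q\<^sub>1\<close> is the first syzygy of \<open>Q\<close>.\<close>

lemma extends_shift:
  assumes Q: "module R Q" and \<rho>: "\<rho> \<in> mod_hom_on R Vec (Fn q) Q" "\<rho> ` Fn q = carrier Q"
    and \<pi>: "\<pi> \<in> mod_hom_on R Vec (Fn n) Vec" "\<pi> ` Fn n \<subseteq> Fn k"
    and ext: "extends R Vec (\<pi> ` Fn n) (Fn k) Q"
      "extends R Vec {v \<in> Fn n. \<pi> v = (\<lambda>_. \<zero>)} (Fn n) Reg"
  shows "extends R Vec {v \<in> Fn n. \<pi> v = (\<lambda>_. \<zero>)} (Fn n) (Vec\<lparr>carrier := {v \<in> Fn q. \<rho> v = \<zero>\<^bsub>Q\<^esub>}\<rparr>)"
  unfolding extends_def
proof
  interpret Q: module R Q by fact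
  let ?Z = "{v \<in> Fn n. \<pi> v = (\<lambda>_. \<zero>)}" and ?K = "{v \<in> Fn q. \<rho> v = \<zero>\<^bsub>Q\<^esub>}"
  have K: "?K \<subseteq> carrier Vec" using Vec.submoduleD(1)[OF submodule_Fn] by blast
  fix f assume f': "f \<in> mod_hom_on R Vec ?Z (Vec\<lparr>carrier := ?K\<rparr>)"
  then have "f \<in> mod_hom_on R Vec ?Z Vec \<and> f ` ?Z \<subseteq> ?K" by (rule mod_hom_on_codomain_iff[OF K, THEN iffD1])
  then have f: "f \<in> mod_hom_on R Vec ?Z Vec" "\<And>z. z \<in> ?Z \<Longrightarrow> f z \<in> Fn q" "\<And>z. z \<in> ?Z \<Longrightarrow> \<rho> (f z) = \<zero>\<^bsub>Q\<^esub>"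
    by blast+
  \<comment> \<open>Vanishing with values in \<open>R\<close>, applied to each coordinate, extends
    \<open>f\<close> to a map \<open>g\<close> into \<open>R^q\<close>. Its values need not lie in
    the kernel of \<open>\<rho>\<close>; the rest of the proof corrects them.\<close>
  have "\<exists>G\<in>mod_hom_on R Vec (Fn n) Reg. \<forall>z\<in>?Z. G z = f z i" for i
    by (rule extendsD[OF ext(2) mod_hom_on_coord[OF f(1)]])
  then have "\<forall>i. \<exists>G. G \<in> mod_hom_on R Vec (Fn n) Reg \<and> (\<forall>z\<in>?Z. G z = f z i)"
    unfolding Bex_def by (intro allI)
  then have "\<exists>G. \<forall>i. G i \<in> mod_hom_on R Vec (Fn n) Reg \<and> (\<forall>z\<in>?Z. G i z = f z i)" by (rule choice)
  then obtain G where G': "\<forall>i. G i \<in> mod_hom_on R Vec (Fn n) Reg \<and> (\<forall>z\<in>?Z. G i z = f z i)" by (rule exE)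
  have G: "\<And>i. G i \<in> mod_hom_on R Vec (Fn n) Reg" "\<And>i z. z \<in> ?Z \<Longrightarrow> G i z = f z i"
    using G' by simp_all
  note GD = mod_hom_onD[OF G(1), simplified]
  define g where "g v = (\<lambda>i. if i < q then G i v else \<zero>)" for v
  have g: "g \<in> mod_hom_on R Vec (Fn n) Vec"
    by (rule mod_hom_onI) (use GD in \<open>auto simp: g_def\<close>)
  have gq: "g v \<in> Fn q" if "v \<in> Fn n" for v
    using GD(1) that by (auto simp: g_def mem_Fn)
  have gf: "g z = f z" if z: "z \<in> ?Z" for z
    using G(2)[OF z] f(2)[OF z] by (auto simp: g_def mem_Fn fun_eq_iff)
  have h0: "(\<lambda>v. \<rho> (g v)) \<in> mod_hom_on R Vec (Fn n) Q"
    by (rule Q.mod_hom_on_compose[OF g _ \<rho>(1)]) (use gq in blast)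
  have sub: "submodule (\<pi> ` Fn n) R Vec"
    by (rule Vec.submodule_image[OF \<pi>(1) module_Vec submodule_Fn submodule_Fn subset_refl])
  \<comment> \<open>The composite \<open>\<rho> \<circ> g\<close> kills the kernel of
    \<open>\<pi>\<close> and factors through its image; the factor extends to \<open>R^k\<close> by
    vanishing with values in \<open>Q\<close>, and then lifts along \<open>\<rho>\<close> to
    \<open>h'\<close>.\<close>
  have "\<exists>h\<in>mod_hom_on R Vec (\<pi> ` Fn n) Q. \<forall>v\<in>Fn n. h (\<pi> v) = \<rho> (g v)"
  proof (rule Q.mod_hom_factor[OF module_Vec module_Vec submodule_Fn sub \<pi>(1) refl h0])
    fix v assume "v \<in> Fn n" "\<pi> v = \<zero>\<^bsub>Vec\<^esub>"
    then have "v \<in> ?Z" by simp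
    then show "\<rho> (g v) = \<zero>\<^bsub>Q\<^esub>" using gf f(3) by simp
  qed
  then obtain h where h: "h \<in> mod_hom_on R Vec (\<pi> ` Fn n) Q" "\<And>v. v \<in> Fn n \<Longrightarrow> h (\<pi> v) = \<rho> (g v)" by blast
  obtain H where H: "H \<in> mod_hom_on R Vec (Fn k) Q" "\<forall>x\<in>\<pi> ` Fn n. H x = h x"
    using extendsD[OF ext(1) h(1)] by (rule bexE)
  have "\<exists>w. w \<in> Fn q \<and> \<rho> w = H (unit_vec R l)" if "l < k" for l
  proof -
    have "H (unit_vec R l) \<in> \<rho> ` Fn q" using mod_hom_onD(1)[OF H(1) unit_vec_Fn[OF that]] \<rho>(2) by simp
    then show ?thesis by auto
  qed
  then have "\<forall>l. \<exists>w. l < k \<longrightarrow> w \<in> Fn q \<and> \<rho> w = H (unit_vec R l)" by (intro allI) simp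
  then have "\<exists>w. \<forall>l. l < k \<longrightarrow> w l \<in> Fn q \<and> \<rho> (w l) = H (unit_vec R l)" by (rule choice)
  then obtain w where w': "\<forall>l. l < k \<longrightarrow> w l \<in> Fn q \<and> \<rho> (w l) = H (unit_vec R l)" by (rule exE)
  have w: "\<And>l. l < k \<Longrightarrow> w l \<in> Fn q" "\<And>l. l < k \<Longrightarrow> \<rho> (w l) = H (unit_vec R l)"
    using w' by simp_all
  have wV: "\<And>l. l < k \<Longrightarrow> w l \<in> carrier Vec" using w(1) Vec.submoduleD(1)[OF submodule_Fn] by blast
  define h' where "h' x = lincomb Vec x w k" for x
  have h': "h' \<in> mod_hom_on R Vec (Fn k) Vec" unfolding h'_def by (rule Vec.hom_lincomb[OF wV])
  have h'q: "h' x \<in> Fn q" if "x \<in> Fn k" for x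
    unfolding h'_def using that w Vec.submoduleD(4)[OF submodule_Fn]
    by (intro Vec.lincomb_closed[OF submodule_Fn]) (auto simp: mem_Fn[of x] simp del: seq_module_simps)
  have \<rho>h': "\<rho> (h' x) = H x" if x: "x \<in> Fn k" for x
  proof -
    have "\<rho> (h' x) = lincomb Q x (\<lambda>l. \<rho> (w l)) k"
      unfolding h'_def using w(1) x by (intro Q.lincomb_hom[OF \<rho>(1) module_Vec submodule_Fn]) (auto simp: mem_Fn[of x])
    also have "\<dots> = lincomb Q x (\<lambda>l. H (unit_vec R l)) k" by (rule Q.lincomb_cong) (auto simp: w)
    also have "\<dots> = H x" using Q.hom_Fn_eq_lincomb[OF H(1) x] by simp
    finally show ?thesis .
  qed
  have c: "(\<lambda>v. h' (\<pi> v)) \<in> mod_hom_on R Vec (Fn n) Vec"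
    by (rule Vec.mod_hom_on_compose[OF \<pi> h'])
  have \<pi>k: "\<pi> v \<in> Fn k" if "v \<in> Fn n" for v using \<pi>(2) that by blast
  \<comment> \<open>Both requirements meet here: \<open>h' \<circ> \<pi>\<close> vanishes on the
    kernel of \<open>\<pi>\<close>, so \<open>r\<close> still extends \<open>f\<close>; and
    \<open>\<rho> \<circ> h' \<circ> \<pi> = \<rho> \<circ> g\<close>, so \<open>r\<close> has
    values in the kernel of \<open>\<rho>\<close>.\<close>
  define r where "r v = g v \<ominus>\<^bsub>Vec\<^esub> h' (\<pi> v)" for v
  have r: "r \<in> mod_hom_on R Vec (Fn n) Vec"
    unfolding r_def by (rule Vec.mod_hom_on_diff[OF g c])
  have "r ` Fn n \<subseteq> ?K"
  proof (intro image_subsetI)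
    fix v assume v: "v \<in> Fn n"
    have "\<rho> (r v) = \<rho> (g v) \<ominus>\<^bsub>Q\<^esub> \<rho> (h' (\<pi> v))"
      unfolding r_def by (rule Q.mod_hom_on_minus[OF \<rho>(1) module_Vec submodule_Fn gq[OF v] h'q[OF \<pi>k[OF v]]])
    also have "\<dots> = \<zero>\<^bsub>Q\<^esub>"
      using \<rho>h'[OF \<pi>k[OF v]] H(2) h(2)[OF v] v mod_hom_onD(1)[OF \<rho>(1) gq[OF v]]
      by (simp add: Q.M.r_neg Q.M.minus_eq)
    finally show "r v \<in> ?K"
      using Vec.submoduleD(6)[OF submodule_Fn gq[OF v] h'q[OF \<pi>k[OF v]]] by (simp add: r_def)
  qed
  then have r': "r \<in> mod_hom_on R Vec (Fn n) (Vec\<lparr>carrier := ?K\<rparr>)"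
    using r by (intro mod_hom_on_codomain_iff[OF K, THEN iffD2]) simp
  have "\<forall>z\<in>?Z. r z = f z"
  proof
    fix z assume z: "z \<in> ?Z"
    then have "h' (\<pi> z) = (\<lambda>_. \<zero>)" using Vec.mod_hom_on_zero[OF h' module_Vec submodule_Fn] by simp
    then have "h' (\<pi> z) = \<zero>\<^bsub>Vec\<^esub>" by simp
    moreover have fz: "f z \<in> carrier Vec" using mod_hom_onD(1)[OF f(1) z] .
    ultimately show "r z = f z" unfolding r_def gf[OF z]
      using Vec.minus_add_self[OF fz Vec.M.zero_closed]
        Vec.M.l_zero[OF Vec.M.minus_closed[OF fz Vec.M.zero_closed]] by (simp del: seq_module_simps)
  qed
  then show "\<exists>g\<in>mod_hom_on R Vec (Fn n) (Vec\<lparr>carrier := ?K\<rparr>). \<forall>x\<in>?Z. g x = f x"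
    using r' by (rule bexI)
qed

end

context syzygies
begin

lemma ext_zero_shift:
  assumes "ext_zero t j" "extends R Vec (L (Suc (Suc t))) (Fn (b (Suc t))) Reg"
  shows "ext_zero (Suc t) (Suc j)"
proof -
  have m: "module R (Vec\<lparr>carrier := L j\<rparr>)" by (rule submodule.submodule_is_module[OF submodule_L module_Vec])
  have "\<pi> j \<in> mod_hom_on R Vec (Fn (b j)) Vec \<and> \<pi> j ` Fn (b j) \<subseteq> L j"
    using \<pi>_hom[of j] \<pi>_image[of j] by simp
  then have \<rho>: "\<pi> j \<in> mod_hom_on R Vec (Fn (b j)) (Vec\<lparr>carrier := L j\<rparr>)" "\<pi> j ` Fn (b j) = carrier (Vec\<lparr>carrier := L j\<rparr>)"
    using mod_hom_on_codomain_iff[OF L_carrier, THEN iffD2] by (blast, simp add: \<pi>_image)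
  have sub: "\<pi> (Suc t) ` Fn (b (Suc t)) \<subseteq> Fn (b t)"
    unfolding \<pi>_image using L_Suc_subset tuples_max_subset by (rule order_trans)
  show ?thesis
    using extends_shift[OF m \<rho> \<pi>_hom sub] assms
    unfolding ext_zero_def \<pi>_image L_Suc[symmetric] by (simp add: L_Suc)
qed

section \<open>The transposed differential and inequalities between Betti numbers\<close>

definition T where
  "T t y = (\<lambda>i. if i < b (Suc t) then lincomb Vec (c (Suc t) i) y (b t) else (\<lambda>_. \<zero>))"

lemma c_Suc_max: "i < b (Suc t) \<Longrightarrow> c (Suc t) i \<in> tuples Reg (b t) \<mm>"
  by (rule subsetD[OF L_Suc_subset c_mem])

lemma c_Suc_coeff: "i < b (Suc t) \<Longrightarrow> l < b t \<Longrightarrow> c (Suc t) i l \<in> \<mm>"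
  using c_Suc_max by (auto simp: tuples_def)

lemma tuples_L_carrier: "y \<in> tuples Vec n (L j) \<Longrightarrow> y l \<in> carrier Vec"
  by (cases "l < n") (use subsetD[OF L_carrier] Vec.M.zero_closed in \<open>auto simp: tuples_def simp del: seq_module_simps(1)\<close>)

lemma T_hom: "T t \<in> mod_hom_on R (seq_module Vec) (tuples Vec (b t) (L j)) (seq_module Vec)"
proof (rule mod_hom_onI)
  have c: "\<And>i l. i < b (Suc t) \<Longrightarrow> l < b t \<Longrightarrow> c (Suc t) i l \<in> carrier R"
    using c_Suc_coeff maxD(1) by blast
  fix y assume y: "y \<in> tuples Vec (b t) (L j)"
  note yc = tuples_L_carrier[OF y]
  show "T t y \<in> carrier (seq_module Vec)"
    unfolding seq_module_simps(1)[of "T t y"]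
  proof
    fix i show "T t y i \<in> carrier Vec"
      using c[of i] yc Vec.M.zero_closed unfolding T_def by (cases "i < b (Suc t)") (simp_all del: seq_module_simps(1))
  qed
  show "T t (y \<oplus>\<^bsub>seq_module Vec\<^esub> z) = T t y \<oplus>\<^bsub>seq_module Vec\<^esub> T t z" if z: "z \<in> tuples Vec (b t) (L j)" for z
  proof
    fix i
    note zc = tuples_L_carrier[OF z]
    show "T t (y \<oplus>\<^bsub>seq_module Vec\<^esub> z) i = (T t y \<oplus>\<^bsub>seq_module Vec\<^esub> T t z) i"
      using Vec.lincomb_add_right[of "b t" "c (Suc t) i" y z] c[of i] yc zc Vec.M.zero_closed Vec.M.l_zero
      by (cases "i < b (Suc t)") (simp_all add: T_def seq_module_simps(3)[where X = Vec] del: seq_module_simps(1,3))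
  qed
  show "T t (r \<odot>\<^bsub>seq_module Vec\<^esub> y) = r \<odot>\<^bsub>seq_module Vec\<^esub> T t y" if r: "r \<in> carrier R" for r
  proof
    fix i
    show "T t (r \<odot>\<^bsub>seq_module Vec\<^esub> y) i = (r \<odot>\<^bsub>seq_module Vec\<^esub> T t y) i"
      using Vec.lincomb_smult_right[of "b t" "c (Suc t) i" r y] c[of i] yc r Vec.smult_r_null[of r]
      by (cases "i < b (Suc t)") (simp_all add: T_def seq_module_simps(4)[where X = Vec] del: seq_module_simps(1,4))
  qed
qed

lemma T_mem:
  assumes "y \<in> tuples Vec (b t) (L j)"
  shows "T t y \<in> tuples Vec (b (Suc t)) (mL j)"
proof -
  have "lincomb Vec (c (Suc t) i) y (b t) \<in> mL j" if "i < b (Suc t)" for i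
  proof (rule Vec.lincomb_closed[OF submodule_mL])
    fix l assume l: "l < b t"
    show "c (Suc t) i l \<in> carrier R" using c_Suc_coeff[OF that l] maxD(1) by blast
    show "c (Suc t) i l \<odot>\<^bsub>Vec\<^esub> y l \<in> mL j"
      using c_Suc_coeff[OF that l] assms l by (intro Vec.mprod_mem) (auto simp: tuples_def)
  qed
  then show ?thesis by (simp add: tuples_def T_def)
qed

text \<open>The coefficients lie in \<open>\<mm>\<close>, which annihilates \<open>mL j\<close>.
  Together with \<open>T_mem\<close> this is what lets the map descend to copies of
  \<open>L j / mL j\<close>.\<close>

lemma T_max:
  assumes "y \<in> tuples Vec (b t) (mL j)"
  shows "T t y = (\<lambda>_ _. \<zero>)"
proof
  fix i
  have "lincomb Vec (c (Suc t) i) y (b t) = \<zero>\<^bsub>Vec\<^esub>" if "i < b (Suc t)"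
  proof (rule Vec.lincomb_zero)
    fix l assume l: "l < b t"
    then have "y l \<in> mL j" using assms by (auto simp: tuples_def)
    then show "c (Suc t) i l \<odot>\<^bsub>Vec\<^esub> y l = \<zero>\<^bsub>Vec\<^esub>" using smult_mL[OF c_Suc_coeff[OF that l]] by simp
  qed
  then show "T t y i = (\<lambda>_. \<zero>)" by (simp add: T_def)
qed

lemma seq_Vec: "module R (seq_module Vec)"
  by (rule Vec.module_seq)

lemma tuples_mL_subset: "tuples Vec n (mL j) \<subseteq> tuples Vec n (L j)"
  by (rule Vec.tuples_mono[OF mL_subset])

lemma mlength_tuples_L: "mlength R (seq_module Vec) (tuples Vec n (mL j)) (tuples Vec n (L j)) = enat (n * b j)"
  using Vec.mlength_tuples[OF submodule_mL submodule_L mL_subset] mlength_L by simp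

lemma tuples_Vec_zero: "tuples Vec n {\<lambda>_. \<zero>} = {\<lambda>_ _. \<zero>}"
  by (auto simp: tuples_def) (metis ext not_le)

lemma mlength_tuples_mL: "mlength R (seq_module Vec) {\<lambda>_ _. \<zero>} (tuples Vec n (mL j)) = enat (n * a j)"
  using Vec.mlength_tuples[OF zero_Vec submodule_mL zero_subset[OF submodule_mL], of n j] mlength_mL
  by (simp add: tuples_Vec_zero)

lemma submodule_tuples_L: "submodule (tuples Vec n (L j)) R (seq_module Vec)"
  by (rule Vec.submodule_tuples[OF submodule_L])

lemma submodule_tuples_mL: "submodule (tuples Vec n (mL j)) R (seq_module Vec)"
  by (rule Vec.submodule_tuples[OF submodule_mL])

lemma submodule_zero_seq: "submodule {\<lambda>_ _. \<zero>} R (seq_module Vec)"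
  using module.submodule_zero[OF seq_Vec] by simp

lemma zero_tuples_mL: "{\<lambda>_ _. \<zero>} \<subseteq> tuples Vec n (mL j)"
  using module.submoduleD(2)[OF seq_Vec submodule_tuples_mL] by simp

lemma lincomb_mem_L:
  assumes "v \<in> Fn n" "y \<in> tuples Vec n (L j)"
  shows "lincomb Vec v y n \<in> L j"
  using assms Vec.submoduleD(4)[OF submodule_L]
  by (intro Vec.lincomb_closed[OF submodule_L]) (auto simp: mem_Fn tuples_def simp del: seq_module_simps(4))

text \<open>The map \<open>T t\<close> is the transpose of the differential \<open>Fn (b (Suc t)) \<rightarrow> Fn (b t)\<close>; its kernel
  consists of the homomorphisms \<open>L t \<rightarrow> L j\<close>.\<close>

lemma T_eq_0_hom:
  assumes "y \<in> tuples Vec (b t) (L j)" "T t y = (\<lambda>_ _. \<zero>)"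
  shows "\<exists>g. g \<in> mod_hom_on R Vec (L t) Vec \<and> g ` L t \<subseteq> L j \<and> (\<forall>l<b t. g (c t l) = y l)"
proof -
  define f where "f v = lincomb Vec v y (b t)" for v
  have f: "f \<in> mod_hom_on R Vec (Fn (b t)) Vec"
    unfolding f_def by (rule Vec.hom_lincomb) (rule tuples_L_carrier[OF assms(1)])
  have "f v = (\<lambda>_. \<zero>)" if v: "v \<in> L (Suc t)" for v
  proof -
    obtain w where w: "w \<in> Fn (b (Suc t))" "v = \<pi> (Suc t) w" using v \<pi>_image[of "Suc t"] by blast
    have cF: "c (Suc t) l \<in> Fn (b t)" if "l < b (Suc t)" for l
      using subsetD[OF tuples_max_subset c_Suc_max[OF that]] .
    have "f v = lincomb Vec w (\<lambda>l. f (c (Suc t) l)) (b (Suc t))"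
      unfolding w(2) using w(1) cF
      by (intro Vec.lincomb_hom[OF f module_Vec submodule_Fn]) (auto simp: mem_Fn[of w])
    also have "\<dots> = \<zero>\<^bsub>Vec\<^esub>"
    proof (rule Vec.lincomb_zero)
      fix l assume l: "l < b (Suc t)"
      have "f (c (Suc t) l) = T t y l" using l by (simp add: T_def f_def)
      then show "w l \<odot>\<^bsub>Vec\<^esub> f (c (Suc t) l) = \<zero>\<^bsub>Vec\<^esub>" using assms(2) w(1) by (simp add: mem_Fn)
    qed
    finally show ?thesis by simp
  qed
  from hom_L[OF f this] obtain g where g: "g \<in> mod_hom_on R Vec (L t) Vec" "\<forall>v\<in>Fn (b t). g (\<pi> t v) = f v"
    by (rule bexE)
  have "g ` L t \<subseteq> L j"
  proof (intro image_subsetI)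
    fix x assume "x \<in> L t"
    then obtain v where v: "v \<in> Fn (b t)" "x = \<pi> t v" using \<pi>_image[of t] by blast
    then show "g x \<in> L j" using g(2) lincomb_mem_L[OF v(1) assms(1)] by (simp add: f_def)
  qed
  moreover have "g (c t l) = y l" if l: "l < b t" for l
  proof -
    have "g (c t l) = f (unit_vec R l)" using g(2) unit_vec_Fn[OF l] \<pi>_unit_vec[OF l] by metis
    also have "\<dots> = y l" unfolding f_def by (rule Vec.lincomb_unit_vec[OF l]) (rule tuples_L_carrier[OF assms(1)])
    finally show ?thesis .
  qed
  ultimately show ?thesis using g(1) by blast
qed

lemma hom_T_eq_0:
  assumes "f \<in> mod_hom_on R Vec (L t) Vec"
  shows "T t (\<lambda>l. if l < b t then f (c t l) else (\<lambda>_. \<zero>)) = (\<lambda>_ _. \<zero>)"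
proof
  fix i
  let ?y = "\<lambda>l. if l < b t then f (c t l) else (\<lambda>_. \<zero>)"
  have "lincomb Vec (c (Suc t) i) ?y (b t) = (\<lambda>_. \<zero>)" if i: "i < b (Suc t)"
  proof -
    have "lincomb Vec (c (Suc t) i) ?y (b t) = lincomb Vec (c (Suc t) i) (\<lambda>l. f (c t l)) (b t)"
      by (rule Vec.lincomb_cong) auto
    also have "\<dots> = f (\<pi> t (c (Suc t) i))"
    proof (rule Vec.lincomb_hom[OF assms module_Vec submodule_L, symmetric])
      show "c (Suc t) i l \<in> carrier R" if "l < b t" for l using c_Suc_coeff[OF i that] maxD(1) by blast
    qed (rule c_mem)
    also have "\<pi> t (c (Suc t) i) = \<zero>\<^bsub>Vec\<^esub>" using c_mem[OF i] by (simp add: L_Suc)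
    finally show ?thesis using Vec.mod_hom_on_zero[OF assms module_Vec submodule_L] by simp
  qed
  then show "T t ?y i = (\<lambda>_. \<zero>)" by (simp add: T_def)
qed

text \<open>A tuple in the kernel of \<open>T t\<close> consists of the values at the generators of
  a homomorphism \<open>L t \<rightarrow> L j\<close>, so by hypothesis its entries lie in
  \<open>mL j\<close>: the induced map is injective.\<close>

lemma max_valued_betti:
  assumes "max_valued t j"
  shows "b t * b j \<le> b (Suc t) * a j"
proof -
  have "mlength R (seq_module Vec) (tuples Vec (b t) (mL j)) (tuples Vec (b t) (L j)) \<le>
      mlength R (seq_module Vec) {\<lambda>_ _. \<zero>} (tuples Vec (b (Suc t)) (mL j))"
  proof (rule mlength_inj[OF seq_Vec seq_Vec submodule_tuples_L submodule_tuples_mL tuples_mL_subset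
        submodule_tuples_mL submodule_zero_seq zero_tuples_mL T_hom])
    show "T t ` tuples Vec (b t) (L j) \<subseteq> tuples Vec (b (Suc t)) (mL j)" using T_mem by blast
  next
    fix y assume y: "y \<in> tuples Vec (b t) (L j)" "T t y \<in> {\<lambda>_ _. \<zero>}"
    from y(2) have "T t y = (\<lambda>_ _. \<zero>)" by simp
    from T_eq_0_hom[OF y(1) this] obtain g where g: "g \<in> mod_hom_on R Vec (L t) Vec" "g ` L t \<subseteq> L j"
      "\<forall>l<b t. g (c t l) = y l" by blast
    then have "g ` L t \<subseteq> mL j" using assms by (auto simp: max_valued_def)
    then have "y l \<in> mL j" if "l < b t" for l using c_mem[OF that] g(3) that by force
    then show "y \<in> tuples Vec (b t) (mL j)" using y(1) by (simp add: tuples_def)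
  qed
  then show ?thesis unfolding mlength_tuples_L mlength_tuples_mL by simp
qed

definition T_kernel where
  "T_kernel t j = {y \<in> tuples Vec (b t) (L j). T t y \<in> {\<lambda>_ _. \<zero>}}"

lemma T_kernel:
  "submodule (T_kernel t j) R (seq_module Vec)" "tuples Vec (b t) (mL j) \<subseteq> T_kernel t j"
  "T_kernel t j \<subseteq> tuples Vec (b t) (L j)"
  unfolding T_kernel_def
  using module.submodule_vimage[OF seq_Vec T_hom seq_Vec submodule_tuples_L submodule_zero_seq]
    tuples_mL_subset T_max by blast+

text \<open>A tuple over \<open>mL j\<close> is killed by the next transposed differential, so it
  comes from a homomorphism on \<open>L (Suc t)\<close>; the values at the unit vectors of an
  extension to \<open>Fn (b t)\<close> form a preimage.\<close>

lemma T_image: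
  assumes "ext_zero t j"
  shows "T t ` tuples Vec (b t) (L j) = tuples Vec (b (Suc t)) (mL j)"
proof (intro equalityI subsetI)
  fix z assume z: "z \<in> tuples Vec (b (Suc t)) (mL j)"
  then have zL: "z \<in> tuples Vec (b (Suc t)) (L j)" using tuples_mL_subset by blast
  have "T (Suc t) z = (\<lambda>_ _. \<zero>)" by (rule T_max[OF z])
  from T_eq_0_hom[OF zL this] obtain g where g: "g \<in> mod_hom_on R Vec (L (Suc t)) Vec" "g ` L (Suc t) \<subseteq> L j"
      "\<forall>l<b (Suc t). g (c (Suc t) l) = z l" by blast
  from ext_zeroD[OF assms g(1,2)] obtain G where G: "G \<in> mod_hom_on R Vec (Fn (b t)) Vec"
    "G ` Fn (b t) \<subseteq> L j" "\<forall>x\<in>L (Suc t). G x = g x" by blast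
  define y where "y l = (if l < b t then G (unit_vec R l) else (\<lambda>_. \<zero>))" for l
  have y: "y \<in> tuples Vec (b t) (L j)" using G(2) unit_vec_Fn by (auto simp: y_def tuples_def)
  have "T t y = z"
  proof
    fix i show "T t y i = z i"
    proof (cases "i < b (Suc t)")
      case True
      have "T t y i = lincomb Vec (c (Suc t) i) (\<lambda>l. G (unit_vec R l)) (b t)"
        using True unfolding T_def by (auto simp: y_def intro!: Vec.lincomb_cong)
      also have "\<dots> = G (c (Suc t) i)"
        by (rule Vec.hom_Fn_eq_lincomb[OF G(1) subsetD[OF tuples_max_subset c_Suc_max[OF True]], symmetric])
      also have "\<dots> = z i" using G(3) c_mem[OF True] g(3) True by simp
      finally show ?thesis .
    next
      case False then show ?thesis using z by (simp add: T_def tuples_def)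
    qed
  qed
  then show "z \<in> T t ` tuples Vec (b t) (L j)" using y by blast
qed (use T_mem in blast)

lemma mlength_T_kernel:
  assumes "ext_zero t j"
  shows "mlength R (seq_module Vec) (T_kernel t j) (tuples Vec (b t) (L j)) = enat (b (Suc t) * a j)"
proof -
  have "mlength R (seq_module Vec) (T_kernel t j) (tuples Vec (b t) (L j)) =
      mlength R (seq_module Vec) {\<lambda>_ _. \<zero>} (tuples Vec (b (Suc t)) (mL j))"
    by (rule module.mlength_eqI[OF seq_Vec seq_Vec submodule_tuples_L T_kernel(1,3)
          submodule_tuples_mL submodule_zero_seq zero_tuples_mL T_hom T_image[OF assms]])
      (simp add: T_kernel_def)
  then show ?thesis unfolding mlength_tuples_mL .
qed

lemma mlength_T_kernel_add:
  assumes "ext_zero t j"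
  shows "enat (b t * b j) = mlength R (seq_module Vec) (tuples Vec (b t) (mL j)) (T_kernel t j) + enat (b (Suc t) * a j)"
  using module.mlength_additive[OF seq_Vec submodule_tuples_mL T_kernel(1) submodule_tuples_L T_kernel(2,3)]
    mlength_T_kernel[OF assms] mlength_tuples_L by simp

lemma ext_zero_betti:
  assumes "ext_zero t j"
  shows "b (Suc t) * a j \<le> b t * b j"
proof -
  have "enat (b (Suc t) * a j) \<le> enat (b t * b j)"
    unfolding mlength_T_kernel_add[OF assms] by (simp add: add_increasing)
  then show ?thesis by simp
qed

text \<open>Equality of the two lengths leaves length zero for the kernel of \<open>T t\<close>
  modulo tuples over \<open>mL j\<close>, and every homomorphism from \<open>L t\<close> to
  \<open>L j\<close> gives an element of that kernel. This gains one index over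
  \<open>ext_zero_max_valued\<close>, which speaks of \<open>L (Suc t)\<close>.\<close>

lemma ext_zero_betti_eq:
  assumes "ext_zero t j" "b (Suc t) * a j = b t * b j"
  shows "max_valued t j"
  unfolding max_valued_def
proof (intro ballI impI image_subsetI)
  fix f x assume f: "f \<in> mod_hom_on R Vec (L t) Vec" "f ` L t \<subseteq> L j" and x: "x \<in> L t"
  have "mlength R (seq_module Vec) (tuples Vec (b t) (mL j)) (T_kernel t j) = 0"
    using mlength_T_kernel_add[OF assms(1)] assms(2)
    by (cases "mlength R (seq_module Vec) (tuples Vec (b t) (mL j)) (T_kernel t j)") (auto simp: zero_enat_def)
  then have eq: "tuples Vec (b t) (mL j) = T_kernel t j"
    using module.mlength_eq_0[OF seq_Vec submodule_tuples_mL T_kernel(1,2)] by blast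
  define y where "y l = (if l < b t then f (c t l) else (\<lambda>_. \<zero>))" for l
  have "y \<in> T_kernel t j"
    using hom_T_eq_0[OF f(1)] f(2) c_mem unfolding T_kernel_def y_def[abs_def] by (auto simp: tuples_def)
  then have y: "y \<in> tuples Vec (b t) (mL j)" using eq by simp
  obtain v where v: "v \<in> Fn (b t)" "x = \<pi> t v" using x \<pi>_image[of t] by blast
  have "f x = lincomb Vec v (\<lambda>l. f (c t l)) (b t)"
    unfolding v(2) using v(1) c_mem
    by (intro Vec.lincomb_hom[OF f(1) module_Vec submodule_L]) (auto simp: mem_Fn)
  also have "\<dots> = lincomb Vec v y (b t)" by (rule Vec.lincomb_cong) (auto simp: y_def)
  also have "\<dots> \<in> mL j"
    using v(1) y Vec.submoduleD(4)[OF submodule_mL]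
    by (intro Vec.lincomb_closed[OF submodule_mL]) (auto simp: mem_Fn tuples_def simp del: seq_module_simps(4))
  finally show "f x \<in> mL j" .
qed

end

lemma direct_sum_simps [simp]:
  "carrier (direct_sum M N) = carrier M \<times> carrier N"
  "\<zero>\<^bsub>direct_sum M N\<^esub> = (\<zero>\<^bsub>M\<^esub>, \<zero>\<^bsub>N\<^esub>)"
  "(x, y) \<oplus>\<^bsub>direct_sum M N\<^esub> (x', y') = (x \<oplus>\<^bsub>M\<^esub> x', y \<oplus>\<^bsub>N\<^esub> y')"
  "r \<odot>\<^bsub>direct_sum M N\<^esub> (x, y) = (r \<odot>\<^bsub>M\<^esub> x, r \<odot>\<^bsub>N\<^esub> y)"
  by (simp_all add: direct_sum_def)

lemma module_direct_sum:
  assumes "module R M" "module R N"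
  shows "module R (direct_sum M N)"
proof -
  interpret M: module R M by fact
  interpret N: module R N by fact
  show ?thesis
  proof (rule moduleI)
    show "cring R" by (rule M.R.is_cring)
    show "abelian_group (direct_sum M N)"
    proof (rule abelian_groupI)
      fix p assume "p \<in> carrier (direct_sum M N)"
      then obtain x y where p: "p = (x, y)" "x \<in> carrier M" "y \<in> carrier N" by auto
      then show "\<exists>q\<in>carrier (direct_sum M N). q \<oplus>\<^bsub>direct_sum M N\<^esub> p = \<zero>\<^bsub>direct_sum M N\<^esub>"
        by (intro bexI[of _ "(\<ominus>\<^bsub>M\<^esub> x, \<ominus>\<^bsub>N\<^esub> y)"]) (auto simp: M.M.l_neg N.M.l_neg)
    qed (auto simp: M.M.a_ac N.M.a_ac)
  qed (auto simp: M.smult_l_distr N.smult_l_distr M.smult_r_distr N.smult_r_distr M.smult_assoc1 N.smult_assoc1)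
qed

section \<open>Extension of homomorphisms and self-injectivity\<close>

context local_cube_zero
begin

text \<open>\<open>Ext\<^sup>1(R/\<mm>, X) = 0\<close>.\<close>

definition residue_ext_zero :: "('a, 'c, 'n) module_scheme \<Rightarrow> bool" where
  "residue_ext_zero X \<longleftrightarrow> (\<forall>g\<in>mod_hom_on R Reg \<mm> X. \<exists>w\<in>carrier X. \<forall>r\<in>\<mm>. g r = r \<odot>\<^bsub>X\<^esub> w)"

lemma residue_ext_zeroD:
  assumes "residue_ext_zero X" "g \<in> mod_hom_on R Reg \<mm> X"
  shows "\<exists>w\<in>carrier X. \<forall>r\<in>\<mm>. g r = r \<odot>\<^bsub>X\<^esub> w"
  using assms(1) unfolding residue_ext_zero_def by (rule bspec[OF _ assms(2)])

text \<open>The map \<open>r \<mapsto> f (r x)\<close> on \<open>\<mm>\<close> is multiplication by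
  some \<open>w\<close>, and \<open>z + r x \<mapsto> f z + r w\<close> is the extension. It is well
  defined because \<open>z + r x = 0\<close> forces \<open>r\<close> into \<open>\<mm>\<close>:
  otherwise \<open>x\<close> would lie in \<open>Z\<close>.\<close>

lemma extend_one_step:
  assumes X: "module R X" and N: "module R N" "residue_ext_zero N"
    and Z: "submodule Z R X" and x: "x \<in> carrier X" "x \<notin> Z" "\<And>r. r \<in> \<mm> \<Longrightarrow> r \<odot>\<^bsub>X\<^esub> x \<in> Z"
    and f: "f \<in> mod_hom_on R X Z N"
  shows "\<exists>g\<in>mod_hom_on R X (Z <+>\<^bsub>X\<^esub> module.cyclic R X x) N. \<forall>z\<in>Z. g z = f z"
proof -
  interpret X: module R X by fact
  interpret N: module R N by fact
  note fD = mod_hom_onD[OF f] and ZD = X.submoduleD[OF Z]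
  have fx: "(\<lambda>r. f (r \<odot>\<^bsub>X\<^esub> x)) \<in> mod_hom_on R Reg \<mm> N"
    using fD x maxD(1) by (intro mod_hom_onI) (simp_all add: X.smult_l_distr X.smult_assoc1)
  obtain w where w: "w \<in> carrier N" and "\<forall>r\<in>\<mm>. f (r \<odot>\<^bsub>X\<^esub> x) = r \<odot>\<^bsub>N\<^esub> w"
    using residue_ext_zeroD[OF N(2) fx] by (rule bexE)
  then have w2: "\<And>r. r \<in> \<mm> \<Longrightarrow> f (r \<odot>\<^bsub>X\<^esub> x) = r \<odot>\<^bsub>N\<^esub> w" by simp
  define D where "D = direct_sum (X\<lparr>carrier := Z\<rparr>) Reg"
  have D: "module R D"
    unfolding D_def by (rule module_direct_sum[OF submodule.submodule_is_module[OF Z X] module_regular])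
  interpret D: module R D by (rule D)
  have cD: "submodule (Z \<times> carrier R) R D" using D.carrier_is_submodule by (simp add: D_def)
  define \<pi> where "\<pi> = (\<lambda>(z, r). z \<oplus>\<^bsub>X\<^esub> r \<odot>\<^bsub>X\<^esub> x)"
  define \<phi> where "\<phi> = (\<lambda>(z, r). f z \<oplus>\<^bsub>N\<^esub> r \<odot>\<^bsub>N\<^esub> w)"
  have \<pi>: "\<pi> \<in> mod_hom_on R D (Z \<times> carrier R) X"
  proof (rule mod_hom_onI)
    fix p q assume "p \<in> Z \<times> carrier R" "q \<in> Z \<times> carrier R"
    then obtain z r z' r' where *: "p = (z, r)" "z \<in> Z" "r \<in> carrier R" "q = (z', r')" "z' \<in> Z" "r' \<in> carrier R"
      by auto
    then have "z \<in> carrier X" "z' \<in> carrier X" using ZD(1) by auto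
    then show "\<pi> p \<in> carrier X" "\<pi> (p \<oplus>\<^bsub>D\<^esub> q) = \<pi> p \<oplus>\<^bsub>X\<^esub> \<pi> q"
      using * x by (auto simp: \<pi>_def D_def X.smult_l_distr X.M.a_ac)
    show "\<pi> (s \<odot>\<^bsub>D\<^esub> p) = s \<odot>\<^bsub>X\<^esub> \<pi> p" if "s \<in> carrier R" for s
      using * x that \<open>z \<in> carrier X\<close> by (auto simp: \<pi>_def D_def X.smult_r_distr X.smult_assoc1)
  qed
  have \<phi>: "\<phi> \<in> mod_hom_on R D (Z \<times> carrier R) N"
  proof (rule mod_hom_onI)
    fix p q assume "p \<in> Z \<times> carrier R" "q \<in> Z \<times> carrier R"
    then obtain z r z' r' where *: "p = (z, r)" "z \<in> Z" "r \<in> carrier R" "q = (z', r')" "z' \<in> Z" "r' \<in> carrier R"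
      by auto
    then have "f z \<in> carrier N" "f z' \<in> carrier N" using fD(1) by auto
    then show "\<phi> p \<in> carrier N" "\<phi> (p \<oplus>\<^bsub>D\<^esub> q) = \<phi> p \<oplus>\<^bsub>N\<^esub> \<phi> q"
      using * w fD(2) by (auto simp: \<phi>_def D_def N.smult_l_distr N.M.a_ac)
    show "\<phi> (s \<odot>\<^bsub>D\<^esub> p) = s \<odot>\<^bsub>N\<^esub> \<phi> p" if "s \<in> carrier R" for s
      using * w that fD(3) \<open>f z \<in> carrier N\<close> by (auto simp: \<phi>_def D_def N.smult_r_distr N.smult_assoc1)
  qed
  have img: "\<pi> ` (Z \<times> carrier R) = Z <+>\<^bsub>X\<^esub> X.cyclic x"
    by (force simp: \<pi>_def X.mem_set_add X.cyclic_def)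
  have ker: "\<phi> p = \<zero>\<^bsub>N\<^esub>" if "p \<in> Z \<times> carrier R" "\<pi> p = \<zero>\<^bsub>X\<^esub>" for p
  proof -
    obtain z r where p0: "p = (z, r)" by (cases p)
    then have p: "p = (z, r)" "z \<in> Z" "r \<in> carrier R" using that(1) by simp_all
    have eq: "z \<oplus>\<^bsub>X\<^esub> r \<odot>\<^bsub>X\<^esub> x = \<zero>\<^bsub>X\<^esub>" using that(2) p by (simp add: \<pi>_def)
    have rx: "r \<odot>\<^bsub>X\<^esub> x \<in> Z"
      by (rule X.submodule_add_cancel[OF Z p(2)]) (use eq p x ZD(2) in auto)
    have "r \<in> \<mm>"
    proof (rule ccontr)
      assume "r \<notin> \<mm>"
      then have u: "r \<in> Units R" using UnitsI p by blast
      have "inv r \<odot>\<^bsub>X\<^esub> (r \<odot>\<^bsub>X\<^esub> x) = x" using u x by (simp flip: X.smult_assoc1 add: Units_closed)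
      then show False using ZD(4)[OF _ rx, of "inv r"] u x(2) by auto
    qed
    then have "\<phi> p = f z \<oplus>\<^bsub>N\<^esub> f (r \<odot>\<^bsub>X\<^esub> x)" using w2 p by (simp add: \<phi>_def)
    also have "\<dots> = f (z \<oplus>\<^bsub>X\<^esub> r \<odot>\<^bsub>X\<^esub> x)" using fD(2)[OF p(2) rx] by simp
    also have "\<dots> = \<zero>\<^bsub>N\<^esub>" unfolding eq by (rule N.mod_hom_on_zero[OF f X Z])
    finally show ?thesis .
  qed
  have "\<exists>g\<in>mod_hom_on R X (Z <+>\<^bsub>X\<^esub> X.cyclic x) N. \<forall>p\<in>Z \<times> carrier R. g (\<pi> p) = \<phi> p"
    by (rule N.mod_hom_factor[OF D X cD X.submodule_set_add[OF Z X.submodule_cyclic[OF x(1)]] \<pi> img \<phi> ker])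
  then obtain g where g: "g \<in> mod_hom_on R X (Z <+>\<^bsub>X\<^esub> X.cyclic x) N" "\<forall>p\<in>Z \<times> carrier R. g (\<pi> p) = \<phi> p"
    by (rule bexE)
  have "g z = f z" if z: "z \<in> Z" for z
  proof -
    have "g (\<pi> (z, \<zero>)) = \<phi> (z, \<zero>)" using g(2) z by blast
    then show ?thesis using z ZD(1) x(1) w fD(1) by (simp add: \<pi>_def \<phi>_def)
  qed
  then show ?thesis using g(1) by blast
qed

text \<open>Induction on the length of \<open>F/Z\<close>, adjoining one socle element of
  \<open>F/Z\<close> at a time. Such an element exists since \<open>\<mm>\<^sup>3 = 0\<close>:
  multiplying an element outside \<open>Z\<close> by elements of \<open>\<mm>\<close> reaches it
  after at most two steps.\<close>

lemma extends_of_residue_ext_zero: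
  assumes X: "module R X" and N: "module R N" "residue_ext_zero N"
    and F: "submodule F R X" and Z: "submodule Z R X" "Z \<subseteq> F" "mlength R X Z F \<noteq> \<infinity>"
  shows "extends R X Z F N"
proof -
  interpret X: module R X by fact
  note FD = X.submoduleD[OF F]
  have "\<exists>g\<in>mod_hom_on R X F N. \<forall>z\<in>Z. g z = f z"
    if "submodule Z R X" "Z \<subseteq> F" "mlength R X Z F = enat n" "f \<in> mod_hom_on R X Z N" for n Z f
    using that
  proof (induction n arbitrary: Z f rule: less_induct)
    case (less n)
    note ZD = X.submoduleD[OF less.prems(1)]
    show ?case
    proof (cases "Z = F")
      case False
      then obtain x0 where x0: "x0 \<in> F" "x0 \<notin> Z" using less.prems(2) by blast
      have "\<exists>x\<in>F. x \<notin> Z \<and> (\<forall>r\<in>\<mm>. r \<odot>\<^bsub>X\<^esub> x \<in> Z)"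
      proof (rule ccontr)
        assume not: "\<not> ?thesis"
        then obtain r where r: "r \<in> \<mm>" "r \<odot>\<^bsub>X\<^esub> x0 \<notin> Z" using x0 by blast
        moreover have "r \<odot>\<^bsub>X\<^esub> x0 \<in> F" using FD(4) x0 maxD(1) r by blast
        ultimately obtain s where s: "s \<in> \<mm>" "s \<odot>\<^bsub>X\<^esub> (r \<odot>\<^bsub>X\<^esub> x0) \<notin> Z" using not by blast
        moreover have "s \<odot>\<^bsub>X\<^esub> (r \<odot>\<^bsub>X\<^esub> x0) \<in> F" using FD(4) x0 maxD(1) r s by blast
        ultimately obtain t where t: "t \<in> \<mm>" "t \<odot>\<^bsub>X\<^esub> (s \<odot>\<^bsub>X\<^esub> (r \<odot>\<^bsub>X\<^esub> x0)) \<notin> Z" using not by blast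
        have "t \<odot>\<^bsub>X\<^esub> (s \<odot>\<^bsub>X\<^esub> (r \<odot>\<^bsub>X\<^esub> x0)) = (t \<otimes> (s \<otimes> r)) \<odot>\<^bsub>X\<^esub> x0"
          using maxD(1)[OF r(1)] maxD(1)[OF s(1)] maxD(1)[OF t(1)] FD(1)[OF x0(1)] by (simp add: X.smult_assoc1)
        also have "\<dots> = \<zero>\<^bsub>X\<^esub>" using cube_zero[OF t(1) s(1) r(1)] FD(1)[OF x0(1)] by simp
        finally show False using t(2) ZD(2) by simp
      qed
      then obtain x where x: "x \<in> F" "x \<notin> Z" "\<And>r. r \<in> \<mm> \<Longrightarrow> r \<odot>\<^bsub>X\<^esub> x \<in> Z" by blast
      have xX: "x \<in> carrier X" using FD(1) x(1) .
      define Z' where "Z' = Z <+>\<^bsub>X\<^esub> X.cyclic x"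
      have cyc: "submodule (X.cyclic x) R X" by (rule X.submodule_cyclic[OF xX])
      have Z': "submodule Z' R X" unfolding Z'_def by (rule X.submodule_set_add[OF less.prems(1) cyc])
      have ZZ': "Z \<subseteq> Z'" unfolding Z'_def by (rule X.set_add_upper[OF less.prems(1) cyc])
      have "x \<in> Z'" unfolding Z'_def using X.set_add_upper(2)[OF less.prems(1) cyc] X.cyclic_self[OF xX] by blast
      then have ne: "Z \<noteq> Z'" using x(2) by blast
      have "X.cyclic x \<subseteq> F" using FD(4)[OF _ x(1)] by (auto simp: X.cyclic_def)
      then have Z'F: "Z' \<subseteq> F" unfolding Z'_def by (rule X.set_add_least[OF F less.prems(2)])
      have "enat n = mlength R X Z Z' + mlength R X Z' F"
        using X.mlength_additive[OF less.prems(1) Z' F ZZ' Z'F] less.prems(3) by simp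
      moreover have "mlength R X Z Z' \<noteq> 0" using X.mlength_eq_0[OF less.prems(1) Z' ZZ'] ne by simp
      ultimately obtain k where k: "mlength R X Z' F = enat k" "k < n"
        by (cases "mlength R X Z Z'"; cases "mlength R X Z' F") (auto simp: zero_enat_def)
      from extend_one_step[OF X N less.prems(1) xX x(2,3) less.prems(4)]
      obtain g where g: "g \<in> mod_hom_on R X Z' N" "\<forall>z\<in>Z. g z = f z" unfolding Z'_def[symmetric] by (rule bexE)
      from less.IH[OF k(2) Z' Z'F k(1) g(1)]
      obtain h where h: "h \<in> mod_hom_on R X F N" "\<forall>z\<in>Z'. h z = g z" by (rule bexE)
      have "\<forall>z\<in>Z. h z = f z" using h(2) g(2) ZZ' by auto
      then show ?thesis using h(1) by blast
    qed (use less.prems in blast)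
  qed
  note step = this
  obtain n where n: "mlength R X Z F = enat n" using Z(3) by auto
  show ?thesis unfolding extends_def by (intro ballI) (rule step[OF Z(1,2) n])
qed

lemma ex_socle: "\<exists>r\<in>carrier R. r \<noteq> \<zero> \<and> (\<forall>x\<in>\<mm>. x \<otimes> r = \<zero>)"
proof (rule ccontr)
  assume not: "\<not> ?thesis"
  have ne: "\<one> \<noteq> \<zero>" using one_notin_max maxD(2) by auto
  then obtain u where u: "u \<in> \<mm>" "u \<otimes> \<one> \<noteq> \<zero>" using not by blast
  then have uR: "u \<in> carrier R" "u \<noteq> \<zero>" using maxD(1) by auto
  then obtain v where v: "v \<in> \<mm>" "v \<otimes> u \<noteq> \<zero>" using not by blast
  then have "v \<otimes> u \<in> carrier R" using maxD(1) uR by auto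
  then obtain w where w: "w \<in> \<mm>" "w \<otimes> (v \<otimes> u) \<noteq> \<zero>" using not v by blast
  then show False using cube_zero[OF w(1) v(1) u(1)] by simp
qed

lemma mult_two_max: "r \<in> \<mm> \<Longrightarrow> s \<in> \<mm> \<Longrightarrow> r \<otimes> s \<in> max2"
  using Reg.mprod_mem[of r \<mm> s \<mm>] by simp

lemma max2_cyclic:
  assumes "mlength R Reg {\<zero>} max2 = 1"
  obtains \<sigma> where "\<sigma> \<in> max2" "\<sigma> \<noteq> \<zero>" "max2 = (\<lambda>r. r \<otimes> \<sigma>) ` carrier R"
proof -
  note zD = Reg.submoduleD[OF submodule_max2]
  have z: "submodule {\<zero>} R Reg" "{\<zero>} \<subseteq> max2" using Reg.submodule_zero zD(2) by auto
  have "{\<zero>} \<noteq> max2"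
    using assms Reg.mlength_eq_0[OF z(1) submodule_max2 z(2)] by auto
  then obtain \<sigma> where \<sigma>: "\<sigma> \<in> max2" "\<sigma> \<noteq> \<zero>" using z by blast
  have \<sigma>R: "\<sigma> \<in> carrier Reg" using zD(1)[OF \<sigma>(1)] by simp
  have cyc: "submodule (Reg.cyclic \<sigma>) R Reg" by (rule Reg.submodule_cyclic[OF \<sigma>R])
  have sub: "Reg.cyclic \<sigma> \<subseteq> max2" using zD(4)[OF _ \<sigma>(1)] by (auto simp: Reg.cyclic_def)
  have z': "{\<zero>} \<subseteq> Reg.cyclic \<sigma>" "{\<zero>} \<noteq> Reg.cyclic \<sigma>"
    using Reg.submoduleD(2)[OF cyc] Reg.cyclic_self[OF \<sigma>R] \<sigma>(2) by auto
  have "mlength R Reg {\<zero>} (Reg.cyclic \<sigma>) \<noteq> 0" using Reg.mlength_eq_0[OF z(1) cyc z'(1)] z'(2) by simp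
  moreover have "1 = mlength R Reg {\<zero>} (Reg.cyclic \<sigma>) + mlength R Reg (Reg.cyclic \<sigma>) max2"
    using Reg.mlength_additive[OF z(1) cyc submodule_max2 z'(1) sub] assms by simp
  ultimately have "mlength R Reg (Reg.cyclic \<sigma>) max2 = 0"
    by (cases "mlength R Reg {\<zero>} (Reg.cyclic \<sigma>)"; cases "mlength R Reg (Reg.cyclic \<sigma>) max2")
      (auto simp: zero_enat_def one_enat_def)
  then have "Reg.cyclic \<sigma> = max2" using Reg.mlength_eq_0[OF cyc submodule_max2 sub] by simp
  then have "max2 = (\<lambda>r. r \<otimes> \<sigma>) ` carrier R" by (simp add: Reg.cyclic_def)
  then show ?thesis by (rule that[OF \<sigma>])
qed

lemma ex_mincover_max: "\<exists>n x. mincover Reg \<mm> n x"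
proof -
  have "mlength R Reg {\<zero>\<^bsub>Reg\<^esub>} \<mm> \<le> mlength R Reg {\<zero>} (carrier R)"
    using maxD(2) max_carrier Reg.submodule_zero submodule_max submodule_carrier
    by (intro Reg.mlength_mono) auto
  then have "mlength R Reg {\<zero>\<^bsub>Reg\<^esub>} \<mm> \<noteq> \<infinity>"
    using finite_length by (cases "mlength R Reg {\<zero>\<^bsub>Reg\<^esub>} \<mm>") auto
  then obtain n c where "\<forall>l<n. c l \<in> \<mm>" "\<mm> = lspan R Reg c n"
    using finite_length_imp_lspan[OF module_regular submodule_max] by blast
  then show ?thesis using ex_mincover[OF module_regular submodule_max] by blast
qed

text \<open>If the socle is \<open>\<mm>\<^sup>2\<close> and simple, multiplication gives a perfect pairing on \<open>\<mm>/\<mm>\<^sup>2\<close>.\<close>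

lemma residue_ext_zero_of_simple_socle:
  assumes len: "mlength R Reg {\<zero>} max2 = 1"
    and soc: "\<And>r. r \<in> carrier R \<Longrightarrow> (\<And>x. x \<in> \<mm> \<Longrightarrow> x \<otimes> r = \<zero>) \<Longrightarrow> r \<in> max2"
  shows "residue_ext_zero Reg"
  unfolding residue_ext_zero_def
proof
  fix g assume g: "g \<in> mod_hom_on R Reg \<mm> Reg"
  note gD = mod_hom_onD[OF g, simplified]
  obtain \<sigma> where \<sigma>: "\<sigma> \<in> max2" "\<sigma> \<noteq> \<zero>" "max2 = (\<lambda>r. r \<otimes> \<sigma>) ` carrier R" using max2_cyclic[OF len] .
  have \<sigma>m: "\<sigma> \<in> \<mm>" using \<sigma>(1) max2_subset by blast
  have \<sigma>R: "\<sigma> \<in> carrier R" using maxD(1)[OF \<sigma>m] .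
  have "g \<sigma> \<in> max2"
  proof (rule soc)
    show "g \<sigma> \<in> carrier R" using gD(1) \<sigma>m .
    fix x assume x: "x \<in> \<mm>"
    have "x \<otimes> g \<sigma> = g (x \<otimes> \<sigma>)" using gD(3)[OF maxD(1)[OF x] \<sigma>m] by simp
    also have "\<dots> = g \<zero>\<^bsub>Reg\<^esub>" using mult_max2[OF x \<sigma>(1)] by simp
    also have "\<dots> = \<zero>" using Reg.mod_hom_on_zero[OF g module_regular submodule_max] by simp
    finally show "x \<otimes> g \<sigma> = \<zero>" .
  qed
  then obtain d where d: "d \<in> carrier R" "g \<sigma> = d \<otimes> \<sigma>" using \<sigma>(3) by auto
  \<comment> \<open>Subtracting multiplication by \<open>d\<close> makes the map vanish at
    \<open>\<sigma>\<close>, hence on \<open>\<mm>\<^sup>2\<close>; its values are then annihilated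
    by \<open>\<mm>\<close> and so lie in \<open>\<mm>\<^sup>2\<close>.\<close>
  define h where "h r = g r \<ominus> d \<otimes> r" for r
  have hR: "h r \<in> carrier R" if "r \<in> \<mm>" for r using gD(1)[OF that] maxD(1)[OF that] d(1) by (simp add: h_def)
  have hadd: "h (r \<oplus> s) = h r \<oplus> h s" if "r \<in> \<mm>" "s \<in> \<mm>" for r s
  proof -
    have c: "g r \<in> carrier R" "g s \<in> carrier R" "r \<in> carrier R" "s \<in> carrier R" using that gD(1) maxD(1) by auto
    have "g r \<oplus> g s \<ominus> d \<otimes> (r \<oplus> s) = (g r \<ominus> d \<otimes> r) \<oplus> (g s \<ominus> d \<otimes> s)" using c d(1) by algebra
    then show ?thesis using gD(2)[OF that] by (simp add: h_def)
  qed
  have hmult: "h (t \<otimes> r) = t \<otimes> h r" if "t \<in> carrier R" "r \<in> \<mm>" for t r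
  proof -
    have c: "g r \<in> carrier R" "r \<in> carrier R" using that gD(1) maxD(1) by auto
    have "t \<otimes> g r \<ominus> d \<otimes> (t \<otimes> r) = t \<otimes> (g r \<ominus> d \<otimes> r)" using c d(1) that(1) by algebra
    then show ?thesis using gD(3)[OF that] by (simp add: h_def)
  qed
  have h\<sigma>: "h \<sigma> = \<zero>" unfolding h_def d(2) using d(1) \<sigma>R by (simp add: r_neg a_minus_def)
  have hmax2: "h s = \<zero>" if "s \<in> max2" for s
  proof -
    have "s \<in> (\<lambda>r. r \<otimes> \<sigma>) ` carrier R" using that unfolding \<sigma>(3) .
    then obtain r where r: "r \<in> carrier R" "s = r \<otimes> \<sigma>" by blast
    then show ?thesis using hmult[OF r(1) \<sigma>m] h\<sigma> by simp
  qed
  have h_soc: "h r \<in> max2" if r: "r \<in> \<mm>" for r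
  proof (rule soc[OF hR[OF r]])
    fix x assume x: "x \<in> \<mm>"
    have "x \<otimes> h r = h (x \<otimes> r)" using hmult[OF maxD(1)[OF x] r] by simp
    also have "\<dots> = \<zero>" by (rule hmax2[OF mult_two_max[OF x r]])
    finally show "x \<otimes> h r = \<zero>" .
  qed
  obtain n x where nx: "mincover Reg \<mm> n x" using ex_mincover_max by blast
  have xm: "x l \<in> \<mm>" if "l < n" for l using nx that by (auto simp: mincover_def)
  have len1: "mlength R Reg max2 \<mm> = enat n" by (rule mincover_mlength[OF module_regular submodule_max nx])
  \<comment> \<open>Multiplication against the generators of \<open>\<mm>\<close>. Its kernel on
    \<open>\<mm>\<close> is contained in \<open>\<mm>\<^sup>2\<close>, and
    \<open>\<mm>/\<mm>\<^sup>2\<close> has the same length \<open>n\<close> as \<open>n\<close>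
    copies of \<open>\<mm>\<^sup>2\<close>. So the map is onto, and \<open>h\<close> is
    multiplication by some \<open>w\<close>.\<close>
  define T where "T w = (\<lambda>l. if l < n then w \<otimes> x l else \<zero>)" for w
  have T: "T \<in> mod_hom_on R Reg \<mm> Vec"
    using xm maxD(1) by (intro mod_hom_onI) (auto simp: T_def l_distr m_assoc fun_eq_iff)
  have gen: "\<exists>v\<in>Fn n. r = lincomb Reg v x n" if "r \<in> \<mm>" for r
    using nx that by (auto simp: mincover_def lspan_def)
  have Tsub: "T ` \<mm> \<subseteq> tuples Reg n max2"
    using xm mult_two_max by (auto simp: T_def tuples_def)
  have ker: "w \<in> max2" if w: "w \<in> \<mm>" "T w = (\<lambda>_. \<zero>)" for w
  proof (rule soc)
    show wR: "w \<in> carrier R" using maxD(1) w by blast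
    fix r assume "r \<in> \<mm>"
    then obtain v where v: "v \<in> Fn n" "r = lincomb Reg v x n" using gen by blast
    have "w \<otimes> r = lincomb Reg v (\<lambda>l. w \<odot>\<^bsub>Reg\<^esub> x l) n"
      using v xm maxD(1) wR by (subst Reg.lincomb_smult_right) (auto simp: mem_Fn)
    also have "\<dots> = \<zero>\<^bsub>Reg\<^esub>"
    proof (rule Reg.lincomb_zero)
      fix l assume "l < n"
      then have "w \<otimes> x l = \<zero>" using fun_cong[OF w(2), of l] by (simp add: T_def)
      then show "v l \<odot>\<^bsub>Reg\<^esub> (w \<odot>\<^bsub>Reg\<^esub> x l) = \<zero>\<^bsub>Reg\<^esub>" using v by (simp add: mem_Fn)
    qed
    finally show "r \<otimes> w = \<zero>" using wR \<open>r \<in> \<mm>\<close> maxD(1) by (simp add: m_comm)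
  qed
  have Tm: "submodule (T ` \<mm>) R Vec"
    by (rule Vec.submodule_image[OF T module_regular submodule_max submodule_max subset_refl])
  have z0: "{\<lambda>_. \<zero>} \<subseteq> T ` \<mm>" using Vec.submoduleD(2)[OF Tm] by simp
  have tm: "submodule (tuples Reg n max2) R Vec" by (rule Reg.submodule_tuples[OF submodule_max2])
  have "mlength R Reg max2 \<mm> \<le> mlength R Vec {\<lambda>_. \<zero>} (T ` \<mm>)"
    by (rule mlength_inj[OF module_regular module_Vec submodule_max submodule_max2 max2_subset Tm zero_Vec z0 T])
      (use ker in auto)
  moreover have "mlength R Vec {\<lambda>_. \<zero>} (tuples Reg n max2) = enat n"
    using Reg.mlength_tuples[OF Reg.submodule_zero submodule_max2] len Reg.submoduleD(2)[OF submodule_max2]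
    by (simp add: tuples_zero)
  moreover have "mlength R Vec {\<lambda>_. \<zero>} (tuples Reg n max2) =
      mlength R Vec {\<lambda>_. \<zero>} (T ` \<mm>) + mlength R Vec (T ` \<mm>) (tuples Reg n max2)"
    by (rule Vec.mlength_additive[OF zero_Vec Tm tm z0 Tsub])
  ultimately have "mlength R Vec (T ` \<mm>) (tuples Reg n max2) = 0"
    unfolding len1
    by (cases "mlength R Vec {\<lambda>_. \<zero>} (T ` \<mm>)"; cases "mlength R Vec (T ` \<mm>) (tuples Reg n max2)")
      (auto simp: zero_enat_def)
  then have eq: "T ` \<mm> = tuples Reg n max2" using Vec.mlength_eq_0[OF Tm tm Tsub] by simp
  have "(\<lambda>l. if l < n then h (x l) else \<zero>) \<in> tuples Reg n max2"
    using h_soc xm by (auto simp: tuples_def)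
  then have "(\<lambda>l. if l < n then h (x l) else \<zero>) \<in> T ` \<mm>" using eq by simp
  then obtain w where w: "w \<in> \<mm>" "T w = (\<lambda>l. if l < n then h (x l) else \<zero>)" by auto
  have wl: "w \<otimes> x l = h (x l)" if "l < n" for l using fun_cong[OF w(2), of l] that by (simp add: T_def)
  have wR: "w \<in> carrier R" using maxD(1) w by blast
  have hhom: "h \<in> mod_hom_on R Reg \<mm> Reg" using hR hadd hmult by (intro mod_hom_onI) auto
  have hw: "h r = r \<otimes> w" if r: "r \<in> \<mm>" for r
  proof -
    obtain v where v: "v \<in> Fn n" "r = lincomb Reg v x n" using gen r by blast
    have vR: "\<And>l. v l \<in> carrier R" using v by (auto simp: mem_Fn)
    have "h r = lincomb Reg v (\<lambda>l. h (x l)) n"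
      unfolding v(2) by (rule Reg.lincomb_hom[OF hhom module_regular submodule_max vR xm])
    also have "\<dots> = lincomb Reg v (\<lambda>l. w \<odot>\<^bsub>Reg\<^esub> x l) n" by (rule Reg.lincomb_cong) (auto simp: wl)
    also have "\<dots> = w \<otimes> r" unfolding v(2)
      using vR xm maxD(1) wR by (subst Reg.lincomb_smult_right) auto
    finally show ?thesis using m_comm[OF wR maxD(1)[OF r]] by simp
  qed
  show "\<exists>w\<in>carrier Reg. \<forall>r\<in>\<mm>. g r = r \<odot>\<^bsub>Reg\<^esub> w"
  proof (intro bexI[of _ "w \<oplus> d"] ballI)
    fix r assume r: "r \<in> \<mm>"
    have c: "g r \<in> carrier R" "r \<in> carrier R" using gD(1)[OF r] maxD(1)[OF r] by auto
    have "g r = h r \<oplus> d \<otimes> r" unfolding h_def using c d(1) by algebra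
    also have "\<dots> = r \<otimes> (w \<oplus> d)" unfolding hw[OF r] using c d(1) wR by algebra
    finally show "g r = r \<odot>\<^bsub>Reg\<^esub> (w \<oplus> d)" by simp
  qed (use wR d(1) in simp)
qed

text \<open>The differences \<open>q - p'\<close> and \<open>s - r'\<close> satisfy, modulo
  \<open>\<mm>\<close>, two linear equations whose determinant is
  \<open>\<alpha>\<gamma> - \<beta>\<^sup>2\<close> up to sign; each equation is a difference of two
  assumptions in which the other terms cancel. Cramer's rule finishes. The lemma serves to show that
  coefficient maps of consecutive differentials agree modulo \<open>\<mm>\<close>.\<close>

lemma perfect_pairing_aux:
  assumes "\<alpha> \<in> carrier R" "\<beta> \<in> carrier R" "\<gamma> \<in> carrier R" "\<alpha> \<otimes> \<gamma> \<ominus> \<beta> \<otimes> \<beta> \<notin> \<mm>"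
    and "p \<in> carrier R" "p' \<in> carrier R" "q \<in> carrier R" "q' \<in> carrier R"
    and "r \<in> carrier R" "r' \<in> carrier R" "s \<in> carrier R" "s' \<in> carrier R"
    and "\<alpha> \<otimes> p \<oplus> \<beta> \<otimes> r \<oplus> \<beta> \<otimes> q \<oplus> \<gamma> \<otimes> s \<in> \<mm>" "\<alpha> \<otimes> p' \<oplus> \<beta> \<otimes> r' \<oplus> \<beta> \<otimes> q' \<oplus> \<gamma> \<otimes> s' \<in> \<mm>"
    and "\<alpha> \<otimes> p \<oplus> \<beta> \<otimes> p' \<oplus> \<beta> \<otimes> r \<oplus> \<gamma> \<otimes> r' \<in> \<mm>" "\<alpha> \<otimes> q \<oplus> \<beta> \<otimes> q' \<oplus> \<beta> \<otimes> s \<oplus> \<gamma> \<otimes> s' \<in> \<mm>"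
  shows "q \<ominus> p' \<in> \<mm>" "s \<ominus> r' \<in> \<mm>"
proof -
  note sub = Reg.submoduleD(6)[OF submodule_max]
  have mi: "u \<ominus> v \<in> \<mm>" if "u \<in> \<mm>" "v \<in> \<mm>" for u v
    using sub[OF that] minus_regular maxD(1) that by simp
  have 1: "\<beta> \<otimes> (q \<ominus> p') \<oplus> \<gamma> \<otimes> (s \<ominus> r') \<in> \<mm>"
  proof -
    have "(\<alpha> \<otimes> p \<oplus> \<beta> \<otimes> r \<oplus> \<beta> \<otimes> q \<oplus> \<gamma> \<otimes> s) \<ominus> (\<alpha> \<otimes> p \<oplus> \<beta> \<otimes> p' \<oplus> \<beta> \<otimes> r \<oplus> \<gamma> \<otimes> r')
        = \<beta> \<otimes> (q \<ominus> p') \<oplus> \<gamma> \<otimes> (s \<ominus> r')" using assms(1-12) by algebra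
    then show ?thesis using mi[OF assms(13,15)] by simp
  qed
  have 2: "\<alpha> \<otimes> (q \<ominus> p') \<oplus> \<beta> \<otimes> (s \<ominus> r') \<in> \<mm>"
  proof -
    have "(\<alpha> \<otimes> q \<oplus> \<beta> \<otimes> q' \<oplus> \<beta> \<otimes> s \<oplus> \<gamma> \<otimes> s') \<ominus> (\<alpha> \<otimes> p' \<oplus> \<beta> \<otimes> r' \<oplus> \<beta> \<otimes> q' \<oplus> \<gamma> \<otimes> s')
        = \<alpha> \<otimes> (q \<ominus> p') \<oplus> \<beta> \<otimes> (s \<ominus> r')" using assms(1-12) by algebra
    then show ?thesis using mi[OF assms(16,14)] by simp
  qed
  have "(\<alpha> \<otimes> \<gamma> \<ominus> \<beta> \<otimes> \<beta>) \<otimes> (q \<ominus> p') =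
      \<gamma> \<otimes> (\<alpha> \<otimes> (q \<ominus> p') \<oplus> \<beta> \<otimes> (s \<ominus> r')) \<ominus> \<beta> \<otimes> (\<beta> \<otimes> (q \<ominus> p') \<oplus> \<gamma> \<otimes> (s \<ominus> r'))"
    using assms(1-12) by algebra
  moreover have "\<dots> \<in> \<mm>" using mi maxD(4) 1 2 assms(1-3) by blast
  ultimately show "q \<ominus> p' \<in> \<mm>" using max_prime[OF _ _ _ assms(4)] assms(1-12) by simp
  have "(\<alpha> \<otimes> \<gamma> \<ominus> \<beta> \<otimes> \<beta>) \<otimes> (s \<ominus> r') =
      \<alpha> \<otimes> (\<beta> \<otimes> (q \<ominus> p') \<oplus> \<gamma> \<otimes> (s \<ominus> r')) \<ominus> \<beta> \<otimes> (\<alpha> \<otimes> (q \<ominus> p') \<oplus> \<beta> \<otimes> (s \<ominus> r'))"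
    using assms(1-12) by algebra
  moreover have "\<dots> \<in> \<mm>" using mi maxD(4) 1 2 assms(1-3) by blast
  ultimately show "s \<ominus> r' \<in> \<mm>" using max_prime[OF _ _ _ assms(4)] assms(1-12) by simp
qed

end

section \<open>Betti sequences\<close>

text \<open>Let \<open>x j\<close> be the ratio of consecutive values of \<open>b\<close>, and
  \<open>y = x m\<close>. The bounds give \<open>a 0 / b 0 = 1 / y\<close>, so
  \<open>e = x 0 + 1 / y\<close>, and \<open>y * s \<le> x 0\<close>. By induction
  \<open>x j \<ge> x 0\<close>, from \<open>e \<le> x (Suc j) + s / x j\<close> and
  \<open>s / x j \<le> s / x 0 \<le> 1 / y\<close>. For \<open>j = m\<close> this reads
  \<open>y \<ge> x 0 \<ge> y * s\<close>.\<close>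

lemma betti_socle_bound:
  fixes a b :: "nat \<Rightarrow> nat" and e s m :: nat
  assumes pos: "\<And>j. b j > 0"
    and step: "\<And>j. b j * e \<le> b (Suc j) + a j" "\<And>j. a (Suc j) \<le> b j * s"
    and eq: "b 0 * e = b 1 + a 0" "a 1 = b 0 * s"
    and bounds: "b m * b 0 \<le> b (Suc m) * a 0" "b (Suc m) * a 0 \<le> b m * b 0" "b (Suc m) * a 1 \<le> b m * b 1"
  shows "s \<le> 1"
proof -
  define x where "x j = real (b (Suc j)) / real (b j)" for j
  define y where "y = x m"
  have bp: "real (b j) > 0" for j using pos by simp
  have xp: "x j > 0" for j unfolding x_def using bp by simp
  have yp: "y > 0" unfolding y_def by (rule xp)
  have "real (b m) * real (b 0) = real (b (Suc m)) * real (a 0)"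
    using bounds(1,2) by (metis antisym of_nat_mult)
  then have a0: "real (a 0) / real (b 0) = 1 / y"
    unfolding y_def x_def using bp[of m] bp[of 0] bp[of "Suc m"] by (simp add: field_simps)
  have "real (b 0) * real e = real (b 1) + real (a 0)" using eq(1) by (metis of_nat_add of_nat_mult)
  then have e0: "real e = x 0 + 1 / y"
    unfolding a0[symmetric] x_def using bp[of 0] by (simp add: field_simps)
  have "real (b (Suc m)) * (real (b 0) * real s) \<le> real (b m) * real (b 1)"
    using bounds(3) unfolding eq(2) by (metis of_nat_le_iff of_nat_mult)
  then have ys: "y * real s \<le> x 0"
    unfolding y_def x_def using bp[of m] bp[of 0] by (simp add: field_simps)
  have "x j \<ge> x 0" for j
  proof (induction j)
    case (Suc j)
    have "real (b (Suc j)) * real e \<le> real (b (Suc (Suc j))) + real (b j) * real s"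
      using step(1)[of "Suc j"] step(2)[of j] by (metis add_left_mono le_trans of_nat_add of_nat_le_iff of_nat_mult)
    then have "real e \<le> x (Suc j) + real s / x j"
      unfolding x_def using bp[of j] bp[of "Suc j"] by (simp add: field_simps)
    moreover have "real s / x j \<le> real s / x 0"
      using Suc xp[of j] xp[of 0] by (intro divide_left_mono) auto
    moreover have "real s / x 0 \<le> 1 / y"
      using ys yp xp[of 0] by (simp add: field_simps)
    ultimately show ?case using e0 by linarith
  qed simp
  from this[of m] have "y * real s \<le> y * 1" using ys by (simp add: y_def)
  then have "real s \<le> 1" using yp by (simp only: mult_le_cancel_left_pos)
  then show ?thesis by simp
qed

text \<open>In terms of the ratios \<open>x j\<close> the bounds say
  \<open>x (k + 1 + j) \<le> x j \<le> x (k + 2 + j)\<close>. The second bound and the first at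
  \<open>j + 1\<close> make \<open>x\<close> nondecreasing, and then the first makes it constant.
  The recursion becomes \<open>x + 1 / x = e\<close> for a positive rational \<open>x\<close>, which
  forces \<open>x = 1\<close>.\<close>

lemma betti_constant:
  fixes b :: "nat \<Rightarrow> nat" and e k :: nat
  assumes pos: "\<And>j. b j > 0" and rec: "\<And>j. b (Suc j) * e = b (Suc (Suc j)) + b j"
    and bounds: "\<And>j. b (k + j + 2) * b j \<le> b (k + j + 1) * b (j + 1)"
      "\<And>j. b (k + j + 2) * b (j + 1) \<le> b (k + j + 3) * b j"
  shows "e = 2" "b j = b 0"
proof -
  define x where "x j = real (b (Suc j)) / real (b j)" for j
  have bp: "real (b j) > 0" for j using pos by simp
  have up: "x (k + 1 + j) \<le> x j" for j
  proof -
    have "real (b (k + j + 2)) * real (b j) \<le> real (b (k + j + 1)) * real (b (j + 1))"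
      using bounds(1)[of j] by (metis of_nat_le_iff of_nat_mult)
    then show ?thesis unfolding x_def using bp[of j] bp[of "k + j + 1"] by (simp add: field_simps)
  qed
  have lo: "x j \<le> x (k + 2 + j)" for j
  proof -
    have "real (b (k + j + 2)) * real (b (j + 1)) \<le> real (b (k + j + 3)) * real (b j)"
      using bounds(2)[of j] by (metis of_nat_le_iff of_nat_mult)
    then show ?thesis unfolding x_def using bp[of j] bp[of "k + j + 2"]
      by (simp add: field_simps eval_nat_numeral)
  qed
  have mono: "x j \<le> x (Suc j)" for j
    using lo[of j] up[of "Suc j"] by (simp add: eval_nat_numeral)
  then have "x (Suc j) \<le> x (k + 1 + j)" for j
    by (induction k) (auto intro: order_trans simp: lift_Suc_mono_le)
  then have const: "x (Suc j) = x j" for j using up[of j] mono[of j] by (meson antisym order_trans)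
  then have x: "x j = x 0" for j by (induction j) auto
  have "real (b 2) * real (b 0) = real (b 1) * real (b 1)"
    using const[of 0] bp[of 0] bp[of 1] unfolding x_def by (simp add: field_simps eval_nat_numeral)
  then have 1: "b 2 * b 0 = b 1 * b 1" by (metis of_nat_eq_iff of_nat_mult)
  have r: "b 1 * e = b 2 + b 0" using rec[of 0] by (simp add: eval_nat_numeral)
  have 2: "b 0 * b 1 * e = b 1 * b 1 + b 0 * b 0"
    using r 1 by (metis add_mult_distrib mult.assoc mult.commute)
  \<comment> \<open>In lowest terms the ratio is \<open>p / q\<close>, with
    \<open>q p e = p\<^sup>2 + q\<^sup>2\<close>. So \<open>p\<close> divides
    \<open>q\<^sup>2\<close> and \<open>q\<close> divides \<open>p\<^sup>2\<close>, and coprimality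
    leaves \<open>p = q = 1\<close>.\<close>
  define d where "d = gcd (b 0) (b 1)"
  have d: "d > 0" using pos[of 0] by (simp add: d_def)
  obtain p q where pq: "b 1 = p * d" "b 0 = q * d" "coprime p q"
    using gcd_coprime_exists[of "b 1" "b 0"] d unfolding d_def by (auto simp: gcd.commute)
  have "d * d * (q * p * e) = d * d * (p * p + q * q)"
    using 2 unfolding pq(1,2) by (simp add: algebra_simps)
  then have 3: "q * p * e = p * p + q * q" using d by simp
  have "p dvd p * p + q * q" "q dvd p * p + q * q" unfolding 3[symmetric] by simp_all
  then have dv: "p dvd q * q" "q dvd p * p" by (simp_all add: dvd_add_right_iff dvd_add_left_iff)
  have "coprime p (q * q)" "coprime q (p * p)" using pq(3) by (auto simp: coprime_commute)
  then have "is_unit p" "is_unit q"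
    using coprime_common_divisor[OF _ dvd_refl dv(1)] coprime_common_divisor[OF _ dvd_refl dv(2)] by blast+
  then have "p = 1" "q = 1" by simp_all
  then have b01: "b 1 = b 0" using pq by simp
  show "e = 2" using 3 \<open>p = 1\<close> \<open>q = 1\<close> by simp
  have "x 0 = 1" using b01 bp[of 0] by (simp add: x_def)
  then have "b (Suc j) = b j" for j using x[of j] bp[of j] by (simp add: x_def)
  then show "b j = b 0" by (induction j) auto
qed

section \<open>Embedding dimension two\<close>

context local_cube_zero
begin

lemma max_mult_right: "r \<in> \<mm> \<Longrightarrow> s \<in> carrier R \<Longrightarrow> r \<otimes> s \<in> \<mm>"
  using maxD(4)[of s r] m_comm[of r s] maxD(1) by simp

lemma mod_hom_on_comb:
  assumes f: "f \<in> mod_hom_on R Vec (Fn n) Vec"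
    and R: "r \<in> carrier R" "s \<in> carrier R" and v: "p \<in> Fn n" "q \<in> Fn n"
  shows "f (r \<odot>\<^bsub>Vec\<^esub> p \<oplus>\<^bsub>Vec\<^esub> s \<odot>\<^bsub>Vec\<^esub> q) = r \<odot>\<^bsub>Vec\<^esub> f p \<oplus>\<^bsub>Vec\<^esub> s \<odot>\<^bsub>Vec\<^esub> f q"
    "r \<odot>\<^bsub>Vec\<^esub> p \<oplus>\<^bsub>Vec\<^esub> s \<odot>\<^bsub>Vec\<^esub> q \<in> Fn n"
  using mod_hom_onD[OF f] Vec.submoduleD(3,4)[OF submodule_Fn] R v by (simp_all del: seq_module_simps)

lemma mod_hom_on_max:
  assumes f: "f \<in> mod_hom_on R Vec (Fn n) Vec" "f ` Fn n \<subseteq> Fn k" and v: "v \<in> tuples Reg n \<mm>"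
  shows "f v \<in> tuples Reg k \<mm>"
proof -
  have F: "submodule (Fn k) R Vec" "Fn k \<subseteq> carrier Vec"
    using submodule_Fn Vec.submoduleD(1)[OF submodule_Fn] by blast+
  have "f v \<in> mprod R Vec \<mm> (Fn k)"
    by (rule Vec.mprod_image[OF f(1) module_Vec submodule_Fn max_carrier F(2) f(2) subsetD[OF tuples_max_mprod v]])
  moreover have "mprod R Vec \<mm> (Fn k) \<subseteq> tuples Reg k \<mm>"
  proof (rule Vec.mprod_least[OF submodule_tuples_max])
    fix r u assume "r \<in> \<mm>" "u \<in> Fn k"
    then show "r \<odot>\<^bsub>Vec\<^esub> u \<in> tuples Reg k \<mm>"
      using maxD(1) max_mult_right by (auto simp: mem_Fn tuples_def)
  qed
  ultimately show ?thesis by blast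
qed

end

text \<open>The symmetric form that multiplication induces on \<open>\<mm>/\<mm>\<^sup>2\<close>,
  with values in the multiples of \<open>\<sigma>\<close>, is recorded by its Gram matrix with
  entries \<open>\<alpha>\<close>, \<open>\<beta>\<close>, \<open>\<gamma>\<close>;
  \<open>disc\<close> says that it is nondegenerate. No diagonal form is assumed, since a nonzero
  alternating form in residue characteristic two has none.\<close>

locale edim_two = local_cube_zero R \<mm> for R :: "('a, 'r) ring_scheme" (structure) and \<mm> +
  fixes x y \<sigma> \<alpha> \<beta> \<gamma> :: 'a
  assumes x: "x \<in> \<mm>" and y: "y \<in> \<mm>" and \<sigma>: "\<sigma> \<in> max2" "\<sigma> \<noteq> \<zero>"
    and coeffs: "\<alpha> \<in> carrier R" "\<beta> \<in> carrier R" "\<gamma> \<in> carrier R"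
    and gens: "\<And>r. r \<in> \<mm> \<Longrightarrow> \<exists>p\<in>carrier R. \<exists>q\<in>carrier R. r = x \<otimes> p \<oplus> y \<otimes> q"
    and xx: "x \<otimes> x = \<alpha> \<otimes> \<sigma>" and xy: "x \<otimes> y = \<beta> \<otimes> \<sigma>" and yy: "y \<otimes> y = \<gamma> \<otimes> \<sigma>"
    and disc: "\<alpha> \<otimes> \<gamma> \<ominus> \<beta> \<otimes> \<beta> \<notin> \<mm>"

lemma (in local_cube_zero) ex_edim_two:
  assumes len: "mlength R Reg {\<zero>} max2 = 1" and dim: "mlength R Reg max2 \<mm> = enat 2"
    and soc: "\<And>r. r \<in> carrier R \<Longrightarrow> (\<And>x. x \<in> \<mm> \<Longrightarrow> x \<otimes> r = \<zero>) \<Longrightarrow> r \<in> max2"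
  shows "\<exists>x y \<sigma> \<alpha> \<beta> \<gamma>. edim_two R \<mm> x y \<sigma> \<alpha> \<beta> \<gamma>"
proof -
  obtain \<sigma> where \<sigma>: "\<sigma> \<in> max2" "\<sigma> \<noteq> \<zero>" "max2 = (\<lambda>r. r \<otimes> \<sigma>) ` carrier R" using max2_cyclic[OF len] .
  obtain n c where nc: "mincover Reg \<mm> n c" using ex_mincover_max by blast
  have "enat n = enat 2" using mincover_mlength[OF module_regular submodule_max nc] dim by simp
  then have c: "mincover Reg \<mm> 2 c" using nc by simp
  define x y where "x = c 0" and "y = c 1"
  have xy: "x \<in> \<mm>" "y \<in> \<mm>" using c by (auto simp: mincover_def x_def y_def)
  have xyR: "x \<in> carrier R" "y \<in> carrier R" using xy maxD(1) by auto
  have \<sigma>R: "\<sigma> \<in> carrier R" using \<sigma>(1) max2_subset maxD(1) by blast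
  have lc: "lincomb Reg v c 2 = x \<otimes> v 0 \<oplus> y \<otimes> v 1" if "v 0 \<in> carrier R" "v 1 \<in> carrier R" for v
    using that xyR by (simp add: x_def y_def eval_nat_numeral m_comm)
  have gens: "\<exists>p\<in>carrier R. \<exists>q\<in>carrier R. r = x \<otimes> p \<oplus> y \<otimes> q" if "r \<in> \<mm>" for r
  proof -
    have "r \<in> lspan R Reg c 2" using c that by (simp add: mincover_def)
    then obtain v where v: "v \<in> Fn 2" "r = lincomb Reg v c 2" by (auto simp: lspan_def)
    then have "v 0 \<in> carrier R" "v 1 \<in> carrier R" by (auto simp: mem_Fn)
    then show ?thesis using v lc by blast
  qed
  have indep: "p \<in> \<mm> \<and> q \<in> \<mm>" if "p \<in> carrier R" "q \<in> carrier R" "x \<otimes> p \<oplus> y \<otimes> q \<in> max2" for p q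
  proof -
    define v where "v i = (if i = 0 then p else if i = 1 then q else \<zero>)" for i :: nat
    have v: "v \<in> Fn 2" using that by (auto simp: v_def mem_Fn)
    have "lincomb Reg v c 2 \<in> max2" using lc[of v] that by (simp add: v_def)
    then have "v \<in> tuples Reg 2 \<mm>"
      using mincover_mprod_iff[OF module_regular submodule_max c v] by simp
    then have "v 0 \<in> \<mm>" "v 1 \<in> \<mm>" by (simp_all add: tuples_def)
    then show ?thesis by (simp add: v_def)
  qed
  have ex: "\<exists>r\<in>carrier R. u \<otimes> v = r \<otimes> \<sigma>" if "u \<in> \<mm>" "v \<in> \<mm>" for u v
  proof -
    have "u \<otimes> v \<in> (\<lambda>r. r \<otimes> \<sigma>) ` carrier R" using mult_two_max[OF that] unfolding \<sigma>(3) .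
    then show ?thesis by blast
  qed
  obtain \<alpha> where \<alpha>: "\<alpha> \<in> carrier R" "x \<otimes> x = \<alpha> \<otimes> \<sigma>" using ex xy by blast
  obtain \<beta> where \<beta>: "\<beta> \<in> carrier R" "x \<otimes> y = \<beta> \<otimes> \<sigma>" using ex xy by blast
  obtain \<gamma> where \<gamma>: "\<gamma> \<in> carrier R" "y \<otimes> y = \<gamma> \<otimes> \<sigma>" using ex xy by blast
  have kill: "r \<otimes> \<sigma> = \<zero>" if "r \<in> \<mm>" for r using mult_max2[OF that \<sigma>(1)] .
  \<comment> \<open>A vector in the radical of the Gram matrix modulo \<open>\<mm>\<close> gives
    \<open>x p + y q\<close> in the socle, which lies in \<open>\<mm>\<^sup>2\<close>; minimality of
    the generators then puts \<open>p\<close> and \<open>q\<close> into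
    \<open>\<mm>\<close>.\<close>
  have rad: "p \<in> \<mm> \<and> q \<in> \<mm>"
    if pq: "p \<in> carrier R" "q \<in> carrier R" "\<alpha> \<otimes> p \<oplus> \<beta> \<otimes> q \<in> \<mm>" "\<beta> \<otimes> p \<oplus> \<gamma> \<otimes> q \<in> \<mm>" for p q
  proof (rule indep[OF pq(1,2)], rule soc)
    show "x \<otimes> p \<oplus> y \<otimes> q \<in> carrier R" using xyR pq by simp
    fix z assume "z \<in> \<mm>"
    then obtain u v where uv: "u \<in> carrier R" "v \<in> carrier R" "z = x \<otimes> u \<oplus> y \<otimes> v" using gens by blast
    have "x \<otimes> (x \<otimes> p \<oplus> y \<otimes> q) = (x \<otimes> x) \<otimes> p \<oplus> (x \<otimes> y) \<otimes> q" using xyR pq by algebra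
    also have "\<dots> = (\<alpha> \<otimes> p \<oplus> \<beta> \<otimes> q) \<otimes> \<sigma>" unfolding \<alpha>(2) \<beta>(2) using \<alpha>(1) \<beta>(1) pq \<sigma>R by algebra
    finally have 1: "x \<otimes> (x \<otimes> p \<oplus> y \<otimes> q) = \<zero>" using kill[OF pq(3)] by simp
    have "y \<otimes> (x \<otimes> p \<oplus> y \<otimes> q) = (x \<otimes> y) \<otimes> p \<oplus> (y \<otimes> y) \<otimes> q" using xyR pq by algebra
    also have "\<dots> = (\<beta> \<otimes> p \<oplus> \<gamma> \<otimes> q) \<otimes> \<sigma>" unfolding \<beta>(2) \<gamma>(2) using \<beta>(1) \<gamma>(1) pq \<sigma>R by algebra
    finally have 2: "y \<otimes> (x \<otimes> p \<oplus> y \<otimes> q) = \<zero>" using kill[OF pq(4)] by simp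
    have "z \<otimes> (x \<otimes> p \<oplus> y \<otimes> q) = u \<otimes> (x \<otimes> (x \<otimes> p \<oplus> y \<otimes> q)) \<oplus> v \<otimes> (y \<otimes> (x \<otimes> p \<oplus> y \<otimes> q))"
      unfolding uv(3) using uv(1,2) xyR pq by algebra
    then show "z \<otimes> (x \<otimes> p \<oplus> y \<otimes> q) = \<zero>" unfolding 1 2 using uv by simp
  qed
  have disc: "\<alpha> \<otimes> \<gamma> \<ominus> \<beta> \<otimes> \<beta> \<notin> \<mm>"
  proof
    assume D: "\<alpha> \<otimes> \<gamma> \<ominus> \<beta> \<otimes> \<beta> \<in> \<mm>"
    have neg: "\<ominus> r \<in> \<mm> \<longleftrightarrow> r \<in> \<mm>" if "r \<in> carrier R" for r
      using Reg.submoduleD(5)[OF submodule_max] uminus_regular that by (metis a_inv_closed minus_minus)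
    \<comment> \<open>If the determinant vanishes modulo \<open>\<mm>\<close>, then
      \<open>(\<beta>, -\<alpha>)\<close> lies in the radical. This gives
      \<open>\<alpha>, \<beta> \<in> \<mm>\<close>, and then \<open>(1, 0)\<close> lies in the
      radical as well.\<close>
    have "\<beta> \<in> \<mm> \<and> \<ominus> \<alpha> \<in> \<mm>"
    proof (rule rad)
      have "\<alpha> \<otimes> \<beta> \<oplus> \<beta> \<otimes> \<ominus> \<alpha> = \<zero>" using \<alpha> \<beta> by algebra
      then show "\<alpha> \<otimes> \<beta> \<oplus> \<beta> \<otimes> \<ominus> \<alpha> \<in> \<mm>" using maxD(2) by simp
      have "\<beta> \<otimes> \<beta> \<oplus> \<gamma> \<otimes> \<ominus> \<alpha> = \<ominus> (\<alpha> \<otimes> \<gamma> \<ominus> \<beta> \<otimes> \<beta>)" using \<alpha>(1) \<beta>(1) \<gamma>(1) by algebra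
      then show "\<beta> \<otimes> \<beta> \<oplus> \<gamma> \<otimes> \<ominus> \<alpha> \<in> \<mm>" using neg D \<alpha>(1) \<beta>(1) \<gamma>(1) by simp
    qed (use \<alpha>(1) \<beta>(1) in auto)
    then have "\<alpha> \<in> \<mm>" "\<beta> \<in> \<mm>" using neg \<alpha>(1) by auto
    then have "\<one> \<in> \<mm> \<and> \<zero> \<in> \<mm>"
      using \<alpha>(1) \<beta>(1) \<gamma>(1) by (intro rad) auto
    then show False using one_notin_max by simp
  qed
  have "edim_two R \<mm> x y \<sigma> \<alpha> \<beta> \<gamma>"
    by (intro edim_two.intro edim_two_axioms.intro local_cube_zero_axioms xy \<sigma>(1,2) \<alpha> \<beta> \<gamma> gens disc)
  then show ?thesis by (intro exI)
qed

context edim_two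
begin

lemma xyR: "x \<in> carrier R" "y \<in> carrier R" "\<sigma> \<in> carrier R"
  using x y \<sigma> max2_subset maxD(1) by blast+

lemma sigma_cancel:
  assumes "r \<in> carrier R" "\<sigma> \<otimes> r = \<zero>"
  shows "r \<in> \<mm>"
proof (rule ccontr)
  assume "r \<notin> \<mm>"
  then have r: "r \<in> Units R" using UnitsI assms by blast
  have "\<sigma> = (\<sigma> \<otimes> r) \<otimes> inv r" using r xyR assms(1) by (simp add: m_assoc)
  also have "\<dots> = \<zero>" using r assms by simp
  finally show False using \<sigma>(2) by simp
qed

lemma tuples_max_decomp:
  assumes "v \<in> tuples Reg n \<mm>"
  shows "\<exists>p\<in>Fn n. \<exists>q\<in>Fn n. v = x \<odot>\<^bsub>Vec\<^esub> p \<oplus>\<^bsub>Vec\<^esub> y \<odot>\<^bsub>Vec\<^esub> q"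
proof -
  have "\<forall>l. \<exists>r. l < n \<longrightarrow> fst r \<in> carrier R \<and> snd r \<in> carrier R \<and> v l = x \<otimes> fst r \<oplus> y \<otimes> snd r"
  proof
    fix l
    show "\<exists>r. l < n \<longrightarrow> fst r \<in> carrier R \<and> snd r \<in> carrier R \<and> v l = x \<otimes> fst r \<oplus> y \<otimes> snd r"
    proof (cases "l < n")
      case True
      then have "v l \<in> \<mm>" using assms by (simp add: tuples_def)
      then obtain p q where "p \<in> carrier R" "q \<in> carrier R" "v l = x \<otimes> p \<oplus> y \<otimes> q" using gens by blast
      then show ?thesis by (intro exI[of _ "(p, q)"]) simp
    qed simp
  qed
  then have "\<exists>h. \<forall>l. l < n \<longrightarrow> fst (h l) \<in> carrier R \<and> snd (h l) \<in> carrier R \<and> v l = x \<otimes> fst (h l) \<oplus> y \<otimes> snd (h l)"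
    by (rule choice)
  then obtain h where h: "\<forall>l. l < n \<longrightarrow> fst (h l) \<in> carrier R \<and> snd (h l) \<in> carrier R \<and> v l = x \<otimes> fst (h l) \<oplus> y \<otimes> snd (h l)"
    by (rule exE)
  define p q where "p l = (if l < n then fst (h l) else \<zero>)" and "q l = (if l < n then snd (h l) else \<zero>)" for l
  have "p \<in> Fn n" "q \<in> Fn n" using h by (auto simp: p_def q_def mem_Fn)
  moreover have "v = x \<odot>\<^bsub>Vec\<^esub> p \<oplus>\<^bsub>Vec\<^esub> y \<odot>\<^bsub>Vec\<^esub> q"
    using h assms xyR by (auto simp: p_def q_def tuples_def fun_eq_iff)
  ultimately show ?thesis by blast
qed

text \<open>A differential with entries in \<open>\<mm>\<close> is written \<open>x u + y v\<close>
  with maps \<open>u\<close>, \<open>v\<close> of free modules. These are determined only modulo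
  \<open>\<mm>\<close>, which is why the identities between them below are congruences.\<close>

lemma linear_decomp:
  assumes c: "\<And>l. l < n \<Longrightarrow> c l \<in> tuples Reg k \<mm>"
  shows "\<exists>u v. u \<in> mod_hom_on R Vec (Fn n) Vec \<and> v \<in> mod_hom_on R Vec (Fn n) Vec \<and>
    u ` Fn n \<subseteq> Fn k \<and> v ` Fn n \<subseteq> Fn k \<and>
    (\<forall>g\<in>Fn n. lincomb Vec g c n = x \<odot>\<^bsub>Vec\<^esub> u g \<oplus>\<^bsub>Vec\<^esub> y \<odot>\<^bsub>Vec\<^esub> v g)"
proof -
  have "\<forall>l. \<exists>r. l < n \<longrightarrow> fst r \<in> Fn k \<and> snd r \<in> Fn k \<and> c l = x \<odot>\<^bsub>Vec\<^esub> fst r \<oplus>\<^bsub>Vec\<^esub> y \<odot>\<^bsub>Vec\<^esub> snd r"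
  proof
    fix l
    show "\<exists>r. l < n \<longrightarrow> fst r \<in> Fn k \<and> snd r \<in> Fn k \<and> c l = x \<odot>\<^bsub>Vec\<^esub> fst r \<oplus>\<^bsub>Vec\<^esub> y \<odot>\<^bsub>Vec\<^esub> snd r"
    proof (cases "l < n")
      case True
      then obtain p q where "p \<in> Fn k" "q \<in> Fn k" "c l = x \<odot>\<^bsub>Vec\<^esub> p \<oplus>\<^bsub>Vec\<^esub> y \<odot>\<^bsub>Vec\<^esub> q"
        using tuples_max_decomp[OF c] by blast
      then show ?thesis by (intro exI[of _ "(p, q)"]) (simp del: seq_module_simps)
    qed simp
  qed
  then have "\<exists>h. \<forall>l. l < n \<longrightarrow> fst (h l) \<in> Fn k \<and> snd (h l) \<in> Fn k \<and>
      c l = x \<odot>\<^bsub>Vec\<^esub> fst (h l) \<oplus>\<^bsub>Vec\<^esub> y \<odot>\<^bsub>Vec\<^esub> snd (h l)" by (rule choice)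
  then obtain h where h: "\<forall>l. l < n \<longrightarrow> fst (h l) \<in> Fn k \<and> snd (h l) \<in> Fn k \<and>
      c l = x \<odot>\<^bsub>Vec\<^esub> fst (h l) \<oplus>\<^bsub>Vec\<^esub> y \<odot>\<^bsub>Vec\<^esub> snd (h l)" by (rule exE)
  define U V where "U l = fst (h l)" and "V l = snd (h l)" for l
  have UV: "U l \<in> Fn k" "V l \<in> Fn k" "c l = x \<odot>\<^bsub>Vec\<^esub> U l \<oplus>\<^bsub>Vec\<^esub> y \<odot>\<^bsub>Vec\<^esub> V l" if "l < n" for l
    using h that unfolding U_def V_def by blast+
  have UVc: "U l \<in> carrier Vec" "V l \<in> carrier Vec" if "l < n" for l
    using UV[OF that] Vec.submoduleD(1)[OF submodule_Fn] by blast+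
  define u v where "u g = lincomb Vec g U n" and "v g = lincomb Vec g V n" for g
  have 1: "u \<in> mod_hom_on R Vec (Fn n) Vec" "v \<in> mod_hom_on R Vec (Fn n) Vec"
    unfolding u_def[abs_def] v_def[abs_def] using UVc by (intro Vec.hom_lincomb; blast)+
  have 2: "u ` Fn n \<subseteq> Fn k" "v ` Fn n \<subseteq> Fn k"
    unfolding u_def v_def using UV Vec.submoduleD(4)[OF submodule_Fn]
    by (auto intro!: Vec.lincomb_closed[OF submodule_Fn] simp del: seq_module_simps simp: mem_Fn[of _ n])
  have 3: "lincomb Vec g c n = x \<odot>\<^bsub>Vec\<^esub> u g \<oplus>\<^bsub>Vec\<^esub> y \<odot>\<^bsub>Vec\<^esub> v g" if g: "g \<in> Fn n" for g
  proof -
    have gR: "\<And>l. g l \<in> carrier R" using g by (simp add: mem_Fn)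
    have "lincomb Vec g c n = lincomb Vec g (\<lambda>l. x \<odot>\<^bsub>Vec\<^esub> U l \<oplus>\<^bsub>Vec\<^esub> y \<odot>\<^bsub>Vec\<^esub> V l) n"
      by (rule Vec.lincomb_cong) (use UV in blast)+
    also have "\<dots> = lincomb Vec g (\<lambda>l. x \<odot>\<^bsub>Vec\<^esub> U l) n \<oplus>\<^bsub>Vec\<^esub> lincomb Vec g (\<lambda>l. y \<odot>\<^bsub>Vec\<^esub> V l) n"
      by (rule Vec.lincomb_add_right) (use gR UVc xyR in \<open>simp_all del: seq_module_simps\<close>)
    also have "\<dots> = x \<odot>\<^bsub>Vec\<^esub> u g \<oplus>\<^bsub>Vec\<^esub> y \<odot>\<^bsub>Vec\<^esub> v g"
      unfolding u_def v_def using gR UVc xyR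
      by (simp add: Vec.lincomb_smult_right del: seq_module_simps)
    finally show ?thesis .
  qed
  show ?thesis using 1 2 3 by blast
qed

text \<open>With arguments \<open>u p\<close>, \<open>u q\<close>, \<open>v p\<close>,
  \<open>v q\<close> this is the coefficient of \<open>\<sigma>\<close> when
  \<open>x u + y v\<close> is applied to \<open>x p + y q\<close>: the entries of the Gram matrix
  replace the products of \<open>x\<close> and \<open>y\<close>.\<close>

definition quad where
  "quad p q r s = (\<alpha> \<odot>\<^bsub>Vec\<^esub> p \<oplus>\<^bsub>Vec\<^esub> \<beta> \<odot>\<^bsub>Vec\<^esub> q) \<oplus>\<^bsub>Vec\<^esub> (\<beta> \<odot>\<^bsub>Vec\<^esub> r \<oplus>\<^bsub>Vec\<^esub> \<gamma> \<odot>\<^bsub>Vec\<^esub> s)"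

lemma quad_Fn:
  assumes "p \<in> Fn n" "q \<in> Fn n" "r \<in> Fn n" "s \<in> Fn n"
  shows "quad p q r s \<in> Fn n"
  unfolding quad_def using assms coeffs Vec.submoduleD(3,4)[OF submodule_Fn] by (simp del: seq_module_simps)

lemma quad_mem:
  assumes "submodule N R Vec" "p \<in> N" "q \<in> N" "r \<in> N" "s \<in> N"
  shows "quad p q r s \<in> N"
  unfolding quad_def using assms coeffs Vec.submoduleD(3,4)[OF assms(1)] by (simp del: seq_module_simps)

lemma hom_quad:
  assumes "f \<in> mod_hom_on R Vec (Fn n) Vec" "p \<in> Fn n" "q \<in> Fn n" "r \<in> Fn n" "s \<in> Fn n"
  shows "f (quad p q r s) = quad (f p) (f q) (f r) (f s)"
  unfolding quad_def
  using mod_hom_onD(2)[OF assms(1)] mod_hom_on_comb[OF assms(1)] assms(2-) coeffs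
  by (simp del: seq_module_simps)

lemma quad_eq:
  assumes u: "u \<in> mod_hom_on R Vec (Fn n) Vec" and v: "v \<in> mod_hom_on R Vec (Fn n) Vec"
    and p: "p \<in> Fn n" and q: "q \<in> Fn n"
  shows "x \<odot>\<^bsub>Vec\<^esub> u (x \<odot>\<^bsub>Vec\<^esub> p \<oplus>\<^bsub>Vec\<^esub> y \<odot>\<^bsub>Vec\<^esub> q) \<oplus>\<^bsub>Vec\<^esub> y \<odot>\<^bsub>Vec\<^esub> v (x \<odot>\<^bsub>Vec\<^esub> p \<oplus>\<^bsub>Vec\<^esub> y \<odot>\<^bsub>Vec\<^esub> q)
    = \<sigma> \<odot>\<^bsub>Vec\<^esub> quad (u p) (u q) (v p) (v q)"
proof
  fix i
  have c: "u p i \<in> carrier R" "u q i \<in> carrier R" "v p i \<in> carrier R" "v q i \<in> carrier R"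
    using mod_hom_onD(1)[OF u p] mod_hom_onD(1)[OF u q] mod_hom_onD(1)[OF v p] mod_hom_onD(1)[OF v q] by simp_all
  have "x \<otimes> (x \<otimes> u p i \<oplus> y \<otimes> u q i) \<oplus> y \<otimes> (x \<otimes> v p i \<oplus> y \<otimes> v q i)
      = (x \<otimes> x) \<otimes> u p i \<oplus> (x \<otimes> y) \<otimes> u q i \<oplus> ((x \<otimes> y) \<otimes> v p i \<oplus> (y \<otimes> y) \<otimes> v q i)"
    using c xyR by algebra
  also have "\<dots> = \<sigma> \<otimes> ((\<alpha> \<otimes> u p i \<oplus> \<beta> \<otimes> u q i) \<oplus> (\<beta> \<otimes> v p i \<oplus> \<gamma> \<otimes> v q i))"
    unfolding xx xy yy using c coeffs xyR by algebra
  finally show "(x \<odot>\<^bsub>Vec\<^esub> u (x \<odot>\<^bsub>Vec\<^esub> p \<oplus>\<^bsub>Vec\<^esub> y \<odot>\<^bsub>Vec\<^esub> q) \<oplus>\<^bsub>Vec\<^esub> y \<odot>\<^bsub>Vec\<^esub> v (x \<odot>\<^bsub>Vec\<^esub> p \<oplus>\<^bsub>Vec\<^esub> y \<odot>\<^bsub>Vec\<^esub> q)) i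
    = (\<sigma> \<odot>\<^bsub>Vec\<^esub> quad (u p) (u q) (v p) (v q)) i"
    unfolding mod_hom_on_comb(1)[OF u xyR(1,2) p q] mod_hom_on_comb(1)[OF v xyR(1,2) p q]
    by (simp add: quad_def)
qed

lemma quad_coord:
  assumes "\<And>i. p i \<in> carrier R" "\<And>i. q i \<in> carrier R" "\<And>i. r i \<in> carrier R" "\<And>i. s i \<in> carrier R"
  shows "quad p q r s i = \<alpha> \<otimes> p i \<oplus> \<beta> \<otimes> q i \<oplus> \<beta> \<otimes> r i \<oplus> \<gamma> \<otimes> s i"
  using assms[of i] coeffs by (simp add: quad_def a_assoc)

lemma sigma_tuples:
  assumes "v \<in> Fn n" "\<sigma> \<odot>\<^bsub>Vec\<^esub> v = (\<lambda>_. \<zero>)"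
  shows "v \<in> tuples Reg n \<mm>"
  using assms sigma_cancel by (auto simp: mem_Fn tuples_def fun_eq_iff)

text \<open>Since \<open>\<sigma> \<odot> g\<close> lies in the image of the syzygy, \<open>g\<close> is modulo \<open>\<mm>\<close> a combination of
  values of \<open>u\<close> and \<open>v\<close>.\<close>

lemma descend:
  assumes u: "u \<in> mod_hom_on R Vec (Fn n) Vec" "u ` Fn n \<subseteq> Fn k"
    and v: "v \<in> mod_hom_on R Vec (Fn n) Vec" "v ` Fn n \<subseteq> Fn k"
    and T: "\<And>w. w \<in> Fn n \<Longrightarrow> T w = x \<odot>\<^bsub>Vec\<^esub> u w \<oplus>\<^bsub>Vec\<^esub> y \<odot>\<^bsub>Vec\<^esub> v w"
      "tuples Reg k max2 \<subseteq> T ` tuples Reg n \<mm>"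
    and \<psi>: "\<psi> \<in> mod_hom_on R Vec (Fn k) Vec" and N: "submodule N R Vec"
    and mem: "\<And>d. d \<in> tuples Reg k \<mm> \<Longrightarrow> \<psi> d \<in> N"
      "\<And>w. w \<in> Fn n \<Longrightarrow> \<psi> (u w) \<in> N" "\<And>w. w \<in> Fn n \<Longrightarrow> \<psi> (v w) \<in> N"
    and g: "g \<in> Fn k"
  shows "\<psi> g \<in> N"
proof -
  have "\<sigma> \<odot>\<^bsub>Vec\<^esub> g \<in> tuples Reg k max2"
    using g \<sigma>(1) Reg.submoduleD(4)[OF submodule_max2 _ \<sigma>(1)] xyR(3)
    by (auto simp: mem_Fn tuples_def m_comm[of \<sigma>])
  then obtain w where w: "w \<in> tuples Reg n \<mm>" "\<sigma> \<odot>\<^bsub>Vec\<^esub> g = T w" using T(2) by blast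
  obtain p q where pq: "p \<in> Fn n" "q \<in> Fn n" "w = x \<odot>\<^bsub>Vec\<^esub> p \<oplus>\<^bsub>Vec\<^esub> y \<odot>\<^bsub>Vec\<^esub> q"
    using tuples_max_decomp[OF w(1)] by blast
  have F: "u p \<in> Fn k" "u q \<in> Fn k" "v p \<in> Fn k" "v q \<in> Fn k" using u(2) v(2) pq by blast+
  define z where "z = quad (u p) (u q) (v p) (v q)"
  have z: "z \<in> Fn k" unfolding z_def by (rule quad_Fn[OF F])
  have eq: "\<sigma> \<odot>\<^bsub>Vec\<^esub> g = \<sigma> \<odot>\<^bsub>Vec\<^esub> z"
    using w(2) T(1)[OF subsetD[OF tuples_max_subset w(1)]] quad_eq[OF u(1) v(1) pq(1,2)]
    unfolding z_def pq(3) by (simp del: seq_module_simps)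
  have gz: "g \<in> carrier Vec" "z \<in> carrier Vec" using g z Vec.submoduleD(1)[OF submodule_Fn] by blast+
  \<comment> \<open>Multiplication by \<open>\<sigma>\<close> kills only tuples over
    \<open>\<mm>\<close>, so \<open>g\<close> agrees with the combination \<open>z\<close> up to
    \<open>\<mm>\<close>.\<close>
  define d where "d = g \<ominus>\<^bsub>Vec\<^esub> z"
  have dF: "d \<in> Fn k" unfolding d_def by (rule Vec.submoduleD(6)[OF submodule_Fn g z])
  have "\<sigma> \<odot>\<^bsub>Vec\<^esub> d = \<sigma> \<odot>\<^bsub>Vec\<^esub> g \<ominus>\<^bsub>Vec\<^esub> \<sigma> \<odot>\<^bsub>Vec\<^esub> z"
    unfolding d_def using gz xyR(3) by (simp add: Vec.M.minus_eq Vec.smult_r_distr Vec.smult_r_minus del: seq_module_simps)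
  also have "\<dots> = \<zero>\<^bsub>Vec\<^esub>" unfolding eq using gz xyR(3) by (simp add: Vec.M.r_neg Vec.M.minus_eq del: seq_module_simps)
  finally have "d \<in> tuples Reg k \<mm>" using sigma_tuples[OF dF] by simp
  then have 1: "\<psi> d \<in> N" by (rule mem(1))
  have "\<psi> z = quad (\<psi> (u p)) (\<psi> (u q)) (\<psi> (v p)) (\<psi> (v q))" unfolding z_def by (rule hom_quad[OF \<psi> F])
  then have 2: "\<psi> z \<in> N" using quad_mem[OF N] mem(2,3) pq by simp
  have "g = z \<oplus>\<^bsub>Vec\<^esub> d" unfolding d_def using Vec.minus_add_self[OF gz] by simp
  then have "\<psi> g = \<psi> z \<oplus>\<^bsub>Vec\<^esub> \<psi> d" using mod_hom_onD(2)[OF \<psi> z dF] by (simp del: seq_module_simps)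
  then show ?thesis using Vec.submoduleD(3)[OF N 2 1] by (simp del: seq_module_simps)
qed

end

section \<open>Descent by two syzygies\<close>

context syzygies
begin

lemma \<pi>_tuples: "\<pi> (Suc k) ` Fn (b (Suc k)) \<subseteq> Fn (b k)"
  unfolding \<pi>_image using L_Suc_subset tuples_max_subset by (rule order_trans)

text \<open>Let \<open>\<phi>\<close> be \<open>f\<close> composed with the cover of
  \<open>L t\<close>, and write the next two differentials as \<open>x u + y v\<close> and
  \<open>x P + y Q\<close>. The maps \<open>\<phi> u P\<close>, \<open>\<phi> v P\<close>,
  \<open>\<phi> u Q\<close>, \<open>\<phi> v Q\<close> kill \<open>L (t + 3)\<close>, so they induce
  homomorphisms from \<open>L (t + 2)\<close> to \<open>L j\<close> and have values in
  \<open>mL j\<close>. Up to \<open>\<mm>\<close>, every vector is a combination of values of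
  \<open>P\<close> and \<open>Q\<close>, and one level below of \<open>u\<close> and
  \<open>v\<close>, which brings the conclusion back to \<open>\<phi>\<close>.\<close>

lemma max_valued_descend:
  assumes E: "edim_two R \<mm> x y \<sigma> \<alpha> \<beta> \<gamma>"
    and mL1: "mL (Suc t) = tuples Reg (b t) max2"
    and mL2: "mL (Suc (Suc t)) = tuples Reg (b (Suc t)) max2"
    and mv: "max_valued (Suc (Suc t)) j"
  shows "max_valued t j"
  unfolding max_valued_def
proof (intro ballI impI)
  interpret E: edim_two R \<mm> x y \<sigma> \<alpha> \<beta> \<gamma> by (rule E)
  fix f assume f: "f \<in> mod_hom_on R Vec (L t) Vec" "f ` L t \<subseteq> L j"
  let ?F = "Fn (b t)" and ?G = "Fn (b (Suc t))" and ?H = "Fn (b (Suc (Suc t)))"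
  let ?N = "mL j"
  note N = submodule_mL[of j]
  have "\<exists>u v. u \<in> mod_hom_on R Vec ?G Vec \<and> v \<in> mod_hom_on R Vec ?G Vec \<and> u ` ?G \<subseteq> ?F \<and> v ` ?G \<subseteq> ?F \<and>
    (\<forall>g\<in>?G. \<pi> (Suc t) g = x \<odot>\<^bsub>Vec\<^esub> u g \<oplus>\<^bsub>Vec\<^esub> y \<odot>\<^bsub>Vec\<^esub> v g)"
    by (rule E.linear_decomp[OF c_Suc_max])
  then obtain u v where uv: "u \<in> mod_hom_on R Vec ?G Vec" "v \<in> mod_hom_on R Vec ?G Vec" "u ` ?G \<subseteq> ?F" "v ` ?G \<subseteq> ?F"
    "\<forall>g\<in>?G. \<pi> (Suc t) g = x \<odot>\<^bsub>Vec\<^esub> u g \<oplus>\<^bsub>Vec\<^esub> y \<odot>\<^bsub>Vec\<^esub> v g"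
    by (elim exE conjE) (rule that)
  have "\<exists>P Q. P \<in> mod_hom_on R Vec ?H Vec \<and> Q \<in> mod_hom_on R Vec ?H Vec \<and> P ` ?H \<subseteq> ?G \<and> Q ` ?H \<subseteq> ?G \<and>
    (\<forall>g\<in>?H. \<pi> (Suc (Suc t)) g = x \<odot>\<^bsub>Vec\<^esub> P g \<oplus>\<^bsub>Vec\<^esub> y \<odot>\<^bsub>Vec\<^esub> Q g)"
    by (rule E.linear_decomp[OF c_Suc_max])
  then obtain P Q where PQ: "P \<in> mod_hom_on R Vec ?H Vec" "Q \<in> mod_hom_on R Vec ?H Vec" "P ` ?H \<subseteq> ?G" "Q ` ?H \<subseteq> ?G"
    "\<forall>g\<in>?H. \<pi> (Suc (Suc t)) g = x \<odot>\<^bsub>Vec\<^esub> P g \<oplus>\<^bsub>Vec\<^esub> y \<odot>\<^bsub>Vec\<^esub> Q g"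
    by (elim exE conjE) (rule that)
  have mem: "u g \<in> ?F" "v g \<in> ?F" if "g \<in> ?G" for g using uv(3,4) that by blast+
  have Mem: "P g \<in> ?G" "Q g \<in> ?G" if "g \<in> ?H" for g using PQ(3,4) that by blast+
  have FR: "w i \<in> carrier R" if "w \<in> Fn n" for w n i using that by (simp add: mem_Fn)
  have FV: "w \<in> carrier Vec" if "w \<in> Fn n" for w n using that by (simp add: mem_Fn)

  \<comment> \<open>The two differentials compose to zero; as the composite is
    \<open>\<sigma>\<close> times \<open>quad\<close>, the latter vanishes modulo
    \<open>\<mm>\<close>.\<close>
  have E1: "E.quad (u (P w)) (u (Q w)) (v (P w)) (v (Q w)) \<in> tuples Reg (b t) \<mm>" if w: "w \<in> ?H" for w
  proof (rule E.sigma_tuples)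
    show "E.quad (u (P w)) (u (Q w)) (v (P w)) (v (Q w)) \<in> ?F"
      by (intro E.quad_Fn mem Mem w)
    have "\<pi> (Suc (Suc t)) w \<in> L (Suc (Suc t))" by (rule \<pi>_mem[OF w])
    then have k: "\<pi> (Suc (Suc t)) w \<in> ?G" "\<pi> (Suc t) (\<pi> (Suc (Suc t)) w) = (\<lambda>_. \<zero>)" by (simp_all add: L_Suc[of "Suc t"])
    have "\<pi> (Suc t) (\<pi> (Suc (Suc t)) w) = \<sigma> \<odot>\<^bsub>Vec\<^esub> E.quad (u (P w)) (u (Q w)) (v (P w)) (v (Q w))"
      using bspec[OF uv(5) k(1)] E.quad_eq[OF uv(1,2) Mem[OF w]] unfolding bspec[OF PQ(5) w] by (simp del: seq_module_simps)
    then show "\<sigma> \<odot>\<^bsub>Vec\<^esub> E.quad (u (P w)) (u (Q w)) (v (P w)) (v (Q w)) = (\<lambda>_. \<zero>)" using k(2) by simp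
  qed
  \<comment> \<open>The same for the second differential, evaluated on an element of its kernel that
    is written as \<open>x p + y q\<close>.\<close>
  have E2: "E.quad (P p) (P q) (Q p) (Q q) \<in> tuples Reg (b (Suc t)) \<mm>"
    if pq: "p \<in> ?H" "q \<in> ?H" "x \<odot>\<^bsub>Vec\<^esub> p \<oplus>\<^bsub>Vec\<^esub> y \<odot>\<^bsub>Vec\<^esub> q \<in> L (Suc (Suc (Suc t)))" for p q
  proof (rule E.sigma_tuples)
    show "E.quad (P p) (P q) (Q p) (Q q) \<in> ?G" by (intro E.quad_Fn Mem pq)
    have k: "x \<odot>\<^bsub>Vec\<^esub> p \<oplus>\<^bsub>Vec\<^esub> y \<odot>\<^bsub>Vec\<^esub> q \<in> ?H"
      "\<pi> (Suc (Suc t)) (x \<odot>\<^bsub>Vec\<^esub> p \<oplus>\<^bsub>Vec\<^esub> y \<odot>\<^bsub>Vec\<^esub> q) = (\<lambda>_. \<zero>)"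
      using pq(3) unfolding L_Suc[of "Suc (Suc t)"] by blast+
    show "\<sigma> \<odot>\<^bsub>Vec\<^esub> E.quad (P p) (P q) (Q p) (Q q) = (\<lambda>_. \<zero>)"
      using bspec[OF PQ(5) k(1)] E.quad_eq[OF PQ(1,2) pq(1,2)] k(2) by (simp del: seq_module_simps)
  qed
  \<comment> \<open>Applying \<open>u\<close> and \<open>v\<close> to \<open>E2\<close>, and taking
    \<open>E1\<close> at \<open>p\<close> and at \<open>q\<close>, gives the four congruences
    required by \<open>perfect_pairing_aux\<close>, coordinate by coordinate.\<close>
  have comm: "v (P p) \<ominus>\<^bsub>Vec\<^esub> u (P q) \<in> tuples Reg (b t) \<mm>" "v (Q p) \<ominus>\<^bsub>Vec\<^esub> u (Q q) \<in> tuples Reg (b t) \<mm>"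
    if pq: "p \<in> ?H" "q \<in> ?H" "x \<odot>\<^bsub>Vec\<^esub> p \<oplus>\<^bsub>Vec\<^esub> y \<odot>\<^bsub>Vec\<^esub> q \<in> L (Suc (Suc (Suc t)))" for p q
  proof -
    note M = mem(1)[OF Mem(1)[OF pq(1)]] mem(1)[OF Mem(1)[OF pq(2)]] mem(2)[OF Mem(1)[OF pq(1)]] mem(2)[OF Mem(1)[OF pq(2)]]
      mem(1)[OF Mem(2)[OF pq(1)]] mem(1)[OF Mem(2)[OF pq(2)]] mem(2)[OF Mem(2)[OF pq(1)]] mem(2)[OF Mem(2)[OF pq(2)]]
    note C = M[THEN FR]
    have co: "z i \<in> \<mm>" if "z \<in> tuples Reg n \<mm>" for z n i
      using that maxD(2) by (cases "i < n") (auto simp: tuples_def)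
    have U: "u (E.quad (P p) (P q) (Q p) (Q q)) \<in> tuples Reg (b t) \<mm>"
      by (rule mod_hom_on_max[OF uv(1,3) E2[OF pq]])
    have V: "v (E.quad (P p) (P q) (Q p) (Q q)) \<in> tuples Reg (b t) \<mm>"
      by (rule mod_hom_on_max[OF uv(2,4) E2[OF pq]])
    note U' = co[OF U[unfolded E.hom_quad[OF uv(1) Mem(1)[OF pq(1)] Mem(1)[OF pq(2)] Mem(2)[OF pq(1)] Mem(2)[OF pq(2)]]],
        unfolded E.quad_coord[OF C(1) C(2) C(5) C(6)]]
    note V' = co[OF V[unfolded E.hom_quad[OF uv(2) Mem(1)[OF pq(1)] Mem(1)[OF pq(2)] Mem(2)[OF pq(1)] Mem(2)[OF pq(2)]]],
        unfolded E.quad_coord[OF C(3) C(4) C(7) C(8)]]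
    note A = co[OF E1[OF pq(1)], unfolded E.quad_coord[OF C(1) C(5) C(3) C(7)]]
    note B = co[OF E1[OF pq(2)], unfolded E.quad_coord[OF C(2) C(6) C(4) C(8)]]
    note D = perfect_pairing_aux[OF E.coeffs E.disc C(1) C(2) C(3) C(4) C(5) C(6) C(7) C(8) A B U' V']
    have F: "v (P p) \<ominus>\<^bsub>Vec\<^esub> u (P q) \<in> ?F" "v (Q p) \<ominus>\<^bsub>Vec\<^esub> u (Q q) \<in> ?F"
      by (rule Vec.submoduleD(6)[OF submodule_Fn], rule M, rule M)+
    show "v (P p) \<ominus>\<^bsub>Vec\<^esub> u (P q) \<in> tuples Reg (b t) \<mm>"
      using F(1) D(1) Reg.seq_minus[of "v (P p)" "u (P q)"] FV[OF M(3)] FV[OF M(2)] minus_regular[OF C(3) C(2)]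
      by (simp add: tuples_def)
    show "v (Q p) \<ominus>\<^bsub>Vec\<^esub> u (Q q) \<in> tuples Reg (b t) \<mm>"
      using F(2) D(2) Reg.seq_minus[of "v (Q p)" "u (Q q)"] FV[OF M(7)] FV[OF M(6)] minus_regular[OF C(7) C(6)]
      by (simp add: tuples_def)
  qed

  define \<phi> where "\<phi> w = f (\<pi> t w)" for w
  have \<phi>: "\<phi> \<in> mod_hom_on R Vec ?F Vec" unfolding \<phi>_def[abs_def]
    by (rule Vec.mod_hom_on_compose[OF \<pi>_hom _ f(1)]) (use \<pi>_image in blast)
  have \<phi>L: "\<phi> w \<in> L j" if "w \<in> ?F" for w using f(2) \<pi>_mem[OF that] unfolding \<phi>_def by blast
  have \<phi>V: "\<phi> w \<in> carrier Vec" if "w \<in> ?F" for w by (rule mod_hom_onD(1)[OF \<phi> that])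
  have \<phi>m: "\<phi> w \<in> ?N" if "w \<in> tuples Reg (b t) \<mm>" for w
    by (rule Vec.mprod_image[OF \<phi> module_Vec submodule_Fn max_carrier L_carrier _ subsetD[OF tuples_max_mprod that]])
      (use \<phi>L in blast)
  \<comment> \<open>\<open>\<phi>\<close> vanishes on the image of the first differential, since the
    cover of \<open>L t\<close> does.\<close>
  have E3: "x \<odot>\<^bsub>Vec\<^esub> \<phi> (u g) \<oplus>\<^bsub>Vec\<^esub> y \<odot>\<^bsub>Vec\<^esub> \<phi> (v g) = (\<lambda>_. \<zero>)" if g: "g \<in> ?G" for g
  proof -
    have "\<pi> (Suc t) g \<in> L (Suc t)" by (rule \<pi>_mem[OF g])
    then have "\<pi> t (\<pi> (Suc t) g) = \<zero>\<^bsub>Vec\<^esub>" by (simp add: L_Suc)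
    then have "\<phi> (\<pi> (Suc t) g) = (\<lambda>_. \<zero>)"
      using Vec.mod_hom_on_zero[OF f(1) module_Vec submodule_L] by (simp add: \<phi>_def)
    then show ?thesis
      using mod_hom_on_comb(1)[OF \<phi> E.xyR(1,2) mem[OF g]] unfolding bspec[OF uv(5) g] by (simp del: seq_module_simps)
  qed

  have main: "\<phi> (u (\<Psi> w)) \<in> ?N \<and> \<phi> (v (\<Psi> w)) \<in> ?N"
    if \<Psi>: "\<Psi> \<in> mod_hom_on R Vec ?H Vec" "\<Psi> ` ?H \<subseteq> ?G"
      and co: "\<And>p q. p \<in> ?H \<Longrightarrow> q \<in> ?H \<Longrightarrow> x \<odot>\<^bsub>Vec\<^esub> p \<oplus>\<^bsub>Vec\<^esub> y \<odot>\<^bsub>Vec\<^esub> q \<in> L (Suc (Suc (Suc t))) \<Longrightarrow>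
        v (\<Psi> p) \<ominus>\<^bsub>Vec\<^esub> u (\<Psi> q) \<in> tuples Reg (b t) \<mm>"
      and w: "w \<in> ?H" for \<Psi> w
  proof -
    have \<Psi>m: "\<Psi> w \<in> ?G" if "w \<in> ?H" for w using \<Psi>(2) that by blast
    \<comment> \<open>By \<open>co\<close> the arguments differ by \<open>\<mm>\<close>, so their
      images under \<open>\<phi>\<close> differ by an element of \<open>mL j\<close>, which
      \<open>x\<close> and \<open>y\<close> annihilate.\<close>
    have swap: "y \<odot>\<^bsub>Vec\<^esub> \<phi> (u (\<Psi> q)) = y \<odot>\<^bsub>Vec\<^esub> \<phi> (v (\<Psi> p))" "x \<odot>\<^bsub>Vec\<^esub> \<phi> (u (\<Psi> q)) = x \<odot>\<^bsub>Vec\<^esub> \<phi> (v (\<Psi> p))"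
      if pq: "p \<in> ?H" "q \<in> ?H" "x \<odot>\<^bsub>Vec\<^esub> p \<oplus>\<^bsub>Vec\<^esub> y \<odot>\<^bsub>Vec\<^esub> q \<in> L (Suc (Suc (Suc t)))" for p q
    proof -
      note Fp = mem(2)[OF \<Psi>m[OF pq(1)]] and Fq = mem(1)[OF \<Psi>m[OF pq(2)]]
      define d where "d = v (\<Psi> p) \<ominus>\<^bsub>Vec\<^esub> u (\<Psi> q)"
      have d: "d \<in> tuples Reg (b t) \<mm>" unfolding d_def by (rule co[OF pq])
      have dF: "d \<in> ?F" using subsetD[OF tuples_max_subset d] .
      have "v (\<Psi> p) = u (\<Psi> q) \<oplus>\<^bsub>Vec\<^esub> d" unfolding d_def using Vec.minus_add_self[OF FV[OF Fp] FV[OF Fq]] by simp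
      then have eq: "\<phi> (v (\<Psi> p)) = \<phi> (u (\<Psi> q)) \<oplus>\<^bsub>Vec\<^esub> \<phi> d" using mod_hom_onD(2)[OF \<phi> Fq dF] by (simp del: seq_module_simps)
      have kill: "r \<odot>\<^bsub>Vec\<^esub> \<phi> d = \<zero>\<^bsub>Vec\<^esub>" if "r \<in> \<mm>" for r using smult_mL[OF that \<phi>m[OF d]] by simp
      show "y \<odot>\<^bsub>Vec\<^esub> \<phi> (u (\<Psi> q)) = y \<odot>\<^bsub>Vec\<^esub> \<phi> (v (\<Psi> p))" "x \<odot>\<^bsub>Vec\<^esub> \<phi> (u (\<Psi> q)) = x \<odot>\<^bsub>Vec\<^esub> \<phi> (v (\<Psi> p))"
        unfolding eq using Vec.smult_r_distr E.xyR \<phi>V[OF Fq] \<phi>V[OF dF] kill[OF E.x] kill[OF E.y]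
        by (simp_all del: seq_module_simps)
    qed
    have induced: "\<phi> (h w) \<in> ?N"
      if h: "h \<in> mod_hom_on R Vec ?H Vec" "h ` ?H \<subseteq> ?F"
        and k: "\<And>p q. p \<in> ?H \<Longrightarrow> q \<in> ?H \<Longrightarrow> x \<odot>\<^bsub>Vec\<^esub> p \<oplus>\<^bsub>Vec\<^esub> y \<odot>\<^bsub>Vec\<^esub> q \<in> L (Suc (Suc (Suc t))) \<Longrightarrow>
          x \<odot>\<^bsub>Vec\<^esub> \<phi> (h p) \<oplus>\<^bsub>Vec\<^esub> y \<odot>\<^bsub>Vec\<^esub> \<phi> (h q) = (\<lambda>_. \<zero>)" for h
    proof -
      have hom: "(\<lambda>w. \<phi> (h w)) \<in> mod_hom_on R Vec ?H Vec" by (rule Vec.mod_hom_on_compose[OF h \<phi>])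
      have "\<phi> (h z) = (\<lambda>_. \<zero>)" if z: "z \<in> L (Suc (Suc (Suc t)))" for z
      proof -
        obtain p q where pq: "p \<in> ?H" "q \<in> ?H" "z = x \<odot>\<^bsub>Vec\<^esub> p \<oplus>\<^bsub>Vec\<^esub> y \<odot>\<^bsub>Vec\<^esub> q"
          using E.tuples_max_decomp[OF subsetD[OF L_Suc_subset z]] by blast
        show ?thesis
          using k[OF pq(1,2)] z mod_hom_on_comb(1)[OF hom E.xyR(1,2) pq(1,2)] unfolding pq(3) by (simp del: seq_module_simps)
      qed
      from hom_L[OF hom this] obtain g where g: "g \<in> mod_hom_on R Vec (L (Suc (Suc t))) Vec"
        "\<forall>w\<in>?H. g (\<pi> (Suc (Suc t)) w) = \<phi> (h w)" by (rule bexE)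
      have "g ` L (Suc (Suc t)) \<subseteq> L j"
      proof (intro image_subsetI)
        fix z assume "z \<in> L (Suc (Suc t))"
        then obtain w' where w': "w' \<in> ?H" "z = \<pi> (Suc (Suc t)) w'" using \<pi>_image[of "Suc (Suc t)"] by blast
        have "h w' \<in> ?F" using h(2) w'(1) by blast
        then show "g z \<in> L j" using bspec[OF g(2) w'(1)] \<phi>L w'(2) by simp
      qed
      then have "g ` L (Suc (Suc t)) \<subseteq> ?N" using mv g(1) unfolding max_valued_def by blast
      then have "g (\<pi> (Suc (Suc t)) w) \<in> ?N" using \<pi>_mem[OF w] by blast
      then show ?thesis using bspec[OF g(2) w] by simp
    qed
    \<comment> \<open>The exchange \<open>swap\<close> replaces \<open>u (\<Psi> q)\<close> by
      \<open>v (\<Psi> p)\<close>, so both terms involve the one vector \<open>\<Psi> p\<close> and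
      \<open>E3\<close> applies.\<close>
    have "\<phi> (u (\<Psi> w)) \<in> ?N"
    proof (rule induced)
      show "(\<lambda>w. u (\<Psi> w)) \<in> mod_hom_on R Vec ?H Vec" by (rule Vec.mod_hom_on_compose[OF \<Psi> uv(1)])
      show "(\<lambda>w. u (\<Psi> w)) ` ?H \<subseteq> ?F" using mem \<Psi>m by blast
      fix p q assume pq: "p \<in> ?H" "q \<in> ?H" "x \<odot>\<^bsub>Vec\<^esub> p \<oplus>\<^bsub>Vec\<^esub> y \<odot>\<^bsub>Vec\<^esub> q \<in> L (Suc (Suc (Suc t)))"
      show "x \<odot>\<^bsub>Vec\<^esub> \<phi> (u (\<Psi> p)) \<oplus>\<^bsub>Vec\<^esub> y \<odot>\<^bsub>Vec\<^esub> \<phi> (u (\<Psi> q)) = (\<lambda>_. \<zero>)"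
        unfolding swap(1)[OF pq] by (rule E3[OF \<Psi>m[OF pq(1)]])
    qed
    moreover have "\<phi> (v (\<Psi> w)) \<in> ?N"
    proof (rule induced)
      show "(\<lambda>w. v (\<Psi> w)) \<in> mod_hom_on R Vec ?H Vec" by (rule Vec.mod_hom_on_compose[OF \<Psi> uv(2)])
      show "(\<lambda>w. v (\<Psi> w)) ` ?H \<subseteq> ?F" using mem \<Psi>m by blast
      fix p q assume pq: "p \<in> ?H" "q \<in> ?H" "x \<odot>\<^bsub>Vec\<^esub> p \<oplus>\<^bsub>Vec\<^esub> y \<odot>\<^bsub>Vec\<^esub> q \<in> L (Suc (Suc (Suc t)))"
      show "x \<odot>\<^bsub>Vec\<^esub> \<phi> (v (\<Psi> p)) \<oplus>\<^bsub>Vec\<^esub> y \<odot>\<^bsub>Vec\<^esub> \<phi> (v (\<Psi> q)) = (\<lambda>_. \<zero>)"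
        unfolding swap(2)[OF pq, symmetric] by (rule E3[OF \<Psi>m[OF pq(2)]])
    qed
    ultimately show ?thesis ..
  qed
  have PN: "\<phi> (u (P w)) \<in> ?N \<and> \<phi> (v (P w)) \<in> ?N" if "w \<in> ?H" for w by (rule main[OF PQ(1,3) comm(1) that])
  have QN: "\<phi> (u (Q w)) \<in> ?N \<and> \<phi> (v (Q w)) \<in> ?N" if "w \<in> ?H" for w by (rule main[OF PQ(2,4) comm(2) that])
  \<comment> \<open>The hypothesis on \<open>mL\<close> enters as the input of
    \<open>descend\<close>: every tuple over \<open>\<mm>\<^sup>2\<close> is the image of a tuple
    over \<open>\<mm>\<close>.\<close>
  have T2: "tuples Reg (b (Suc t)) max2 \<subseteq> \<pi> (Suc (Suc t)) ` tuples Reg (b (Suc (Suc t))) \<mm>"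
    unfolding \<pi>_image_max mL2 by simp
  have T1: "tuples Reg (b t) max2 \<subseteq> \<pi> (Suc t) ` tuples Reg (b (Suc t)) \<mm>"
    unfolding \<pi>_image_max mL1 by simp
  have uN: "\<phi> (u g) \<in> ?N" if g: "g \<in> ?G" for g
  proof (rule E.descend[OF PQ(1,3,2,4) _ T2 Vec.mod_hom_on_compose[OF uv(1,3) \<phi>] N _ _ _ g])
    show "\<pi> (Suc (Suc t)) w = x \<odot>\<^bsub>Vec\<^esub> P w \<oplus>\<^bsub>Vec\<^esub> y \<odot>\<^bsub>Vec\<^esub> Q w" if "w \<in> ?H" for w by (rule bspec[OF PQ(5) that])
    show "\<phi> (u d) \<in> ?N" if "d \<in> tuples Reg (b (Suc t)) \<mm>" for d by (rule \<phi>m[OF mod_hom_on_max[OF uv(1,3) that]])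
  qed (use PN QN in simp_all)
  have vN: "\<phi> (v g) \<in> ?N" if g: "g \<in> ?G" for g
  proof (rule E.descend[OF PQ(1,3,2,4) _ T2 Vec.mod_hom_on_compose[OF uv(2,4) \<phi>] N _ _ _ g])
    show "\<pi> (Suc (Suc t)) w = x \<odot>\<^bsub>Vec\<^esub> P w \<oplus>\<^bsub>Vec\<^esub> y \<odot>\<^bsub>Vec\<^esub> Q w" if "w \<in> ?H" for w by (rule bspec[OF PQ(5) that])
    show "\<phi> (v d) \<in> ?N" if "d \<in> tuples Reg (b (Suc t)) \<mm>" for d by (rule \<phi>m[OF mod_hom_on_max[OF uv(2,4) that]])
  qed (use PN QN in simp_all)
  have \<phi>N: "\<phi> g \<in> ?N" if g: "g \<in> ?F" for g
  proof (rule E.descend[OF uv(1,3,2,4) _ T1 \<phi> N \<phi>m uN vN g])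
    show "\<pi> (Suc t) w = x \<odot>\<^bsub>Vec\<^esub> u w \<oplus>\<^bsub>Vec\<^esub> y \<odot>\<^bsub>Vec\<^esub> v w" if "w \<in> ?G" for w by (rule bspec[OF uv(5) that])
  qed
  show "f ` L t \<subseteq> ?N"
  proof (intro image_subsetI)
    fix z assume "z \<in> L t"
    then obtain w where "w \<in> ?F" "z = \<pi> t w" using \<pi>_image[of t] by blast
    then show "f z \<in> ?N" using \<phi>N[of w] by (simp add: \<phi>_def)
  qed
qed

section \<open>Nonvanishing of syzygies, the simple socle and the two rigidity theorems\<close>

lemma not_max_valued_self:
  assumes "b j > 0"
  shows "\<not> max_valued j j"
proof
  assume mv: "max_valued j j"
  have "(\<lambda>x. x) \<in> mod_hom_on R Vec (L j) Vec"
    using subsetD[OF L_carrier] by (intro mod_hom_onI) (simp_all del: seq_module_simps)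
  from bspec[OF mv[unfolded max_valued_def] this] have "(\<lambda>x. x) ` L j \<subseteq> mL j" by simp
  then have "mL j = L j" using mL_subset by auto
  then have "mlength R Vec (mL j) (L j) = 0" by (rule Vec.mlength_eq_0[OF submodule_mL submodule_L mL_subset, THEN iffD2])
  then show False using mlength_L assms by (simp add: zero_enat_def)
qed

text \<open>A cover with at least one generator is never injective: a nonzero socle element times a
  basis vector is a relation, as the generators have entries in \<open>\<mm>\<close>. So every
  syzygy of a nonzero \<open>L j\<close> is nonzero.\<close>

lemma b_pos_Suc:
  assumes "b j > 0"
  shows "b (Suc j) > 0"
proof (rule ccontr)
  assume "\<not> b (Suc j) > 0"
  then have "L (Suc j) = {\<lambda>_. \<zero>}" using \<pi>_image[of "Suc j"] by (simp add: tuples_zero[symmetric])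
  moreover obtain r where r: "r \<in> carrier R" "r \<noteq> \<zero>" "\<forall>x\<in>\<mm>. x \<otimes> r = \<zero>" using ex_socle by blast
  moreover have "(\<lambda>i. r \<otimes> unit_vec R 0 i) \<in> L (Suc j)"
    using socle_mem_L_Suc[OF assms r(1)] r(3) by blast
  ultimately have "r \<otimes> unit_vec R 0 0 = \<zero>" by (metis singletonD)
  then show False using r by (simp add: unit_vec_def)
qed

lemma b_pos: "b 0 > 0 \<Longrightarrow> b j > 0"
  by (induction j) (auto intro: b_pos_Suc)

lemma b_zero: "b 0 = 0 \<Longrightarrow> L 0 = {\<lambda>_. \<zero>}"
  using \<pi>_image[of 0] by simp

lemma extends_Reg:
  assumes "residue_ext_zero Reg"
  shows "extends R Vec (L (Suc t)) (Fn (b t)) Reg"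
proof (rule extends_of_residue_ext_zero[OF module_Vec module_regular assms submodule_Fn submodule_L])
  show sub: "L (Suc t) \<subseteq> Fn (b t)" using L_Suc_subset tuples_max_subset by (rule order_trans)
  have "mlength R Vec (L (Suc t)) (Fn (b t)) \<le> mlength R Vec {\<lambda>_. \<zero>} (Fn (b t))"
    using sub by (intro Vec.mlength_mono zero_Vec submodule_L submodule_Fn zero_subset) auto
  then show "mlength R Vec (L (Suc t)) (Fn (b t)) \<noteq> \<infinity>"
    using finite_length_sub[OF submodule_Fn subset_refl, of "b t"]
    by (cases "mlength R Vec (L (Suc t)) (Fn (b t))") auto
qed

text \<open>Over a self-injective ring Ext with values in \<open>R\<close> vanishes at every syzygy,
  so both arguments can be replaced by their next syzygies any number of times.\<close>

lemma ext_zero_shift_all: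
  assumes "residue_ext_zero Reg" "ext_zero t 0"
  shows "ext_zero (j + t) j"
  by (induction j) (auto intro: ext_zero_shift extends_Reg assms)

text \<open>For \<open>\<sigma>'\<close>, \<open>\<tau>\<close> in \<open>\<mm>\<^sup>2\<close> with
  \<open>\<sigma>'\<close> nonzero, sending \<open>\<sigma>'\<close> to \<open>\<tau>\<close> is
  well defined, since \<open>\<sigma>'\<close> has annihilator \<open>\<mm>\<close> and
  \<open>\<mm>\<close> kills \<open>\<tau>\<close>. Extending this map to \<open>R\<close> shows
  that \<open>\<tau>\<close> is a multiple of \<open>\<sigma>'\<close>, so
  \<open>\<mm>\<^sup>2\<close> is simple.\<close>

lemma simple_socle_of_residue_ext_zero:
  assumes "residue_ext_zero Reg" "b 0 > 0" "\<And>r. r \<in> carrier R \<Longrightarrow> (\<And>x. x \<in> \<mm> \<Longrightarrow> x \<otimes> r = \<zero>) \<Longrightarrow> r \<in> max2"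
  shows "mlength R Reg {\<zero>} max2 = 1"
proof -
  obtain \<sigma> where \<sigma>: "\<sigma> \<in> carrier R" "\<sigma> \<noteq> \<zero>" "\<forall>x\<in>\<mm>. x \<otimes> \<sigma> = \<zero>" using ex_socle by blast
  have \<sigma>2: "\<sigma> \<in> max2" using assms(3) \<sigma> by blast
  have max2R: "\<And>r. r \<in> max2 \<Longrightarrow> r \<in> carrier R" using max2_subset maxD(1) by blast
  have kill: "x \<otimes> \<tau> = \<zero>" if "x \<in> \<mm>" "\<tau> \<in> max2" for x \<tau> by (rule mult_max2[OF that])
  have ann: "r \<in> \<mm>" if "r \<in> carrier R" "r \<otimes> \<tau> = \<zero>" "\<tau> \<in> carrier R" "\<tau> \<noteq> \<zero>" for r \<tau>
  proof (rule ccontr)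
    assume "r \<notin> \<mm>"
    then have u: "r \<in> Units R" using UnitsI that by blast
    have "\<tau> = inv r \<otimes> (r \<otimes> \<tau>)" using u that(1,3) by (simp flip: m_assoc)
    then show False using u that by simp
  qed
  have cyc: "submodule (Reg.cyclic \<tau>) R Reg" if "\<tau> \<in> carrier R" for \<tau>
    using Reg.submodule_cyclic that by simp
  have mult: "\<exists>r\<in>carrier R. \<tau> = r \<otimes> \<sigma>'" if \<sigma>': "\<sigma>' \<in> max2" "\<sigma>' \<noteq> \<zero>" and \<tau>: "\<tau> \<in> max2" for \<sigma>' \<tau>
  proof -
    have R: "\<sigma>' \<in> carrier R" "\<tau> \<in> carrier R" using max2R \<sigma>' \<tau> by auto
    have h: "(\<lambda>r. r \<otimes> \<sigma>') \<in> mod_hom_on R Reg (carrier R) Reg" "(\<lambda>r. r \<otimes> \<tau>) \<in> mod_hom_on R Reg (carrier R) Reg"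
      using R by (auto intro!: mod_hom_onI simp: l_distr m_assoc)
    have "\<exists>g\<in>mod_hom_on R Reg (Reg.cyclic \<sigma>') Reg. \<forall>r\<in>carrier R. g (r \<otimes> \<sigma>') = r \<otimes> \<tau>"
    proof (rule Reg.mod_hom_factor[OF module_regular module_regular submodule_carrier cyc[OF R(1)] h(1) _ h(2)])
      show "(\<lambda>r. r \<otimes> \<sigma>') ` carrier R = Reg.cyclic \<sigma>'" by (simp add: Reg.cyclic_def)
      fix r assume "r \<in> carrier R" "r \<otimes> \<sigma>' = \<zero>\<^bsub>Reg\<^esub>"
      then show "r \<otimes> \<tau> = \<zero>\<^bsub>Reg\<^esub>" using ann R \<sigma>'(2) kill[OF _ \<tau>] by simp
    qed
    then obtain g where g: "g \<in> mod_hom_on R Reg (Reg.cyclic \<sigma>') Reg" "\<forall>r\<in>carrier R. g (r \<otimes> \<sigma>') = r \<otimes> \<tau>" by (rule bexE)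
    have sub: "Reg.cyclic \<sigma>' \<subseteq> carrier R" using R by (auto simp: Reg.cyclic_def)
    have "mlength R Reg (Reg.cyclic \<sigma>') (carrier R) \<le> mlength R Reg {\<zero>} (carrier R)"
      using sub Reg.submodule_zero Reg.submoduleD(2)[OF cyc[OF R(1)]] by (intro Reg.mlength_mono cyc R submodule_carrier) auto
    then have fin: "mlength R Reg (Reg.cyclic \<sigma>') (carrier R) \<noteq> \<infinity>"
      using finite_length by (cases "mlength R Reg (Reg.cyclic \<sigma>') (carrier R)") auto
    obtain h where h: "h \<in> mod_hom_on R Reg (carrier R) Reg" "\<forall>z\<in>Reg.cyclic \<sigma>'. h z = g z"
      using extendsD[OF extends_of_residue_ext_zero[OF module_regular module_regular assms(1) submodule_carrier cyc[OF R(1)] sub fin] g(1)]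
      by (rule bexE)
    have "\<sigma>' \<in> Reg.cyclic \<sigma>'" using Reg.cyclic_self R by simp
    then have "h \<sigma>' = g (\<one> \<otimes> \<sigma>')" using h(2) R by simp
    also have "\<dots> = \<tau>" using bspec[OF g(2) one_closed] R(2) by simp
    finally have "\<tau> = h (\<sigma>' \<otimes> \<one>)" using R by simp
    also have "\<dots> = \<sigma>' \<otimes> h \<one>" using mod_hom_onD(3)[OF h(1), of \<sigma>' \<one>] R by simp
    also have "\<dots> = h \<one> \<otimes> \<sigma>'" using mod_hom_onD(1)[OF h(1), of \<one>] R by (simp add: m_comm)
    finally show ?thesis using mod_hom_onD(1)[OF h(1), of \<one>] by auto
  qed
  show ?thesis
  proof (rule Reg.mlength_eq_1[OF _ submodule_max2])
    show "submodule {\<zero>} R Reg" using Reg.submodule_zero by simp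
    show "{\<zero>} \<subset> max2" using \<sigma>2 \<sigma>(2) Reg.submoduleD(2)[OF submodule_max2] by auto
    fix V assume V: "submodule V R Reg" "{\<zero>} \<subseteq> V" "V \<subseteq> max2"
    show "V = {\<zero>} \<or> V = max2"
    proof (cases "V \<subseteq> {\<zero>}")
      case False
      then obtain \<sigma>' where \<sigma>': "\<sigma>' \<in> V" "\<sigma>' \<noteq> \<zero>" by blast
      have "\<tau> \<in> V" if \<tau>: "\<tau> \<in> max2" for \<tau>
      proof -
        have m: "\<sigma>' \<in> max2" using V(3) \<sigma>'(1) by blast
        obtain r where "r \<in> carrier R" "\<tau> = r \<otimes> \<sigma>'" using mult[OF m \<sigma>'(2) \<tau>] by (rule bexE)
        then show ?thesis using Reg.submoduleD(4)[OF V(1) _ \<sigma>'(1)] by simp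
      qed
      then show ?thesis using V(3) by blast
    qed (use V(2) in blast)
  qed
qed

theorem gorenstein_rigidity:
  assumes res: "residue_ext_zero Reg" and ext: "ext_zero t 0"
  shows "L 0 = {\<lambda>_. \<zero>}"
proof (rule ccontr)
  assume "L 0 \<noteq> {\<lambda>_. \<zero>}"
  then have b0: "b 0 > 0" using b_zero by auto
  have bp: "b j > 0" for j by (rule b_pos[OF b0])
  have ext_j: "ext_zero (j + t) j" for j by (rule ext_zero_shift_all[OF assms])
  have mv: "max_valued (Suc (j + t)) j" for j by (rule ext_zero_max_valued[OF ext_j])
  have mL: "mL (Suc j) = tuples Reg (b j) max2" for j by (rule mL_Suc_eq[OF mv bp])
  have soc: "\<And>r. r \<in> carrier R \<Longrightarrow> (\<And>x. x \<in> \<mm> \<Longrightarrow> x \<otimes> r = \<zero>) \<Longrightarrow> r \<in> max2"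
    using socle_eq_max2[OF mv bp bp] by blast
  have len: "mlength R Reg {\<zero>} max2 = 1" by (rule simple_socle_of_residue_ext_zero[OF res b0 soc])
  then have s: "s = 1" using mlength_max2 by (simp add: one_enat_def)
  \<comment> \<open>With \<open>s = 1\<close> the lengths \<open>a\<close> are Betti numbers again,
    from index one on. There is no such formula for \<open>a 0\<close>, and so the last part works
    with \<open>L 1\<close> in place of \<open>L 0\<close>.\<close>
  have a: "a (Suc j) = b j" for j using betti_step(4)[OF mL] s by simp
  have rec: "b (Suc j) * e = b (Suc (Suc j)) + b j" for j using betti_step(3)[OF mL] a by simp
  have "b (t + j + 2) * b j \<le> b (t + j + 1) * b (j + 1)" for j
    using ext_zero_betti[OF ext_j[of "Suc j"]] a by (simp add: add.commute add.left_commute)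
  moreover have "b (t + j + 2) * b (j + 1) \<le> b (t + j + 3) * b j" for j
    using max_valued_betti[OF mv[of "Suc j"]] a by (simp add: add.commute add.left_commute eval_nat_numeral)
  ultimately have const: "e = 2" "\<And>j. b j = b 0"
    using betti_constant[where b = b and e = e and k = t] bp rec by blast+
  have "mlength R Reg max2 \<mm> = enat 2" using mlength_max2_max const(1) by simp
  then obtain x y \<sigma> \<alpha> \<beta> \<gamma> where E: "edim_two R \<mm> x y \<sigma> \<alpha> \<beta> \<gamma>" using ex_edim_two[OF len _ soc] by metis
  \<comment> \<open>Descent by two preserves parity, so reaching \<open>L 1\<close> itself needs a
    starting point of odd index; \<open>top\<close> and \<open>low\<close> supply two adjacent
    indices.\<close>
  have down: "max_valued (2 * k + i) 1 \<Longrightarrow> max_valued i 1" for k i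
  proof (induction k)
    case (Suc k)
    have "max_valued (Suc (Suc (2 * k + i))) 1" using Suc.prems by simp
    then show ?case using Suc.IH max_valued_descend[OF E mL mL] by blast
  qed simp
  have top: "max_valued (Suc (Suc t)) 1" using mv[of 1] by simp
  \<comment> \<open>Since all Betti numbers agree, the inequality obtained from
    \<open>ext_zero\<close> is an equality, which yields the index just below
    \<open>top\<close>.\<close>
  have "b (Suc (Suc t)) * a 1 = b (Suc t) * b 1"
    using a[of 0] const(2)[of "Suc (Suc t)"] const(2)[of "Suc t"] const(2)[of 1] by simp
  then have low: "max_valued (Suc t) 1" using ext_zero_betti_eq[of "Suc t" 1] ext_j[of 1] by simp
  have "max_valued 1 1"
  proof (cases "even t")
    case True
    then obtain k where "t = 2 * k" by (elim evenE)
    then show ?thesis using down[of k 1] low by simp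
  next
    case False
    then obtain k where "t = 2 * k + 1" by (elim oddE)
    then show ?thesis using down[of "Suc k" 1] top by simp
  qed
  then show False using not_max_valued_self[OF bp] by blast
qed

text \<open>The first hypothesis gives one bound of \<open>betti_socle_bound\<close> through
  \<open>ext_zero_max_valued\<close>, the other two give the remaining bounds directly, all with
  \<open>m = Suc t\<close>; the third also puts the socle of \<open>R\<close> inside
  \<open>\<mm>\<^sup>2\<close>. Once \<open>s = 1\<close> is known, \<open>R\<close> is
  self-injective and \<open>gorenstein_rigidity\<close> applies to the first hypothesis.\<close>

theorem rigidity:
  assumes "ext_zero t 0" "ext_zero (Suc t) 0" "ext_zero (Suc t) 1"
  shows "L 0 = {\<lambda>_. \<zero>}"
proof (rule ccontr)
  assume ne: "L 0 \<noteq> {\<lambda>_. \<zero>}"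
  then have b0: "b 0 > 0" using b_zero by auto
  have bp: "b j > 0" for j by (rule b_pos[OF b0])
  have mv1: "max_valued (Suc (Suc t)) (Suc 0)" using ext_zero_max_valued[OF assms(3)] by simp
  have mL: "mL (Suc 0) = tuples Reg (b 0) max2" by (rule mL_Suc_eq[OF mv1 bp])
  have soc: "\<And>r. r \<in> carrier R \<Longrightarrow> (\<And>x. x \<in> \<mm> \<Longrightarrow> x \<otimes> r = \<zero>) \<Longrightarrow> r \<in> max2"
    using socle_eq_max2[OF mv1 bp bp] by blast
  have "s \<le> 1"
  proof (rule betti_socle_bound[where b = b and a = a and e = e and m = "Suc t"])
    show "b 0 * e = b 1 + a 0" using betti_step(3)[OF mL] by simp
    show "a 1 = b 0 * s" using betti_step(4)[OF mL] by simp
    show "b (Suc t) * b 0 \<le> b (Suc (Suc t)) * a 0"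
      by (rule max_valued_betti[OF ext_zero_max_valued[OF assms(1)]])
    show "b (Suc (Suc t)) * a 0 \<le> b (Suc t) * b 0" by (rule ext_zero_betti[OF assms(2)])
    show "b (Suc (Suc t)) * a 1 \<le> b (Suc t) * b 1" by (rule ext_zero_betti[OF assms(3)])
  qed (use bp betti_step(1,2) in auto)
  \<comment> \<open>The socle is nonzero and contained in \<open>\<mm>\<^sup>2\<close>.\<close>
  moreover have "s \<noteq> 0"
  proof
    assume "s = 0"
    then have "mlength R Reg {\<zero>} max2 = 0" using mlength_max2 by (simp add: zero_enat_def)
    then have "{\<zero>} = max2"
      using Reg.mlength_eq_0[OF _ submodule_max2, of "{\<zero>}"] Reg.submodule_zero Reg.submoduleD(2)[OF submodule_max2] by simp
    moreover obtain r where "r \<in> carrier R" "r \<noteq> \<zero>" "\<forall>x\<in>\<mm>. x \<otimes> r = \<zero>" using ex_socle by blast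
    ultimately show False using soc[of r] by blast
  qed
  ultimately have "mlength R Reg {\<zero>} max2 = 1" using mlength_max2 by (simp add: one_enat_def)
  then have "residue_ext_zero Reg" by (rule residue_ext_zero_of_simple_socle[OF _ soc])
  then show False using gorenstein_rigidity[OF _ assms(1)] ne by blast
qed

end

section \<open>Free modules\<close>

lemma mod_hom_compose:
  assumes "f \<in> mod_hom R A B" "g \<in> mod_hom R B C"
  shows "(\<lambda>x. g (f x)) \<in> mod_hom R A C"
  using mod_homD[OF assms(1)] mod_homD[OF assms(2)] by (intro mod_homI) simp_all

context module
begin

lemma mod_hom_zero: "f \<in> mod_hom R X M \<Longrightarrow> module R X \<Longrightarrow> f \<zero>\<^bsub>X\<^esub> = \<zero>\<^bsub>M\<^esub>"
  using mod_hom_on_zero[where f = f and X = X and U = "carrier X"] module.carrier_is_submodule[of R X]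
  by (simp add: mod_hom_on_carrier)

lemma mod_hom_minus:
  "f \<in> mod_hom R X M \<Longrightarrow> module R X \<Longrightarrow> x \<in> carrier X \<Longrightarrow> y \<in> carrier X \<Longrightarrow>
    f (x \<ominus>\<^bsub>X\<^esub> y) = f x \<ominus>\<^bsub>M\<^esub> f y"
  using mod_hom_on_minus[where f = f and X = X and U = "carrier X"] module.carrier_is_submodule[of R X]
  by (simp add: mod_hom_on_carrier)

lemma mod_hom_diff:
  "f \<in> mod_hom R X M \<Longrightarrow> g \<in> mod_hom R X M \<Longrightarrow> (\<lambda>x. f x \<ominus>\<^bsub>M\<^esub> g x) \<in> mod_hom R X M"
  using mod_hom_on_diff[where f = f and X = X and U = "carrier X" and g = g] by (simp add: mod_hom_on_carrier)

lemma lin_comb_closed: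
  assumes "A \<subseteq> carrier M" "c \<in> A \<rightarrow> carrier R"
  shows "lin_comb M c A \<in> carrier M"
  unfolding lin_comb_def using assms by (intro M.finsum_closed) auto

lemma lin_comb_mem:
  assumes "submodule U R M" "finite A" "A \<subseteq> U" "c \<in> A \<rightarrow> carrier R"
  shows "lin_comb M c A \<in> U"
  using assms(2-)
proof (induction A)
  case (insert s A)
  note U = submoduleD[OF assms(1)]
  have "lin_comb M c (insert s A) = c s \<odot>\<^bsub>M\<^esub> s \<oplus>\<^bsub>M\<^esub> lin_comb M c A"
    unfolding lin_comb_def using insert U(1) by (intro M.finsum_insert) auto
  then show ?case using insert U(3,4) by auto
qed (use submoduleD(2)[OF assms(1)] in \<open>simp add: lin_comb_def\<close>)

lemma finsum_hom:
  assumes "module R P" "f \<in> mod_hom R P M" "finite A" "h \<in> A \<rightarrow> carrier P"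
  shows "f (finsum P h A) = finsum M (\<lambda>s. f (h s)) A"
  using assms(3,4)
proof (induction A)
  case empty
  interpret P: module R P by fact
  show ?case using mod_hom_zero[OF assms(2,1)] by simp
next
  case (insert s A)
  interpret P: module R P by fact
  note fD = mod_homD[OF assms(2)]
  have "finsum P h (insert s A) = h s \<oplus>\<^bsub>P\<^esub> finsum P h A"
    using insert by (intro P.M.finsum_insert) auto
  moreover have "finsum M (\<lambda>s. f (h s)) (insert s A) = f (h s) \<oplus>\<^bsub>M\<^esub> finsum M (\<lambda>s. f (h s)) A"
    using insert fD(1) by (intro M.finsum_insert) auto
  moreover have "finsum P h A \<in> carrier P" using insert by (intro P.M.finsum_closed) auto
  ultimately show ?case using insert fD(2) by auto
qed

lemma lin_comb_hom:
  assumes "module R P" "f \<in> mod_hom R P M" "finite A" "A \<subseteq> carrier P" "c \<in> A \<rightarrow> carrier R"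
  shows "f (lin_comb P c A) = finsum M (\<lambda>s. c s \<odot>\<^bsub>M\<^esub> f s) A"
proof -
  interpret P: module R P by fact
  have "f (lin_comb P c A) = finsum M (\<lambda>s. f (c s \<odot>\<^bsub>P\<^esub> s)) A"
    unfolding lin_comb_def using assms(4,5) by (intro finsum_hom[OF assms(1-3)]) auto
  also have "\<dots> = finsum M (\<lambda>s. c s \<odot>\<^bsub>M\<^esub> f s) A"
    using assms(4,5) mod_homD[OF assms(2)] by (intro M.finsum_cong') (auto simp: Pi_def subset_iff)
  finally show ?thesis .
qed

lemma finsum_extend:
  assumes "finite E" "D \<subseteq> E" "\<And>s. s \<in> E \<Longrightarrow> y s \<in> carrier M" "\<And>s. s \<in> D \<Longrightarrow> c s \<in> carrier R"
  shows "finsum M (\<lambda>s. c s \<odot>\<^bsub>M\<^esub> y s) D = finsum M (\<lambda>s. (if s \<in> D then c s else \<zero>) \<odot>\<^bsub>M\<^esub> y s) E"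
  using assms by (intro M.add.finprod_mono_neutral_cong_left) auto

lemma lin_comb_extend:
  assumes "finite E" "D \<subseteq> E" "E \<subseteq> carrier M" "c \<in> D \<rightarrow> carrier R"
  shows "lin_comb M c D = lin_comb M (\<lambda>s. if s \<in> D then c s else \<zero>) E"
  unfolding lin_comb_def using assms by (intro finsum_extend) auto

end

lemma lin_independent_unique:
  assumes P: "module R P" "lin_independent R P S" and D: "finite D" "D \<subseteq> S"
    and c: "c \<in> D \<rightarrow> carrier R" "c' \<in> D \<rightarrow> carrier R" and eq: "lin_comb P c D = lin_comb P c' D"
    and s: "s \<in> D"
  shows "c s = c' s"
proof -
  interpret P: module R P by fact
  have S: "S \<subseteq> carrier P" using P(2) by (simp add: lin_independent_def)
  have cl: "lin_comb P c D \<in> carrier P" "lin_comb P c' D \<in> carrier P"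
    using P.lin_comb_closed D S c by blast+
  define e where "e s = c s \<ominus>\<^bsub>R\<^esub> c' s" for s
  have el: "s \<in> carrier P" "c s \<in> carrier R" "c' s \<in> carrier R" "e s \<in> carrier R" if "s \<in> D" for s
    using that c D S unfolding e_def by (auto simp: Pi_def)
  have eR: "e \<in> D \<rightarrow> carrier R" using el(4) by auto
  have "lin_comb P c D = lin_comb P (\<lambda>s. e s \<oplus>\<^bsub>R\<^esub> c' s) D"
    unfolding lin_comb_def
  proof (rule P.M.finsum_cong'[OF refl])
    show "(\<lambda>s. (e s \<oplus>\<^bsub>R\<^esub> c' s) \<odot>\<^bsub>P\<^esub> s) \<in> D \<rightarrow> carrier P" using el by simp
    fix s assume s: "s \<in> D"
    have "e s \<oplus>\<^bsub>R\<^esub> c' s = c s" unfolding e_def using el[OF s] by (simp add: a_minus_def P.R.a_assoc P.R.l_neg)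
    then show "c s \<odot>\<^bsub>P\<^esub> s = (e s \<oplus>\<^bsub>R\<^esub> c' s) \<odot>\<^bsub>P\<^esub> s" by simp
  qed
  also have "\<dots> = finsum P (\<lambda>s. e s \<odot>\<^bsub>P\<^esub> s \<oplus>\<^bsub>P\<^esub> c' s \<odot>\<^bsub>P\<^esub> s) D"
    unfolding lin_comb_def using el by (intro P.M.finsum_cong') (simp_all add: P.smult_l_distr)
  also have "\<dots> = lin_comb P e D \<oplus>\<^bsub>P\<^esub> lin_comb P c' D"
    unfolding lin_comb_def using el by (intro P.M.finsum_addf) simp_all
  finally have "lin_comb P e D \<oplus>\<^bsub>P\<^esub> lin_comb P c' D = lin_comb P c' D" using eq by simp
  then have "(lin_comb P e D \<oplus>\<^bsub>P\<^esub> lin_comb P c' D) \<ominus>\<^bsub>P\<^esub> lin_comb P c' D = \<zero>\<^bsub>P\<^esub>"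
    using cl(2) by (simp add: P.M.minus_eq P.M.r_neg)
  moreover have "lin_comb P e D \<in> carrier P" using P.lin_comb_closed[OF _ eR] D S by blast
  ultimately have "lin_comb P e D = \<zero>\<^bsub>P\<^esub>" using cl(2) by (simp add: P.M.minus_eq P.M.a_assoc P.M.r_neg)
  then have "\<forall>s\<in>D. e s = \<zero>\<^bsub>R\<^esub>" using P(2) D eR unfolding lin_independent_def by simp
  then have "e s = \<zero>\<^bsub>R\<^esub>" using s by simp
  moreover have "e s \<oplus>\<^bsub>R\<^esub> c' s = c s" unfolding e_def using el[OF s] by (simp add: a_minus_def P.R.a_assoc P.R.l_neg)
  ultimately show ?thesis using el[OF s] by simp
qed

text \<open>The value is read off from any representation over the basis. Two representations are
  widened by zero coefficients to the union of their supports, where independence makes the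
  coefficients agree.\<close>

lemma (in module) free_module_extend:
  assumes P: "module R P" "generates R P S" "lin_independent R P S"
    and y: "\<And>s. s \<in> S \<Longrightarrow> y s \<in> carrier M"
  shows "\<exists>h\<in>mod_hom R P M. \<forall>s\<in>S. h s = y s"
proof -
  interpret P: module R P by fact
  have S: "S \<subseteq> carrier P" using P(2) by (simp add: generates_def)
  define rep where "rep x c D \<longleftrightarrow> finite D \<and> D \<subseteq> S \<and> c \<in> D \<rightarrow> carrier R \<and> x = lin_comb P c D" for x c D
  have ex: "\<exists>c D. rep x c D" if "x \<in> carrier P" for x
    using P(2) that unfolding generates_def rep_def by blast
  define val where "val c D = finsum M (\<lambda>s. c s \<odot>\<^bsub>M\<^esub> y s) D" for c D
  have widen: "rep x (\<lambda>s. if s \<in> D then c s else \<zero>) E" "val c D = val (\<lambda>s. if s \<in> D then c s else \<zero>) E"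
    if "rep x c D" "finite E" "D \<subseteq> E" "E \<subseteq> S" for x c D E
  proof -
    have "lin_comb P c D = lin_comb P (\<lambda>s. if s \<in> D then c s else \<zero>) E"
      using that S unfolding rep_def by (intro P.lin_comb_extend) auto
    then show "rep x (\<lambda>s. if s \<in> D then c s else \<zero>) E" using that unfolding rep_def by auto
    show "val c D = val (\<lambda>s. if s \<in> D then c s else \<zero>) E"
      unfolding val_def using that y unfolding rep_def by (intro finsum_extend) auto
  qed
  have same: "val c D = val c' D" if "rep x c D" "rep x c' D" for x c c' D
    unfolding val_def
  proof (rule M.finsum_cong'[OF refl])
    have D: "D \<subseteq> S" "c' \<in> D \<rightarrow> carrier R" using that by (auto simp: rep_def)
    then show "(\<lambda>s. c' s \<odot>\<^bsub>M\<^esub> y s) \<in> D \<rightarrow> carrier M" using y by auto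
    fix s assume "s \<in> D"
    then have "c s = c' s"
      using that unfolding rep_def by (intro lin_independent_unique[OF P(1,3), of D]) auto
    then show "c s \<odot>\<^bsub>M\<^esub> y s = c' s \<odot>\<^bsub>M\<^esub> y s" by simp
  qed
  have unique: "val c D = val c' D'" if "rep x c D" "rep x c' D'" for x c D c' D'
  proof -
    have E: "finite (D \<union> D')" "D \<union> D' \<subseteq> S" using that by (auto simp: rep_def)
    note w = widen[OF that(1) E(1) Un_upper1 E(2)] and w' = widen[OF that(2) E(1) Un_upper2 E(2)]
    show ?thesis using w(2) w'(2) same[OF w(1) w'(1)] by (simp only:)
  qed
  define h where "h x = (let r = (SOME r. rep x (fst r) (snd r)) in val (fst r) (snd r))" for x
  have h: "h x = val c D" if "rep x c D" for x c D
  proof -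
    have "rep x (fst (SOME r. rep x (fst r) (snd r))) (snd (SOME r. rep x (fst r) (snd r)))"
      by (rule someI[of "\<lambda>r. rep x (fst r) (snd r)" "(c, D)"]) (use that in simp)
    then show ?thesis unfolding h_def Let_def by (rule unique[OF _ that])
  qed
  have valM: "val c D \<in> carrier M" if "rep x c D" for x c D
    unfolding val_def using that y unfolding rep_def by (intro M.finsum_closed) auto
  have "h \<in> mod_hom R P M"
  proof (rule mod_homI)
    fix x assume "x \<in> carrier P"
    then obtain c D where "rep x c D" using ex by blast
    then show "h x \<in> carrier M" using h valM by simp
  next
    fix x x' assume "x \<in> carrier P" "x' \<in> carrier P"
    then obtain c D c' D' where r0: "rep x c D" "rep x' c' D'" using ex by blast
    define E where "E = D \<union> D'"
    have E: "finite E" "E \<subseteq> S" "D \<subseteq> E" "D' \<subseteq> E" using r0 by (auto simp: rep_def E_def)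
    define e e' where "e s = (if s \<in> D then c s else \<zero>)" and "e' s = (if s \<in> D' then c' s else \<zero>)" for s
    have r: "rep x e E" "rep x' e' E"
      unfolding e_def[abs_def] e'_def[abs_def] using widen(1)[OF r0(1) E(1,3,2)] widen(1)[OF r0(2) E(1,4,2)] by auto
    then have eR: "\<And>s. s \<in> E \<Longrightarrow> e s \<in> carrier R" "\<And>s. s \<in> E \<Longrightarrow> e' s \<in> carrier R" by (auto simp: rep_def)
    have EP: "\<And>s. s \<in> E \<Longrightarrow> s \<in> carrier P" using E S by auto
    have Ey: "\<And>s. s \<in> E \<Longrightarrow> y s \<in> carrier M" using E y by auto
    have "lin_comb P (\<lambda>s. e s \<oplus> e' s) E = finsum P (\<lambda>s. e s \<odot>\<^bsub>P\<^esub> s \<oplus>\<^bsub>P\<^esub> e' s \<odot>\<^bsub>P\<^esub> s) E"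
      unfolding lin_comb_def using eR EP by (intro P.M.finsum_cong') (auto simp: P.smult_l_distr)
    also have "\<dots> = lin_comb P e E \<oplus>\<^bsub>P\<^esub> lin_comb P e' E"
      unfolding lin_comb_def using eR EP by (intro P.M.finsum_addf) auto
    finally have "rep (x \<oplus>\<^bsub>P\<^esub> x') (\<lambda>s. e s \<oplus> e' s) E" using r eR unfolding rep_def by auto
    then have "h (x \<oplus>\<^bsub>P\<^esub> x') = val (\<lambda>s. e s \<oplus> e' s) E" by (rule h)
    also have "\<dots> = finsum M (\<lambda>s. e s \<odot>\<^bsub>M\<^esub> y s \<oplus>\<^bsub>M\<^esub> e' s \<odot>\<^bsub>M\<^esub> y s) E"
      unfolding val_def using eR Ey by (intro M.finsum_cong') (auto simp: smult_l_distr)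
    also have "\<dots> = val e E \<oplus>\<^bsub>M\<^esub> val e' E"
      unfolding val_def using eR Ey by (intro M.finsum_addf) auto
    finally show "h (x \<oplus>\<^bsub>P\<^esub> x') = h x \<oplus>\<^bsub>M\<^esub> h x'" using h r by simp
  next
    fix t x assume t: "t \<in> carrier R" and "x \<in> carrier P"
    then obtain c D where r: "rep x c D" using ex by blast
    then have D: "finite D" "\<And>s. s \<in> D \<Longrightarrow> c s \<in> carrier R" "\<And>s. s \<in> D \<Longrightarrow> s \<in> carrier P" "\<And>s. s \<in> D \<Longrightarrow> y s \<in> carrier M"
      using S y by (auto simp: rep_def)
    have "t \<odot>\<^bsub>P\<^esub> lin_comb P c D = finsum P (\<lambda>s. t \<odot>\<^bsub>P\<^esub> (c s \<odot>\<^bsub>P\<^esub> s)) D"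
      unfolding lin_comb_def using D t by (intro P.finsum_smult_ldistr) auto
    also have "\<dots> = lin_comb P (\<lambda>s. t \<otimes> c s) D"
      unfolding lin_comb_def using D t by (intro P.M.finsum_cong') (auto simp: P.smult_assoc1)
    finally have "rep (t \<odot>\<^bsub>P\<^esub> x) (\<lambda>s. t \<otimes> c s) D" using r t D unfolding rep_def by auto
    then have "h (t \<odot>\<^bsub>P\<^esub> x) = val (\<lambda>s. t \<otimes> c s) D" by (rule h)
    also have "\<dots> = finsum M (\<lambda>s. t \<odot>\<^bsub>M\<^esub> (c s \<odot>\<^bsub>M\<^esub> y s)) D"
      unfolding val_def using D t by (intro M.finsum_cong') (auto simp: smult_assoc1)
    also have "\<dots> = t \<odot>\<^bsub>M\<^esub> val c D"
      unfolding val_def using D t by (intro finsum_smult_ldistr[symmetric]) auto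
    finally show "h (t \<odot>\<^bsub>P\<^esub> x) = t \<odot>\<^bsub>M\<^esub> h x" using h r by simp
  qed
  moreover have "h s = y s" if s: "s \<in> S" for s
  proof -
    have "lin_comb P (\<lambda>_. \<one>) {s} = s"
      unfolding lin_comb_def using s S by (subst P.M.finsum_insert) auto
    then have "rep s (\<lambda>_. \<one>) {s}" using s by (simp add: rep_def)
    then have "h s = val (\<lambda>_. \<one>) {s}" by (rule h)
    also have "\<dots> = y s" unfolding val_def using y[OF s] by (subst M.finsum_insert) auto
    finally show ?thesis .
  qed
  ultimately show ?thesis by blast
qed

text \<open>Preimages under \<open>p\<close> are chosen for the basis elements only. Asking that the
  image of \<open>g\<close> lie in that of \<open>p\<close>, rather than that \<open>p\<close> be
  onto, is what lifting through a differential requires.\<close>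

lemma free_module_lift:
  assumes P: "free_module R P" and A: "module R A" and B: "module R B"
    and p: "p \<in> mod_hom R A B" and g: "g \<in> mod_hom R P B" "g ` carrier P \<subseteq> p ` carrier A"
  shows "\<exists>h\<in>mod_hom R P A. \<forall>x\<in>carrier P. p (h x) = g x"
proof -
  obtain S where S: "generates R P S" "lin_independent R P S" and mP: "module R P"
    using P unfolding free_module_def by blast
  interpret A: module R A by fact
  interpret B: module R B by fact
  have SP: "S \<subseteq> carrier P" using S(1) by (simp add: generates_def)
  have "\<forall>s. \<exists>a. s \<in> S \<longrightarrow> a \<in> carrier A \<and> p a = g s"
  proof
    fix s
    show "\<exists>a. s \<in> S \<longrightarrow> a \<in> carrier A \<and> p a = g s"
    proof (cases "s \<in> S")
      case True
      then have "g s \<in> p ` carrier A" using g(2) SP by blast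
      then obtain a where "a \<in> carrier A" "g s = p a" by blast
      then show ?thesis by auto
    qed simp
  qed
  then have "\<exists>y. \<forall>s. s \<in> S \<longrightarrow> y s \<in> carrier A \<and> p (y s) = g s" by (rule choice)
  then obtain y where y: "\<forall>s. s \<in> S \<longrightarrow> y s \<in> carrier A \<and> p (y s) = g s" by (rule exE)
  have y': "\<And>s. s \<in> S \<Longrightarrow> y s \<in> carrier A" using y by simp
  from A.free_module_extend[OF mP S y'] obtain h where h: "h \<in> mod_hom R P A" "\<forall>s\<in>S. h s = y s" by (rule bexE)
  have ph: "(\<lambda>x. p (h x)) \<in> mod_hom R P B" by (rule mod_hom_compose[OF h(1) p])
  have "p (h x) = g x" if x: "x \<in> carrier P" for x
  proof -
    obtain D c where D: "finite D" "D \<subseteq> S" "c \<in> D \<rightarrow> carrier R" "x = lin_comb P c D"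
      using S(1) x unfolding generates_def by blast
    have DP: "D \<subseteq> carrier P" using D SP by blast
    have "p (h x) = finsum B (\<lambda>s. c s \<odot>\<^bsub>B\<^esub> p (h s)) D"
      unfolding D(4) by (rule B.lin_comb_hom[OF mP ph D(1) DP D(3)])
    also have "\<dots> = finsum B (\<lambda>s. c s \<odot>\<^bsub>B\<^esub> g s) D"
    proof (rule B.M.finsum_cong'[OF refl])
      show "(\<lambda>s. c s \<odot>\<^bsub>B\<^esub> g s) \<in> D \<rightarrow> carrier B" using D DP mod_homD(1)[OF g(1)] by (auto simp: Pi_def subset_iff)
      fix s assume "s \<in> D"
      then have "p (h s) = g s" using D(2) h(2) y by auto
      then show "c s \<odot>\<^bsub>B\<^esub> p (h s) = c s \<odot>\<^bsub>B\<^esub> g s" by simp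
    qed
    also have "\<dots> = g x" unfolding D(4) by (rule B.lin_comb_hom[OF mP g(1) D(1) DP D(3), symmetric])
    finally show ?thesis .
  qed
  then show ?thesis using h(1) by blast
qed

lemma free_module_iso:
  assumes F: "free_module R F" and G: "module R G" and f: "f \<in> mod_hom R F G" "bij_betw f (carrier F) (carrier G)"
  shows "free_module R G"
proof -
  obtain S where S: "generates R F S" "lin_independent R F S" and mF: "module R F"
    using F unfolding free_module_def by blast
  interpret F: module R F by fact
  interpret G: module R G by fact
  have SF: "S \<subseteq> carrier F" using S(1) by (simp add: generates_def)
  have inj: "inj_on f (carrier F)" and im: "f ` carrier F = carrier G" using f(2) by (auto simp: bij_betw_def)
  have transfer: "f (lin_comb F c D) = lin_comb G c' (f ` D)"
    if D: "finite D" "D \<subseteq> S" "c \<in> D \<rightarrow> carrier R" "\<And>s. s \<in> D \<Longrightarrow> c' (f s) = c s" for c c' D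
  proof -
    have DF: "D \<subseteq> carrier F" using D SF by blast
    have injD: "inj_on f D" using inj DF by (rule inj_on_subset)
    have fD: "\<And>s. s \<in> D \<Longrightarrow> f s \<in> carrier G" using DF mod_homD(1)[OF f(1)] by auto
    have "lin_comb G c' (f ` D) = finsum G (\<lambda>s. c' (f s) \<odot>\<^bsub>G\<^esub> f s) D"
      unfolding lin_comb_def using D fD by (intro G.M.finsum_reindex injD) (auto simp: Pi_def)
    also have "\<dots> = finsum G (\<lambda>s. c s \<odot>\<^bsub>G\<^esub> f s) D"
      using D fD by (intro G.M.finsum_cong') (auto simp: Pi_def)
    also have "\<dots> = f (lin_comb F c D)" by (rule G.lin_comb_hom[OF mF f(1) D(1) DF D(3), symmetric])
    finally show ?thesis by simp
  qed
  have "generates R G (f ` S)"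
    unfolding generates_def
  proof (intro conjI ballI)
    show "f ` S \<subseteq> carrier G" using SF mod_homD(1)[OF f(1)] by auto
    fix z assume "z \<in> carrier G"
    then obtain x where x: "x \<in> carrier F" "z = f x" using im by blast
    obtain D c where D: "finite D" "D \<subseteq> S" "c \<in> D \<rightarrow> carrier R" "x = lin_comb F c D"
      using S(1) x(1) unfolding generates_def by blast
    have injD: "inj_on f D" using inj D SF by (meson inj_on_subset order_trans)
    define c' where "c' t = c (inv_into D f t)" for t
    have c': "c' (f s) = c s" if "s \<in> D" for s unfolding c'_def using inv_into_f_f[OF injD that] by simp
    have "z = lin_comb G c' (f ` D)" unfolding x(2) D(4) by (rule transfer[OF D(1-3) c'])
    moreover have "c' \<in> f ` D \<rightarrow> carrier R" using c' D(3) by auto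
    ultimately show "\<exists>A c. finite A \<and> A \<subseteq> f ` S \<and> c \<in> A \<rightarrow> carrier R \<and> z = lin_comb G c A"
      using D(1,2) by (intro exI[of _ "f ` D"] exI[of _ c']) auto
  qed
  moreover have "lin_independent R G (f ` S)"
    unfolding lin_independent_def
  proof (intro conjI allI impI)
    show "f ` S \<subseteq> carrier G" using SF mod_homD(1)[OF f(1)] by auto
    fix A c assume A: "finite A \<and> A \<subseteq> f ` S \<and> c \<in> A \<rightarrow> carrier R \<and> lin_comb G c A = \<zero>\<^bsub>G\<^esub>"
    then obtain D where D: "D \<subseteq> S" "finite D" "A = f ` D" by (meson finite_subset_image)
    have cD: "(\<lambda>s. c (f s)) \<in> D \<rightarrow> carrier R" using A D by auto
    have "f (lin_comb F (\<lambda>s. c (f s)) D) = f \<zero>\<^bsub>F\<^esub>"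
      using transfer[OF D(2,1) cD] A D(3) G.mod_hom_zero[OF f(1) mF] by simp
    moreover have "lin_comb F (\<lambda>s. c (f s)) D \<in> carrier F" using F.lin_comb_closed[OF _ cD] D SF by auto
    ultimately have "lin_comb F (\<lambda>s. c (f s)) D = \<zero>\<^bsub>F\<^esub>" using inj by (auto dest: inj_onD)
    then have "\<forall>s\<in>D. c (f s) = \<zero>\<^bsub>R\<^esub>" using S(2) D cD unfolding lin_independent_def by blast
    then show "\<forall>x\<in>A. c x = \<zero>\<^bsub>R\<^esub>" using D(3) by blast
  qed
  ultimately show ?thesis using G by (auto simp: free_module_def)
qed

lemma (in module) lincomb_eq_finsum:
  assumes "\<And>l. l < n \<Longrightarrow> v l \<in> carrier R" "\<And>l. l < n \<Longrightarrow> c l \<in> carrier M"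
  shows "lincomb M v c n = finsum M (\<lambda>l. v l \<odot>\<^bsub>M\<^esub> c l) {..<n}"
  using assms
proof (induction n)
  case (Suc n)
  have "finsum M (\<lambda>l. v l \<odot>\<^bsub>M\<^esub> c l) (insert n {..<n}) = v n \<odot>\<^bsub>M\<^esub> c n \<oplus>\<^bsub>M\<^esub> finsum M (\<lambda>l. v l \<odot>\<^bsub>M\<^esub> c l) {..<n}"
    using Suc.prems by (intro M.finsum_insert) auto
  moreover have "finsum M (\<lambda>l. v l \<odot>\<^bsub>M\<^esub> c l) {..<n} \<in> carrier M" using Suc.prems by (intro M.finsum_closed) auto
  ultimately show ?case using Suc by (simp add: lessThan_Suc M.a_comm)
qed simp

lemma lincomb_carrier_update: "lincomb (X\<lparr>carrier := U\<rparr>) v c n = lincomb X v c n"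
  by (induction n) simp_all

lemma (in cring) free_module_Fn:
  assumes "\<one> \<noteq> \<zero>"
  shows "free_module R (Vec\<lparr>carrier := Fn n\<rparr>)"
proof -
  let ?V = "Vec\<lparr>carrier := Fn n\<rparr>" and ?E = "unit_vec R ` {..<n}"
  have V: "module R ?V" by (rule submodule.submodule_is_module[OF submodule_Fn module_Vec])
  interpret V: module R ?V by (rule V)
  \<comment> \<open>Bases are sets, so the unit vectors have to be pairwise distinct; this is where
    \<open>\<one> \<noteq> \<zero>\<close> enters.\<close>
  have inj: "inj_on (unit_vec R) {..<n}"
    using assms by (auto simp: inj_on_def unit_vec_def fun_eq_iff)
  have E: "?E \<subseteq> Fn n" "finite ?E" using unit_vec_Fn by auto
  have sum: "lin_comb ?V c ?E = (\<lambda>l. if l < n then c (unit_vec R l) else \<zero>)"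
    if c: "\<And>u. u \<in> ?E \<Longrightarrow> c u \<in> carrier R" for c
  proof -
    let ?v = "\<lambda>l. if l < n then c (unit_vec R l) else \<zero>"
    have v: "?v \<in> Fn n" using c by (auto simp: mem_Fn)
    have "lin_comb ?V c ?E = finsum ?V (\<lambda>l. c (unit_vec R l) \<odot>\<^bsub>?V\<^esub> unit_vec R l) {..<n}"
      unfolding lin_comb_def
    proof (rule V.M.finsum_reindex[OF _ inj])
      show "(\<lambda>x. c x \<odot>\<^bsub>?V\<^esub> x) \<in> ?E \<rightarrow> carrier ?V"
      proof
        fix u assume "u \<in> ?E"
        then have "u \<in> carrier ?V" using E(1) by auto
        then show "c u \<odot>\<^bsub>?V\<^esub> u \<in> carrier ?V" using c[OF \<open>u \<in> ?E\<close>] V.smult_closed by blast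
      qed
    qed
    also have "\<dots> = lincomb ?V (\<lambda>l. c (unit_vec R l)) (unit_vec R) n"
      by (rule V.lincomb_eq_finsum[symmetric]) (use c E in auto)
    also have "\<dots> = lincomb ?V ?v (unit_vec R) n" by (rule V.lincomb_cong) auto
    also have "\<dots> = ?v" unfolding lincomb_carrier_update by (rule lincomb_unit_vecs[OF v])
    finally show ?thesis .
  qed
  have "generates R ?V ?E"
    unfolding generates_def
  proof (intro conjI ballI)
    show "?E \<subseteq> carrier ?V" using E by simp
    fix v assume "v \<in> carrier ?V"
    then have v: "v \<in> Fn n" by simp
    define c where "c u = v (inv_into {..<n} (unit_vec R) u)" for u
    have cu: "c (unit_vec R l) = v l" if "l < n" for l unfolding c_def using inv_into_f_f[OF inj, of l] that by simp
    have cR: "c u \<in> carrier R" for u using v by (simp add: c_def mem_Fn)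
    have "lin_comb ?V c ?E = v" using sum[of c] cu cR v by (auto simp: mem_Fn fun_eq_iff)
    then show "\<exists>A c. finite A \<and> A \<subseteq> ?E \<and> c \<in> A \<rightarrow> carrier R \<and> v = lin_comb ?V c A"
      using cR E(2) by (intro exI[of _ ?E] exI[of _ c]) auto
  qed
  moreover have "lin_independent R ?V ?E"
    unfolding lin_independent_def
  proof (intro conjI allI impI ballI)
    show "?E \<subseteq> carrier ?V" using E by simp
    fix A c u assume A: "finite A \<and> A \<subseteq> ?E \<and> c \<in> A \<rightarrow> carrier R \<and> lin_comb ?V c A = \<zero>\<^bsub>?V\<^esub>" and u: "u \<in> A"
    let ?c = "\<lambda>u. if u \<in> A then c u else \<zero>"
    have "lin_comb ?V c A = lin_comb ?V ?c ?E" using A E by (intro V.lin_comb_extend) auto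
    also have "\<dots> = (\<lambda>l. if l < n then ?c (unit_vec R l) else \<zero>)" by (rule sum) (use A in auto)
    finally have eq: "(\<lambda>l. if l < n then ?c (unit_vec R l) else \<zero>) = (\<lambda>_. \<zero>)" using A by simp
    obtain l where l: "l < n" "u = unit_vec R l" using A u by auto
    then show "c u = \<zero>" using fun_cong[OF eq, of l] u by simp
  qed
  ultimately show ?thesis using V by (auto simp: free_module_def)
qed

section \<open>Comparison of resolutions\<close>

lemma free_resolutionD:
  assumes "free_resolution R M F d \<epsilon>"
  shows "free_module R (F n)" "module R (F n)" "\<epsilon> \<in> mod_hom R (F 0) M" "d n \<in> mod_hom R (F (Suc n)) (F n)"
    "\<epsilon> ` carrier (F 0) = carrier M"
    "x \<in> d 0 ` carrier (F (Suc 0)) \<longleftrightarrow> x \<in> carrier (F 0) \<and> \<epsilon> x = \<zero>\<^bsub>M\<^esub>"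
    "x \<in> d (Suc n) ` carrier (F (Suc (Suc n))) \<longleftrightarrow> x \<in> carrier (F (Suc n)) \<and> d n x = \<zero>\<^bsub>F n\<^esub>"
proof -
  note r1 = assms[unfolded free_resolution_def]
  note r2 = r1[THEN conjunct2] note r3 = r2[THEN conjunct2] note r4 = r3[THEN conjunct2] note r5 = r4[THEN conjunct2]
  show f: "free_module R (F n)" by (rule r1[THEN conjunct1, THEN spec])
  show "module R (F n)" using f by (simp add: free_module_def)
  show "\<epsilon> \<in> mod_hom R (F 0) M" by (rule r2[THEN conjunct1])
  show "d n \<in> mod_hom R (F (Suc n)) (F n)" by (rule r3[THEN conjunct1, THEN spec])
  show "\<epsilon> ` carrier (F 0) = carrier M" by (rule r4[THEN conjunct1])
  show "x \<in> d 0 ` carrier (F (Suc 0)) \<longleftrightarrow> x \<in> carrier (F 0) \<and> \<epsilon> x = \<zero>\<^bsub>M\<^esub>"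
    unfolding r5[THEN conjunct1, unfolded One_nat_def] by (simp add: a_kernel_def')
  show "x \<in> d (Suc n) ` carrier (F (Suc (Suc n))) \<longleftrightarrow> x \<in> carrier (F (Suc n)) \<and> d n x = \<zero>\<^bsub>F n\<^esub>"
    unfolding r5[THEN conjunct2, THEN spec] by (simp add: a_kernel_def')
qed

lemma chain_map_lift:
  assumes F: "free_module R F" and P: "module R P" "module R P'" and d: "d \<in> mod_hom R P' P"
    and f: "f \<in> mod_hom R F P" "\<And>x. x \<in> carrier F \<Longrightarrow> f x \<in> d ` carrier P'"
  shows "\<exists>h. h \<in> mod_hom R F P' \<and> (\<forall>x\<in>carrier F. d (h x) = f x)"
proof -
  have "f ` carrier F \<subseteq> d ` carrier P'" using f(2) by (rule image_subsetI)
  from free_module_lift[OF F P(2,1) d f(1) this] show ?thesis unfolding Bex_def .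
qed

text \<open>Chain maps \<open>\<alpha>\<close>, \<open>\<beta>\<close> between two resolutions; \<open>\<theta>\<close> is the part of the homotopy showing that
  \<open>\<alpha> \<circ> \<beta> - 1\<close> on the syzygy extends to the ambient free module.\<close>

lemma resolution_comparison:
  assumes F: "free_resolution R M F d \<epsilon>" and P: "free_resolution R M P d' \<epsilon>'" and M: "module R M"
  shows "\<exists>\<alpha> \<beta> \<theta>. \<alpha> \<in> mod_hom R (F i) (P i) \<and> \<beta> \<in> mod_hom R (P i) (F i) \<and> \<theta> \<in> mod_hom R (P i) (P i) \<and>
    (\<forall>z\<in>d i ` carrier (F (Suc i)). \<alpha> z \<in> d' i ` carrier (P (Suc i))) \<and>
    (\<forall>z\<in>d' i ` carrier (P (Suc i)). \<beta> z \<in> d i ` carrier (F (Suc i))) \<and>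
    (\<forall>x\<in>carrier (P i). \<theta> x \<in> d' i ` carrier (P (Suc i))) \<and>
    (\<forall>z\<in>d' i ` carrier (P (Suc i)). \<alpha> (\<beta> z) = z \<oplus>\<^bsub>P i\<^esub> \<theta> z)"
proof (induction i)
  case 0
  note FD = free_resolutionD[OF F] and PD = free_resolutionD[OF P]
  interpret M: module R M by (rule M)
  interpret P0: module R "P 0" by (rule PD(2))
  obtain \<alpha> where \<alpha>: "\<alpha> \<in> mod_hom R (F 0) (P 0)" "\<forall>x\<in>carrier (F 0). \<epsilon>' (\<alpha> x) = \<epsilon> x"
    using chain_map_lift[OF FD(1) M PD(2) PD(3) FD(3)] mod_homD(1)[OF FD(3)] PD(5) by auto
  obtain \<beta> where \<beta>: "\<beta> \<in> mod_hom R (P 0) (F 0)" "\<forall>x\<in>carrier (P 0). \<epsilon> (\<beta> x) = \<epsilon>' x"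
    using chain_map_lift[OF PD(1) M FD(2) FD(3) PD(3)] mod_homD(1)[OF PD(3)] FD(5) by auto
  note \<alpha>D = mod_homD[OF \<alpha>(1)] and \<beta>D = mod_homD[OF \<beta>(1)]
  define \<theta> where "\<theta> x = \<alpha> (\<beta> x) \<ominus>\<^bsub>P 0\<^esub> x" for x
  have id: "(\<lambda>x. x) \<in> mod_hom R (P 0) (P 0)" by (rule mod_homI) simp_all
  have \<alpha>\<beta>: "(\<lambda>x. \<alpha> (\<beta> x)) \<in> mod_hom R (P 0) (P 0)" by (rule mod_hom_compose[OF \<beta>(1) \<alpha>(1)])
  have \<theta>: "\<theta> \<in> mod_hom R (P 0) (P 0)" unfolding \<theta>_def[abs_def] by (rule P0.mod_hom_diff[OF \<alpha>\<beta> id])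
  have 1: "\<alpha> z \<in> d' 0 ` carrier (P (Suc 0))" if "z \<in> d 0 ` carrier (F (Suc 0))" for z
    using that \<alpha>D(1) \<alpha>(2) unfolding FD(6) PD(6) by simp
  have 2: "\<beta> z \<in> d 0 ` carrier (F (Suc 0))" if "z \<in> d' 0 ` carrier (P (Suc 0))" for z
    using that \<beta>D(1) \<beta>(2) unfolding FD(6) PD(6) by simp
  have 3: "\<theta> x \<in> d' 0 ` carrier (P (Suc 0))" if x: "x \<in> carrier (P 0)" for x
  proof -
    have c: "\<alpha> (\<beta> x) \<in> carrier (P 0)" using \<alpha>D(1) \<beta>D(1) x by simp
    have "\<epsilon>' (\<theta> x) = \<epsilon>' (\<alpha> (\<beta> x)) \<ominus>\<^bsub>M\<^esub> \<epsilon>' x" unfolding \<theta>_def by (rule M.mod_hom_minus[OF PD(3) PD(2) c x])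
    also have "\<dots> = \<zero>\<^bsub>M\<^esub>" using \<alpha>(2) \<beta>(2) \<beta>D(1)[OF x] x mod_homD(1)[OF PD(3) x] by (simp add: M.M.minus_eq M.M.r_neg)
    finally show ?thesis unfolding PD(6) using mod_homD(1)[OF \<theta> x] by simp
  qed
  have 4: "\<alpha> (\<beta> z) = z \<oplus>\<^bsub>P 0\<^esub> \<theta> z" if z: "z \<in> d' 0 ` carrier (P (Suc 0))" for z
  proof -
    have "z \<in> carrier (P 0)" using z unfolding PD(6) by simp
    then show ?thesis unfolding \<theta>_def using \<alpha>D(1) \<beta>D(1) P0.minus_add_self by simp
  qed
  show ?case using \<alpha>(1) \<beta>(1) \<theta> 1 2 3 4 by (intro exI[of _ \<alpha>] exI[of _ \<beta>] exI[of _ \<theta>]) simp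
next
  case (Suc i)
  note FD = free_resolutionD[OF F] and PD = free_resolutionD[OF P]
  let ?Z = "d i ` carrier (F (Suc i))" and ?Z' = "d' i ` carrier (P (Suc i))"
  obtain \<alpha> \<beta> \<theta> where \<alpha>: "\<alpha> \<in> mod_hom R (F i) (P i)" and \<beta>: "\<beta> \<in> mod_hom R (P i) (F i)" and \<theta>: "\<theta> \<in> mod_hom R (P i) (P i)"
    and Z: "\<forall>z\<in>?Z. \<alpha> z \<in> ?Z'" "\<forall>z\<in>?Z'. \<beta> z \<in> ?Z" "\<forall>x\<in>carrier (P i). \<theta> x \<in> ?Z'" "\<forall>z\<in>?Z'. \<alpha> (\<beta> z) = z \<oplus>\<^bsub>P i\<^esub> \<theta> z"
    using Suc.IH by (elim exE conjE) (rule that)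
  note \<alpha>D = mod_homD[OF \<alpha>] and \<beta>D = mod_homD[OF \<beta>] and \<theta>D = mod_homD[OF \<theta>]
  note dD = mod_homD[OF FD(4)] and d'D = mod_homD[OF PD(4)]
  interpret Pi: module R "P i" by (rule PD(2))
  interpret PS: module R "P (Suc i)" by (rule PD(2))
  interpret Fi: module R "F i" by (rule FD(2))
  have f1: "\<alpha> (d i x) \<in> ?Z'" if "x \<in> carrier (F (Suc i))" for x using Z(1) that by blast
  have "\<exists>h. h \<in> mod_hom R (F (Suc i)) (P (Suc i)) \<and> (\<forall>x\<in>carrier (F (Suc i)). d' i (h x) = \<alpha> (d i x))"
    by (rule chain_map_lift[OF FD(1) PD(2) PD(2) PD(4) mod_hom_compose[OF FD(4) \<alpha>]]) (rule f1)
  then obtain \<alpha>' where \<alpha>': "\<alpha>' \<in> mod_hom R (F (Suc i)) (P (Suc i))" "\<forall>x\<in>carrier (F (Suc i)). d' i (\<alpha>' x) = \<alpha> (d i x)" by (elim exE conjE) (rule that)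
  have f2: "\<beta> (d' i x) \<in> ?Z" if "x \<in> carrier (P (Suc i))" for x using Z(2) that by blast
  have "\<exists>h. h \<in> mod_hom R (P (Suc i)) (F (Suc i)) \<and> (\<forall>x\<in>carrier (P (Suc i)). d i (h x) = \<beta> (d' i x))"
    by (rule chain_map_lift[OF PD(1) FD(2) FD(2) FD(4) mod_hom_compose[OF PD(4) \<beta>]]) (rule f2)
  then obtain \<beta>' where \<beta>': "\<beta>' \<in> mod_hom R (P (Suc i)) (F (Suc i))" "\<forall>x\<in>carrier (P (Suc i)). d i (\<beta>' x) = \<beta> (d' i x)" by (elim exE conjE) (rule that)
  have f3: "\<theta> x \<in> ?Z'" if "x \<in> carrier (P i)" for x using Z(3) that by blast
  have "\<exists>h. h \<in> mod_hom R (P i) (P (Suc i)) \<and> (\<forall>x\<in>carrier (P i). d' i (h x) = \<theta> x)"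
    by (rule chain_map_lift[OF PD(1) PD(2) PD(2) PD(4) \<theta>]) (rule f3)
  then obtain \<eta> where \<eta>: "\<eta> \<in> mod_hom R (P i) (P (Suc i))" "\<forall>x\<in>carrier (P i). d' i (\<eta> x) = \<theta> x" by (elim exE conjE) (rule that)
  note \<alpha>'D = mod_homD[OF \<alpha>'(1)] and \<beta>'D = mod_homD[OF \<beta>'(1)] and \<eta>D = mod_homD[OF \<eta>(1)]
  \<comment> \<open>Subtracting \<open>\<eta> \<circ> d'\<close> from
    \<open>\<alpha>' \<circ> \<beta>' - 1\<close> gives values in the next syzygy, as
    \<open>d' \<circ> \<eta> = \<theta>\<close>; on that syzygy the subtracted term vanishes, so the
    required identity survives.\<close>
  define \<theta>' where "\<theta>' x = (\<alpha>' (\<beta>' x) \<ominus>\<^bsub>P (Suc i)\<^esub> x) \<ominus>\<^bsub>P (Suc i)\<^esub> \<eta> (d' i x)" for x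
  have id: "(\<lambda>x. x) \<in> mod_hom R (P (Suc i)) (P (Suc i))" by (rule mod_homI) simp_all
  have \<theta>': "\<theta>' \<in> mod_hom R (P (Suc i)) (P (Suc i))" unfolding \<theta>'_def[abs_def]
    by (rule PS.mod_hom_diff[OF PS.mod_hom_diff[OF mod_hom_compose[OF \<beta>'(1) \<alpha>'(1)] id] mod_hom_compose[OF PD(4) \<eta>(1)]])
  have 1: "\<alpha>' z \<in> d' (Suc i) ` carrier (P (Suc (Suc i)))" if "z \<in> d (Suc i) ` carrier (F (Suc (Suc i)))" for z
    using that \<alpha>'D(1) \<alpha>'(2) Pi.mod_hom_zero[OF \<alpha> FD(2)] unfolding FD(7) PD(7) by simp
  have 2: "\<beta>' z \<in> d (Suc i) ` carrier (F (Suc (Suc i)))" if "z \<in> d' (Suc i) ` carrier (P (Suc (Suc i)))" for z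
    using that \<beta>'D(1) \<beta>'(2) Fi.mod_hom_zero[OF \<beta> PD(2)] unfolding FD(7) PD(7) by simp
  have 3: "\<theta>' x \<in> d' (Suc i) ` carrier (P (Suc (Suc i)))" if x: "x \<in> carrier (P (Suc i))" for x
  proof -
    have c: "\<alpha>' (\<beta>' x) \<in> carrier (P (Suc i))" "\<beta>' x \<in> carrier (F (Suc i))" "d' i x \<in> carrier (P i)" "\<eta> (d' i x) \<in> carrier (P (Suc i))"
      using \<alpha>'D(1) \<beta>'D(1) d'D(1) \<eta>D(1) x by simp_all
    have t: "\<theta> (d' i x) \<in> carrier (P i)" using \<theta>D(1) c by simp
    have "d' i (\<theta>' x) = (d' i (\<alpha>' (\<beta>' x)) \<ominus>\<^bsub>P i\<^esub> d' i x) \<ominus>\<^bsub>P i\<^esub> d' i (\<eta> (d' i x))"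
      unfolding \<theta>'_def using Pi.mod_hom_minus[OF PD(4) PD(2)] c x by simp
    also have "d' i (\<alpha>' (\<beta>' x)) = d' i x \<oplus>\<^bsub>P i\<^esub> \<theta> (d' i x)" using \<alpha>'(2) \<beta>'(2) c x Z(4) by simp
    also have "d' i (\<eta> (d' i x)) = \<theta> (d' i x)" using \<eta>(2) c by simp
    also have "((d' i x \<oplus>\<^bsub>P i\<^esub> \<theta> (d' i x)) \<ominus>\<^bsub>P i\<^esub> d' i x) \<ominus>\<^bsub>P i\<^esub> \<theta> (d' i x) = \<zero>\<^bsub>P i\<^esub>"
      using c(3) t by (simp add: Pi.M.minus_eq Pi.M.a_assoc Pi.M.a_comm[of "\<theta> (d' i x)"] Pi.M.r_neg1 Pi.M.r_neg Pi.M.r_neg2 Pi.M.l_neg)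
    finally show ?thesis unfolding PD(7) using mod_homD(1)[OF \<theta>' x] by simp
  qed
  have 4: "\<alpha>' (\<beta>' z) = z \<oplus>\<^bsub>P (Suc i)\<^esub> \<theta>' z" if "z \<in> d' (Suc i) ` carrier (P (Suc (Suc i)))" for z
  proof -
    have z: "z \<in> carrier (P (Suc i))" "d' i z = \<zero>\<^bsub>P i\<^esub>" using that unfolding PD(7) by simp_all
    have c: "\<alpha>' (\<beta>' z) \<in> carrier (P (Suc i))" using \<alpha>'D(1) \<beta>'D(1) z by simp
    have "\<eta> (d' i z) = \<zero>\<^bsub>P (Suc i)\<^esub>" unfolding z(2) by (rule PS.mod_hom_zero[OF \<eta>(1) PD(2)])
    then have "\<theta>' z = \<alpha>' (\<beta>' z) \<ominus>\<^bsub>P (Suc i)\<^esub> z" unfolding \<theta>'_def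
      using PS.minus_add_self[of "\<alpha>' (\<beta>' z) \<ominus>\<^bsub>P (Suc i)\<^esub> z" "\<zero>\<^bsub>P (Suc i)\<^esub>"] c z by simp
    then show ?thesis using PS.minus_add_self[OF c z(1)] by simp
  qed
  show ?case using \<alpha>'(1) \<beta>'(1) \<theta>' 1 2 3 4 by (intro exI[of _ \<alpha>'] exI[of _ \<beta>'] exI[of _ \<theta>']) simp
qed

text \<open>A map \<open>f\<close> on the syzygy of \<open>P\<close> becomes a cocycle
  \<open>f \<circ> \<alpha> \<circ> d\<close> on \<open>F\<close>, hence equals some
  \<open>g \<circ> d\<close>. On the syzygy \<open>g \<circ> \<beta> = f \<circ> \<alpha> \<circ>
  \<beta> = f + f \<circ> \<theta>\<close>, and as \<open>\<theta>\<close> maps all of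
  \<open>P i\<close> into the syzygy, \<open>g \<circ> \<beta> - f \<circ> \<theta>\<close> extends
  \<open>f\<close>.\<close>

lemma extends_of_acyclic:
  assumes F: "free_resolution R M F d \<epsilon>" and P: "free_resolution R M P d' \<epsilon>'" and M: "module R M" and N: "module R N"
    and acyclic: "\<And>f. f \<in> mod_hom R (F (Suc i)) N \<Longrightarrow> (\<And>x. x \<in> carrier (F (Suc (Suc i))) \<Longrightarrow> f (d (Suc i) x) = \<zero>\<^bsub>N\<^esub>) \<Longrightarrow>
      \<exists>g\<in>mod_hom R (F i) N. \<forall>x\<in>carrier (F (Suc i)). f x = g (d i x)"
  shows "extends R (P i) (d' i ` carrier (P (Suc i))) (carrier (P i)) N"
  unfolding extends_def
proof
  interpret N: module R N by (rule N)
  note FD = free_resolutionD[OF F] and PD = free_resolutionD[OF P]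
  let ?Z = "d i ` carrier (F (Suc i))" and ?Z' = "d' i ` carrier (P (Suc i))"
  fix f assume f: "f \<in> mod_hom_on R (P i) ?Z' N"
  note fD = mod_hom_onD[OF f] and dD = mod_homD[OF FD(4)]
  interpret Pi: module R "P i" by (rule PD(2))
  have Z': "submodule ?Z' R (P i)"
    using Pi.submodule_image[where f = "d' i" and X = "P (Suc i)" and U = "carrier (P (Suc i))" and V = "carrier (P (Suc i))"] PD(2,4)
      module.carrier_is_submodule[OF PD(2)] by (simp add: mod_hom_on_carrier)
  obtain \<alpha> \<beta> \<theta> where \<alpha>: "\<alpha> \<in> mod_hom R (F i) (P i)" and \<beta>: "\<beta> \<in> mod_hom R (P i) (F i)" and \<theta>: "\<theta> \<in> mod_hom R (P i) (P i)"
    and Z: "\<forall>z\<in>?Z. \<alpha> z \<in> ?Z'" "\<forall>z\<in>?Z'. \<beta> z \<in> ?Z" "\<forall>x\<in>carrier (P i). \<theta> x \<in> ?Z'" "\<forall>z\<in>?Z'. \<alpha> (\<beta> z) = z \<oplus>\<^bsub>P i\<^esub> \<theta> z"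
    using resolution_comparison[OF F P M, of i] by (elim exE conjE) (rule that)
  have \<alpha>d: "\<alpha> (d i x) \<in> ?Z'" if "x \<in> carrier (F (Suc i))" for x using Z(1) that by blast
  have ad: "(\<lambda>x. \<alpha> (d i x)) \<in> mod_hom R (F (Suc i)) (P i)" by (rule mod_hom_compose[OF FD(4) \<alpha>])
  have cocycle: "(\<lambda>x. f (\<alpha> (d i x))) \<in> mod_hom R (F (Suc i)) N"
    using mod_homD[OF ad] \<alpha>d fD by (intro mod_homI) simp_all
  have "f (\<alpha> (d i (d (Suc i) x))) = \<zero>\<^bsub>N\<^esub>" if x: "x \<in> carrier (F (Suc (Suc i)))" for x
  proof -
    have "d (Suc i) x \<in> d (Suc i) ` carrier (F (Suc (Suc i)))" using x by blast
    then have "d i (d (Suc i) x) = \<zero>\<^bsub>F i\<^esub>" unfolding FD(7) by simp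
    then show ?thesis using Pi.mod_hom_zero[OF \<alpha> FD(2)] N.mod_hom_on_zero[OF f PD(2) Z'] by simp
  qed
  from acyclic[OF cocycle this] obtain g where g: "g \<in> mod_hom R (F i) N" "\<forall>x\<in>carrier (F (Suc i)). f (\<alpha> (d i x)) = g (d i x)"
    by (rule bexE)
  have f\<theta>: "(\<lambda>x. f (\<theta> x)) \<in> mod_hom R (P i) N"
    using mod_homD[OF \<theta>] Z(3) fD by (intro mod_homI) simp_all
  define G where "G x = g (\<beta> x) \<ominus>\<^bsub>N\<^esub> f (\<theta> x)" for x
  have G: "G \<in> mod_hom R (P i) N" unfolding G_def[abs_def] by (rule N.mod_hom_diff[OF mod_hom_compose[OF \<beta> g(1)] f\<theta>])
  have "G z = f z" if z: "z \<in> ?Z'" for z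
  proof -
    have zP: "z \<in> carrier (P i)" using Pi.submoduleD(1)[OF Z' z] .
    have tz: "\<theta> z \<in> ?Z'" using Z(3) zP by blast
    have "\<beta> z \<in> ?Z" using Z(2) z by blast
    then obtain y where y: "y \<in> carrier (F (Suc i))" "\<beta> z = d i y" by blast
    have "g (\<beta> z) = f (\<alpha> (\<beta> z))" using bspec[OF g(2) y(1)] y(2) by simp
    also have "\<dots> = f (z \<oplus>\<^bsub>P i\<^esub> \<theta> z)" by (simp only: bspec[OF Z(4) z])
    also have "\<dots> = f z \<oplus>\<^bsub>N\<^esub> f (\<theta> z)" by (rule fD(2)[OF z tz])
    finally show ?thesis unfolding G_def using fD(1)[OF z] fD(1)[OF tz] by (simp add: N.M.minus_eq N.M.a_assoc N.M.r_neg)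
  qed
  then show "\<exists>g\<in>mod_hom_on R (P i) (carrier (P i)) N. \<forall>x\<in>?Z'. g x = f x"
    using G unfolding mod_hom_on_carrier by blast
qed

text \<open>If the quotient is zero, the coset of a cocycle is the set of coboundaries, and the
  cocycle lies in its own coset. Members of \<open>Hom_module\<close> are extensional functions, so
  \<open>f\<close> is restricted to the carrier beforehand.\<close>

lemma zero_Hom_cohomologyD:
  assumes F: "\<And>n. module R (F n)" and d: "\<And>n. d n \<in> mod_hom R (F (Suc n)) (F n)" and N: "module R N"
    and zero: "zero_module (Hom_cohomology R F d N (Suc i))"
    and f: "f \<in> mod_hom R (F (Suc i)) N" "\<And>x. x \<in> carrier (F (Suc (Suc i))) \<Longrightarrow> f (d (Suc i) x) = \<zero>\<^bsub>N\<^esub>"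
  shows "\<exists>g\<in>mod_hom R (F i) N. \<forall>x\<in>carrier (F (Suc i)). f x = g (d i x)"
proof -
  interpret N: module R N by (rule N)
  interpret FS: module R "F (Suc i)" by (rule F)
  interpret Fi: module R "F i" by (rule F)
  note dD = mod_homD[OF d]
  define f0 where "f0 = restrict f (carrier (F (Suc i)))"
  let ?H = "Hom_module R (F (Suc i)) N"
  have f0: "f0 \<in> carrier ?H"
    using mod_homD[OF f(1)] unfolding f0_def Hom_module_def by (auto intro!: mod_homI)
  have "compose (carrier (F (Suc (Suc i)))) f0 (d (Suc i)) = \<zero>\<^bsub>Hom_module R (F (Suc (Suc i))) N\<^esub>"
    using f(2) dD(1)[of _ "Suc i"] by (auto simp: Hom_module_def compose_def f0_def fun_eq_iff restrict_def)
  then have cocycle: "f0 \<in> Hom_cocycles R F d N (Suc i)" using f0 by (simp add: Hom_cocycles_def)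
  let ?K = "Hom_coboundaries R F d N (Suc i)"
  have z: "(\<lambda>x\<in>carrier (F i). \<zero>\<^bsub>N\<^esub>) \<in> carrier (Hom_module R (F i) N)"
    by (auto simp: Hom_module_def intro!: mod_homI)
  have "compose (carrier (F (Suc i))) (\<lambda>x\<in>carrier (F i). \<zero>\<^bsub>N\<^esub>) (d i) = \<zero>\<^bsub>?H\<^esub>"
    using dD(1)[of _ i] by (auto simp: Hom_module_def compose_def fun_eq_iff restrict_def)
  then have zK: "\<zero>\<^bsub>?H\<^esub> \<in> ?K" using z unfolding Hom_coboundaries_def by (auto intro!: rev_image_eqI[OF z])
  have "\<zero>\<^bsub>?H\<^esub> \<oplus>\<^bsub>?H\<^esub> f0 = f0"
    using mod_homD(1)[OF f(1)] by (auto simp: Hom_module_def f0_def fun_eq_iff restrict_def)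
  then have mem: "f0 \<in> ?K +>\<^bsub>?H\<lparr>carrier := Hom_cocycles R F d N (Suc i)\<rparr>\<^esub> f0"
    using zK unfolding a_r_coset_def' by force
  have "?K +>\<^bsub>?H\<lparr>carrier := Hom_cocycles R F d N (Suc i)\<rparr>\<^esub> f0 \<in> carrier (Hom_cohomology R F d N (Suc i))"
    using cocycle unfolding Hom_cohomology_def quotient_module_def A_RCOSETS_def' by auto
  then have "?K +>\<^bsub>?H\<lparr>carrier := Hom_cocycles R F d N (Suc i)\<rparr>\<^esub> f0 = ?K"
    using zero unfolding zero_module_def by (simp add: Hom_cohomology_def quotient_module_def)
  then have "f0 \<in> ?K" using mem by simp
  then obtain g where g: "g \<in> carrier (Hom_module R (F i) N)" "f0 = compose (carrier (F (Suc i))) g (d i)"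
    unfolding Hom_coboundaries_def by auto
  have "g \<in> mod_hom R (F i) N" using g(1) by (simp add: Hom_module_def)
  moreover have "f x = g (d i x)" if "x \<in> carrier (F (Suc i))" for x
    using fun_cong[OF g(2), of x] that by (simp add: f0_def compose_def)
  ultimately show ?thesis by blast
qed

text \<open>\<open>Ext\<close> refers to a resolution selected by \<open>SOME\<close>; the premise
  \<open>ex\<close> ensures that the selected pair is a resolution. Nothing else is known about it,
  so the vanishing is moved to a given resolution \<open>P\<close>.\<close>

lemma zero_Ext_extends:
  assumes ex: "\<exists>(F :: nat \<Rightarrow> ('a, ('a \<times> 'b) list) module) d \<epsilon>. free_resolution R M F d \<epsilon>"
    and P: "free_resolution R M P d' \<epsilon>'" and M: "module R (M :: ('a, 'b, 'm) module_scheme)" and N: "module R N"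
    and zero: "zero_module (Ext R (Suc i) M N)"
  shows "extends R (P i) (d' i ` carrier (P (Suc i))) (carrier (P i)) N"
proof -
  obtain F d where Fd: "chosen_resolution R M = (F, d)" by (cases "chosen_resolution R M")
  have "case chosen_resolution R M of (F, d) \<Rightarrow> \<exists>\<epsilon>. free_resolution R M F d \<epsilon>"
    unfolding chosen_resolution_def by (rule someI_ex) (use ex in auto)
  then obtain \<epsilon> where F: "free_resolution R M F d \<epsilon>" using Fd by auto
  note FD = free_resolutionD[OF F]
  have "zero_module (Hom_cohomology R F d N (Suc i))" using zero by (simp add: Ext_def Fd)
  note D = zero_Hom_cohomologyD[where F = F and d = d, OF FD(2) FD(4) N this]
  show ?thesis by (rule extends_of_acyclic[OF F P M N D])
qed

section \<open>Transport of resolutions\<close>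

text \<open>Structure carried along an injection into another type: the minimal resolution lives on
  sequences, while \<open>Ext\<close> selects among resolutions on lists.\<close>

definition transport_module :: "('f \<Rightarrow> 'g) \<Rightarrow> ('a, 'f) module \<Rightarrow> ('a, 'g) module" where
  "transport_module \<phi> F = (let \<psi> = inv_into (carrier F) \<phi> in
     \<lparr>carrier = \<phi> ` carrier F, monoid.mult = undefined, monoid.one = undefined,
      ring.zero = \<phi> \<zero>\<^bsub>F\<^esub>, ring.add = (\<lambda>x y. \<phi> (\<psi> x \<oplus>\<^bsub>F\<^esub> \<psi> y)), smult = (\<lambda>r x. \<phi> (r \<odot>\<^bsub>F\<^esub> \<psi> x))\<rparr>)"

lemma transport_module:
  assumes F: "module R F" and inj: "inj_on \<phi> (carrier F)"
  shows "module R (transport_module \<phi> F)" "\<phi> \<in> mod_hom R F (transport_module \<phi> F)"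
    "inv_into (carrier F) \<phi> \<in> mod_hom R (transport_module \<phi> F) F"
    "carrier (transport_module \<phi> F) = \<phi> ` carrier F" "\<zero>\<^bsub>transport_module \<phi> F\<^esub> = \<phi> \<zero>\<^bsub>F\<^esub>"
proof -
  interpret F: module R F by (rule F)
  let ?G = "transport_module \<phi> F" and ?\<psi> = "inv_into (carrier F) \<phi>"
  have \<psi>: "?\<psi> (\<phi> x) = x" if "x \<in> carrier F" for x using inv_into_f_f[OF inj that] .
  show c: "carrier ?G = \<phi> ` carrier F" by (simp add: transport_module_def Let_def)
  show z: "\<zero>\<^bsub>?G\<^esub> = \<phi> \<zero>\<^bsub>F\<^esub>" by (simp add: transport_module_def Let_def)
  have a: "\<phi> x \<oplus>\<^bsub>?G\<^esub> \<phi> y = \<phi> (x \<oplus>\<^bsub>F\<^esub> y)" if "x \<in> carrier F" "y \<in> carrier F" for x y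
    using that \<psi> by (simp add: transport_module_def Let_def)
  have s: "r \<odot>\<^bsub>?G\<^esub> \<phi> x = \<phi> (r \<odot>\<^bsub>F\<^esub> x)" if "x \<in> carrier F" for r x
    using that \<psi> by (simp add: transport_module_def Let_def)
  show "module R ?G"
  proof (rule moduleI)
    show "cring R" by (rule F.R.is_cring)
    show "abelian_group ?G"
    proof (rule abelian_groupI)
      fix x assume "x \<in> carrier ?G"
      then obtain u where u: "u \<in> carrier F" "x = \<phi> u" unfolding c by blast
      then show "\<exists>y\<in>carrier ?G. y \<oplus>\<^bsub>?G\<^esub> x = \<zero>\<^bsub>?G\<^esub>"
        unfolding c z by (intro bexI[of _ "\<phi> (\<ominus>\<^bsub>F\<^esub> u)"]) (auto simp: a F.M.l_neg)
    qed (auto simp: c z a F.M.a_ac)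
  qed (auto simp: c a s F.smult_l_distr F.smult_r_distr F.smult_assoc1)
  show "\<phi> \<in> mod_hom R F ?G" by (rule mod_homI) (auto simp: c a s)
  show "?\<psi> \<in> mod_hom R ?G F" by (rule mod_homI) (auto simp: c a s \<psi>)
qed

lemma transport_resolution:
  assumes P: "free_resolution R M P d \<epsilon>" and inj: "\<And>n. inj_on (\<phi> n) (carrier (P n))"
  shows "free_resolution R M (\<lambda>n. transport_module (\<phi> n) (P n))
    (\<lambda>n x. \<phi> n (d n (inv_into (carrier (P (Suc n))) (\<phi> (Suc n)) x))) (\<lambda>x. \<epsilon> (inv_into (carrier (P 0)) (\<phi> 0) x))"
proof -
  note PD = free_resolutionD[OF P]
  note T = transport_module[OF PD(2) inj]
  let ?\<psi> = "\<lambda>n. inv_into (carrier (P n)) (\<phi> n)"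
  have \<psi>: "?\<psi> n (\<phi> n x) = x" if "x \<in> carrier (P n)" for x n using inv_into_f_f[OF inj that] .
  have dP: "d n x \<in> carrier (P n)" if "x \<in> carrier (P (Suc n))" for n x using mod_homD(1)[OF PD(4) that] .
  have zP: "\<zero>\<^bsub>P n\<^esub> \<in> carrier (P n)" for n
    using module.carrier_is_submodule[OF PD(2)[of n]] module.submoduleD(2)[OF PD(2)[of n]] by blast
  have bij: "bij_betw (\<phi> n) (carrier (P n)) (carrier (transport_module (\<phi> n) (P n)))" for n
    using inj T(4) by (simp add: bij_betw_def)
  have im: "(\<lambda>x. \<phi> n (d n (?\<psi> (Suc n) x))) ` \<phi> (Suc n) ` carrier (P (Suc n)) = \<phi> n ` (d n ` carrier (P (Suc n)))" for n
    using \<psi>[of _ "Suc n"] by (force simp: image_image)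
  have ker0: "d 0 ` carrier (P (Suc 0)) = {x \<in> carrier (P 0). \<epsilon> x = \<zero>\<^bsub>M\<^esub>}" using PD(6) by blast
  have kerS: "d (Suc n) ` carrier (P (Suc (Suc n))) = {x \<in> carrier (P (Suc n)). d n x = \<zero>\<^bsub>P n\<^esub>}" for n using PD(7) by blast
  have eqz: "\<phi> n x = \<phi> n \<zero>\<^bsub>P n\<^esub> \<longleftrightarrow> x = \<zero>\<^bsub>P n\<^esub>" if "x \<in> carrier (P n)" for n x
    using inj_on_eq_iff[OF inj that zP] .
  show ?thesis
    unfolding free_resolution_def a_kernel_def' T(4) T(5)
  proof (intro conjI allI)
    show "free_module R (transport_module (\<phi> n) (P n))" for n by (rule free_module_iso[OF PD(1) T(1,2) bij])
    show "(\<lambda>x. \<epsilon> (?\<psi> 0 x)) \<in> mod_hom R (transport_module (\<phi> 0) (P 0)) M" by (rule mod_hom_compose[OF T(3) PD(3)])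
    show "(\<lambda>x. \<phi> n (d n (?\<psi> (Suc n) x))) \<in> mod_hom R (transport_module (\<phi> (Suc n)) (P (Suc n))) (transport_module (\<phi> n) (P n))" for n
      by (rule mod_hom_compose[OF mod_hom_compose[OF T(3) PD(4)] T(2)])
    show "(\<lambda>x. \<epsilon> (?\<psi> 0 x)) ` \<phi> 0 ` carrier (P 0) = carrier M"
      using PD(5) \<psi>[of _ 0] by (force simp: image_image)
    show "(\<lambda>x. \<phi> 0 (d 0 (?\<psi> (Suc 0) x))) ` \<phi> 1 ` carrier (P 1) = {x \<in> \<phi> 0 ` carrier (P 0). \<epsilon> (?\<psi> 0 x) = \<zero>\<^bsub>M\<^esub>}"
      unfolding One_nat_def im ker0 using \<psi>[of _ 0] by force
    show "(\<lambda>x. \<phi> (Suc n) (d (Suc n) (?\<psi> (Suc (Suc n)) x))) ` \<phi> (Suc (Suc n)) ` carrier (P (Suc (Suc n))) =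
        {x \<in> \<phi> (Suc n) ` carrier (P (Suc n)). \<phi> n (d n (?\<psi> (Suc n) x)) = \<phi> n \<zero>\<^bsub>P n\<^esub>}" for n
      unfolding im kerS using \<psi>[of _ "Suc n"] eqz[OF dP] by force
  qed
qed

section \<open>Artinian local rings\<close>

lemma (in cring) ideal_iff_submodule: "ideal I R \<longleftrightarrow> submodule I R Reg"
proof -
  interpret G: module R Reg by (rule module_regular)
  show ?thesis
  proof
    assume "ideal I R"
    then interpret I: ideal I R .
    show "submodule I R Reg"
      unfolding G.submodule_iff using I.a_subset I.zero_closed I.a_closed I.I_l_closed by auto
  next
    assume I: "submodule I R Reg"
    note D = G.submoduleD[OF I, simplified]
    show "ideal I R"
    proof (rule idealI)
      show "ring R" by (rule ring_axioms)
      show "subgroup I (add_monoid R)"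
      proof
        show "I \<subseteq> carrier (add_monoid R)" using D(1) by auto
        show "x \<otimes>\<^bsub>add_monoid R\<^esub> y \<in> I" if "x \<in> I" "y \<in> I" for x y using D(3) that by simp
        show "\<one>\<^bsub>add_monoid R\<^esub> \<in> I" using D(2) by simp
        show "inv\<^bsub>add_monoid R\<^esub> x \<in> I" if "x \<in> I" for x
          using D(5)[OF that] uminus_regular[OF D(1)[OF that]] by (simp add: a_inv_def)
      qed
      show "x \<otimes> a \<in> I" if "a \<in> I" "x \<in> carrier R" for a x using D(4) that by simp
      show "a \<otimes> x \<in> I" if "a \<in> I" "x \<in> carrier R" for a x
        using D(4)[OF that(2,1)] m_comm[OF D(1)[OF that(1)] that(2)] by simp
    qed
  qed
qed

text \<open>Without a minimal member, choosing a strictly smaller one over and over gives a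
  descending sequence that never becomes stationary.\<close>

lemma artinian_minimal:
  assumes R: "artinian_ring R" and S: "S \<noteq> {}" "\<And>I. I \<in> S \<Longrightarrow> ideal I R"
  shows "\<exists>I\<in>S. \<forall>J\<in>S. J \<subseteq> I \<longrightarrow> J = I"
proof (rule ccontr)
  assume not: "\<not> ?thesis"
  have ex: "\<exists>J. J \<in> S \<and> J \<subset> I" if "I \<in> S" for I using not that by blast
  obtain I0 where I0: "I0 \<in> S" using S(1) by blast
  define f where "f = rec_nat I0 (\<lambda>_ I. SOME J. J \<in> S \<and> J \<subset> I)"
  have fS: "f (Suc n) = (SOME J. J \<in> S \<and> J \<subset> f n)" for n by (simp add: f_def)
  have f: "f n \<in> S" for n
  proof (induction n)
    case (Suc n)
    show ?case unfolding fS using someI_ex[OF ex[OF Suc]] by (rule conjunct1)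
  qed (simp add: f_def I0)
  have sub: "f (Suc n) \<subset> f n" for n
    unfolding fS using someI_ex[OF ex[OF f]] by (rule conjunct2)
  have "(\<forall>n. ideal (f n) R) \<and> (\<forall>n. f (Suc n) \<subseteq> f n)" using f S(2) sub by blast
  then have "\<exists>n. \<forall>k\<ge>n. f k = f n" using R unfolding artinian_ring_def by blast
  then obtain n where n: "\<forall>k\<ge>n. f k = f n" ..
  have "f (Suc n) = f n" by (rule n[rule_format, OF le_SucI[OF order_refl]])
  then show False using sub[of n] by simp
qed

lemma local_cube_zeroI:
  fixes R (structure)
  assumes A: "artinian_ring R" and L: "local_ring R \<mm>"
    and cube: "\<mm> \<cdot>\<^bsub>R\<^esub> \<mm> \<cdot>\<^bsub>R\<^esub> \<mm> = {\<zero>\<^bsub>R\<^esub>}"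
  shows "local_cube_zero R \<mm>"
proof -
  interpret cring R using A by (simp add: artinian_ring_def)
  interpret m: maximalideal \<mm> R using L by (simp add: local_ring_def)
  interpret G: module R Reg by (rule module_regular)
  have mI: "ideal \<mm> R" by (rule m.is_ideal)
  have msub: "submodule \<mm> R Reg" using mI ideal_iff_submodule by simp
  note mD = G.submoduleD[OF msub, simplified]
  have mR: "\<mm> \<subseteq> carrier R" using mD(1) by blast
  have cz: "r \<otimes> (s \<otimes> t) = \<zero>" if "r \<in> \<mm>" "s \<in> \<mm>" "t \<in> \<mm>" for r s t
  proof -
    have "(r \<otimes> s) \<otimes> t \<in> \<mm> \<cdot>\<^bsub>R\<^esub> \<mm> \<cdot>\<^bsub>R\<^esub> \<mm>" by (intro ideal_prod.prod that)
    then show ?thesis using cube mD(1)[OF that(1)] mD(1)[OF that(2)] mD(1)[OF that(3)] by (simp add: m_assoc)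
  qed
  have one: "\<one> \<notin> \<mm>" using m.one_imp_carrier m.I_notcarr by blast
  have U: "r \<in> Units R" if r: "r \<in> carrier R" "r \<notin> \<mm>" for r
  proof -
    have rI: "ideal (PIdl r) R" by (rule cgenideal_ideal[OF r(1)])
    have J: "ideal (\<mm> <+> PIdl r) R" by (rule add_ideals[OF mI rI])
    have Js: "submodule (PIdl r) R Reg" using rI ideal_iff_submodule by simp
    have "\<mm> <+>\<^bsub>Reg\<^esub> PIdl r = \<mm> <+> PIdl r" by (simp add: set_add_def')
    then have up: "\<mm> \<subseteq> \<mm> <+> PIdl r" "PIdl r \<subseteq> \<mm> <+> PIdl r" using G.set_add_upper[OF msub Js] by simp_all
    have "r \<in> PIdl r" by (rule cgenideal_self[OF r(1)])
    then have "\<mm> <+> PIdl r \<noteq> \<mm>" using up r(2) by blast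
    then have "\<mm> <+> PIdl r = carrier R"
      using m.I_maximal[OF J up(1)] additive_subgroup.a_subset[OF ideal.axioms(1)[OF J]] by blast
    then have "\<one> \<in> \<mm> <+> PIdl r" by simp
    then obtain a s where as: "a \<in> \<mm>" "s \<in> carrier R" "\<one> = a \<oplus> s \<otimes> r"
      by (auto simp: set_add_def' cgenideal_def)
    have aR: "a \<in> carrier R" using mD(1) as(1) .
    have "s \<otimes> r = (a \<oplus> s \<otimes> r) \<ominus> a" using aR as(2) r(1) by algebra
    then have sr: "s \<otimes> r = \<one> \<ominus> a" unfolding as(3)[symmetric] .
    \<comment> \<open>The geometric series: \<open>\<one> + a + a\<^sup>2\<close> inverts
      \<open>\<one> - a\<close> because \<open>a\<^sup>3 = 0\<close>.\<close>
    have "(s \<otimes> (\<one> \<oplus> a \<oplus> a \<otimes> a)) \<otimes> r = (s \<otimes> r) \<otimes> (\<one> \<oplus> a \<oplus> a \<otimes> a)" using aR as(2) r(1) by algebra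
    also have "\<dots> = \<one> \<ominus> a \<otimes> (a \<otimes> a)" unfolding sr using aR by algebra
    also have "\<dots> = \<one>" using cz[OF as(1,1,1)] by (simp add: a_minus_def)
    finally have 1: "(s \<otimes> (\<one> \<oplus> a \<oplus> a \<otimes> a)) \<otimes> r = \<one>" .
    moreover have c: "s \<otimes> (\<one> \<oplus> a \<oplus> a \<otimes> a) \<in> carrier R" using aR as(2) by simp
    ultimately have "r \<otimes> (s \<otimes> (\<one> \<oplus> a \<oplus> a \<otimes> a)) = \<one>" using m_comm[OF r(1) c] by simp
    then show ?thesis using 1 c r(1) unfolding Units_def by blast
  qed
  have Rsub: "submodule (carrier R) R Reg" using G.carrier_is_submodule by simp
  \<comment> \<open>Finite length comes from an ideal \<open>I\<close> minimal among those with
    \<open>R/I\<close> of finite length: if \<open>I\<close> were nonzero, it would contain an ideal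
    \<open>W\<close> with \<open>I/W\<close> simple, a smaller member of \<open>S\<close>.\<close>
  define S where "S = {I. submodule I R Reg \<and> mlength R Reg I (carrier R) \<noteq> \<infinity>}"
  have "mlength R Reg (carrier R) (carrier R) = 0" using G.mlength_eq_0[OF Rsub Rsub] by simp
  then have "carrier R \<in> S" using Rsub by (simp add: S_def zero_enat_def)
  then have "S \<noteq> {}" by blast
  then obtain I where I: "I \<in> S" "\<forall>J\<in>S. J \<subseteq> I \<longrightarrow> J = I"
    using artinian_minimal[OF A, of S] ideal_iff_submodule unfolding S_def by blast
  have Is: "submodule I R Reg" using I(1) by (simp add: S_def)
  note ID = G.submoduleD[OF Is, simplified]
  have IR: "I \<subseteq> carrier R" using ID(1) by blast
  let ?mI = "mprod R Reg \<mm> I"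
  have mIs: "submodule ?mI R Reg" using G.submodule_mprod[of \<mm> I] mR IR by simp
  have mII: "?mI \<subseteq> I" by (rule G.mprod_subset[OF mR Is])
  have "I = {\<zero>}"
  proof (rule ccontr)
    assume ne: "I \<noteq> {\<zero>}"
    \<comment> \<open>If \<open>\<mm> I = I\<close>, then \<open>I = \<mm>\<^sup>3 I = 0\<close>;
      the inclusions \<open>a1\<close> and \<open>a2\<close> carry this out one factor at a
      time.\<close>
    have "?mI \<noteq> I"
    proof
      assume eq: "?mI = I"
      have a1: "?mI \<subseteq> {z \<in> carrier R. \<forall>s\<in>\<mm>. \<forall>t\<in>\<mm>. s \<otimes> (t \<otimes> z) = \<zero>}"
      proof (rule G.mprod_least)
        show "submodule {z \<in> carrier R. \<forall>s\<in>\<mm>. \<forall>t\<in>\<mm>. s \<otimes> (t \<otimes> z) = \<zero>} R Reg"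
          unfolding G.submodule_iff using mD(1) by (auto simp: r_distr m_lcomm)
        fix r u assume ru: "r \<in> \<mm>" "u \<in> I"
        have "s \<otimes> (t \<otimes> (r \<otimes> u)) = \<zero>" if "s \<in> \<mm>" "t \<in> \<mm>" for s t
        proof -
          have "s \<otimes> (t \<otimes> (r \<otimes> u)) = (s \<otimes> (t \<otimes> r)) \<otimes> u"
            using mD(1)[OF that(1)] mD(1)[OF that(2)] mD(1)[OF ru(1)] ID(1)[OF ru(2)] by (simp add: m_assoc)
          then show ?thesis using cz[OF that ru(1)] ID(1)[OF ru(2)] by simp
        qed
        then show "r \<odot>\<^bsub>Reg\<^esub> u \<in> {z \<in> carrier R. \<forall>s\<in>\<mm>. \<forall>t\<in>\<mm>. s \<otimes> (t \<otimes> z) = \<zero>}"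
          using mD(1)[OF ru(1)] ID(1)[OF ru(2)] by simp
      qed
      have a2: "?mI \<subseteq> {z \<in> carrier R. \<forall>s\<in>\<mm>. s \<otimes> z = \<zero>}"
      proof (rule G.mprod_least)
        show "submodule {z \<in> carrier R. \<forall>s\<in>\<mm>. s \<otimes> z = \<zero>} R Reg"
          unfolding G.submodule_iff using mD(1) by (auto simp: r_distr m_lcomm)
        fix r u assume ru: "r \<in> \<mm>" "u \<in> I"
        then show "r \<odot>\<^bsub>Reg\<^esub> u \<in> {z \<in> carrier R. \<forall>s\<in>\<mm>. s \<otimes> z = \<zero>}"
          using a1 eq mD(1)[OF ru(1)] ID(1)[OF ru(2)] by auto
      qed
      have "?mI \<subseteq> {\<zero>}"
      proof (rule G.mprod_least)
        show "submodule {\<zero>} R Reg" using G.submodule_zero by simp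
        fix r u assume ru: "r \<in> \<mm>" "u \<in> I"
        then show "r \<odot>\<^bsub>Reg\<^esub> u \<in> {\<zero>}" using a2 eq by auto
      qed
      then show False using eq ne ID(2) by blast
    qed
    then obtain x where x: "x \<in> I" "x \<notin> ?mI" using mII by blast
    define \<A> where "\<A> = {W. submodule W R Reg \<and> ?mI \<subseteq> W \<and> W \<subseteq> I \<and> x \<notin> W}"
    \<comment> \<open>As \<open>I\<close> is not known to be finitely generated, Zorn's lemma is
      used to find a submodule of \<open>I\<close> that contains \<open>\<mm> I\<close> and is
      maximal without \<open>x\<close>; the quotient of \<open>I\<close> by it will be
      simple.\<close>
    have "\<exists>W\<in>\<A>. \<forall>V\<in>\<A>. W \<subseteq> V \<longrightarrow> V = W"
    proof (rule subset_Zorn_nonempty)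
      have "?mI \<in> \<A>" using mIs mII x(2) by (simp add: \<A>_def)
      then show "\<A> \<noteq> {}" by blast
      fix \<C> assume C: "\<C> \<noteq> {}" "subset.chain \<A> \<C>"
      have CA: "\<C> \<subseteq> \<A>" and tot: "\<And>V W. V \<in> \<C> \<Longrightarrow> W \<in> \<C> \<Longrightarrow> V \<subseteq> W \<or> W \<subseteq> V"
        using C(2) by (auto simp: subset.chain_def)
      have CD: "submodule W R Reg" "?mI \<subseteq> W" "W \<subseteq> I" "x \<notin> W" if "W \<in> \<C>" for W
        using CA that by (auto simp: \<A>_def)
      have "submodule (\<Union>\<C>) R Reg"
        unfolding G.submodule_iff
      proof (intro conjI ballI)
        show "\<Union>\<C> \<subseteq> carrier Reg" using CD(3) IR by auto
        obtain W where "W \<in> \<C>" using C(1) by blast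
        then show "\<zero>\<^bsub>Reg\<^esub> \<in> \<Union>\<C>" using G.submoduleD(2)[OF CD(1)] by blast
      next
        fix y z assume "y \<in> \<Union>\<C>" "z \<in> \<Union>\<C>"
        then obtain V W where VW: "V \<in> \<C>" "W \<in> \<C>" "y \<in> V" "z \<in> W" by blast
        show "y \<oplus>\<^bsub>Reg\<^esub> z \<in> \<Union>\<C>"
        proof (cases "V \<subseteq> W")
          case True
          then have "y \<oplus>\<^bsub>Reg\<^esub> z \<in> W" using VW G.submoduleD(3)[OF CD(1)[OF VW(2)]] by blast
          then show ?thesis using VW by blast
        next
          case False
          then have "z \<in> V" using tot VW by blast
          then have "y \<oplus>\<^bsub>Reg\<^esub> z \<in> V" using VW G.submoduleD(3)[OF CD(1)[OF VW(1)]] by blast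
          then show ?thesis using VW by blast
        qed
      next
        fix r y assume r: "r \<in> carrier R" and "y \<in> \<Union>\<C>"
        then obtain W where W: "W \<in> \<C>" "y \<in> W" by blast
        then have "r \<odot>\<^bsub>Reg\<^esub> y \<in> W" using r G.submoduleD(4)[OF CD(1)[OF W(1)]] by blast
        then show "r \<odot>\<^bsub>Reg\<^esub> y \<in> \<Union>\<C>" using W by blast
      qed
      moreover have "?mI \<subseteq> \<Union>\<C>" "\<Union>\<C> \<subseteq> I" "x \<notin> \<Union>\<C>" using C(1) CD(2,3,4) by blast+
      ultimately show "\<Union>\<C> \<in> \<A>" by (simp add: \<A>_def)
    qed
    then obtain W where W: "W \<in> \<A>" "\<forall>V\<in>\<A>. W \<subseteq> V \<longrightarrow> V = W" by blast
    have Ws: "submodule W R Reg" "?mI \<subseteq> W" "W \<subseteq> I" "x \<notin> W" using W(1) by (auto simp: \<A>_def)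
    note WD = G.submoduleD[OF Ws(1), simplified]
    have "mlength R Reg W I = 1"
    proof (rule G.mlength_eq_1[OF Ws(1) Is])
      show "W \<subset> I" using Ws x by blast
      fix V assume V: "submodule V R Reg" "W \<subseteq> V" "V \<subseteq> I"
      note VD = G.submoduleD[OF V(1), simplified]
      show "V = W \<or> V = I"
      proof (cases "x \<in> V")
        case False
        then have "V \<in> \<A>" using V Ws(2) by (auto simp: \<A>_def)
        then show ?thesis using W(2) V(2) by blast
      next
        case True
        have "y \<in> V" if y: "y \<in> I" for y
        proof (cases "y \<in> W")
          case False
          have yR: "y \<in> carrier R" using ID(1) y .
          have cy: "submodule (G.cyclic y) R Reg" using G.submodule_cyclic yR by simp
          let ?Y = "W <+>\<^bsub>Reg\<^esub> G.cyclic y"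
          have Y: "submodule ?Y R Reg" "W \<subseteq> ?Y" "G.cyclic y \<subseteq> ?Y"
            using G.submodule_set_add[OF Ws(1) cy] G.set_add_upper[OF Ws(1) cy] by blast+
          have "G.cyclic y \<subseteq> I" using ID(4)[OF _ y] by (auto simp: G.cyclic_def)
          then have YI: "?Y \<subseteq> I" by (rule G.set_add_least[OF Is Ws(3)])
          have "y \<in> ?Y" using Y(3) G.cyclic_self[of y] yR by auto
          then have "?Y \<noteq> W" using False by blast
          then have "?Y \<notin> \<A>" using W(2) Y(2) by blast
          then have "x \<in> ?Y" using Y YI Ws(2) by (auto simp: \<A>_def)
          then obtain w r where wr: "w \<in> W" "r \<in> carrier R" "x = w \<oplus> r \<otimes> y"
            by (auto simp: G.mem_set_add G.cyclic_def)
          have "r \<notin> \<mm>"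
          proof
            assume "r \<in> \<mm>"
            then have "r \<otimes> y \<in> W" using G.mprod_mem[of r \<mm> y I] y Ws(2) by auto
            then show False using WD(3)[OF wr(1)] wr(3) Ws(4) by simp
          qed
          then have u: "r \<in> Units R" using U wr by blast
          have "w \<in> V" using wr V by blast
          then have "r \<otimes> y \<in> V"
            using G.submodule_add_cancel[OF V(1), of w "r \<otimes> y"] wr True yR by simp
          then have "inv r \<otimes> (r \<otimes> y) \<in> V" using VD(4) u by simp
          then show ?thesis using u yR m_assoc[of "inv r" r y] by (simp add: Units_closed)
        qed (use V in blast)
        then show ?thesis using V(3) by blast
      qed
    qed
    then have "mlength R Reg W (carrier R) = 1 + mlength R Reg I (carrier R)"
      using G.mlength_additive[OF Ws(1) Is Rsub Ws(3) IR] by simp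
    then have "W \<in> S" using I(1) Ws(1) by (cases "mlength R Reg I (carrier R)") (auto simp: S_def one_enat_def)
    then show False using I(2) Ws x by blast
  qed
  then have "mlength R Reg {\<zero>} (carrier R) \<noteq> \<infinity>" using I(1) by (simp add: S_def)
  then show ?thesis
    by (intro local_cube_zero.intro local_cube_zero_axioms.intro is_cring msub one U cz)
qed

section \<open>Finite injective dimension\<close>

context local_cube_zero
begin

text \<open>The inclusion of \<open>\<mm>\<close> into \<open>R\<close> is among the test maps, and
  the required element is the value at \<open>\<one>\<close> of the extension.\<close>

lemma injective_imp_residue_ext_zero:
  assumes "injective_module R E"
  shows "residue_ext_zero E"
  unfolding residue_ext_zero_def
proof
  fix g assume g: "g \<in> mod_hom_on R Reg \<mm> E"
  have E: "module R E" using assms by (simp add: injective_module_def)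
  let ?A = "Reg\<lparr>carrier := \<mm>\<rparr>"
  have A: "module R ?A" by (rule submodule.submodule_is_module[OF submodule_max module_regular])
  have f: "(\<lambda>x. x) \<in> mod_hom R ?A Reg" using maxD(1) by (intro mod_homI) simp_all
  note inj = assms[unfolded injective_module_def, THEN conjunct2, rule_format, of ?A Reg "\<lambda>x. x" g]
  have "\<exists>h\<in>mod_hom R Reg E. \<forall>x\<in>carrier ?A. h x = g x"
    by (rule inj) (use A module_regular f g in \<open>simp add: inj_on_def\<close>)
  then obtain h where h: "h \<in> mod_hom R Reg E" "\<forall>x\<in>carrier ?A. h x = g x" by (rule bexE)
  have "g r = r \<odot>\<^bsub>E\<^esub> h \<one>" if r: "r \<in> \<mm>" for r
  proof -
    have "g r = h (r \<otimes> \<one>)" using h(2) r maxD(1) by simp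
    also have "\<dots> = r \<odot>\<^bsub>E\<^esub> h \<one>" using mod_homD(3)[OF h(1), of r \<one>] maxD(1)[OF r] by simp
    finally show ?thesis .
  qed
  moreover have "h \<one> \<in> carrier E" using mod_homD(1)[OF h(1), of \<one>] by simp
  ultimately show "\<exists>w\<in>carrier E. \<forall>r\<in>\<mm>. g r = r \<odot>\<^bsub>E\<^esub> w" by blast
qed

text \<open>With \<open>k = R/\<mm>\<close> and a socle element \<open>s\<close>: \<open>Ext\<^sup>1(k, C) = Ext\<^sup>1(R s, C)\<close> is a quotient of
  \<open>Hom(R s, D)\<close>, and homomorphisms \<open>R s \<rightarrow> D\<close> extend to \<open>R\<close>.\<close>

lemma residue_ext_zero_kernel:
  assumes E: "module R E" "residue_ext_zero E" and E': "module R E'" and \<delta>: "\<delta> \<in> mod_hom R E E'"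
    and D: "residue_ext_zero (E'\<lparr>carrier := \<delta> ` carrier E\<rparr>)"
  shows "residue_ext_zero (E\<lparr>carrier := {x \<in> carrier E. \<delta> x = \<zero>\<^bsub>E'\<^esub>}\<rparr>)"
  unfolding residue_ext_zero_def
proof
  interpret E: module R E by (rule E(1))
  interpret E': module R E' by (rule E')
  let ?C = "{x \<in> carrier E. \<delta> x = \<zero>\<^bsub>E'\<^esub>}" and ?D = "\<delta> ` carrier E"
  note \<delta>D = mod_homD[OF \<delta>]
  fix g assume g': "g \<in> mod_hom_on R Reg \<mm> (E\<lparr>carrier := ?C\<rparr>)"
  have CE: "?C \<subseteq> carrier E" by blast
  have "g \<in> mod_hom_on R Reg \<mm> E \<and> g ` \<mm> \<subseteq> ?C" using g' by (rule mod_hom_on_codomain_iff[OF CE, THEN iffD1])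
  then have g: "g \<in> mod_hom_on R Reg \<mm> E" "\<And>r. r \<in> \<mm> \<Longrightarrow> \<delta> (g r) = \<zero>\<^bsub>E'\<^esub>" by blast+
  obtain w where w: "w \<in> carrier E" "\<forall>r\<in>\<mm>. g r = r \<odot>\<^bsub>E\<^esub> w" using residue_ext_zeroD[OF E(2) g(1)] by (rule bexE)
  have Ds: "submodule ?D R E'"
    using E'.submodule_image[where f = \<delta> and X = E and U = "carrier E" and V = "carrier E"] \<delta> E(1) E.carrier_is_submodule
    by (simp add: mod_hom_on_carrier)
  have mD: "module R (E'\<lparr>carrier := ?D\<rparr>)" by (rule submodule.submodule_is_module[OF Ds E'])
  interpret D: module R "E'\<lparr>carrier := ?D\<rparr>" by (rule mD)
  obtain s where s: "s \<in> carrier R" "s \<noteq> \<zero>" "\<forall>x\<in>\<mm>. x \<otimes> s = \<zero>" using ex_socle by blast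
  have ann: "r \<in> \<mm>" if "r \<in> carrier R" "r \<otimes> s = \<zero>" for r
  proof (rule ccontr)
    assume "r \<notin> \<mm>"
    then have u: "r \<in> Units R" using UnitsI that by blast
    have "s = inv r \<otimes> (r \<otimes> s)" using u s(1) m_assoc[of "inv r" r s] by (simp add: Units_closed)
    then show False using u that(2) s by simp
  qed
  have cyc: "submodule (Reg.cyclic s) R Reg" using Reg.submodule_cyclic s(1) by simp
  have h0: "(\<lambda>r. r \<otimes> s) \<in> mod_hom_on R Reg (carrier R) Reg"
    using s(1) by (auto intro!: mod_hom_onI simp: l_distr m_assoc)
  have \<delta>w: "\<delta> w \<in> ?D" "\<delta> w \<in> carrier E'" using w(1) \<delta>D(1) by auto
  have h1: "(\<lambda>r. r \<odot>\<^bsub>E'\<^esub> \<delta> w) \<in> mod_hom_on R Reg (carrier R) (E'\<lparr>carrier := ?D\<rparr>)"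
    using \<delta>w E'.submoduleD(4)[OF Ds _ \<delta>w(1)] by (intro mod_hom_onI) (simp_all add: E'.smult_l_distr E'.smult_assoc1)
  have kill: "r \<odot>\<^bsub>E'\<^esub> \<delta> w = \<zero>\<^bsub>E'\<^esub>" if "r \<in> \<mm>" for r
    using \<delta>D(3)[OF maxD(1)[OF that] w(1)] w(2) g(2)[OF that] that by simp
  have "\<exists>f\<in>mod_hom_on R Reg (Reg.cyclic s) (E'\<lparr>carrier := ?D\<rparr>). \<forall>r\<in>carrier R. f (r \<otimes> s) = r \<odot>\<^bsub>E'\<^esub> \<delta> w"
  proof (rule D.mod_hom_factor[OF module_regular module_regular submodule_carrier cyc h0 _ h1])
    show "(\<lambda>r. r \<otimes> s) ` carrier R = Reg.cyclic s" by (simp add: Reg.cyclic_def)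
    fix r assume "r \<in> carrier R" "r \<otimes> s = \<zero>\<^bsub>Reg\<^esub>"
    then show "r \<odot>\<^bsub>E'\<^esub> \<delta> w = \<zero>\<^bsub>E'\<lparr>carrier := ?D\<rparr>\<^esub>" using kill ann by simp
  qed
  then obtain f where f: "f \<in> mod_hom_on R Reg (Reg.cyclic s) (E'\<lparr>carrier := ?D\<rparr>)"
    "\<forall>r\<in>carrier R. f (r \<otimes> s) = r \<odot>\<^bsub>E'\<^esub> \<delta> w" by (rule bexE)
  have sub: "Reg.cyclic s \<subseteq> carrier R" using s(1) by (auto simp: Reg.cyclic_def)
  have "mlength R Reg (Reg.cyclic s) (carrier R) \<le> mlength R Reg {\<zero>} (carrier R)"
    using sub Reg.submodule_zero Reg.submoduleD(2)[OF cyc] by (intro Reg.mlength_mono cyc submodule_carrier) auto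
  then have fin: "mlength R Reg (Reg.cyclic s) (carrier R) \<noteq> \<infinity>"
    using finite_length by (cases "mlength R Reg (Reg.cyclic s) (carrier R)") auto
  obtain h where h: "h \<in> mod_hom_on R Reg (carrier R) (E'\<lparr>carrier := ?D\<rparr>)" "\<forall>z\<in>Reg.cyclic s. h z = f z"
    using extendsD[OF extends_of_residue_ext_zero[OF module_regular mD D submodule_carrier cyc sub fin] f(1)]
    by (rule bexE)
  have "h \<one> \<in> ?D" using mod_hom_onD(1)[OF h(1), of \<one>] by simp
  then obtain d where d: "d \<in> carrier E" "h \<one> = \<delta> d" by blast
  have "s \<in> Reg.cyclic s" using Reg.cyclic_self s(1) by simp
  then have "h s = f (\<one> \<otimes> s)" using h(2) s(1) by simp
  also have "\<dots> = \<delta> w" using bspec[OF f(2) one_closed] E'.smult_one[OF \<delta>w(2)] by simp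
  finally have "h (s \<otimes> \<one>) = \<delta> w" using s(1) by simp
  then have sd: "s \<odot>\<^bsub>E'\<^esub> \<delta> d = \<delta> w" using mod_hom_onD(3)[OF h(1), of s \<one>] s(1) d(2) by simp
  \<comment> \<open>\<open>s d\<close> is annihilated by \<open>\<mm>\<close>, so subtracting it
    does not change products with \<open>\<mm>\<close>; it does bring \<open>w\<close> into the
    kernel, since \<open>\<delta> w = s \<delta> d\<close>.\<close>
  define c where "c = w \<ominus>\<^bsub>E\<^esub> s \<odot>\<^bsub>E\<^esub> d"
  have sdE: "s \<odot>\<^bsub>E\<^esub> d \<in> carrier E" using s(1) d(1) by simp
  have "\<delta> c = \<delta> w \<ominus>\<^bsub>E'\<^esub> \<delta> (s \<odot>\<^bsub>E\<^esub> d)" unfolding c_def by (rule E'.mod_hom_minus[OF \<delta> E(1) w(1) sdE])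
  also have "\<dots> = \<zero>\<^bsub>E'\<^esub>" using \<delta>D(3)[OF s(1) d(1)] sd \<delta>w(2) by (simp add: E'.M.minus_eq E'.M.r_neg)
  finally have c: "c \<in> ?C" using w(1) sdE by (simp add: c_def)
  have "g r = r \<odot>\<^bsub>E\<^esub> c" if r: "r \<in> \<mm>" for r
  proof -
    have rR: "r \<in> carrier R" using maxD(1) r .
    have "r \<odot>\<^bsub>E\<^esub> (s \<odot>\<^bsub>E\<^esub> d) = (r \<otimes> s) \<odot>\<^bsub>E\<^esub> d" using rR s(1) d(1) by (simp add: E.smult_assoc1)
    then have "r \<odot>\<^bsub>E\<^esub> (s \<odot>\<^bsub>E\<^esub> d) = \<zero>\<^bsub>E\<^esub>" using s(3) r d(1) by simp
    moreover have "w = s \<odot>\<^bsub>E\<^esub> d \<oplus>\<^bsub>E\<^esub> c" unfolding c_def using E.minus_add_self[OF w(1) sdE] by simp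
    ultimately have "r \<odot>\<^bsub>E\<^esub> w = r \<odot>\<^bsub>E\<^esub> c" using E.smult_r_distr[OF rR sdE, of c] c rR by simp
    then show ?thesis using w(2) r by simp
  qed
  then show "\<exists>c\<in>carrier (E\<lparr>carrier := ?C\<rparr>). \<forall>r\<in>\<mm>. g r = r \<odot>\<^bsub>E\<lparr>carrier := ?C\<rparr>\<^esub> c" using c by auto
qed

text \<open>Descending induction along the cocycles of the finite injective resolution, from degree
  \<open>Suc n\<close>, where they are zero, with \<open>residue_ext_zero_kernel\<close> for each
  step down. In degree zero the cocycles are a copy of \<open>R\<close>, and \<open>\<eta>\<close>
  transfers the property.\<close>

lemma gorenstein_imp_residue_ext_zero:
  assumes "gorenstein_local_ring R"
  shows "residue_ext_zero Reg"
proof -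
  obtain n and I :: "nat \<Rightarrow> ('a, 'a list) module" and \<delta> \<eta> where
    res: "injective_resolution R Reg I \<delta> \<eta>" and zero: "\<forall>j>n. zero_module (I j)"
    using assms unfolding gorenstein_local_ring_def by blast
  note r1 = res[unfolded injective_resolution_def]
  note r2 = r1[THEN conjunct2] note r3 = r2[THEN conjunct2] note r4 = r3[THEN conjunct2] note r5 = r4[THEN conjunct2]
  have inj: "injective_module R (I j)" for j by (rule r1[THEN conjunct1, THEN spec])
  have I: "module R (I j)" for j using inj[of j] by (simp add: injective_module_def)
  have \<eta>: "\<eta> \<in> mod_hom R Reg (I 0)" by (rule r2[THEN conjunct1])
  have \<delta>: "\<delta> j \<in> mod_hom R (I j) (I (Suc j))" for j by (rule r3[THEN conjunct1, THEN spec])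
  have \<eta>i: "inj_on \<eta> (carrier Reg)" by (rule r4[THEN conjunct1])
  let ?C = "\<lambda>j. {x \<in> carrier (I j). \<delta> j x = \<zero>\<^bsub>I (Suc j)\<^esub>}"
  have \<eta>im: "\<eta> ` carrier R = ?C 0" using r5[THEN conjunct1] by (simp add: a_kernel_def')
  have \<delta>im: "\<delta> j ` carrier (I j) = ?C (Suc j)" for j
    using r5[THEN conjunct2, THEN spec, of j] by (simp add: a_kernel_def')
  have res_C: "residue_ext_zero (I 0\<lparr>carrier := ?C 0\<rparr>)"
  proof (rule inc_induct[of 0 "Suc n"])
    show "residue_ext_zero (I (Suc n)\<lparr>carrier := ?C (Suc n)\<rparr>)"
      unfolding residue_ext_zero_def
    proof
      interpret I: module R "I (Suc n)" by (rule I)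
      have z: "carrier (I (Suc n)) = {\<zero>\<^bsub>I (Suc n)\<^esub>}" using zero by (simp add: zero_module_def)
      fix g assume g: "g \<in> mod_hom_on R Reg \<mm> (I (Suc n)\<lparr>carrier := ?C (Suc n)\<rparr>)"
      have "\<delta> (Suc n) \<zero>\<^bsub>I (Suc n)\<^esub> = \<zero>\<^bsub>I (Suc (Suc n))\<^esub>" by (rule module.mod_hom_zero[OF I \<delta> I])
      then have "\<zero>\<^bsub>I (Suc n)\<^esub> \<in> ?C (Suc n)" by simp
      moreover have "g r = r \<odot>\<^bsub>I (Suc n)\<^esub> \<zero>\<^bsub>I (Suc n)\<^esub>" if "r \<in> \<mm>" for r
      proof -
        have "g r \<in> carrier (I (Suc n))" using mod_hom_onD(1)[OF g that] by simp
        then show ?thesis using z maxD(1)[OF that] by simp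
      qed
      ultimately show "\<exists>w\<in>carrier (I (Suc n)\<lparr>carrier := ?C (Suc n)\<rparr>). \<forall>r\<in>\<mm>. g r = r \<odot>\<^bsub>I (Suc n)\<lparr>carrier := ?C (Suc n)\<rparr>\<^esub> w"
        by auto
    qed
    fix j assume IH: "residue_ext_zero (I (Suc j)\<lparr>carrier := ?C (Suc j)\<rparr>)"
    show "residue_ext_zero (I j\<lparr>carrier := ?C j\<rparr>)"
      by (rule residue_ext_zero_kernel[OF I injective_imp_residue_ext_zero[OF inj] I \<delta> IH[folded \<delta>im]])
  qed simp
  show ?thesis
    unfolding residue_ext_zero_def
  proof
    fix g assume g: "g \<in> mod_hom_on R Reg \<mm> Reg"
    note gD = mod_hom_onD[OF g] and \<eta>D = mod_homD[OF \<eta>]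
    have C0: "?C 0 \<subseteq> carrier (I 0)" by blast
    have "(\<lambda>r. \<eta> (g r)) \<in> mod_hom_on R Reg \<mm> (I 0)" using gD \<eta>D by (intro mod_hom_onI) simp_all
    moreover have "(\<lambda>r. \<eta> (g r)) ` \<mm> \<subseteq> ?C 0" unfolding \<eta>im[symmetric] using gD(1) by auto
    ultimately have "(\<lambda>r. \<eta> (g r)) \<in> mod_hom_on R Reg \<mm> (I 0\<lparr>carrier := ?C 0\<rparr>)"
      by (intro mod_hom_on_codomain_iff[OF C0, THEN iffD2] conjI)
    from residue_ext_zeroD[OF res_C this] obtain w where w: "w \<in> ?C 0" "\<forall>r\<in>\<mm>. \<eta> (g r) = r \<odot>\<^bsub>I 0\<^esub> w" by auto
    then obtain t where t: "t \<in> carrier R" "w = \<eta> t" using \<eta>im by blast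
    have "g r = r \<otimes> t" if r: "r \<in> \<mm>" for r
    proof (rule inj_onD[OF \<eta>i])
      show "\<eta> (g r) = \<eta> (r \<otimes> t)" using w(2) r t \<eta>D(3)[OF maxD(1)[OF r], of t] by simp
      show "g r \<in> carrier Reg" "r \<otimes> t \<in> carrier Reg" using gD(1)[OF r] maxD(1)[OF r] t(1) by simp_all
    qed
    then show "\<exists>w\<in>carrier Reg. \<forall>r\<in>\<mm>. g r = r \<odot>\<^bsub>Reg\<^esub> w" using t(1) by auto
  qed
qed

end

section \<open>The main theorem\<close>

lemma extends_direct_sum:
  assumes M: "module R M" and N: "module R N" and ext: "extends R X Z F (direct_sum M N)"
  shows "extends R X Z F M" "extends R X Z F N"
proof -
  interpret M: module R M by (rule M)
  interpret N: module R N by (rule N)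
  show "extends R X Z F M"
    unfolding extends_def
  proof
    fix f assume f: "f \<in> mod_hom_on R X Z M"
    have f': "(\<lambda>x. (f x, \<zero>\<^bsub>N\<^esub>)) \<in> mod_hom_on R X Z (direct_sum M N)"
      using mod_hom_onD[OF f] by (intro mod_hom_onI) simp_all
    obtain g where g: "g \<in> mod_hom_on R X F (direct_sum M N)" "\<forall>x\<in>Z. g x = (f x, \<zero>\<^bsub>N\<^esub>)"
      using extendsD[OF ext f'] by (rule bexE)
    have "(\<lambda>x. fst (g x)) \<in> mod_hom_on R X F M"
    proof (rule mod_hom_onI)
      fix x assume x: "x \<in> F"
      then show "fst (g x) \<in> carrier M" using mod_hom_onD(1)[OF g(1) x] by auto
      show "fst (g (x \<oplus>\<^bsub>X\<^esub> y)) = fst (g x) \<oplus>\<^bsub>M\<^esub> fst (g y)" if "y \<in> F" for y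
        using mod_hom_onD(2)[OF g(1) x that] by (cases "g x"; cases "g y") simp
      show "fst (g (r \<odot>\<^bsub>X\<^esub> x)) = r \<odot>\<^bsub>M\<^esub> fst (g x)" if "r \<in> carrier R" for r
        using mod_hom_onD(3)[OF g(1) that x] by (cases "g x") simp
    qed
    then show "\<exists>g\<in>mod_hom_on R X F M. \<forall>x\<in>Z. g x = f x" by (rule bexI[rotated]) (use g(2) in simp)
  qed
  show "extends R X Z F N"
    unfolding extends_def
  proof
    fix f assume f: "f \<in> mod_hom_on R X Z N"
    have f': "(\<lambda>x. (\<zero>\<^bsub>M\<^esub>, f x)) \<in> mod_hom_on R X Z (direct_sum M N)"
      using mod_hom_onD[OF f] by (intro mod_hom_onI) simp_all
    obtain g where g: "g \<in> mod_hom_on R X F (direct_sum M N)" "\<forall>x\<in>Z. g x = (\<zero>\<^bsub>M\<^esub>, f x)"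
      using extendsD[OF ext f'] by (rule bexE)
    have "(\<lambda>x. snd (g x)) \<in> mod_hom_on R X F N"
    proof (rule mod_hom_onI)
      fix x assume x: "x \<in> F"
      then show "snd (g x) \<in> carrier N" using mod_hom_onD(1)[OF g(1) x] by auto
      show "snd (g (x \<oplus>\<^bsub>X\<^esub> y)) = snd (g x) \<oplus>\<^bsub>N\<^esub> snd (g y)" if "y \<in> F" for y
        using mod_hom_onD(2)[OF g(1) x that] by (cases "g x"; cases "g y") simp
      show "snd (g (r \<odot>\<^bsub>X\<^esub> x)) = r \<odot>\<^bsub>N\<^esub> snd (g x)" if "r \<in> carrier R" for r
        using mod_hom_onD(3)[OF g(1) that x] by (cases "g x") simp
    qed
    then show "\<exists>g\<in>mod_hom_on R X F N. \<forall>x\<in>Z. g x = f x" by (rule bexI[rotated]) (use g(2) in simp)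
  qed
qed

lemma (in local_cube_zero) fin_gen_mincover:
  assumes "fin_gen_module R M"
  shows "\<exists>n c. mincover M (carrier M) n c"
proof -
  obtain B where M: "module R M" and B: "finite B" "generates R M B"
    using assms by (auto simp: fin_gen_module_def)
  interpret M: module R M by (rule M)
  have "\<exists>n f. B = f ` {i::nat. i < n} \<and> inj_on f {i. i < n}"
    by (rule finite_imp_nat_seg_image_inj_on[OF B(1)])
  then obtain n f where f: "B = f ` {i::nat. i < n}" by (elim exE conjE) (rule that)
  have BM: "B \<subseteq> carrier M" using B(2) by (simp add: generates_def)
  have fM: "f l \<in> carrier M" if "l < n" for l using f BM that by blast
  have sp: "submodule (lspan R M f n) R M" by (rule M.submodule_span[OF fM])
  have Bsp: "B \<subseteq> lspan R M f n" unfolding f using M.span_gen fM by auto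
  have "carrier M = lspan R M f n"
  proof
    show "carrier M \<subseteq> lspan R M f n"
    proof
      fix x assume "x \<in> carrier M"
      then obtain A c where A: "finite A" "A \<subseteq> B" "c \<in> A \<rightarrow> carrier R" "x = lin_comb M c A"
        using B(2) unfolding generates_def by blast
      have "A \<subseteq> lspan R M f n" using A(2) Bsp by (rule order_trans)
      then show "x \<in> lspan R M f n" unfolding A(4) by (rule M.lin_comb_mem[OF sp A(1) _ A(3)])
    qed
    show "lspan R M f n \<subseteq> carrier M" using M.submoduleD(1)[OF sp] by blast
  qed
  then show ?thesis using ex_mincover[OF M M.carrier_is_submodule] fM by blast
qed

lemma (in syzygies) free_resolution_minimal:
  assumes M: "module R M" and c0: "mincover M (carrier M) p c0"
    and L0: "L 0 = {v \<in> Fn p. lincomb M v c0 p = \<zero>\<^bsub>M\<^esub>}"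
  shows "free_resolution R M (\<lambda>i. Vec\<lparr>carrier := Fn (case i of 0 \<Rightarrow> p | Suc j \<Rightarrow> b j)\<rparr>) \<pi> (\<lambda>v. lincomb M v c0 p)"
proof -
  interpret M: module R M by (rule M)
  have one: "\<one> \<noteq> \<zero>" using one_notin_max maxD(2) by auto
  note h = mincover_hom[OF M M.carrier_is_submodule c0]
  have \<pi>F: "\<pi> n ` Fn (b n) \<subseteq> Fn (case n of 0 \<Rightarrow> p | Suc j \<Rightarrow> b j)" for n
  proof (cases n)
    case 0
    then show ?thesis unfolding \<pi>_image using L0_subset tuples_max_subset[of p] by simp
  next
    case (Suc k)
    then show ?thesis using \<pi>_tuples by simp
  qed
  have cF: "Fn n \<subseteq> carrier Vec" for n using Vec.submoduleD(1)[OF submodule_Fn] by blast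
  show ?thesis
    unfolding free_resolution_def a_kernel_def'
  proof (intro conjI allI)
    show "free_module R (Vec\<lparr>carrier := Fn (case n of 0 \<Rightarrow> p | Suc j \<Rightarrow> b j)\<rparr>)" for n by (rule free_module_Fn[OF one])
    show "(\<lambda>v. lincomb M v c0 p) \<in> mod_hom R (Vec\<lparr>carrier := Fn (case 0 of 0 \<Rightarrow> p | Suc j \<Rightarrow> b j)\<rparr>) M"
      using h(1) by simp
    show "\<pi> n \<in> mod_hom R (Vec\<lparr>carrier := Fn (case Suc n of 0 \<Rightarrow> p | Suc j \<Rightarrow> b j)\<rparr>)
        (Vec\<lparr>carrier := Fn (case n of 0 \<Rightarrow> p | Suc j \<Rightarrow> b j)\<rparr>)" for n
      using mod_hom_on_codomain_iff[OF cF, THEN iffD2, OF conjI[OF \<pi>_hom \<pi>F]] by simp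
    show "(\<lambda>v. lincomb M v c0 p) ` carrier (Vec\<lparr>carrier := Fn (case 0 of 0 \<Rightarrow> p | Suc j \<Rightarrow> b j)\<rparr>) = carrier M"
      using h(2) by simp
    show "\<pi> 0 ` carrier (Vec\<lparr>carrier := Fn (case 1 of 0 \<Rightarrow> p | Suc j \<Rightarrow> b j)\<rparr>) =
        {x \<in> carrier (Vec\<lparr>carrier := Fn (case 0 of 0 \<Rightarrow> p | Suc j \<Rightarrow> b j)\<rparr>). lincomb M x c0 p = \<zero>\<^bsub>M\<^esub>}"
      using \<pi>_image[of 0] L0 by simp
    show "\<pi> (Suc n) ` carrier (Vec\<lparr>carrier := Fn (case Suc (Suc n) of 0 \<Rightarrow> p | Suc j \<Rightarrow> b j)\<rparr>) =
        {x \<in> carrier (Vec\<lparr>carrier := Fn (case Suc n of 0 \<Rightarrow> p | Suc j \<Rightarrow> b j)\<rparr>). \<pi> n x =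
          \<zero>\<^bsub>Vec\<lparr>carrier := Fn (case n of 0 \<Rightarrow> p | Suc j \<Rightarrow> b j)\<rparr>\<^esub>}" for n
      using \<pi>_image[of "Suc n"] L_Suc[of n] by simp
  qed
qed

text \<open>The type over which \<open>Ext\<close> selects its resolution consists of lists of
  pairs; the second components are the fixed filler \<open>undefined\<close>, and the first ones
  recover the vector.\<close>

lemma (in cring) inj_on_list_of_vec:
  "inj_on (\<lambda>v. map (\<lambda>l. (v l, undefined)) [0..<n]) (Fn n)"
proof (rule inj_onI)
  fix v w assume v: "v \<in> Fn n" and w: "w \<in> Fn n"
    and eq: "map (\<lambda>l. (v l, undefined)) [0..<n] = map (\<lambda>l. (w l, undefined)) [0..<n]"
  have "v l = w l" if "l < n" for l using eq that by simp
  then show "v = w" using v w by (auto simp: mem_Fn fun_eq_iff) (metis not_le)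
qed

theorem theorem4p1:
  fixes R :: "('a, 'r) ring_scheme" and \<mm> :: "'a set" and M :: "('a, 'b, 'm) module_scheme"
  assumes "artinian_ring R" and "local_ring R \<mm>"
    and "\<mm> \<cdot>\<^bsub>R\<^esub> \<mm> \<cdot>\<^bsub>R\<^esub> \<mm> = {\<zero>\<^bsub>R\<^esub>}"
    and "fin_gen_module R M"
  shows "((\<exists>n\<ge>2. \<forall>i\<in>{n..n+3}. zero_module (Ext R i M (direct_sum M (regular_module R))))
           \<longrightarrow> free_module R M) \<and>
         (gorenstein_local_ring R \<and> (\<exists>i>0. zero_module (Ext R i M M)) \<longrightarrow> free_module R M)"
proof -
  interpret local_cube_zero R \<mm> by (rule local_cube_zeroI[OF assms(1-3)])
  have M: "module R M" using assms(4) by (simp add: fin_gen_module_def)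
  interpret M: module R M by (rule M)
  obtain p c0 where c0: "mincover M (carrier M) p c0" using fin_gen_mincover[OF assms(4)] by blast
  let ?\<epsilon> = "\<lambda>v. lincomb M v c0 p"
  let ?K = "{v \<in> Fn p. ?\<epsilon> v = \<zero>\<^bsub>M\<^esub>}"
  have K: "submodule ?K R Vec" by (rule submodule_kernel[OF M M.carrier_is_submodule c0])
  have Km: "?K \<subseteq> tuples Reg p \<mm>" using c0 by (auto simp: mincover_def)
  obtain L b c where S: "syzygies R \<mm> L b c p" and L0: "L 0 = ?K" using ex_syzygies[OF K Km] by blast
  interpret S: syzygies R \<mm> L b c p by (rule S)
  let ?P = "\<lambda>i. Vec\<lparr>carrier := Fn (case i of 0 \<Rightarrow> p | Suc j \<Rightarrow> b j)\<rparr>"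
  have P: "free_resolution R M ?P S.\<pi> ?\<epsilon>" by (rule S.free_resolution_minimal[OF M c0 L0])
  have lists: "\<exists>(F :: nat \<Rightarrow> ('a, ('a \<times> 'b) list) module) d \<epsilon>. free_resolution R M F d \<epsilon>"
    by (intro exI, rule transport_resolution[OF P,
          where \<phi> = "\<lambda>i v. map (\<lambda>l. (v l, undefined)) [0..<(case i of 0 \<Rightarrow> p | Suc j \<Rightarrow> b j)]"])
      (simp add: inj_on_list_of_vec)
  \<comment> \<open>\<open>L i\<close> sits inside the free module in degree \<open>i\<close> of the
    minimal resolution, of rank \<open>p\<close> for \<open>i = 0\<close> and
    \<open>b (i - 1)\<close> afterwards; this inclusion computes Ext in degree
    \<open>Suc i\<close>.\<close>
  have Ext: "extends R Vec (L i) (Fn (case i of 0 \<Rightarrow> p | Suc j \<Rightarrow> b j)) N"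
    if "module R N" "zero_module (Ext R (Suc i) M N)" for N :: "('a, 'c, 'n) module_scheme" and i
    using zero_Ext_extends[OF lists P M that] S.\<pi>_image[of i] by (simp add: extends_def mod_hom_def)
  note \<epsilon> = mincover_hom(1,2)[OF M M.carrier_is_submodule c0]
  \<comment> \<open>The exact sequence from \<open>L 0\<close> through \<open>R^p\<close> to
    \<open>M\<close>: vanishing from \<open>M\<close> to \<open>M\<close> in degree
    \<open>i + 1\<close> and from \<open>M\<close> to \<open>R\<close> in degree
    \<open>i + 2\<close> gives vanishing from \<open>M\<close> to \<open>L 0\<close> in degree
    \<open>i + 2\<close>.\<close>
  have shift: "S.ext_zero i 0"
    if "extends R Vec (L i) (Fn (case i of 0 \<Rightarrow> p | Suc j \<Rightarrow> b j)) M" "extends R Vec (L (Suc i)) (Fn (b i)) Reg" for i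
  proof -
    have sub: "S.\<pi> i ` Fn (b i) \<subseteq> Fn (case i of 0 \<Rightarrow> p | Suc j \<Rightarrow> b j)"
    proof (cases i)
      case 0 then show ?thesis unfolding S.\<pi>_image using L0 by simp
    next
      case (Suc k) then show ?thesis using S.\<pi>_tuples by simp
    qed
    show ?thesis
      using extends_shift[OF M \<epsilon> S.\<pi>_hom sub] that L0 unfolding S.ext_zero_def S.\<pi>_image S.L_Suc by simp
  qed
  have free: "free_module R M" if "L 0 = {\<lambda>_. \<zero>\<^bsub>R\<^esub>}"
  proof (rule free_module_iso[OF _ M])
    let ?F = "Vec\<lparr>carrier := Fn p\<rparr>"
    have "\<one>\<^bsub>R\<^esub> \<noteq> \<zero>\<^bsub>R\<^esub>" using one_notin_max maxD(2) by auto
    then show "free_module R ?F" by (rule free_module_Fn)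
    show "?\<epsilon> \<in> mod_hom R ?F M" by (rule \<epsilon>(1))
    have "inj_on ?\<epsilon> (Fn p)"
    proof (rule inj_onI)
      fix v w assume v: "v \<in> Fn p" and w: "w \<in> Fn p" and eq: "?\<epsilon> v = ?\<epsilon> w"
      have "?\<epsilon> (v \<ominus>\<^bsub>Vec\<^esub> w) = ?\<epsilon> v \<ominus>\<^bsub>M\<^esub> ?\<epsilon> w" by (rule M.mod_hom_on_minus[OF \<epsilon>(1) module_Vec submodule_Fn v w])
      also have "\<dots> = \<zero>\<^bsub>M\<^esub>" unfolding eq using mod_hom_onD(1)[OF \<epsilon>(1) w] by (simp add: M.M.minus_eq M.M.r_neg)
      finally have "v \<ominus>\<^bsub>Vec\<^esub> w \<in> L 0" unfolding L0 using Vec.submoduleD(6)[OF submodule_Fn v w] by simp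
      then have "v \<ominus>\<^bsub>Vec\<^esub> w = \<zero>\<^bsub>Vec\<^esub>" using that by simp
      then show "v = w" using Vec.minus_eq_zero Vec.submoduleD(1)[OF submodule_Fn] v w by blast
    qed
    then show "bij_betw ?\<epsilon> (carrier ?F) (carrier M)" using \<epsilon>(2) by (simp add: bij_betw_def)
  qed
  have part1: "free_module R M"
    if n: "n \<ge> 2" "\<forall>i\<in>{n..n+3}. zero_module (Ext R i M (direct_sum M (regular_module R)))" for n
  proof -
    \<comment> \<open>Degree \<open>Suc i\<close> of Ext belongs to the syzygy \<open>L i\<close>,
      so the four vanishing degrees correspond to \<open>L t\<close> up to
      \<open>L (t + 3)\<close>.\<close>
    obtain t where t: "n = Suc t" using n(1) by (cases n) auto
    have both: "extends R Vec (L i) (Fn (case i of 0 \<Rightarrow> p | Suc j \<Rightarrow> b j)) M"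
      "extends R Vec (L i) (Fn (case i of 0 \<Rightarrow> p | Suc j \<Rightarrow> b j)) Reg" if "i \<in> {t..t+3}" for i
    proof -
      have "zero_module (Ext R (Suc i) M (direct_sum M Reg))" using n(2) that t by simp
      then have "extends R Vec (L i) (Fn (case i of 0 \<Rightarrow> p | Suc j \<Rightarrow> b j)) (direct_sum M Reg)"
        by (rule Ext[OF module_direct_sum[OF M module_regular]])
      then show "extends R Vec (L i) (Fn (case i of 0 \<Rightarrow> p | Suc j \<Rightarrow> b j)) M"
        "extends R Vec (L i) (Fn (case i of 0 \<Rightarrow> p | Suc j \<Rightarrow> b j)) Reg"
        by (rule extends_direct_sum[OF M module_regular])+
    qed
    \<comment> \<open>Each application of \<open>shift\<close> takes the values in \<open>M\<close>
      at one index and the values in \<open>R\<close> at the next; the third claim moves the target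
      from \<open>L 0\<close> to \<open>L 1\<close>.\<close>
    have 1: "S.ext_zero t 0" using shift[OF both(1)[of t]] both(2)[of "Suc t"] by simp
    have 2: "S.ext_zero (Suc t) 0" using shift[OF both(1)[of "Suc t"]] both(2)[of "Suc (Suc t)"] by simp
    have 3: "S.ext_zero (Suc t) 1" using S.ext_zero_shift[OF 1] both(2)[of "Suc (Suc t)"] by simp
    show ?thesis by (rule free[OF S.rigidity[OF 1 2 3]])
  qed
  have part2: "free_module R M" if gor: "gorenstein_local_ring R" and i: "i > 0" "zero_module (Ext R i M M)" for i
  proof -
    obtain t where t: "i = Suc t" using i(1) by (cases i) auto
    \<comment> \<open>In this part the vanishing with values in \<open>R\<close> comes from
      self-injectivity instead of being assumed.\<close>
    have res: "residue_ext_zero Reg" by (rule gorenstein_imp_residue_ext_zero[OF gor])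
    have "extends R Vec (L t) (Fn (case t of 0 \<Rightarrow> p | Suc j \<Rightarrow> b j)) M" using Ext[OF M] i(2) t by simp
    then have "S.ext_zero t 0" using S.extends_Reg[OF res] by (rule shift)
    then show ?thesis by (rule free[OF S.gorenstein_rigidity[OF res]])
  qed
  show ?thesis using part1 part2 by blast
qed

end
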